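(* Let $k$ be an algebraically closed field, let $m\ge 2$ be an integer and set $d=3m-1$. Let $g\in k[x,y,z]$ be a polynomial of the form $$g(x,y,z)=z^m+\sum_{i=1}^m a_i(x,y)z^{m-i}$$ that is $\mathrm{WT}$-homogeneous of weight $3m$, such that no monomial of $g$ lies in the ideal $(x,y)^{d-1}$ and such that the monomial $x^{3(m-1)}z$ appears in $g$ with nonzero coefficient (so $g$ has standard degree $d-1$). Let $G(X,Y,Z,W)=W^{d-1}g(X/W,Y/W,Z/W)$, a homogeneous polynomial of degree $d-1$. In $\mathbb{P}^3=\mathrm{Proj}(k[X,Y,Z,W])$ let $L$ be the line $X=Y=0$ and, for an integer $a\ge 0$ and a scalar $t\in k^*$, let $S_t$ be the surface of equation $XGZ^a-tYW^{a+d-1}=0$. Let $C_t$ be the unique locally Cohen-Macaulay $d$-structure on $L$ contained in $S_t$. Then: (i) For every integer $a\ge 0$ and every $t\in k^*$, the curve $C_t$ is a primitive $d$-line of type $e=a+m-1$. (ii) Suppose furthermore that the ideal $I=(x,y)^{d-1}+(g)\subset k[x,y,z]$ contains no nonzero polynomial of (standard) degree $d-2$. Then $$\mathrm{H}^0(\mathcal{I}_{C_t}(n))=\mathrm{H}^0(\mathcal{I}_L^d(n))\qquad\text{for all } n\le a+d-1.$$ In particular, if a polynomial $g$ as in (ii) exists for the given $m$ (with $d=3m-1$), then all of the following hold: (A1) there is a primitive $d$-line of type $\frac{d-2}{3}$ that is not contained in a surface of degree $d-1$; (A2) there is a primitive $d$-line $C$ of type $\frac{d+1}{3}$, with support a line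 $L$, such that $\mathrm{H}^0(\mathcal{I}_C(n))=\mathrm{H}^0(\mathcal{I}_L^d(n))$ for all $n\le d$; (A3) there is a primitive $d$-line $C$ of type $\frac{d+4}{3}$, with support a line $L$, such that $\mathrm{H}^0(\mathcal{I}_C(n))=\mathrm{H}^0(\mathcal{I}_L^d(n))$ for all $n\le d+1$; (A4) for each $d'\in\{d,d+1,d+2\}$ there exists a locally Cohen-Macaulay curve in $\mathbb{P}^3$ of degree $d'$ and arithmetic genus $P(d',d')=(d'-1)d'+1-\binom{d'+2}{3}$ that does not lie on a surface of degree $<d'$.
   Context: $\mathrm{WT}$ is the weight function on $k[x,y,z]$ with $\mathrm{WT}(x)=1$, $\mathrm{WT}(y)=2$, $\mathrm{WT}(z)=3$; a polynomial is $\mathrm{WT}$-homogeneous of weight $n$ if all its monomials $x^ay^bz^c$ satisfy $a+2b+3c=n$. "Standard degree" means the usual total degree. A (locally Cohen-Macaulay) curve in $\mathbb{P}^3$ is a one-dimensional closed subscheme with no zero-dimensional irreducible or embedded components. Its degree and arithmetic genus $p_a$ are defined by its Hilbert polynomial $\deg(C)\,n+1-p_a(C)$. For a closed subscheme $Y\subset\mathbb{P}^3$, $\mathcal{I}_Y$ denotes its ideal sheaf in $\mathcal{O}_{\mathbb{P}^3}$, and $\mathcal{I}_L^d$ is the $d$-th power of $\mathcal{I}_L$. Since $\mathcal{I}_L^d\subseteq \mathcal{I}_C$ for the curves $C$ considered, the equalities of $\mathrm{H}^0$ are equalities of subspaces of $\mathrm{H}^0(\mathcal{O}_{\mathbb{P}^3}(n))$.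 A locally Cohen-Macaulay $d$-structure on a line $L$ is a locally Cohen-Macaulay curve of degree $d$ whose support is $L$. If a surface $S\supset L$ is generically smooth along $L$ (as $S_t$ is), $S$ contains a unique locally Cohen-Macaulay $d$-structure on $L$: it is obtained by intersecting $S$ with the subscheme $L_d$ defined by $\mathcal{I}_L^d$ and removing embedded points. A primitive $d$-line ($d\ge2$) with support $L$ is a locally Cohen-Macaulay curve $C$ of degree $d$ with support the line $L$ that is locally contained in a smooth surface (i.e. every point of $L$ has an open neighbourhood $U$ in $\mathbb{P}^3$ such that $C\cap U$ is contained in a smooth surface in $U$). For such $C$, $\mathcal{I}_{L,C}/\mathcal{I}_{L,C}^2$ is an invertible $\mathcal{O}_L$-module, hence isomorphic to $\mathcal{O}_L(e)$ for a unique integer $e$, called the type of $C$; here $\mathcal{I}_{L,C}$ is the ideal sheaf of $L$ in $C$. *)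

theory Defs
  imports
    Complex_Main
    "HOL-Library.Poly_Mapping"
    "HOL-Library.Numeral_Type"
    "HOL-Library.FuncSet"
    "HOL-Computational_Algebra.Polynomial"
    "HOL-Computational_Algebra.Fraction_Field"
begin

section \<open>Polynomials\<close>

text \<open>
  A polynomial over \<open>'a\<close> with variables indexed by \<open>'v\<close> is a finitely supported function from
  exponent vectors to coefficients.  The variables $x,y,z$ are the elements \<open>0, 1, 2\<close> of the
  type \<open>3\<close>, and $X,Y,Z,W$ are the elements \<open>0, 1, 2, 3\<close> of the type \<open>4\<close>.
\<close>

type_synonym ('v, 'a) pol = "('v \<Rightarrow>\<^sub>0 nat) \<Rightarrow>\<^sub>0 'a"

abbreviation (input) lookup where "lookup \<equiv> Poly_Mapping.lookup"
abbreviation (input) keys where "keys \<equiv> Poly_Mapping.keys"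
abbreviation (input) single where "single \<equiv> Poly_Mapping.single"

abbreviation mon :: "('v \<Rightarrow>\<^sub>0 nat) \<Rightarrow> ('v, 'a::comm_ring_1) pol"
  where "mon t \<equiv> single t 1"

abbreviation var :: "'v \<Rightarrow> ('v, 'a::comm_ring_1) pol"
  where "var i \<equiv> mon (single i 1)"

definition scal :: "'a \<Rightarrow> ('v, 'a::comm_ring_1) pol \<Rightarrow> ('v, 'a) pol"
  where "scal c p = single 0 c * p"

definition mon_deg :: "('v::finite \<Rightarrow>\<^sub>0 nat) \<Rightarrow> nat"
  where "mon_deg t = (\<Sum>i\<in>UNIV. lookup t i)"

definition tot_deg :: "('v::finite, 'a::zero) pol \<Rightarrow> nat"
  where "tot_deg p = Max (insert 0 (mon_deg ` keys p))"

text \<open>The degree is an integer, so that for negative \<open>n\<close> only the zero polynomial qualifies.\<close>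

definition homog :: "int \<Rightarrow> ('v::finite, 'a::zero) pol \<Rightarrow> bool"
  where "homog n p \<longleftrightarrow> (\<forall>t\<in>keys p. int (mon_deg t) = n)"

definition partial :: "'v \<Rightarrow> ('v, 'a::comm_ring_1) pol \<Rightarrow> ('v, 'a) pol"
  where "partial i p = (\<Sum>t\<in>keys p.
     single (t - single i 1) (of_nat (lookup t i) * lookup p t))"

text \<open>
  For a subring \<open>R\<close> of the ambient commutative ring, \<open>span_over R A\<close> is the \<open>R\<close>-submodule
  generated by \<open>A\<close>; it is the ideal of \<open>R\<close> generated by \<open>A\<close> if \<open>A \<subseteq> R\<close>.
\<close>

definition span_over :: "'r::comm_ring_1 set \<Rightarrow> 'r set \<Rightarrow> 'r set"
  where "span_over R A = {\<Sum>a\<in>B. c a * a | B c. finite B \<and> B \<subseteq> A \<and> (\<forall>a\<in>B. c a \<in> R)}"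

definition is_ideal :: "'r::comm_ring_1 set \<Rightarrow> 'r set \<Rightarrow> bool"
  where "is_ideal R I \<longleftrightarrow> I \<subseteq> R \<and> span_over R I = I"

definition ideal_prod :: "'r::comm_ring_1 set \<Rightarrow> 'r set \<Rightarrow> 'r set \<Rightarrow> 'r set"
  where "ideal_prod R I J = span_over R {x * y | x y. x \<in> I \<and> y \<in> J}"

fun ideal_pow :: "'r::comm_ring_1 set \<Rightarrow> 'r set \<Rightarrow> nat \<Rightarrow> 'r set"
  where
    "ideal_pow R I 0 = R"
  | "ideal_pow R I (Suc n) = ideal_prod R I (ideal_pow R I n)"

definition ideal_sum :: "'r::comm_ring_1 set \<Rightarrow> 'r set \<Rightarrow> 'r set"
  where "ideal_sum I J = {x + y | x y. x \<in> I \<and> y \<in> J}"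

abbreviation ideal_gen :: "'r::comm_ring_1 set \<Rightarrow> 'r set"
  where "ideal_gen A \<equiv> span_over UNIV A"


section \<open>Projective space\<close>

text \<open>
  \<open>'a cring\<close> is the homogeneous coordinate ring $S$ of $\mathbb{P}^3$ and \<open>'a cfield\<close> its
  fraction field.  As $S$ is a domain, the sections of $\mathcal{O}(n)$ over $D_+(h)$, i.e. the
  degree \<open>n\<close> part of $S_h$, and all submodules of it, are subsets of \<open>'a cfield\<close>.
\<close>

type_synonym 'a cring = "(4, 'a) pol"
type_synonym 'a cfield = "'a cring fract"

abbreviation (input) quot :: "'a::field cring \<Rightarrow> 'a cring \<Rightarrow> 'a cfield"
  where "quot \<equiv> Fraction_Field.Fract"

text \<open>The \<open>h\<close> whose sets $D_+(h)$ form the standard basis of nonempty affine open sets.\<close>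

definition basics :: "'a::field cring set"
  where "basics = {h. h \<noteq> 0 \<and> homog (int (tot_deg h)) h \<and> tot_deg h > 0}"

definition sections_O :: "int \<Rightarrow> 'a::field cring \<Rightarrow> 'a cfield set"
  where "sections_O n h = {quot f (h ^ r) | f r. homog (int r * int (tot_deg h) + n) f}"

abbreviation regular :: "'a::field cring \<Rightarrow> 'a cfield set"
  where "regular \<equiv> sections_O 0"

text \<open>
  A closed subscheme of $\mathbb{P}^3$ is represented by its quasi-coherent ideal sheaf, and
  this in turn by its values on the basis of open sets $D_+(h)$.  The condition relating \<open>h\<close> and
  \<open>h * h'\<close> expresses the restriction maps (which are inclusions) and quasi-coherence; the sheaf
  property is then automatic.  Outside \<open>basics\<close> the function has a default value, so that
  equality of functions is equality of sheaves.
\<close>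

type_synonym 'a sheaf = "'a cring \<Rightarrow> 'a cfield set"

definition closed_subscheme :: "'a::field sheaf \<Rightarrow> bool"
  where "closed_subscheme J \<longleftrightarrow>
     J \<in> extensional basics \<and>
     (\<forall>h\<in>basics. is_ideal (regular h) (J h)) \<and>
     (\<forall>h\<in>basics. \<forall>h'\<in>basics. J (h * h') = span_over (regular (h * h')) (J h))"

text \<open>The ideal sheaf associated with a homogeneous ideal of $S$.\<close>

definition assoc_sheaf :: "'a::field cring set \<Rightarrow> 'a sheaf"
  where "assoc_sheaf I =
     (\<lambda>h\<in>basics. {quot f (h ^ r) | f r. f \<in> I \<and> homog (int r * int (tot_deg h)) f})"

definition contained_in :: "'a::field sheaf \<Rightarrow> 'a sheaf \<Rightarrow> bool"
  where "contained_in C D \<longleftrightarrow> (\<forall>h\<in>basics. D h \<subseteq> C h)"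

definition sheaf_pow :: "'a::field sheaf \<Rightarrow> nat \<Rightarrow> 'a sheaf"
  where "sheaf_pow J n = (\<lambda>h\<in>basics. ideal_pow (regular h) (J h) n)"

text \<open>The submodule $\mathcal{J}(n) = \mathcal{J}\cdot\mathcal{O}(n)$ of $\mathcal{O}(n)$.\<close>

definition twist :: "int \<Rightarrow> 'a::field sheaf \<Rightarrow> 'a sheaf"
  where "twist n J = (\<lambda>h\<in>basics. ideal_prod (regular h) (J h) (sections_O n h))"

text \<open>$\mathrm{H}^0(\mathcal{J}(n))$ as a subspace of $\mathrm{H}^0(\mathcal{O}(n)) = S_n$.\<close>

definition H0 :: "'a::field sheaf \<Rightarrow> int \<Rightarrow> 'a cring set"
  where "H0 J n = {F. homog n F \<and> (\<forall>h\<in>basics. quot F 1 \<in> twist n J h)}"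


subsection \<open>Points, dimension, associated points\<close>

text \<open>Points of $\mathrm{Proj}\,S$: homogeneous primes not containing the irrelevant ideal.\<close>

definition points :: "'a::field cring set set"
  where "points = {P. is_ideal UNIV P \<and>
     P = ideal_gen {f \<in> P. \<exists>n. homog n f} \<and>
     P \<noteq> UNIV \<and> (\<forall>f g. f * g \<in> P \<longrightarrow> f \<in> P \<or> g \<in> P) \<and>
     \<not> range var \<subseteq> P}"

text \<open>The support of the closed subscheme with ideal sheaf \<open>J\<close>; for a point \<open>P\<close> of $D_+(h)$,
  \<open>assoc_sheaf P h\<close> is the prime ideal of $\mathcal{O}(D_+(h))$ corresponding to \<open>P\<close>.\<close>

definition support :: "'a::field sheaf \<Rightarrow> 'a cring set set"
  where "support J = {P \<in> points. \<forall>h\<in>basics. h \<notin> P \<longrightarrow> J h \<subseteq> assoc_sheaf P h}"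

definition has_chain :: "'a::field sheaf \<Rightarrow> nat \<Rightarrow> bool"
  where "has_chain J n \<longleftrightarrow>
     (\<exists>P. (\<forall>i\<le>n. P i \<in> support J) \<and> (\<forall>i<n. P i \<subset> P (Suc i)))"

definition has_dimension :: "'a::field sheaf \<Rightarrow> nat \<Rightarrow> bool"
  where "has_dimension J n \<longleftrightarrow> has_chain J n \<and> \<not> has_chain J (Suc n)"

definition closed_point :: "'a::field cring set \<Rightarrow> bool"
  where "closed_point P \<longleftrightarrow> P \<in> points \<and> (\<forall>Q\<in>points. \<not> P \<subset> Q)"

text \<open>The associated points of $\mathcal{O}/\mathcal{J}$, i.e. the generic points of the
  irreducible and embedded components: \<open>P\<close> is the annihilator of a local section.\<close>

definition associated_point :: "'a::field sheaf \<Rightarrow> 'a cring set \<Rightarrow> bool"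
  where "associated_point J P \<longleftrightarrow> P \<in> points \<and>
     (\<exists>h\<in>basics. h \<notin> P \<and>
       (\<exists>s\<in>regular h. {r \<in> regular h. r * s \<in> J h} = assoc_sheaf P h))"


subsection \<open>Curves and their numerical invariants\<close>

definition lcm_curve :: "'a::field sheaf \<Rightarrow> bool"
  where "lcm_curve C \<longleftrightarrow> closed_subscheme C \<and> has_dimension C 1 \<and>
     (\<forall>P. associated_point C P \<longrightarrow> \<not> closed_point P)"

lemma vector_space_scal: "vector_space (scal :: 'a::field \<Rightarrow> ('v, 'a) pol \<Rightarrow> ('v, 'a) pol)"
  by unfold_locales
    (simp_all add: scal_def distrib_left distrib_right single_add mult_single flip: mult.assoc)

abbreviation dim_k :: "('v, 'a::field) pol set \<Rightarrow> nat"
  where "dim_k \<equiv> vector_space.dim scal"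

text \<open>$\dim_k S_n / \mathrm{H}^0(\mathcal{I}_C(n))$, which equals $\chi(\mathcal{O}_C(n))$
  for large \<open>n\<close>; the dimensions are finite.\<close>

definition hilbert_function :: "'a::field sheaf \<Rightarrow> nat \<Rightarrow> int"
  where "hilbert_function C n =
     int (dim_k {F :: 'a cring. homog (int n) F}) - int (dim_k (H0 C (int n)))"

definition hilbert_polynomial :: "'a::field sheaf \<Rightarrow> rat poly \<Rightarrow> bool"
  where "hilbert_polynomial C p \<longleftrightarrow>
     (\<forall>\<^sub>F n in sequentially. of_int (hilbert_function C n) = poly p (of_nat n))"

definition curve_degree_genus :: "'a::field sheaf \<Rightarrow> nat \<Rightarrow> int \<Rightarrow> bool"
  where "curve_degree_genus C \<delta> \<gamma> \<longleftrightarrow>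
     hilbert_polynomial C [:of_int (1 - \<gamma>), of_nat \<delta>:]"

definition curve_degree :: "'a::field sheaf \<Rightarrow> nat \<Rightarrow> bool"
  where "curve_degree C \<delta> \<longleftrightarrow> (\<exists>\<gamma>. curve_degree_genus C \<delta> \<gamma>)"

definition surface :: "'a::field cring \<Rightarrow> 'a sheaf"
  where "surface F = assoc_sheaf (ideal_gen {F})"

definition on_surface_of_degree :: "'a::field sheaf \<Rightarrow> nat \<Rightarrow> bool"
  where "on_surface_of_degree C n \<longleftrightarrow> n > 0 \<and>
     (\<exists>F. F \<noteq> 0 \<and> homog (int n) F \<and> contained_in C (surface F))"


section \<open>Multiple structures on lines\<close>

definition is_line :: "'a::field sheaf \<Rightarrow> bool"
  where "is_line L \<longleftrightarrow> (\<exists>l l'. homog 1 l \<and> homog 1 l' \<and>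
     (\<forall>\<alpha> \<beta>. scal \<alpha> l + scal \<beta> l' = 0 \<longrightarrow> \<alpha> = 0 \<and> \<beta> = 0) \<and>
     L = assoc_sheaf (ideal_gen {l, l'}))"

definition lcm_structure :: "nat \<Rightarrow> 'a::field sheaf \<Rightarrow> 'a sheaf \<Rightarrow> bool"
  where "lcm_structure d L C \<longleftrightarrow>
     lcm_curve C \<and> curve_degree C d \<and> support C = support L"

text \<open>Only meaningful if there is exactly one such structure.\<close>

definition the_lcm_structure :: "nat \<Rightarrow> 'a::field sheaf \<Rightarrow> 'a sheaf \<Rightarrow> 'a sheaf"
  where "the_lcm_structure d L S = (THE C. lcm_structure d L C \<and> contained_in C S)"

text \<open>
  A smooth surface in an open set is locally given by one equation, so a surface in a
  neighbourhood of \<open>P\<close> is $\{F = 0\} \cap D_+(h)$ after shrinking the neighbourhood to some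
  $D_+(h)$.  Smoothness is the Jacobian criterion at all points of this set (by Euler's formula
  the homogeneous partial derivatives can be used).
\<close>

definition smooth_surface_on :: "'a::field cring \<Rightarrow> 'a cring \<Rightarrow> bool"
  where "smooth_surface_on h F \<longleftrightarrow> (\<exists>n. homog n F) \<and>
     (\<forall>Q\<in>points. h \<notin> Q \<and> F \<in> Q \<longrightarrow> (\<exists>i. partial i F \<notin> Q))"

definition locally_in_smooth_surface :: "'a::field sheaf \<Rightarrow> 'a sheaf \<Rightarrow> bool"
  where "locally_in_smooth_surface L C \<longleftrightarrow>
     (\<forall>P\<in>support L. \<exists>h\<in>basics. h \<notin> P \<and>
       (\<exists>F. smooth_surface_on h F \<and> surface F h \<subseteq> C h))"

definition primitive_line :: "nat \<Rightarrow> 'a::field sheaf \<Rightarrow> 'a sheaf \<Rightarrow> bool"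
  where "primitive_line d L C \<longleftrightarrow> d \<ge> 2 \<and> is_line L \<and> lcm_structure d L C \<and>
     locally_in_smooth_surface L C"

text \<open>
  For $\mathcal{O}$-submodules $\mathcal{B} \subseteq \mathcal{A}$ and
  $\mathcal{B}' \subseteq \mathcal{A}'$ of the constant sheaf \<open>'a cfield\<close>, an isomorphism
  $\mathcal{A}/\mathcal{B} \cong \mathcal{A}'/\mathcal{B}'$ of $\mathcal{O}$-modules.  It is
  described on the basis of open sets, by maps \<open>\<phi> h\<close> sending a section of $\mathcal{A}$ to a
  representative of the image of its class: the conditions say that \<open>\<phi> h\<close> induces a well defined
  injective map on the quotients which is surjective, linear, and commutes with restriction.
\<close>

definition quotient_sheaf_iso ::
  "'a::field sheaf \<Rightarrow> 'a sheaf \<Rightarrow> 'a sheaf \<Rightarrow> 'a sheaf \<Rightarrow> bool"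
  where "quotient_sheaf_iso A B A' B' \<longleftrightarrow> (\<exists>\<phi>. \<forall>h\<in>basics.
     (\<forall>x\<in>A h. \<phi> h x \<in> A' h) \<and>
     (\<forall>x\<in>A h. \<forall>y\<in>A h. \<phi> h (x + y) - (\<phi> h x + \<phi> h y) \<in> B' h) \<and>
     (\<forall>r\<in>regular h. \<forall>x\<in>A h. \<phi> h (r * x) - r * \<phi> h x \<in> B' h) \<and>
     (\<forall>x\<in>A h. \<phi> h x \<in> B' h \<longleftrightarrow> x \<in> B h) \<and>
     (\<forall>y\<in>A' h. \<exists>x\<in>A h. \<phi> h x - y \<in> B' h) \<and>
     (\<forall>h'\<in>basics. \<forall>x\<in>A h. \<phi> (h * h') x - \<phi> h x \<in> B' (h * h')))"

text \<open>
  With $\mathcal{I}_{L,C} = \mathcal{I}_L/\mathcal{I}_C$ one has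
  $\mathcal{I}_{L,C}/\mathcal{I}_{L,C}^2 = \mathcal{I}_L/(\mathcal{I}_L^2 + \mathcal{I}_C)$; and
  $\mathcal{O}_L(e) = \mathcal{O}(e)/\mathcal{I}_L(e)$.
\<close>

definition has_type :: "'a::field sheaf \<Rightarrow> 'a sheaf \<Rightarrow> int \<Rightarrow> bool"
  where "has_type L C e \<longleftrightarrow>
     quotient_sheaf_iso L (\<lambda>h. ideal_sum (sheaf_pow L 2 h) (C h)) (sections_O e) (twist e L)"

definition primitive_line_of_type :: "nat \<Rightarrow> int \<Rightarrow> 'a::field sheaf \<Rightarrow> 'a sheaf \<Rightarrow> bool"
  where "primitive_line_of_type d e L C \<longleftrightarrow> primitive_line d L C \<and> has_type L C e"


section \<open>The polynomial $g$ and the curves $C_t$\<close>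

definition WT :: "(3 \<Rightarrow>\<^sub>0 nat) \<Rightarrow> nat"
  where "WT t = lookup t 0 + 2 * lookup t 1 + 3 * lookup t 2"

definition WT_homog :: "nat \<Rightarrow> (3, 'a::zero) pol \<Rightarrow> bool"
  where "WT_homog n p \<longleftrightarrow> (\<forall>t\<in>keys p. WT t = n)"

definition xy_power :: "nat \<Rightarrow> (3, 'a::field) pol set"
  where "xy_power n = ideal_pow UNIV (ideal_gen {var 0, var 1}) n"

definition good_g :: "nat \<Rightarrow> nat \<Rightarrow> (3, 'a::field) pol \<Rightarrow> bool"
  where "good_g m d g \<longleftrightarrow>
     (\<exists>a. (\<forall>i\<in>{1..m}. \<forall>t\<in>keys (a i). lookup t 2 = 0) \<and>
          g = var 2 ^ m + (\<Sum>i=1..m. a i * var 2 ^ (m - i))) \<and>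
     WT_homog (3 * m) g \<and>
     (\<forall>t\<in>keys g. mon t \<notin> (xy_power (d - 1) :: (3, 'a) pol set)) \<and>
     lookup g (single 0 (3 * (m - 1)) + single 2 1) \<noteq> 0"

definition no_poly_of_degree :: "nat \<Rightarrow> (3, 'a::field) pol \<Rightarrow> bool"
  where "no_poly_of_degree d g \<longleftrightarrow>
     \<not> (\<exists>f \<in> ideal_sum (xy_power (d - 1)) (ideal_gen {g}). f \<noteq> 0 \<and> tot_deg f = d - 2)"

text \<open>$W^N g(X/W, Y/W, Z/W)$, for \<open>N\<close> at least the degree of \<open>g\<close>.\<close>

definition homogenize :: "nat \<Rightarrow> (3, 'a::field) pol \<Rightarrow> 'a cring"
  where "homogenize N g = (\<Sum>t\<in>keys g. scal (lookup g t)
     (var 0 ^ lookup t 0 * var 1 ^ lookup t 1 * var 2 ^ lookup t 2 * var 3 ^ (N - mon_deg t)))"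

definition line_L :: "'a::field sheaf"
  where "line_L = assoc_sheaf (ideal_gen {var 0, var 1})"

definition surface_S :: "nat \<Rightarrow> (3, 'a::field) pol \<Rightarrow> nat \<Rightarrow> 'a \<Rightarrow> 'a sheaf"
  where "surface_S d g a t = surface
     (var 0 * homogenize (d - 1) g * var 2 ^ a - scal t (var 1 * var 3 ^ (a + d - 1)))"

definition curve_C :: "nat \<Rightarrow> (3, 'a::field) pol \<Rightarrow> nat \<Rightarrow> 'a \<Rightarrow> 'a sheaf"
  where "curve_C d g a t = the_lcm_structure d line_L (surface_S d g a t)"

end

theory Submission
  imports Defs
begin

text \<open>
  In the chart $W = 1$ the equation of $S_t$ reads $y = t^{-1} x z^a g(x, y, z)$, and iterating it gives a power
  series $y = \varphi(x, z)$ in $x$ with leading term $t^{-1} x z^{a+m}$.  So \<open>theta\<close>, the substitution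
  $(x, y, z, w) \mapsto (x, \varphi, z, 1)$, describes $C_t$: its ideal consists of the $f$ with
  $x^d \mid \theta(f)$.  Any locally Cohen-Macaulay structure on $L$ inside $S_t$ is of this form with some exponent
  in place of $d$, since its ideals on the charts are primary, and the degree determines the exponent.

  Smoothness along $W = 0$, the Hilbert polynomial and the type come from an equation that is linear in $x$ near
  the point $W = 0$ of $L$.  Such an equation exists because, for the weights $1, 2, 3$ of $x, y, z$, the polynomial $g$
  is homogeneous: modulo $x^d$ a power of $z$ times $x$ is a polynomial in $\varphi$ and $z$ of sufficiently
  small weight.

  For (ii), an equation of $C_t$ is $u (x z^a g - t y)$ modulo $(x, y)^d$.  If $u \notin (x, y)^{d-1}$, the part of highest
  weight of $u$ times $g$ yields a nonzero element of $(x, y)^{d-1} + (g)$ of degree at most $d - 2$.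
  For (A4) take $C_t$ with $a = d' - d$ and add a disjoint line or double line.
\<close>

text \<open>The obstacle is the point W = 0 of L: there the equation of S_t is singular, and phi,
  computed at W = 1, says nothing directly. With \<kappa> = a + m, the relation t phi = x z^a g(x,
  phi, z) trades z^\<kappa> x, of weight 3\<kappa> + 1, for t phi, of weight 2, and for terms of
  unchanged weight but higher order in x. Modulo x^d this stops and yields x z^N = Psi(phi, z) with
  weights at most 3N + 2 - 3\<kappa>. A monomial phi^i z^j with i < d has degree (weight + i)/3,
  hence at most N + (d + 1 - 3\<kappa>)/3, and this is at most N because d + 1 = 3m. So x z^N -
  Psi(y, z) homogenises to an equation in which x z^N is the only term without W. All else is first
  order: both charts share the linear part t w^\<kappa> y - z^\<kappa> x, which gives normal forms
  (Hilbert function) and the type \<kappa> - 1. For uniqueness, an unknown structure could have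
  multiplicity r > d, where no equation at W = 0 is available; independence of the normal forms
  still bounds its degree from below by r. In (A4) the added structure is dictated by the genus: a
  reduced line for d + 1, a double line for d + 2.\<close>

declare One_nat_def [simp del]

section \<open>Evaluation and grading of polynomials\<close>

definition cst :: "'a \<Rightarrow> ('v, 'a::comm_ring_1) pol" where "cst c = single 0 c"

lemma cst_simps [simp]: "cst 0 = 0" "cst 1 = 1"
  by (simp_all add: cst_def)

lemma cst_add: "cst (a + b) = cst a + cst b"
  and cst_mult: "cst (a * b) = cst a * cst b"
  by (simp_all add: cst_def single_add mult_single)

lemma scal_eq: "scal c p = cst c * p"
  by (simp add: scal_def cst_def)

lemma lookup_cst_mult: "lookup (cst c * p) t = c * lookup p t"
  by (simp add: cst_def flip: mult_map_scale_conv_mult)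
     (simp add: Poly_Mapping.map.rep_eq when_def)

lemma pol_sum_monomials: "p = (\<Sum>t\<in>keys p. single t (lookup p t))"
  by (rule poly_mapping_eqI) (simp add: lookup_sum lookup_single when_def in_keys_iff)

lemma single_conv_cst: "single t c = cst c * mon t"
  by (simp add: cst_def mult_single)

lemma pol_induct [case_names mon add]:
  assumes "\<And>t c. P (single t c)" "\<And>p q. P p \<Longrightarrow> P q \<Longrightarrow> P (p + q)"
  shows "P (p :: ('v, 'a::comm_ring_1) pol)"
proof -
  have "P (\<Sum>t\<in>A. single t (lookup p t))" if "finite A" for A
    using that
  proof (induction A rule: finite_induct)
    case empty
    show ?case using assms(1)[of 0 0] by simp
  qed (simp add: assms)
  from this[of "keys p"] show ?thesis using pol_sum_monomials[of p] by simp
qed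

lemma sum_single_mono: "t = (\<Sum>i\<in>UNIV. single i (lookup t i))" for t :: "'v::finite \<Rightarrow>\<^sub>0 nat"
  by (rule poly_mapping_eqI) (simp add: lookup_sum lookup_single when_def)

lemma mon_sum: "finite A \<Longrightarrow> (mon (\<Sum>i\<in>A. f i) :: ('v, 'a::comm_ring_1) pol) = (\<Prod>i\<in>A. mon (f i))"
proof (induction A rule: finite_induct)
  case (insert x A)
  have "mon (f x + sum f A) = (mon (f x) * mon (sum f A) :: ('v, 'a) pol)"
    by (simp add: mult_single)
  then show ?case using insert by simp
qed simp

lemma var_power: "(var i :: ('v, 'a::comm_ring_1) pol) ^ n = mon (single i n)"
proof (induction n)
  case (Suc n)
  have "single i (Suc n) = single i 1 + single i n" by (metis single_add plus_1_eq_Suc)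
  then show ?case using Suc by (simp add: mult_single)
qed simp

lemma mon_conv_prod:
  "(mon t :: ('v::finite, 'a::comm_ring_1) pol) = (\<Prod>i\<in>UNIV. var i ^ lookup t i)"
  by (subst sum_single_mono) (simp add: mon_sum var_power)

text \<open>The coefficient map \<open>c\<close> is free because evaluations go to polynomial rings,
  to polynomials in one auxiliary variable (first order expansions), to the fraction field (charts)
  and to the field itself.\<close>

definition peval :: "('a \<Rightarrow> 'r) \<Rightarrow> ('v \<Rightarrow> 'r) \<Rightarrow> ('v::finite, 'a::comm_ring_1) pol \<Rightarrow> 'r::comm_ring_1"
  where "peval c \<rho> p = (\<Sum>t\<in>keys p. c (lookup p t) * (\<Prod>i\<in>UNIV. \<rho> i ^ lookup t i))"

locale coeff_hom =
  fixes c :: "'a::comm_ring_1 \<Rightarrow> 'r::comm_ring_1"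
  assumes c_add: "c (x + y) = c x + c y" and c_mult: "c (x * y) = c x * c y" and c_one: "c 1 = 1"
begin

lemma c_zero: "c 0 = 0"
  using c_add[of 0 0] by simp

lemma c_minus: "c (- x) = - c x"
  using c_add[of x "-x"] c_zero by (simp add: eq_neg_iff_add_eq_0 add.commute)

abbreviation "ev \<equiv> peval c"

lemma peval_superset:
  assumes "finite A" "keys p \<subseteq> A"
  shows "ev \<rho> p = (\<Sum>t\<in>A. c (lookup p t) * (\<Prod>i\<in>UNIV. \<rho> i ^ lookup t i))"
  unfolding peval_def
  by (rule sum.mono_neutral_left) (use assms in \<open>auto simp: in_keys_iff c_zero\<close>)

lemma peval_add: "ev \<rho> (p + q) = ev \<rho> p + ev \<rho> q"
proof -
  have "keys (p + q) \<subseteq> keys p \<union> keys q" by (rule Poly_Mapping.keys_add)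
  then show ?thesis
    by (simp add: peval_superset[of "keys p \<union> keys q"] lookup_add c_add ring_distribs sum.distrib)
qed

lemma peval_single: "ev \<rho> (single t a) = c a * (\<Prod>i\<in>UNIV. \<rho> i ^ lookup t i)"
  by (subst peval_superset[of "{t}"]) auto

lemma peval_zero [simp]: "ev \<rho> 0 = 0"
  by (simp add: peval_def)

lemma peval_cst: "ev \<rho> (cst a) = c a"
  by (simp add: cst_def peval_single)

lemma peval_one [simp]: "ev \<rho> 1 = 1"
  using peval_cst[of \<rho> 1] by (simp add: c_one)

lemma peval_minus: "ev \<rho> (- p) = - ev \<rho> p"
  using peval_add[of \<rho> p "-p"] by (simp add: eq_neg_iff_add_eq_0 add.commute)

lemma peval_diff: "ev \<rho> (p - q) = ev \<rho> p - ev \<rho> q"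
  using peval_add[of \<rho> p "-q"] by (simp add: peval_minus)

lemma peval_sum: "ev \<rho> (\<Sum>x\<in>A. f x) = (\<Sum>x\<in>A. ev \<rho> (f x))"
  by (induction A rule: infinite_finite_induct) (simp_all add: peval_add)

lemma peval_mult: "ev \<rho> (p * q) = ev \<rho> p * ev \<rho> q"
proof (induction p rule: pol_induct)
  case (mon t a)
  show ?case
  proof (induction q rule: pol_induct)
    case (mon s b)
    show ?case
      by (simp add: mult_single peval_single c_mult lookup_add power_add prod.distrib mult_ac)
  qed (simp add: distrib_left peval_add)
qed (simp add: distrib_right peval_add)

lemma peval_power: "ev \<rho> (p ^ n) = ev \<rho> p ^ n"
  by (induction n) (simp_all add: peval_mult)

lemma peval_var [simp]: "ev \<rho> (var j) = \<rho> j"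
proof -
  have "(\<Prod>i\<in>UNIV. \<rho> i ^ lookup (single j 1) i) = (\<Prod>i\<in>UNIV. if i = j then \<rho> i else 1)"
    by (rule prod.cong) (auto simp: lookup_single when_def)
  then show ?thesis by (simp add: peval_single c_one)
qed

lemma peval_mon: "ev \<rho> (mon t) = (\<Prod>i\<in>UNIV. \<rho> i ^ lookup t i)"
  by (simp add: peval_single c_one)

lemma peval_scal: "ev \<rho> (scal a p) = c a * ev \<rho> p"
  by (simp add: scal_eq peval_mult peval_cst)

lemmas peval_simps = peval_add peval_minus peval_diff peval_mult peval_power peval_cst peval_scal peval_sum

text \<open>The universal property of polynomial rings. Composite substitutions are computed below
  by taking the composite as \<open>H\<close> and reading off its values on the variables.\<close>

lemma peval_unique:
  assumes "\<And>p q. H (p + q) = H p + H q" "\<And>p q. H (p * q) = H p * H q" "\<And>a. H (cst a) = c a"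
  shows "H p = ev (\<lambda>i. H (var i)) p"
proof (induction p rule: pol_induct)
  case (mon t a)
  have "H 1 = 1" using assms(3)[of 1] by (simp add: c_one)
  then have pow: "H (p ^ n) = H p ^ n" for p n by (induction n) (simp_all add: assms)
  have prd: "H (\<Prod>i\<in>A. f i) = (\<Prod>i\<in>A. H (f i))" if "finite A" for A and f :: "'b \<Rightarrow> _"
    using that by (induction A rule: finite_induct) (simp_all add: assms \<open>H 1 = 1\<close>)
  show ?case
    by (simp add: single_conv_cst[of t a] assms peval_simps peval_mon)
       (simp add: mon_conv_prod[of t] pow prd)
qed (simp add: assms peval_add)

lemma peval_scale:
  assumes "homog (int n) p"
  shows "ev (\<lambda>i. u * \<rho> i) p = u ^ n * ev \<rho> p"
proof -
  have "(\<Prod>i\<in>UNIV. (u * \<rho> i) ^ lookup t i) = u ^ n * (\<Prod>i\<in>UNIV. \<rho> i ^ lookup t i)" if "t \<in> keys p" for t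
  proof -
    have "(\<Sum>i\<in>UNIV. lookup t i) = n"
      using that assms by (auto simp: homog_def mon_deg_def simp del: of_nat_sum)
    then show ?thesis by (simp add: power_mult_distrib prod.distrib flip: power_sum)
  qed
  then show ?thesis by (simp add: peval_def sum_distrib_left mult_ac)
qed

lemma peval_induct:
  assumes "\<And>t. t \<in> keys p \<Longrightarrow> Q (c (lookup p t) * (\<Prod>i\<in>UNIV. \<rho> i ^ lookup t i))"
    "Q 0" "\<And>x y. Q x \<Longrightarrow> Q y \<Longrightarrow> Q (x + y)"
  shows "Q (ev \<rho> p)"
proof -
  have "Q (\<Sum>t\<in>A. c (lookup p t) * (\<Prod>i\<in>UNIV. \<rho> i ^ lookup t i))" if "A \<subseteq> keys p" for A
    using finite_subset[OF that finite_keys] that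
    by (induction A rule: finite_induct) (use assms in auto)
  then show ?thesis by (simp add: peval_def)
qed

end

interpretation cst: coeff_hom "cst :: 'a::comm_ring_1 \<Rightarrow> ('v, 'a) pol"
  by unfold_locales (simp_all add: cst_add cst_mult)

lemma peval_id [simp]: "peval cst var p = p"
  by (induction p rule: pol_induct)
     (simp_all add: cst.peval_add cst.peval_single mon_conv_prod single_conv_cst[symmetric] flip: mon_conv_prod)

abbreviation subst :: "('v \<Rightarrow> ('w, 'a) pol) \<Rightarrow> ('v::finite, 'a::comm_ring_1) pol \<Rightarrow> ('w, 'a) pol"
  where "subst \<equiv> peval cst"

lemmas subst_simps = cst.peval_simps cst.peval_var cst.peval_zero cst.peval_one

section \<open>Ideals as closed subsets, and congruences modulo them\<close>

definition idl :: "'r::comm_ring_1 set \<Rightarrow> bool"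
  where "idl I \<longleftrightarrow> 0 \<in> I \<and> (\<forall>x\<in>I. \<forall>y\<in>I. x + y \<in> I) \<and> (\<forall>r. \<forall>x\<in>I. r * x \<in> I)"

lemma idlI: "0 \<in> I \<Longrightarrow> (\<And>x y. x \<in> I \<Longrightarrow> y \<in> I \<Longrightarrow> x + y \<in> I) \<Longrightarrow> (\<And>r x. x \<in> I \<Longrightarrow> r * x \<in> I) \<Longrightarrow> idl I"
  by (auto simp: idl_def)

context
  fixes I :: "'r::comm_ring_1 set" assumes I: "idl I"
begin

lemma idl_0: "0 \<in> I" and idl_add: "x \<in> I \<Longrightarrow> y \<in> I \<Longrightarrow> x + y \<in> I"
  and idl_mult: "x \<in> I \<Longrightarrow> r * x \<in> I"
  using I by (auto simp: idl_def)

lemma idl_mult_right: "x \<in> I \<Longrightarrow> x * r \<in> I"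
  using idl_mult by (metis mult.commute)

lemma idl_minus: "x \<in> I \<Longrightarrow> - x \<in> I"
  using idl_mult[of x "-1"] by simp

lemma idl_diff: "x \<in> I \<Longrightarrow> y \<in> I \<Longrightarrow> x - y \<in> I"
  using idl_add[OF _ idl_minus] by fastforce

lemma idl_cong: "x - y \<in> I \<Longrightarrow> x \<in> I \<longleftrightarrow> y \<in> I"
  using idl_add[of "x - y" y] idl_diff[of x "x - y"] by auto

lemma idl_sum: "(\<And>a. a \<in> A \<Longrightarrow> f a \<in> I) \<Longrightarrow> sum f A \<in> I"
  by (induction A rule: infinite_finite_induct) (auto intro: idl_0 idl_add)

lemma idl_mult_cong: "x - y \<in> I \<Longrightarrow> x' - y' \<in> I \<Longrightarrow> x * x' - y * y' \<in> I"
proof -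
  assume a: "x - y \<in> I" "x' - y' \<in> I"
  have "x * x' - y * y' = x' * (x - y) + y * (x' - y')" by (simp add: algebra_simps)
  then show ?thesis using a by (auto intro: idl_add idl_mult)
qed

lemma idl_add_cong: "x - y \<in> I \<Longrightarrow> x' - y' \<in> I \<Longrightarrow> x + x' - (y + y') \<in> I"
  using idl_add[of "x - y" "x' - y'"] by (simp add: algebra_simps)

lemma idl_trans: "x - y \<in> I \<Longrightarrow> y - z \<in> I \<Longrightarrow> x - z \<in> I"
  using idl_add[of "x - y" "y - z"] by simp

lemma idl_power_cong: "x - y \<in> I \<Longrightarrow> x ^ n - y ^ n \<in> I"
  by (induction n) (auto intro: idl_mult_cong idl_0)

lemma idl_power: "x \<in> I \<Longrightarrow> n > 0 \<Longrightarrow> x ^ n \<in> I"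
  by (cases n) (auto intro: idl_mult_right)

lemma idl_prod_cong: "(\<And>i. i \<in> A \<Longrightarrow> f i - g i \<in> I) \<Longrightarrow> prod f A - prod g A \<in> I"
  by (induction A rule: infinite_finite_induct) (auto intro: idl_mult_cong idl_0)

text \<open>Polynomial expressions respect congruences. All later reductions modulo an ideal use
  this form: a variable is replaced by an element congruent to it.\<close>

lemma idl_peval_cong: "(\<And>i. \<rho> i - \<sigma> i \<in> I) \<Longrightarrow> peval c \<rho> p - peval c \<sigma> p \<in> I"
  unfolding peval_def sum_subtractf[symmetric]
  by (rule idl_sum) (auto intro!: idl_mult idl_prod_cong idl_power_cong simp flip: right_diff_distrib)

end

lemma idl_Int: "idl I \<Longrightarrow> idl J \<Longrightarrow> idl (I \<inter> J)"
  by (auto simp: idl_def)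

lemma idl_sum_ideal: "idl I \<Longrightarrow> idl J \<Longrightarrow> idl (ideal_sum I J)"
proof (rule idlI)
  assume I: "idl I" and J: "idl J"
  show "0 \<in> ideal_sum I J"
    using idl_0[OF I] idl_0[OF J] by (force simp: ideal_sum_def)
  show "x + y \<in> ideal_sum I J" if xy: "x \<in> ideal_sum I J" "y \<in> ideal_sum I J" for x y
  proof -
    obtain a b a' b' where "x = a + b" "y = a' + b'" "a \<in> I" "a' \<in> I" "b \<in> J" "b' \<in> J"
      using xy unfolding ideal_sum_def by blast
    then have "x + y = (a + a') + (b + b')" "a + a' \<in> I" "b + b' \<in> J"
      by (auto intro: idl_add I J)
    then show ?thesis unfolding ideal_sum_def by blast
  qed
  show "r * x \<in> ideal_sum I J" if "x \<in> ideal_sum I J" for r x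
    using that I J by (force simp: ideal_sum_def distrib_left intro: idl_mult)
qed

lemma ideal_sum_left: "idl J \<Longrightarrow> x \<in> I \<Longrightarrow> x \<in> ideal_sum I J"
  by (force simp: ideal_sum_def dest: idl_0)

lemma ideal_sum_right: "idl I \<Longrightarrow> x \<in> J \<Longrightarrow> x \<in> ideal_sum I J"
  by (force simp: ideal_sum_def dest: idl_0)

section \<open>Submodules over a subring and their generators\<close>

definition subring :: "'r::comm_ring_1 set \<Rightarrow> bool"
  where "subring R \<longleftrightarrow> 0 \<in> R \<and> 1 \<in> R \<and> (\<forall>x\<in>R. \<forall>y\<in>R. x + y \<in> R \<and> x * y \<in> R)"

definition submod :: "'r::comm_ring_1 set \<Rightarrow> 'r set \<Rightarrow> bool"
  where "submod R M \<longleftrightarrow> 0 \<in> M \<and> (\<forall>x\<in>M. \<forall>y\<in>M. x + y \<in> M) \<and> (\<forall>r\<in>R. \<forall>x\<in>M. r * x \<in> M)"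

lemma submod_sum: "submod R M \<Longrightarrow> (\<And>a. a \<in> A \<Longrightarrow> f a \<in> M) \<Longrightarrow> sum f A \<in> M"
  by (induction A rule: infinite_finite_induct) (auto simp: submod_def)

lemma span_over_least: "submod R M \<Longrightarrow> A \<subseteq> M \<Longrightarrow> span_over R A \<subseteq> M"
  by (auto simp: span_over_def intro!: submod_sum) (auto simp: submod_def)

lemma span_over_superset: "subring R \<Longrightarrow> A \<subseteq> span_over R A"
proof
  fix a assume "subring R" "a \<in> A"
  then show "a \<in> span_over R A"
    unfolding span_over_def by (intro CollectI exI[of _ "{a}"] exI[of _ "\<lambda>_. 1"]) (auto simp: subring_def)
qed

lemma span_over_submod:
  assumes R: "subring R"
  shows "submod R (span_over R A)"
  unfolding submod_def
proof (intro conjI ballI)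
  show "0 \<in> span_over R A"
    unfolding span_over_def by (intro CollectI exI[of _ "{}"]) auto
next
  fix x y assume "x \<in> span_over R A" "y \<in> span_over R A"
  then obtain B c B' c' where *: "x = (\<Sum>a\<in>B. c a * a)" "finite B" "B \<subseteq> A" "\<forall>a\<in>B. c a \<in> R"
    "y = (\<Sum>a\<in>B'. c' a * a)" "finite B'" "B' \<subseteq> A" "\<forall>a\<in>B'. c' a \<in> R"
    by (auto simp: span_over_def)
  define d where "d a = (if a \<in> B then c a else 0) + (if a \<in> B' then c' a else 0)" for a
  have "x = (\<Sum>a\<in>B \<union> B'. (if a \<in> B then c a else 0) * a)"
    unfolding *(1) using * by (intro sum.mono_neutral_cong_left) auto
  moreover have "y = (\<Sum>a\<in>B \<union> B'. (if a \<in> B' then c' a else 0) * a)"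
    unfolding *(5) using * by (intro sum.mono_neutral_cong_left) auto
  ultimately have "x + y = (\<Sum>a\<in>B \<union> B'. d a * a)"
    by (simp add: d_def distrib_right sum.distrib)
  moreover have "\<forall>a\<in>B \<union> B'. d a \<in> R"
    using * R by (auto simp: d_def subring_def)
  ultimately show "x + y \<in> span_over R A"
    unfolding span_over_def using * by (intro CollectI exI[of _ "B \<union> B'"] exI[of _ d]) auto
next
  fix r x assume r: "r \<in> R" and "x \<in> span_over R A"
  then obtain B c where *: "x = (\<Sum>a\<in>B. c a * a)" "finite B" "B \<subseteq> A" "\<forall>a\<in>B. c a \<in> R"
    by (auto simp: span_over_def)
  then have "r * x = (\<Sum>a\<in>B. (r * c a) * a)"
    by (simp add: sum_distrib_left mult.assoc)
  with * r R show "r * x \<in> span_over R A"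
    unfolding span_over_def by (intro CollectI exI[of _ B] exI[of _ "\<lambda>a. r * c a"]) (auto simp: subring_def)
qed

lemma span_over_eq: "subring R \<Longrightarrow> submod R M \<Longrightarrow> A \<subseteq> M \<Longrightarrow> M \<subseteq> span_over R A \<Longrightarrow> span_over R A = M"
  using span_over_least by blast

lemma is_ideal_iff: "subring R \<Longrightarrow> is_ideal R I \<longleftrightarrow> I \<subseteq> R \<and> submod R I"
  unfolding is_ideal_def
  using span_over_submod span_over_least[of R I I] span_over_superset[of R I] by (metis order_refl subset_antisym)

lemma subring_UNIV [simp]: "subring UNIV"
  by (simp add: subring_def)

lemma submod_UNIV: "submod UNIV I \<longleftrightarrow> idl I"
  by (simp add: submod_def idl_def)

lemma is_ideal_UNIV: "is_ideal UNIV I \<longleftrightarrow> idl I"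
  by (simp add: is_ideal_iff submod_UNIV)

lemma idl_ideal_gen: "idl (ideal_gen A)"
  using span_over_submod[of UNIV A] by (simp add: submod_UNIV)

lemma ideal_gen_superset: "A \<subseteq> ideal_gen A"
  by (simp add: span_over_superset)

lemma ideal_gen_least: "idl I \<Longrightarrow> A \<subseteq> I \<Longrightarrow> ideal_gen A \<subseteq> I"
  by (simp add: span_over_least submod_UNIV)

lemma idl_prod_ideal: "idl (ideal_prod UNIV I J)"
  unfolding ideal_prod_def by (rule idl_ideal_gen)

lemma mult_in_ideal_prod: "subring R \<Longrightarrow> x \<in> I \<Longrightarrow> y \<in> J \<Longrightarrow> x * y \<in> ideal_prod R I J"
  unfolding ideal_prod_def using span_over_superset by fast

lemma ideal_prod_least:
  "submod R M \<Longrightarrow> (\<And>x y. x \<in> I \<Longrightarrow> y \<in> J \<Longrightarrow> x * y \<in> M) \<Longrightarrow> ideal_prod R I J \<subseteq> M"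
  unfolding ideal_prod_def by (rule span_over_least) auto

section \<open>Homogeneous components and graded ideals\<close>

lemma mon_deg_add: "mon_deg (s + t) = mon_deg s + mon_deg t"
  by (simp add: mon_deg_def lookup_add sum.distrib)

lemma mon_deg_single [simp]: "mon_deg (single i n) = n"
  by (simp add: mon_deg_def lookup_single when_def)

lemma mon_deg_zero [simp]: "mon_deg 0 = 0"
  by (simp add: mon_deg_def)

lemma homog_zero [simp]: "homog n 0"
  by (simp add: homog_def)

lemma homog_add: "homog n p \<Longrightarrow> homog n q \<Longrightarrow> homog n (p + q)"
  using Poly_Mapping.keys_add[of p q] by (auto simp: homog_def)

lemma homog_minus: "homog n p \<Longrightarrow> homog n (- p)" for p :: "('v::finite, 'a::comm_ring_1) pol"
  by (simp add: homog_def)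

lemma homog_diff: "homog n p \<Longrightarrow> homog n q \<Longrightarrow> homog n (p - q)"
  for p q :: "('v::finite, 'a::comm_ring_1) pol"
  using homog_add[of n p "-q"] homog_minus[of n q] by simp

lemma homog_sum: "(\<And>x. x \<in> A \<Longrightarrow> homog n (f x)) \<Longrightarrow> homog n (sum f A)"
  by (induction A rule: infinite_finite_induct) (auto intro: homog_add)

lemma homog_mult:
  fixes p q :: "('v::finite, 'a::comm_ring_1) pol"
  assumes "homog n p" "homog m q"
  shows "homog (n + m) (p * q)"
  using keys_mult[of p q] assms by (fastforce simp: homog_def mon_deg_add)

lemma homog_single: "int (mon_deg t) = n \<Longrightarrow> homog n (single t c)"
  by (simp add: homog_def)

lemma homog_cst: "homog 0 (cst c :: ('v::finite, 'a::comm_ring_1) pol)"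
  by (simp add: cst_def homog_single)

lemma homog_one: "homog 0 (1 :: ('v::finite, 'a::comm_ring_1) pol)"
  using homog_cst[of 1] by simp

lemma homog_var: "homog 1 (var i :: ('v::finite, 'a::comm_ring_1) pol)"
  by (simp add: homog_single)

lemma homog_power:
  fixes p :: "('v::finite, 'a::comm_ring_1) pol"
  shows "homog n p \<Longrightarrow> homog (int k * n) (p ^ k)"
proof (induction k)
  case (Suc k)
  then show ?case using homog_mult[of n p "int k * n" "p ^ k"] by (simp add: algebra_simps)
qed (simp add: homog_one)

lemma homog_var_power: "homog (int k) (var i ^ k :: ('v::finite, 'a::comm_ring_1) pol)"
  using homog_power[OF homog_var, of k i] by simp

lemma homog_scal: "homog n p \<Longrightarrow> homog n (scal c p)"
  for p :: "('v::finite, 'a::comm_ring_1) pol"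
  using homog_mult[OF homog_cst, of n p c] by (simp add: scal_eq)

lemma homog_negative: "homog n p \<Longrightarrow> n < 0 \<Longrightarrow> p = 0"
  for p :: "('v::finite, 'a::zero) pol"
  unfolding homog_def keys_eq_empty[symmetric] by fastforce

lemma tot_deg_homog: "homog (int n) p \<Longrightarrow> p \<noteq> 0 \<Longrightarrow> tot_deg p = n"
  for p :: "('v::finite, 'a::zero) pol"
proof -
  assume *: "homog (int n) p" "p \<noteq> 0"
  then obtain t where t: "t \<in> keys p" by (metis keys_eq_empty ex_in_conv)
  have "mon_deg ` keys p = {n}" using * t by (force simp: homog_def)
  then show ?thesis by (simp add: tot_deg_def)
qed

lemma mon_deg_le_tot_deg: "t \<in> keys p \<Longrightarrow> mon_deg t \<le> tot_deg p"
  unfolding tot_deg_def by (rule Max_ge) auto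

lemma tot_deg_le: "(\<And>t. t \<in> keys p \<Longrightarrow> mon_deg t \<le> n) \<Longrightarrow> tot_deg p \<le> n"
  unfolding tot_deg_def by (subst Max_le_iff) auto

text \<open>One operation covers homogeneous components, truncations by order along a line, and
  parts of a given weight.\<close>

definition restr :: "('v \<Rightarrow>\<^sub>0 nat) set \<Rightarrow> ('v, 'a::comm_ring_1) pol \<Rightarrow> ('v, 'a) pol"
  where "restr A p = (\<Sum>t\<in>keys p \<inter> A. single t (lookup p t))"

lemma lookup_restr: "lookup (restr A p) t = (if t \<in> A then lookup p t else 0)"
  by (auto simp: restr_def lookup_sum lookup_single when_def in_keys_iff)

lemma keys_restr: "keys (restr A p) = keys p \<inter> A"
  by (auto simp: in_keys_iff lookup_restr split: if_splits)

lemma restr_add: "restr A (p + q) = restr A p + restr A q"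
  by (rule poly_mapping_eqI) (simp add: lookup_restr lookup_add)

lemma restr_compl: "p = restr A p + restr (- A) p"
  by (rule poly_mapping_eqI) (simp add: lookup_restr lookup_add)

lemma restr_id: "keys p \<subseteq> A \<Longrightarrow> restr A p = p"
  by (rule poly_mapping_eqI) (auto simp: lookup_restr in_keys_iff)

lemma restr_zero [simp]: "restr A 0 = 0"
  by (rule poly_mapping_eqI) (simp add: lookup_restr)

lemma restr_eq_zero: "restr A p = 0 \<longleftrightarrow> keys p \<inter> A = {}"
  by (metis keys_eq_empty keys_restr)

lemma sum_restr_level:
  "p = (\<Sum>n\<in>w ` keys p. restr {t. w t = n} p)"
proof (rule poly_mapping_eqI)
  fix t
  have "(\<Sum>n\<in>w ` keys p. if w t = n then lookup p t else 0) = lookup p t"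
    by (cases "t \<in> keys p") (auto simp: in_keys_iff)
  then show "lookup p t = lookup (\<Sum>n\<in>w ` keys p. restr {t. w t = n} p) t"
    by (simp add: lookup_sum lookup_restr)
qed

abbreviation comp :: "nat \<Rightarrow> ('v::finite, 'a::comm_ring_1) pol \<Rightarrow> ('v, 'a) pol"
  where "comp n \<equiv> restr {t. mon_deg t = n}"

lemma homog_comp: "homog (int n) (comp n p)"
  by (simp add: homog_def keys_restr)

lemma comp_homog: "homog (int n) p \<Longrightarrow> comp m p = (if n = m then p else 0)"
  by (auto simp: restr_eq_zero homog_def intro!: restr_id)

lemma comp_mult_homog:
  fixes p q :: "('v::finite, 'a::comm_ring_1) pol"
  assumes "homog (int n) q"
  shows "comp m (q * p) = (if n \<le> m then q * comp (m - n) p else 0)"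
proof (induction p rule: pol_induct)
  case (mon t c)
  have *: "homog (int (n + mon_deg t)) (q * single t c)"
    using homog_mult[OF assms homog_single[OF refl]] by simp
  have "comp k (single t c) = (if mon_deg t = k then single t c else 0)" for k
    by (rule comp_homog) (simp add: homog_single)
  then show ?case using comp_homog[OF *, of m] by (auto simp: not_le)
qed (auto simp: distrib_left restr_add)

definition graded :: "('v::finite, 'a::comm_ring_1) pol set \<Rightarrow> bool"
  where "graded I \<longleftrightarrow> idl I \<and> (\<forall>f\<in>I. \<forall>n. comp n f \<in> I)"

lemma graded_gen:
  assumes "graded I"
  shows "I = ideal_gen {f \<in> I. \<exists>n. homog n f}"
proof
  have I: "idl I" using assms by (simp add: graded_def)
  show "ideal_gen {f \<in> I. \<exists>n. homog n f} \<subseteq> I"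
    by (rule ideal_gen_least[OF I]) auto
  show "I \<subseteq> ideal_gen {f \<in> I. \<exists>n. homog n f}"
  proof
    fix f assume "f \<in> I"
    then have "comp n f \<in> ideal_gen {f \<in> I. \<exists>n. homog n f}" for n
      using assms homog_comp by (intro subsetD[OF ideal_gen_superset]) (auto simp: graded_def)
    then show "f \<in> ideal_gen {f \<in> I. \<exists>n. homog n f}"
      by (subst sum_restr_level[of f mon_deg]) (auto intro: idl_sum idl_ideal_gen)
  qed
qed

lemma comp_sum: "comp k (sum F A) = (\<Sum>x\<in>A. comp k (F x))"
  by (induction A rule: infinite_finite_induct) (simp_all add: restr_add)

text \<open>The largest graded ideal inside \<open>I\<close>. It makes homogeneous ideals out of the
  ideals of charts, where a variable is set to 1.\<close>

definition gr_part :: "('v::finite, 'a::comm_ring_1) pol set \<Rightarrow> ('v, 'a) pol set"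
  where "gr_part I = {f. \<forall>n. comp n f \<in> I}"

lemma graded_gr_part:
  fixes I :: "('v::finite, 'a::comm_ring_1) pol set"
  assumes I: "idl I"
  shows "graded (gr_part I)"
  unfolding graded_def
proof
  show "idl (gr_part I)"
    unfolding gr_part_def
  proof (rule idlI)
    fix r x :: "('v, 'a) pol" assume x: "x \<in> {f. \<forall>n. comp n f \<in> I}"
    have "comp k (comp j r * x) \<in> I" for j k
      using x by (auto simp: comp_mult_homog[OF homog_comp] intro: idl_mult[OF I] idl_0[OF I])
    moreover have "r * x = (\<Sum>j\<in>mon_deg ` keys r. comp j r * x)"
      by (subst sum_restr_level[of r mon_deg]) (simp add: sum_distrib_right)
    then have "comp k (r * x) = (\<Sum>j\<in>mon_deg ` keys r. comp k (comp j r * x))" for k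
      by (simp only: comp_sum)
    ultimately show "r * x \<in> {f. \<forall>n. comp n f \<in> I}"
      by (auto intro: idl_sum[OF I])
  qed (auto simp: restr_add intro: idl_0[OF I] idl_add[OF I])
  show "\<forall>f\<in>gr_part I. \<forall>n. comp n f \<in> gr_part I"
    using idl_0[OF I] by (auto simp: gr_part_def comp_homog[OF homog_comp])
qed

lemma gr_part_homog:
  assumes I: "idl I" and f: "homog n f"
  shows "f \<in> gr_part I \<longleftrightarrow> f \<in> I"
proof (cases "f = 0")
  case True
  then show ?thesis using idl_0[OF I] by (simp add: gr_part_def)
next
  case False
  then have "homog (int (nat n)) f" using f homog_negative[OF f] by force
  then have "comp m f = (if nat n = m then f else 0)" for m by (rule comp_homog)
  then show ?thesis using idl_0[OF I] by (auto simp: gr_part_def)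
qed

text \<open>\<open>gr_part I\<close> is an ideal that contains the homogeneous generators, so it is
  all of \<open>I\<close>.\<close>

lemma graded_of_gen:
  fixes I :: "('v::finite, 'a::comm_ring_1) pol set"
  assumes "I = ideal_gen {f \<in> I. \<exists>n. homog n f}"
  shows "graded I"
proof -
  have I: "idl I" by (subst assms) (rule idl_ideal_gen)
  have "idl (gr_part I)" using graded_gr_part[OF I] by (simp add: graded_def)
  then have "ideal_gen {f \<in> I. \<exists>n. homog n f} \<subseteq> gr_part I"
    by (rule ideal_gen_least) (auto simp: gr_part_homog[OF I])
  then have "I \<subseteq> gr_part I" using assms by blast
  then show ?thesis using I by (auto simp: graded_def gr_part_def)
qed

text \<open>Take the lowest components of \<open>f\<close> and \<open>g\<close> outside the ideal.\<close>

lemma graded_primeI: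
  fixes P :: "('v::finite, 'a::comm_ring_1) pol set"
  assumes P: "graded P"
    and hom: "\<And>f g n m. homog (int n) f \<Longrightarrow> homog (int m) g \<Longrightarrow> f * g \<in> P \<Longrightarrow> f \<in> P \<or> g \<in> P"
    and fg: "f * g \<in> P"
  shows "f \<in> P \<or> g \<in> P"
proof (rule ccontr)
  assume neg: "\<not> (f \<in> P \<or> g \<in> P)"
  have I: "idl P" using P by (simp add: graded_def)
  have ex: "\<exists>n. comp n f \<notin> P" if "f \<notin> P" for f
    using that sum_restr_level[of f mon_deg] idl_sum[OF I] by metis
  define n where "n = (LEAST n. comp n f \<notin> P)"
  define m where "m = (LEAST n. comp n g \<notin> P)"
  have n: "comp n f \<notin> P" and n': "\<And>k. k < n \<Longrightarrow> comp k f \<in> P"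
    using LeastI_ex[OF ex[of f]] not_less_Least neg unfolding n_def by auto
  have m: "comp m g \<notin> P" and m': "\<And>k. k < m \<Longrightarrow> comp k g \<in> P"
    using LeastI_ex[OF ex[of g]] not_less_Least neg unfolding m_def by auto
  have s: "comp k (sum F A) = (\<Sum>x\<in>A. comp k (F x))" if "finite A"
    for F :: "nat \<Rightarrow> ('v, 'a) pol" and A k
    using that by (induction A rule: finite_induct) (simp_all add: restr_add)
  let ?A = "insert n (mon_deg ` keys f)"
  have f: "f = (\<Sum>j\<in>?A. comp j f)"
  proof (cases "n \<in> mon_deg ` keys f")
    case False
    then have "comp n f = 0" by (auto simp: restr_eq_zero)
    then show ?thesis using n idl_0[OF I] by simp
  qed (use sum_restr_level[of f mon_deg] in \<open>simp add: insert_absorb\<close>)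
  have "comp (n + m) (f * g) = (\<Sum>j\<in>?A. comp (n + m) (comp j f * g))"
    by (subst f) (simp add: sum_distrib_right s del: sum.insert sum.insert_if)
  also have "\<dots> = comp (n + m) (comp n f * g) + (\<Sum>j\<in>?A - {n}. comp (n + m) (comp j f * g))"
    by (rule sum.remove) auto
  finally have eq: "comp (n + m) (f * g) = comp n f * comp m g + (\<Sum>j\<in>?A - {n}. comp (n + m) (comp j f * g))"
    by (simp add: comp_mult_homog[OF homog_comp])
  have "(\<Sum>j\<in>?A - {n}. comp (n + m) (comp j f * g)) \<in> P"
  proof (rule idl_sum[OF I])
    fix j assume "j \<in> ?A - {n}"
    then consider "j < n" | "j > n" by fastforce
    then show "comp (n + m) (comp j f * g) \<in> P"
    proof cases
      case 1
      then show ?thesis using n' by (auto simp: comp_mult_homog[OF homog_comp] intro: idl_0[OF I] idl_mult_right[OF I])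
    next
      case 2
      then have "j \<le> n + m \<Longrightarrow> comp (n + m - j) g \<in> P" by (intro m') auto
      then show ?thesis by (auto simp: comp_mult_homog[OF homog_comp] intro: idl_0[OF I] idl_mult[OF I])
    qed
  qed
  moreover have "comp (n + m) (f * g) \<in> P" using fg P by (auto simp: graded_def)
  ultimately have "comp n f * comp m g \<in> P"
    using eq idl_diff[OF I] by (metis add_diff_cancel_right')
  then show False using hom[OF homog_comp homog_comp] n m by blast
qed

subsection \<open>Monomial ideals\<close>

definition vdeg :: "'v set \<Rightarrow> ('v::finite \<Rightarrow>\<^sub>0 nat) \<Rightarrow> nat"
  where "vdeg V t = (\<Sum>i\<in>V. lookup t i)"

text \<open>The \<open>n\<close>-th power of the ideal of the variables in \<open>V\<close> (see
  \<open>ideal_pow_vars\<close>), described by exponents so that membership is decided monomial by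
  monomial.\<close>

definition vpow :: "'v set \<Rightarrow> nat \<Rightarrow> ('v::finite, 'a::comm_ring_1) pol set"
  where "vpow V n = {f. \<forall>t\<in>keys f. n \<le> vdeg V t}"

lemma vdeg_add: "vdeg V (s + t) = vdeg V s + vdeg V t"
  by (simp add: vdeg_def lookup_add sum.distrib)

lemma vdeg_single: "vdeg V (single i n) = (if i \<in> V then n else 0)"
  by (simp add: vdeg_def lookup_single when_def)

lemma vpow_mult: "f \<in> vpow V n \<Longrightarrow> g \<in> vpow V m \<Longrightarrow> f * g \<in> vpow V (n + m)"
  using keys_mult[of f g] by (fastforce simp: vpow_def vdeg_add intro: add_mono)

lemma idl_vpow: "idl (vpow V n :: ('v::finite, 'a::comm_ring_1) pol set)"
proof (rule idlI)
  show "x + y \<in> vpow V n" if "x \<in> vpow V n" "y \<in> vpow V n" for x y :: "('v, 'a) pol"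
    using that Poly_Mapping.keys_add[of x y] by (auto simp: vpow_def)
  show "r * x \<in> vpow V n" if "x \<in> vpow V n" for r x :: "('v, 'a) pol"
    using vpow_mult[of r V 0 x n] that by (simp add: vpow_def)
qed (simp add: vpow_def)

lemma graded_vpow: "graded (vpow V n)"
  by (auto simp: graded_def idl_vpow) (auto simp: vpow_def keys_restr)

lemma mon_in_vpow: "mon t \<in> (vpow V n :: ('v::finite, 'a::comm_ring_1) pol set) \<longleftrightarrow> n \<le> vdeg V t"
  by (simp add: vpow_def)

lemma single_in_vpow: "n \<le> vdeg V t \<Longrightarrow> single t c \<in> vpow V n"
  by (simp add: vpow_def)

lemma var_in_vpow: "i \<in> V \<Longrightarrow> var i \<in> vpow V 1"
  by (simp add: vpow_def vdeg_single)

lemma var_power_in_vpow: "i \<in> V \<Longrightarrow> var i ^ n \<in> vpow V n"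
  by (simp add: vpow_def vdeg_single var_power)

lemma vpow_mono: "n \<le> m \<Longrightarrow> vpow V m \<subseteq> vpow V n"
  by (force simp: vpow_def)

lemma mon_split_var:
  assumes "lookup t i > 0"
  shows "mon t = (var i * mon (t - single i 1) :: ('v::finite, 'a::comm_ring_1) pol)"
proof -
  have "single i 1 + (t - single i 1) = t"
    by (rule poly_mapping_eqI) (use assms in \<open>auto simp: lookup_add lookup_minus lookup_single when_def\<close>)
  then show ?thesis by (simp add: mult_single)
qed

text \<open>A monomial of \<open>V\<close>-degree above \<open>n\<close> is a variable of
  \<open>V\<close> times a monomial of \<open>V\<close>-degree one less, so those of
  \<open>V\<close>-degree exactly \<open>n\<close> generate.\<close>

lemma vpow_in_idl:
  fixes I :: "('v::finite, 'a::comm_ring_1) pol set"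
  assumes "idl I" "\<And>t. vdeg V t = n \<Longrightarrow> mon t \<in> I" "f \<in> vpow V n"
  shows "f \<in> I"
proof -
  have "mon t \<in> I" if "vdeg V t \<ge> n" for t
    using that
  proof (induction "vdeg V t - n" arbitrary: t)
    case 0
    then show ?case using assms(2) by simp
  next
    case (Suc k)
    then have "vdeg V t > 0" by simp
    then obtain i where i: "i \<in> V" "lookup t i > 0"
      unfolding vdeg_def by (metis gr0I less_irrefl sum.neutral)
    have "t = single i 1 + (t - single i 1)"
      by (rule poly_mapping_eqI) (use i in \<open>auto simp: lookup_add lookup_minus lookup_single when_def\<close>)
    then have "vdeg V t = 1 + vdeg V (t - single i 1)"
      using i by (metis vdeg_add vdeg_single)
    then have "mon (t - single i 1) \<in> I" using Suc by (intro Suc(1)) auto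
    then show ?case using mon_split_var[OF i(2)] idl_mult[OF assms(1)] by metis
  qed
  then have "single t (lookup f t) \<in> I" if "t \<in> keys f" for t
    using that assms(3) by (subst single_conv_cst) (auto simp: vpow_def intro: idl_mult[OF assms(1)])
  then show ?thesis
    by (subst pol_sum_monomials) (rule idl_sum[OF assms(1)])
qed

lemma ideal_gen_vars: "ideal_gen (var ` V) = (vpow V 1 :: ('v::finite, 'a::comm_ring_1) pol set)"
proof
  show "ideal_gen (var ` V) \<subseteq> (vpow V 1 :: ('v, 'a) pol set)"
    by (rule ideal_gen_least[OF idl_vpow]) (auto intro: var_in_vpow)
  show "(vpow V 1 :: ('v, 'a) pol set) \<subseteq> ideal_gen (var ` V)"
  proof
    fix f :: "('v, 'a) pol" assume f: "f \<in> vpow V 1"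
    show "f \<in> ideal_gen (var ` V)"
    proof (rule vpow_in_idl[OF idl_ideal_gen _ f])
      fix t :: "'v \<Rightarrow>\<^sub>0 nat" assume "vdeg V t = 1"
      then obtain i where i: "i \<in> V" "lookup t i > 0"
        unfolding vdeg_def by (metis gr0I sum.neutral zero_neq_one)
      then show "mon t \<in> ideal_gen (var ` V :: ('v, 'a) pol set)"
        by (subst mon_split_var[OF i(2)], intro idl_mult_right[OF idl_ideal_gen] subsetD[OF ideal_gen_superset])
           simp
    qed
  qed
qed

lemma ideal_prod_vpow:
  "ideal_prod UNIV (vpow V 1) (vpow V n) = (vpow V (Suc n) :: ('v::finite, 'a::comm_ring_1) pol set)"
proof
  show "ideal_prod UNIV (vpow V 1) (vpow V n) \<subseteq> (vpow V (Suc n) :: ('v, 'a) pol set)"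
    by (rule ideal_prod_least) (use vpow_mult[of _ V 1 _ n] in \<open>auto simp: submod_UNIV idl_vpow plus_1_eq_Suc\<close>)
  show "(vpow V (Suc n) :: ('v, 'a) pol set) \<subseteq> ideal_prod UNIV (vpow V 1) (vpow V n)"
  proof
    fix f :: "('v, 'a) pol" assume f: "f \<in> vpow V (Suc n)"
    show "f \<in> ideal_prod UNIV (vpow V 1) (vpow V n)"
    proof (rule vpow_in_idl[OF idl_prod_ideal _ f])
      fix t :: "'v \<Rightarrow>\<^sub>0 nat" assume t: "vdeg V t = Suc n"
      then obtain i where i: "i \<in> V" "lookup t i > 0"
        unfolding vdeg_def by (metis gr0I sum.neutral nat.distinct(1))
      have "t = single i 1 + (t - single i 1)"
        by (rule poly_mapping_eqI) (use i in \<open>auto simp: lookup_add lookup_minus lookup_single when_def\<close>)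
      then have "vdeg V t = 1 + vdeg V (t - single i 1)"
        using i by (metis vdeg_add vdeg_single)
      then show "mon t \<in> ideal_prod UNIV (vpow V 1) (vpow V n :: ('v, 'a) pol set)"
        using i t by (subst mon_split_var[OF i(2)])
          (auto intro!: mult_in_ideal_prod single_in_vpow simp: vdeg_single)
    qed
  qed
qed

lemma ideal_pow_vars:
  "ideal_pow UNIV (ideal_gen (var ` V)) n = (vpow V n :: ('v::finite, 'a::comm_ring_1) pol set)"
proof (induction n)
  case (Suc n)
  then show ?case unfolding ideal_pow.simps(2) by (simp only: ideal_prod_vpow ideal_gen_vars)
qed (simp add: vpow_def)

text \<open>Restriction to the linear space where the variables of \<open>V\<close> vanish. Staying
  in the same ring makes it a projection, which picks representatives modulo
  \<open>vpow V 1\<close>.\<close>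

definition kill :: "'v set \<Rightarrow> ('v::finite, 'a::comm_ring_1) pol \<Rightarrow> ('v, 'a) pol"
  where "kill V = subst (\<lambda>i. if i \<in> V then 0 else var i)"

lemma kill_simps: "kill V (p + q) = kill V p + kill V q" "kill V (p * q) = kill V p * kill V q"
  "kill V (p - q) = kill V p - kill V q" "kill V (p ^ n) = kill V p ^ n"
  "kill V (- p) = - kill V p" "kill V (cst c) = cst c"
  "kill V 0 = 0" "kill V 1 = 1" "kill V (var i) = (if i \<in> V then 0 else var i)"
  "kill V (scal c p) = cst c * kill V p"
  by (simp_all add: kill_def subst_simps)

lemma kill_eq_restr: "kill V p = restr {t. vdeg V t = 0} p" for p :: "('v::finite, 'a::comm_ring_1) pol"
proof (induction p rule: pol_induct)
  case (mon t c)
  show ?case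
  proof (cases "vdeg V t = 0")
    case True
    then have z: "i \<in> V \<Longrightarrow> lookup t i = 0" for i
      by (simp add: vdeg_def)
    have "(\<Prod>i\<in>UNIV. (if i \<in> V then 0 else var i) ^ lookup t i) = (\<Prod>i\<in>UNIV. var i ^ lookup t i :: ('v, 'a) pol)"
      by (rule prod.cong) (auto simp: z)
    then show ?thesis using True
      by (simp add: kill_def cst.peval_single restr_id flip: mon_conv_prod single_conv_cst)
  next
    case False
    then obtain i where i: "i \<in> V" "lookup t i \<noteq> 0" by (auto simp: vdeg_def)
    then have "(\<Prod>i\<in>UNIV. (if i \<in> V then 0 else var i) ^ lookup t i) = (0 :: ('v, 'a) pol)"
      by (intro prod_zero) (auto intro!: exI[of _ i] simp: power_0_left)
    moreover have "restr {t. vdeg V t = 0} (single t c) = 0" using False by (simp add: restr_eq_zero)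
    ultimately show ?thesis by (simp add: kill_def cst.peval_single)
  qed
qed (simp add: kill_simps restr_add)

lemma kill_eq_0: "kill V p = 0 \<longleftrightarrow> p \<in> vpow V 1"
  by (force simp: kill_eq_restr restr_eq_zero vpow_def)

lemma diff_kill: "p - kill V p \<in> vpow V 1"
  unfolding kill_eq_0[symmetric] by (simp add: kill_simps) (simp add: kill_eq_restr restr_id keys_restr)

text \<open>\<open>vpow V 1\<close> is the kernel of the ring homomorphism \<open>kill V\<close>
  into a domain.\<close>

lemma vpow_prime: "f * g \<in> vpow V 1 \<Longrightarrow> f \<in> vpow V 1 \<or> g \<in> vpow V 1"
  for f g :: "('v::{finite,linorder}, 'a::idom) pol"
  by (simp add: kill_eq_0[symmetric] kill_simps)

lemma one_notin_vpow: "1 \<notin> (vpow V 1 :: ('v::finite, 'a::comm_ring_1) pol set)"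
  by (simp add: kill_eq_0[symmetric] kill_simps)

section \<open>Sheaves associated with ideals\<close>

lemma basics_nz [simp]: "h \<in> basics \<Longrightarrow> h \<noteq> 0"
  and basics_homog: "h \<in> basics \<Longrightarrow> homog (int (tot_deg h)) h"
  and basics_pos: "h \<in> basics \<Longrightarrow> tot_deg h > 0"
  by (auto simp: basics_def)

lemma var_nz [simp]: "(var i :: ('v, 'a::comm_ring_1) pol) \<noteq> 0"
  by (simp flip: keys_eq_empty)

lemma tot_deg_var [simp]: "tot_deg (var i :: ('v::finite, 'a::comm_ring_1) pol) = 1"
  by (rule tot_deg_homog[OF _ var_nz]) (simp only: of_nat_1 homog_var)

lemma var_basics [simp]: "var i \<in> basics"
  by (simp only: basics_def mem_Collect_eq tot_deg_var of_nat_1 homog_var var_nz zero_less_one simp_thms)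

lemma tot_deg_mult_basics:
  fixes h h' :: "'a::field cring"
  assumes "h \<in> basics" "h' \<in> basics"
  shows "tot_deg (h * h') = tot_deg h + tot_deg h'"
proof (rule tot_deg_homog)
  show "homog (int (tot_deg h + tot_deg h')) (h * h')"
    unfolding of_nat_add by (intro homog_mult basics_homog assms)
qed (use assms in simp)

lemma mult_basics [simp]:
  fixes h h' :: "'a::field cring"
  assumes "h \<in> basics" "h' \<in> basics"
  shows "h * h' \<in> basics"
  unfolding basics_def mem_Collect_eq tot_deg_mult_basics[OF assms] of_nat_add
  using homog_mult[OF basics_homog basics_homog, OF assms] basics_pos[OF assms(1)] assms
  by (intro conjI) simp_all

lemma homog_basics_power: "h \<in> basics \<Longrightarrow> homog (int k * int (tot_deg h)) (h ^ k)"
  for h :: "'a::field cring"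
  by (rule homog_power) (rule basics_homog)

section \<open>Fractions and sections over D_+(h)\<close>

lemma quot_sum: "d \<noteq> 0 \<Longrightarrow> quot (sum f A) d = (\<Sum>a\<in>A. quot (f a) d)"
proof (induction A rule: infinite_finite_induct)
  case (insert x A)
  have "quot (f x) d + quot (sum f A) d = quot ((f x + sum f A) * d) (d * d)"
    using insert.prems by (simp add: algebra_simps)
  also have "\<dots> = quot (f x + sum f A) d" using insert.prems by (simp add: eq_fract)
  finally show ?case using insert by simp
qed (simp_all add: fract_collapse)

lemma quot_cancel: "c \<noteq> 0 \<Longrightarrow> b \<noteq> 0 \<Longrightarrow> quot (a * c) (b * c) = quot a b"
  for a b c :: "'a::field cring"
  by (simp add: eq_fract algebra_simps)

text \<open>Common form of \<open>sections_O\<close> and \<open>assoc_sheaf\<close>, so that sums,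
  products and restrictions are treated once. The ideal \<open>I\<close> may be inhomogeneous: only
  its homogeneous elements enter.\<close>

definition sect :: "'a::field cring set \<Rightarrow> int \<Rightarrow> 'a cring \<Rightarrow> 'a cfield set"
  where "sect I n h = {quot f (h ^ r) | f r. f \<in> I \<and> homog (int r * int (tot_deg h) + n) f}"

lemma sections_O_eq: "sections_O n h = sect UNIV n h"
  by (simp add: sections_O_def sect_def)

lemma assoc_sheaf_eq: "h \<in> basics \<Longrightarrow> assoc_sheaf I h = sect I 0 h"
  by (simp add: assoc_sheaf_def sect_def)

lemma sectI: "f \<in> I \<Longrightarrow> homog (int r * int (tot_deg h) + n) f \<Longrightarrow> quot f (h ^ r) \<in> sect I n h"
  by (auto simp: sect_def)

lemma sectE:
  assumes "x \<in> sect I n h"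
  obtains f r where "x = quot f (h ^ r)" "f \<in> I" "homog (int r * int (tot_deg h) + n) f"
  using assms by (auto simp: sect_def)

text \<open>A section has many representations as a fraction, and a given numerator lies in the
  ideal only after multiplication by some power of \<open>h\<close>.\<close>

lemma quot_in_sect_iff:
  fixes h :: "'a::field cring"
  assumes "h \<in> basics" "idl I" "homog (int r * int (tot_deg h) + n) f"
  shows "quot f (h ^ r) \<in> sect I n h \<longleftrightarrow> (\<exists>j. f * h ^ j \<in> I)"
proof
  assume "quot f (h ^ r) \<in> sect I n h"
  then obtain f' s where f': "quot f (h ^ r) = quot f' (h ^ s)" "f' \<in> I" by (auto elim!: sectE)
  then have "f * h ^ s = f' * h ^ r" using assms by (simp add: eq_fract)
  then show "\<exists>j. f * h ^ j \<in> I" using f' idl_mult_right[OF assms(2)] by metis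
next
  assume "\<exists>j. f * h ^ j \<in> I"
  then obtain j where j: "f * h ^ j \<in> I" by blast
  have "homog (int r * int (tot_deg h) + n + int j * int (tot_deg h)) (f * h ^ j)"
    by (intro homog_mult assms homog_basics_power)
  then have "quot (f * h ^ j) (h ^ (r + j)) \<in> sect I n h"
    by (intro sectI j) (simp add: algebra_simps)
  then show "quot f (h ^ r) \<in> sect I n h"
    using assms by (simp add: power_add quot_cancel)
qed

lemma sect_mult:
  fixes h :: "'a::field cring"
  assumes "x \<in> sect I n h" "y \<in> sect J m h" "\<And>f g. f \<in> I \<Longrightarrow> g \<in> J \<Longrightarrow> f * g \<in> K"
  shows "x * y \<in> sect K (n + m) h"
proof -
  obtain f r g s where *: "x = quot f (h ^ r)" "f \<in> I" "homog (int r * int (tot_deg h) + n) f"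
    "y = quot g (h ^ s)" "g \<in> J" "homog (int s * int (tot_deg h) + m) g"
    using assms by (auto elim!: sectE)
  have "homog (int (r + s) * int (tot_deg h) + (n + m)) (f * g)"
    using homog_mult[OF *(3,6)] by (simp add: algebra_simps)
  then have "quot (f * g) (h ^ (r + s)) \<in> sect K (n + m) h" by (rule sectI[OF assms(3)[OF *(2,5)]])
  then show ?thesis using * by (simp add: power_add)
qed

lemma sect_add:
  fixes h :: "'a::field cring"
  assumes h: "h \<in> basics" and I: "idl I" and "x \<in> sect I n h" "y \<in> sect I n h"
  shows "x + y \<in> sect I n h"
proof -
  obtain f r g s where *: "x = quot f (h ^ r)" "f \<in> I" "homog (int r * int (tot_deg h) + n) f"
    "y = quot g (h ^ s)" "g \<in> I" "homog (int s * int (tot_deg h) + n) g"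
    using assms by (auto elim!: sectE)
  have "homog (int (r + s) * int (tot_deg h) + n) (f * h ^ s + g * h ^ r)"
    using homog_mult[OF *(3) homog_basics_power[OF h, of s]] homog_mult[OF *(6) homog_basics_power[OF h, of r]]
    by (intro homog_add) (simp_all add: algebra_simps)
  moreover have "f * h ^ s + g * h ^ r \<in> I"
    using * I by (auto intro: idl_add idl_mult_right)
  moreover have "x + y = quot (f * h ^ s + g * h ^ r) (h ^ (r + s))"
    using * h by (simp add: power_add add_fract)
  ultimately show ?thesis by (metis sectI)
qed

lemma sect_zero:
  assumes "h \<in> basics" "idl I" shows "0 \<in> sect I n h"
  using sectI[of 0 I 0 h n] idl_0[OF assms(2)] by (simp add: fract_collapse)

lemma idl_UNIV [simp]: "idl UNIV"
  by (simp add: idl_def)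

lemma one_in_regular: "1 \<in> sect UNIV 0 h"
  using sectI[of 1 UNIV 0 h 0] homog_one by (simp add: fract_collapse)

lemma subring_regular [simp]: "h \<in> basics \<Longrightarrow> subring (regular h)"
  unfolding subring_def sections_O_eq
  using sect_mult[of _ UNIV 0 h _ UNIV 0 UNIV] by (auto simp: sect_zero one_in_regular sect_add)

lemma submod_sect: "h \<in> basics \<Longrightarrow> idl I \<Longrightarrow> submod (regular h) (sect I n h)"
  unfolding submod_def sections_O_eq
  using sect_mult[of _ UNIV 0 h _ I n I] by (auto simp: sect_zero sect_add idl_mult)

lemma sect_mono: "I \<subseteq> J \<Longrightarrow> sect I n h \<subseteq> sect J n h"
  by (auto simp: sect_def)

lemma sect_restrict_mult:
  fixes h h' :: "'a::field cring"
  assumes h: "h \<in> basics" "h' \<in> basics" and I: "idl I" and "x \<in> sect I n h"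
  shows "x \<in> sect I n (h * h')"
proof -
  obtain f r where *: "x = quot f (h ^ r)" "f \<in> I" "homog (int r * int (tot_deg h) + n) f"
    using assms by (auto elim!: sectE)
  have "homog (int r * int (tot_deg (h * h')) + n) (f * h' ^ r)"
    using homog_mult[OF *(3) homog_basics_power[OF h(2), of r]]
    by (simp add: algebra_simps tot_deg_mult_basics h)
  then have "quot (f * h' ^ r) ((h * h') ^ r) \<in> sect I n (h * h')"
    using * by (intro sectI idl_mult_right[OF I]) auto
  then show ?thesis using * h by (simp add: power_mult_distrib quot_cancel)
qed

text \<open>Its powers are the denominators needed to pass from $D_+(h)$ to $D_+(hh')$.\<close>

definition loc_unit :: "'a::field cring \<Rightarrow> 'a cring \<Rightarrow> 'a cfield"
  where "loc_unit h h' = quot (h' ^ tot_deg h) (h ^ tot_deg h')"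

lemma loc_unit_regular:
  assumes "h \<in> basics" "h' \<in> basics" shows "loc_unit h h' \<in> regular h"
  unfolding loc_unit_def sections_O_eq
  using homog_basics_power[OF assms(2), of "tot_deg h"] by (intro sectI) (simp_all add: mult.commute)

lemma loc_unit_power: "loc_unit h h' ^ k = quot (h' ^ (tot_deg h * k)) (h ^ (tot_deg h' * k))"
  by (induction k) (simp_all add: loc_unit_def power_add fract_collapse)

lemma subring_power: "subring R \<Longrightarrow> x \<in> R \<Longrightarrow> x ^ k \<in> R"
  by (induction k) (auto simp: subring_def)

lemma loc_unit_inverse:
  fixes h h' :: "'a::field cring"
  assumes "h \<in> basics" "h' \<in> basics"
  obtains v where "v \<in> regular (h * h')" "v * loc_unit h h' ^ k = 1"
proof
  let ?a = "tot_deg h" and ?b = "tot_deg h'"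
  let ?v = "quot (h ^ ((?a + ?b) * k)) ((h * h') ^ (?a * k))"
  have "homog (int ((?a + ?b) * k) * int ?a) (h ^ ((?a + ?b) * k))"
    by (rule homog_basics_power[OF assms(1)])
  then show "?v \<in> regular (h * h')"
    unfolding sections_O_eq by (intro sectI) (simp_all add: tot_deg_mult_basics assms algebra_simps)
  let ?d = "h ^ ((?a + ?b) * k) * h' ^ (?a * k)"
  have "h ^ ((?a + ?b) * k) = h ^ (?a * k) * h ^ (?b * k)"
    by (simp add: distrib_right power_add)
  then have "(h * h') ^ (?a * k) * h ^ (?b * k) = ?d" by (simp add: power_mult_distrib mult_ac)
  then have "?v * loc_unit h h' ^ k = quot (1 * ?d) (1 * ?d)"
    unfolding loc_unit_power mult_fract by simp
  also have "\<dots> = quot 1 1" by (rule quot_cancel) (use assms in auto)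
  also have "\<dots> = 1" by (simp add: fract_collapse)
  finally show "?v * loc_unit h h' ^ k = 1" .
qed

lemma loc_unit_mult_regular:
  fixes h h' :: "'a::field cring"
  assumes h: "h \<in> basics" "h' \<in> basics" and "c \<in> sect I n (h * h')" and I: "idl I"
  shows "\<exists>k. loc_unit h h' ^ k * c \<in> sect I n h"
proof -
  obtain g r where g: "c = quot g ((h * h') ^ r)" "g \<in> I" "homog (int r * int (tot_deg (h * h')) + n) g"
    using assms by (auto elim!: sectE)
  let ?a = "tot_deg h" and ?b = "tot_deg h'"
  have "loc_unit h h' ^ r * c = quot ((h' ^ (?a * r - r) * g) * h' ^ r) (h ^ (?b * r + r) * h' ^ r)"
    unfolding g loc_unit_power mult_fract
  proof (rule arg_cong2[where f = quot])
    have "?a * r = (?a * r - r) + r" using basics_pos[OF h(1)] by (cases ?a) auto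
    then have "h' ^ (?a * r) = h' ^ (?a * r - r) * h' ^ r" by (metis power_add)
    then show "h' ^ (?a * r) * g = h' ^ (?a * r - r) * g * h' ^ r" by (simp add: algebra_simps)
  qed (simp add: power_mult_distrib power_add algebra_simps)
  also have "\<dots> = quot (h' ^ (?a * r - r) * g) (h ^ (?b * r + r))"
    using h by (intro quot_cancel) auto
  also have "\<dots> \<in> sect I n h"
  proof (rule sectI)
    obtain a' where "?a = Suc a'" using basics_pos[OF h(1)] by (cases ?a) auto
    then have "int (?a * r - r) * int ?b + (int r * int (tot_deg (h * h')) + n) = int (?b * r + r) * int ?a + n"
      by (simp add: tot_deg_mult_basics h algebra_simps)
    then show "homog (int (?b * r + r) * int ?a + n) (h' ^ (?a * r - r) * g)"
      using homog_mult[OF homog_basics_power[OF h(2), of "?a * r - r"] g(3)] by (simp only:)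
  qed (use g I idl_mult in auto)
  finally show ?thesis by blast
qed

text \<open>D_+(h h') is the locus in D_+(h) where \<open>loc_unit h h'\<close> is invertible.
  Quasi-coherence thereby becomes a statement about the powers of one element.\<close>

lemma span_over_loc:
  fixes h h' :: "'a::field cring"
  assumes h: "h \<in> basics" "h' \<in> basics" and M: "submod (regular h) M"
  shows "span_over (regular (h * h')) M = {x. \<exists>k. loc_unit h h' ^ k * x \<in> M}" (is "_ = ?L")
proof (rule span_over_eq)
  have R: "regular h \<subseteq> regular (h * h')"
    using sect_restrict_mult[OF h, of UNIV] by (auto simp: sections_O_eq)
  have u: "loc_unit h h' ^ k \<in> regular h" for k
    using h by (intro subring_power loc_unit_regular) auto
  have mon: "loc_unit h h' ^ k' * x \<in> M" if "loc_unit h h' ^ k * x \<in> M" "k \<le> k'" for k k' x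
  proof -
    have eq: "loc_unit h h' ^ k' = loc_unit h h' ^ (k' - k) * loc_unit h h' ^ k"
      using that by (simp flip: power_add)
    have "loc_unit h h' ^ (k' - k) * (loc_unit h h' ^ k * x) \<in> M"
      using that u M unfolding submod_def by blast
    then show ?thesis unfolding eq mult.assoc .
  qed
  show "submod (regular (h * h')) ?L"
    unfolding submod_def
  proof (intro conjI ballI)
    show "0 \<in> ?L" using M by (simp add: submod_def)
    fix x y assume "x \<in> ?L" "y \<in> ?L"
    then obtain k l where "loc_unit h h' ^ k * x \<in> M" "loc_unit h h' ^ l * y \<in> M" by blast
    then have "loc_unit h h' ^ (max k l) * x \<in> M" "loc_unit h h' ^ (max k l) * y \<in> M"
      by (auto intro: mon)
    then have "loc_unit h h' ^ (max k l) * (x + y) \<in> M" using M by (simp add: submod_def distrib_left)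
    then show "x + y \<in> ?L" by blast
  next
    fix r x assume r: "r \<in> regular (h * h')" and "x \<in> ?L"
    then obtain k where k: "loc_unit h h' ^ k * x \<in> M" by blast
    obtain l where "loc_unit h h' ^ l * r \<in> regular h"
      using loc_unit_mult_regular[OF h, of r UNIV 0] r by (auto simp: sections_O_eq)
    then have "(loc_unit h h' ^ l * r) * (loc_unit h h' ^ k * x) \<in> M"
      using k M by (simp add: submod_def)
    then have "loc_unit h h' ^ (l + k) * (r * x) \<in> M" by (simp add: power_add mult_ac)
    then show "r * x \<in> ?L" by blast
  qed
  show "M \<subseteq> ?L" by (auto intro: exI[of _ 0])
  show "?L \<subseteq> span_over (regular (h * h')) M"
  proof
    fix x assume "x \<in> ?L"
    then obtain k where k: "loc_unit h h' ^ k * x \<in> M" by blast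
    obtain v where v: "v \<in> regular (h * h')" "v * loc_unit h h' ^ k = 1"
      using loc_unit_inverse[OF h] by blast
    have sm: "submod (regular (h * h')) (span_over (regular (h * h')) M)"
      using h by (intro span_over_submod) simp
    have "M \<subseteq> span_over (regular (h * h')) M" using h by (intro span_over_superset) simp
    then have "v * (loc_unit h h' ^ k * x) \<in> span_over (regular (h * h')) M"
      using sm v k by (auto simp: submod_def)
    then show "x \<in> span_over (regular (h * h')) M" using v by (simp flip: mult.assoc)
  qed
qed (use h in simp)

lemma closed_subscheme_assoc:
  assumes I: "idl I"
  shows "closed_subscheme (assoc_sheaf I)"
  unfolding closed_subscheme_def
proof (intro conjI ballI)
  show "assoc_sheaf I \<in> extensional basics" by (simp add: assoc_sheaf_def)
  fix h :: "'a cring" assume h: "h \<in> basics"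
  show "is_ideal (regular h) (assoc_sheaf I h)"
    using h submod_sect[OF h I, of 0] sect_mono[of I UNIV 0 h]
    unfolding is_ideal_iff[OF subring_regular[OF h]] assoc_sheaf_eq[OF h] by (simp add: sections_O_eq)
  fix h' :: "'a cring" assume h': "h' \<in> basics"
  have "sect I 0 (h * h') = {x. \<exists>k. loc_unit h h' ^ k * x \<in> sect I 0 h}"
  proof
    show "sect I 0 (h * h') \<subseteq> {x. \<exists>k. loc_unit h h' ^ k * x \<in> sect I 0 h}"
      using loc_unit_mult_regular[OF h h' _ I] by blast
    show "{x. \<exists>k. loc_unit h h' ^ k * x \<in> sect I 0 h} \<subseteq> sect I 0 (h * h')"
    proof safe
      fix x k assume k: "loc_unit h h' ^ k * x \<in> sect I 0 h"
      obtain v where v: "v \<in> regular (h * h')" "v * loc_unit h h' ^ k = 1"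
        using loc_unit_inverse[OF h h'] by blast
      have "v * (loc_unit h h' ^ k * x) \<in> sect I 0 (h * h')"
        using submod_sect[OF mult_basics[OF h h'] I, of 0] v sect_restrict_mult[OF h h' I k]
        by (simp add: submod_def)
      then show "x \<in> sect I 0 (h * h')" using v by (simp flip: mult.assoc)
    qed
  qed
  then show "assoc_sheaf I (h * h') = span_over (regular (h * h')) (assoc_sheaf I h)"
    using span_over_loc[OF h h' submod_sect[OF h I]] h h' by (simp add: assoc_sheaf_eq)
qed

lemma closed_subscheme_submod:
  "closed_subscheme C \<Longrightarrow> h \<in> basics \<Longrightarrow> submod (regular h) (C h)"
  and closed_subscheme_regular: "closed_subscheme C \<Longrightarrow> h \<in> basics \<Longrightarrow> C h \<subseteq> regular h"
  by (auto simp: closed_subscheme_def is_ideal_iff)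

lemma closed_subscheme_loc:
  assumes "closed_subscheme C" "h \<in> basics" "h' \<in> basics"
  shows "C (h * h') = {x. \<exists>k. loc_unit h h' ^ k * x \<in> C h}"
  using assms span_over_loc[of h h' "C h"] closed_subscheme_submod[of C h]
  by (simp add: closed_subscheme_def)

section \<open>Twists, powers and global sections of ideal sheaves\<close>

lemma mon_split_deg:
  fixes t :: "'v::finite \<Rightarrow>\<^sub>0 nat"
  shows "n \<le> mon_deg t \<Longrightarrow> \<exists>u v. t = u + v \<and> mon_deg v = n"
proof (induction n)
  case (Suc n)
  then obtain u v where uv: "t = u + v" "mon_deg v = n" by auto
  then have "mon_deg u > 0" using Suc by (simp add: mon_deg_add)
  then obtain i where i: "lookup u i > 0" unfolding mon_deg_def by (metis gr0I less_irrefl sum.neutral)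
  have "u = (u - single i 1) + single i 1"
    by (rule poly_mapping_eqI) (use i in \<open>auto simp: lookup_add lookup_minus lookup_single when_def\<close>)
  then have "t = (u - single i 1) + (single i 1 + v)" using uv by (metis add.assoc)
  then show ?case using uv by (metis mon_deg_add mon_deg_single plus_1_eq_Suc)
qed (auto intro: exI[of _ t] exI[of _ 0])

text \<open>Extending the fraction by \<open>h ^ M\<close> and expanding that power into monomials
  makes the numerators splittable into factors of prescribed degree; this proves the surjectivity of
  multiplication maps below.\<close>

lemma quot_expand:
  fixes h :: "'a::field cring"
  assumes "h \<in> basics"
  shows "quot f (h ^ r) = (\<Sum>t\<in>keys (h ^ M). quot (f * single t (lookup (h ^ M) t)) (h ^ (r + M)))"
proof -
  have "quot f (h ^ r) = quot (f * h ^ M) (h ^ (r + M))"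
    using assms by (simp add: power_add quot_cancel)
  also have "f * h ^ M = (\<Sum>t\<in>keys (h ^ M). f * single t (lookup (h ^ M) t))"
    by (subst pol_sum_monomials[of "h ^ M"]) (simp add: sum_distrib_left)
  finally show ?thesis using assms by (simp add: quot_sum)
qed

lemma basics_power_keys: "h \<in> basics \<Longrightarrow> t \<in> keys (h ^ M) \<Longrightarrow> mon_deg t = M * tot_deg h"
  for h :: "'a::field cring"
  using homog_basics_power[of h M] unfolding homog_def by (metis of_nat_eq_iff of_nat_mult)

lemma twist_assoc:
  fixes h :: "'a::field cring"
  assumes h: "h \<in> basics" and I: "idl I" and n: "n \<ge> 0"
  shows "twist n (assoc_sheaf I) h = sect I n h"
proof
  have tw: "twist n (assoc_sheaf I) h = ideal_prod (regular h) (sect I 0 h) (sect UNIV n h)"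
    using h by (simp add: twist_def assoc_sheaf_eq sections_O_eq)
  show "twist n (assoc_sheaf I) h \<subseteq> sect I n h"
    unfolding tw using sect_mult[of _ I 0 h _ UNIV n I] idl_mult_right[OF I]
    by (intro ideal_prod_least submod_sect h I) auto
  show "sect I n h \<subseteq> twist n (assoc_sheaf I) h"
  proof
    fix x assume "x \<in> sect I n h"
    then obtain f r where f: "x = quot f (h ^ r)" "f \<in> I" "homog (int r * int (tot_deg h) + n) f"
      by (auto elim!: sectE)
    \<comment> \<open>A monomial of \<open>h ^ n\<close> has degree at least \<open>n\<close>, since
      \<open>h\<close> has positive degree; a monomial of degree exactly \<open>n\<close> can
      therefore be split off as the section of O(n).\<close>
    define M where "M = nat n"
    have "quot (f * single t c) (h ^ (r + M)) \<in> twist n (assoc_sheaf I) h" if "mon_deg t = M * tot_deg h" for t c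
    proof -
      have "nat n \<le> mon_deg t" using that basics_pos[OF h] by (cases "tot_deg h") (auto simp: M_def)
      then obtain u v where uv: "t = u + v" "mon_deg v = nat n" using mon_split_deg by blast
      have du: "int (mon_deg u) = int M * int (tot_deg h) - n"
        using that uv n by (simp add: mon_deg_add) (metis add_diff_cancel_right' nat_0_le of_nat_add of_nat_mult)
      have "homog (int r * int (tot_deg h) + n + (int M * int (tot_deg h) - n)) (f * single u c)"
        by (intro homog_mult f homog_single du)
      then have "quot (f * single u c) (h ^ (r + M)) \<in> sect I 0 h"
        using f(2) by (intro sectI idl_mult_right[OF I]) (simp_all add: algebra_simps)
      moreover have "quot (mon v) (h ^ 0) \<in> sect UNIV n h"
        using uv n by (intro sectI homog_single) auto
      ultimately have "quot (f * single u c) (h ^ (r + M)) * quot (mon v) (h ^ 0) \<in> twist n (assoc_sheaf I) h"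
        unfolding tw by (intro mult_in_ideal_prod) (use h in simp_all)
      moreover have "f * single t c = f * single u c * mon v"
        unfolding uv(1) mult.assoc mult_single by simp
      ultimately show ?thesis by (simp only: mult_fract power_0 mult_1_right)
    qed
    moreover have "submod (regular h) (twist n (assoc_sheaf I) h)"
      unfolding tw ideal_prod_def by (rule span_over_submod) (use h in simp)
    ultimately show "x \<in> twist n (assoc_sheaf I) h"
      unfolding f(1) quot_expand[OF h, of f r M]
      by (intro submod_sum) (auto dest: basics_power_keys[OF h])
  qed
qed

lemma H0_negative:
  assumes "n < 0" shows "H0 J n = {0}"
proof -
  have "0 \<in> twist n J h" if "h \<in> basics" for h
    using that span_over_submod[of "regular h"] by (auto simp: twist_def ideal_prod_def submod_def)
  then show ?thesis using assms homog_negative[of n] by (auto simp: H0_def fract_collapse)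
qed

text \<open>Global sections are the forms that lie in \<open>I\<close> up to a power of each
  variable; the saturation hypothesis \<open>sat\<close> removes these powers.\<close>

lemma H0_assoc:
  assumes I: "idl I" and n: "n \<ge> 0"
    and sat: "\<And>F. homog n F \<Longrightarrow> (\<And>i. \<exists>k. F * var i ^ k \<in> I) \<Longrightarrow> F \<in> I"
  shows "H0 (assoc_sheaf I) n = {F \<in> I. homog n F}"
proof -
  have "quot F 1 \<in> twist n (assoc_sheaf I) h \<longleftrightarrow> (\<exists>k. F * h ^ k \<in> I)" if "h \<in> basics" "homog n F" for F h
    using quot_in_sect_iff[OF that(1) I, of 0 n F] that by (simp add: twist_assoc I n)
  moreover have "\<exists>k. F * h ^ k \<in> I" if "F \<in> I" for F h using that by (auto intro: exI[of _ 0])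
  ultimately show ?thesis using sat by (auto simp: H0_def)
qed

lemma on_surface_mem:
  assumes I: "idl I" and F: "homog (int n) F" and "contained_in (assoc_sheaf I) (surface F)"
  shows "\<exists>k. F * var i ^ k \<in> I"
proof -
  have "F \<in> ideal_gen {F}" using ideal_gen_superset by blast
  then have "quot F (var i ^ n) \<in> sect (ideal_gen {F}) 0 (var i)"
    by (intro sectI) (use F in auto)
  then have "quot F (var i ^ n) \<in> sect I 0 (var i)"
    using assms(3) var_basics[of i] by (auto simp: contained_in_def surface_def assoc_sheaf_eq)
  then show ?thesis using quot_in_sect_iff[of "var i" I n 0 F] I F by simp
qed

text \<open>Splitting a variable off a monomial changes its degree, while both factors must be
  fractions of degree zero. One extra \<open>h\<close> repairs this: of a monomial of
  \<open>h\<close>, all but one variable go to the variable split off, and the remaining one takes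
  its place.\<close>

lemma sheaf_pow_vpow:
  "sheaf_pow (assoc_sheaf (vpow V 1)) n = (assoc_sheaf (vpow V n) :: 'a::field sheaf)"
proof
  fix h :: "'a cring"
  show "sheaf_pow (assoc_sheaf (vpow V 1)) n h = assoc_sheaf (vpow V n) h"
  proof (cases "h \<in> basics")
    case h: True
    have "ideal_pow (regular h) (sect (vpow V 1) 0 h) n = sect (vpow V n) 0 h"
    proof (induction n)
      case 0
      then show ?case by (simp add: sections_O_eq vpow_def)
    next
      case (Suc n)
      let ?P = "ideal_prod (regular h) (sect (vpow V 1) 0 h) (sect (vpow V n) 0 h)"
      have sub: "submod (regular h) ?P"
        unfolding ideal_prod_def by (rule span_over_submod) (use h in simp)
      have "?P \<subseteq> sect (vpow V (Suc n)) 0 h"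
        using sect_mult[of _ "vpow V 1" 0 h _ "vpow V n" 0 "vpow V (Suc n)"] vpow_mult[of _ V 1 _ n]
        by (intro ideal_prod_least submod_sect h idl_vpow) (auto simp: plus_1_eq_Suc)
      moreover have "sect (vpow V (Suc n)) 0 h \<subseteq> ?P"
      proof
        fix x assume "x \<in> sect (vpow V (Suc n)) 0 h"
        then obtain f r where f: "x = quot f (h ^ r)" "f \<in> vpow V (Suc n)" "homog (int r * int (tot_deg h)) f"
          by (auto elim!: sectE)
        have "quot (single s c * single t b) (h ^ (r + 1)) \<in> ?P"
          if s: "vdeg V s \<ge> Suc n" "int (mon_deg s) = int r * int (tot_deg h)" and t: "mon_deg t = tot_deg h" for s t c b
        proof -
          have "vdeg V s > 0" using s by simp
          then obtain i where i: "i \<in> V" "lookup s i > 0"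
            unfolding vdeg_def by (metis gr0I less_irrefl sum.neutral)
          define s' where "s' = s - single i 1"
          have s': "s = single i 1 + s'" unfolding s'_def
            by (rule poly_mapping_eqI) (use i in \<open>auto simp: lookup_add lookup_minus lookup_single when_def\<close>)
          then have v: "vdeg V s' \<ge> n" "mon_deg s = 1 + mon_deg s'"
            using s i by (auto simp: vdeg_add vdeg_single mon_deg_add)
          obtain u w where uw: "t = w + u" "mon_deg u = tot_deg h - 1"
            using mon_split_deg[of "tot_deg h - 1" t] t by auto
          have w: "mon_deg w = 1" using uw t basics_pos[OF h] by (simp add: mon_deg_add)
          have "quot (single (single i 1 + u) c) (h ^ 1) \<in> sect (vpow V 1) 0 h"
            using uw basics_pos[OF h] i
            by (intro sectI single_in_vpow homog_single) (auto simp: vdeg_add vdeg_single mon_deg_add)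
          moreover have "quot (single (s' + w) b) (h ^ r) \<in> sect (vpow V n) 0 h"
            using v w s by (intro sectI single_in_vpow homog_single) (auto simp: vdeg_add mon_deg_add)
          ultimately have "quot (single (single i 1 + u) c) (h ^ 1) * quot (single (s' + w) b) (h ^ r) \<in> ?P"
            by (intro mult_in_ideal_prod) (use h in simp_all)
          moreover have "single (single i 1 + u) c * single (s' + w) b = single s c * single t b"
            unfolding s' uw(1) by (simp add: mult_single ac_simps)
          moreover have "h ^ 1 * h ^ r = h ^ (r + 1)" by (simp add: power_add)
          ultimately show ?thesis by (simp only: mult_fract)
        qed
        note * = this
        have "quot (f * single t b) (h ^ (r + 1)) \<in> ?P" if t: "mon_deg t = tot_deg h" for t b
        proof -
          have "f * single t b = (\<Sum>s\<in>keys f. single s (lookup f s) * single t b)"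
            by (subst pol_sum_monomials[of f]) (simp add: sum_distrib_right)
          moreover have "quot (single s (lookup f s) * single t b) (h ^ (r + 1)) \<in> ?P" if "s \<in> keys f" for s
            using that f by (intro * t) (auto simp: vpow_def homog_def)
          ultimately show ?thesis using h by (simp only: quot_sum power_not_zero basics_nz not_False_eq_True) (rule submod_sum[OF sub])
        qed
        then show "x \<in> ?P"
          unfolding f(1) quot_expand[OF h, of f r 1] using basics_power_keys[OF h, of _ 1]
          by (intro submod_sum[OF sub]) auto
      qed
      ultimately show ?case using Suc by simp
    qed
    then show ?thesis using h by (simp add: sheaf_pow_def assoc_sheaf_eq)
  qed (simp add: sheaf_pow_def assoc_sheaf_def)
qed

text \<open>The four charts cover projective space: a section of one ideal lies in the other after
  multiplication by powers of the elements \<open>loc_unit h (var i)\<close>, and these powers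
  generate the unit ideal.\<close>

lemma closed_subscheme_eqI:
  assumes C: "closed_subscheme C" and C': "closed_subscheme C'"
    and eq: "\<And>i. C (var i) = C' (var i)"
  shows "C = C'"
proof -
  have sub: "C h \<subseteq> C' h" if C: "closed_subscheme C" and C': "closed_subscheme C'"
    and eq: "\<And>i. C (var i) = C' (var i)" and h: "h \<in> basics" for h and C C' :: "'a sheaf"
  proof
    fix s assume s: "s \<in> C h"
    have R: "s \<in> regular h" using s closed_subscheme_regular[OF C h] by blast
    have sm: "submod (regular h) (C' h)" by (rule closed_subscheme_submod[OF C' h])
    have "\<exists>k. loc_unit h (var i) ^ k * s \<in> C' h" for i
    proof -
      have "s \<in> C (h * var i)"
        using s by (simp add: closed_subscheme_loc[OF C h var_basics]) (rule exI[of _ 0], simp)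
      also have "C (h * var i) = C' (h * var i)"
      proof -
        have "C (var i * h) = span_over (regular (var i * h)) (C (var i))"
          using C h var_basics[of i] unfolding closed_subscheme_def by blast
        also have "\<dots> = C' (var i * h)"
          using C' h var_basics[of i] unfolding closed_subscheme_def eq by blast
        finally show ?thesis by (simp only: mult.commute)
      qed
      finally show ?thesis by (simp add: closed_subscheme_loc[OF C' h var_basics])
    qed
    then obtain k where k: "\<And>i. loc_unit h (var i) ^ k i * s \<in> C' h" by metis
    define K where "K = (\<Sum>i\<in>UNIV. k i)"
    have K: "loc_unit h (var i) ^ K * s \<in> C' h" for i
    proof -
      have "k i \<le> K" unfolding K_def by (rule member_le_sum) auto
      then have eq: "loc_unit h (var i) ^ K = loc_unit h (var i) ^ (K - k i) * loc_unit h (var i) ^ k i"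
        by (simp flip: power_add)
      show ?thesis
        using k[of i] sm h subring_power[OF subring_regular[OF h] loc_unit_regular[OF h var_basics]]
        unfolding eq mult.assoc submod_def by blast
    qed
    define D where "D = tot_deg h"
    \<comment> \<open>Write 1 as \<open>h ^ (4 * K)\<close> over itself. By the pigeonhole principle
      a monomial of degree 4 K D contains some variable K D times, and so a factor
      \<open>loc_unit h (var i) ^ K\<close>.\<close>
    have "quot (single t c) (h ^ (4 * K)) * s \<in> C' h" if t: "mon_deg t = 4 * K * D" for t c
    proof -
      have "\<exists>i. lookup t i \<ge> K * D"
      proof (rule ccontr)
        assume neg: "\<not> (\<exists>i. lookup t i \<ge> K * D)"
        have "mon_deg t < (\<Sum>i\<in>(UNIV :: 4 set). K * D)"
          unfolding mon_deg_def using neg by (intro sum_strict_mono) (auto simp: not_le)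
        then show False using t by simp
      qed
      then obtain i where i: "lookup t i \<ge> K * D" by blast
      define t' where "t' = t - single i (K * D)"
      have tt: "t = single i (K * D) + t'" unfolding t'_def
        by (rule poly_mapping_eqI) (use i in \<open>auto simp: lookup_add lookup_minus lookup_single when_def\<close>)
      have "int (mon_deg t') = int (3 * K) * int D"
        using t by (simp add: tt mon_deg_add)
      then have r: "quot (single t' c) (h ^ (3 * K)) \<in> regular h"
        unfolding sections_O_eq by (intro sectI homog_single) (simp_all add: D_def)
      have "quot (single t c) (h ^ (4 * K)) = loc_unit h (var i) ^ K * quot (single t' c) (h ^ (3 * K))"
      proof -
        have "single t c = var i ^ (tot_deg h * K) * single t' c"
          unfolding tt D_def by (simp only: var_power mult_single mult_1 mult.commute[of K])
        moreover have "h ^ (4 * K) = h ^ (tot_deg (var i :: 'a cring) * K) * h ^ (3 * K)"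
          unfolding tot_deg_var by (simp flip: power_add)
        ultimately show ?thesis unfolding loc_unit_power mult_fract by simp
      qed
      then have "quot (single t c) (h ^ (4 * K)) * s = quot (single t' c) (h ^ (3 * K)) * (loc_unit h (var i) ^ K * s)"
        by (simp add: mult_ac)
      also have "\<dots> \<in> C' h" using r K[of i] sm unfolding submod_def by blast
      finally show ?thesis .
    qed
    then have "(\<Sum>t\<in>keys (h ^ (4 * K)). quot (1 * single t (lookup (h ^ (4 * K)) t)) (h ^ (0 + 4 * K)) * s) \<in> C' h"
      by (intro submod_sum[OF sm]) (auto dest!: basics_power_keys[OF h] simp: D_def)
    moreover have "(\<Sum>t\<in>keys (h ^ (4 * K)). quot (1 * single t (lookup (h ^ (4 * K)) t)) (h ^ (0 + 4 * K)) * s) = s"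
      unfolding sum_distrib_right[symmetric] quot_expand[OF h, of 1 0 "4 * K", symmetric]
      by (simp add: fract_collapse)
    ultimately show "s \<in> C' h" by simp
  qed
  show ?thesis
  proof (rule extensionalityI[where A = basics])
    show "C \<in> extensional basics" "C' \<in> extensional basics" using C C' by (simp_all add: closed_subscheme_def)
    show "C h = C' h" if "h \<in> basics" for h
      using sub[OF C C' eq that] sub[OF C' C eq[symmetric] that] by blast
  qed
qed

section \<open>Points on a line\<close>

lemma pointsD:
  assumes "P \<in> points"
  shows points_idl: "idl P" and points_graded: "graded P" and points_prime: "f * g \<in> P \<Longrightarrow> f \<in> P \<or> g \<in> P"
    and points_one: "1 \<notin> P" and points_var: "\<exists>i. var i \<notin> P"
proof -
  show I: "idl P" using assms by (simp add: points_def is_ideal_UNIV)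
  show "graded P" using assms unfolding points_def by (intro graded_of_gen) blast
  show "f * g \<in> P \<Longrightarrow> f \<in> P \<or> g \<in> P" using assms unfolding points_def by blast
  show "1 \<notin> P"
  proof
    assume "1 \<in> P"
    then have "x \<in> P" for x using idl_mult[OF I, of 1 x] by simp
    then show False using assms by (auto simp: points_def)
  qed
  show "\<exists>i. var i \<notin> P" using assms by (auto simp: points_def)
qed

lemma pointsI:
  assumes "graded P" "1 \<notin> P" "\<And>f g. f * g \<in> P \<Longrightarrow> f \<in> P \<or> g \<in> P" "var i \<notin> P"
  shows "P \<in> points"
  unfolding points_def mem_Collect_eq
proof (intro conjI)
  show "is_ideal UNIV P" using assms by (simp add: is_ideal_UNIV graded_def)
  show "P = ideal_gen {f \<in> P. \<exists>n. homog n f}" by (rule graded_gen[OF assms(1)])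
qed (use assms in blast)+

lemma points_power: "P \<in> points \<Longrightarrow> f ^ n \<in> P \<Longrightarrow> f \<in> P"
  by (induction n) (auto dest: points_prime points_one)

lemma quot_in_sect_point:
  assumes "P \<in> points" "h \<in> basics" "h \<notin> P" "homog (int r * int (tot_deg h) + n) f"
  shows "quot f (h ^ r) \<in> sect P n h \<longleftrightarrow> f \<in> P"
  using quot_in_sect_iff[OF assms(2) points_idl[OF assms(1)] assms(4)]
    points_prime[OF assms(1)] points_power[OF assms(1)] assms(3) by (metis mult.right_neutral power_0)

lemma support_assoc:
  "P \<in> support (assoc_sheaf I) \<longleftrightarrow> P \<in> points \<and> (\<forall>f n. f \<in> I \<and> homog n f \<longrightarrow> f \<in> P)" (is "_ \<longleftrightarrow> ?R")
proof
  assume P: "P \<in> support (assoc_sheaf I)"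
  then have pt: "P \<in> points" by (simp add: support_def)
  show ?R
  proof (intro conjI allI impI pt)
    fix f n assume f: "f \<in> I \<and> homog n f"
    show "f \<in> P"
    proof (cases "f = 0")
      case False
      then have n: "n = int (nat n)" using f homog_negative[of n f] by force
      obtain i where i: "var i \<notin> P" using points_var[OF pt] by blast
      have "quot f (var i ^ nat n) \<in> sect I 0 (var i)" using f n by (intro sectI) auto
      then have "quot f (var i ^ nat n) \<in> sect P 0 (var i)"
        using P i var_basics[of i] by (auto simp: support_def assoc_sheaf_eq)
      then show ?thesis using quot_in_sect_point[OF pt var_basics i, of "nat n" 0 f] f n by simp
    qed (use points_idl[OF pt] idl_0 in auto)
  qed
next
  assume ?R
  then show "P \<in> support (assoc_sheaf I)"
    by (auto simp: support_def assoc_sheaf_eq sect_def)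
qed

lemma graded_ext:
  assumes "graded P" "idl Q" "\<And>f n. f \<in> P \<Longrightarrow> homog (int n) f \<Longrightarrow> f \<in> Q"
  shows "P \<subseteq> Q"
proof
  fix f assume "f \<in> P"
  then have "comp n f \<in> Q" for n using assms homog_comp[of n f] by (auto simp: graded_def)
  then show "f \<in> Q" by (subst sum_restr_level[of f mon_deg]) (auto intro: idl_sum[OF assms(2)])
qed

lemma homog_prod_power:
  fixes \<rho> :: "'v::finite \<Rightarrow> ('w::finite, 'a::comm_ring_1) pol"
  assumes "\<And>i. homog 1 (\<rho> i)"
  shows "homog (int (mon_deg t)) (\<Prod>i\<in>UNIV. \<rho> i ^ lookup t i)"
proof -
  have "homog (\<Sum>i\<in>A. int (lookup t i)) (\<Prod>i\<in>A. \<rho> i ^ lookup t i)" for A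
  proof (induction A rule: infinite_finite_induct)
    case (insert x F)
    then show ?case using homog_mult[OF homog_power[OF assms[of x], of "lookup t x"]] by auto
  qed (simp_all add: homog_one)
  from this[of UNIV] show ?thesis by (simp add: mon_deg_def)
qed

lemma homog_subst:
  fixes \<rho> :: "'v::finite \<Rightarrow> ('w::finite, 'a::comm_ring_1) pol"
  assumes "\<And>i. homog 1 (\<rho> i)" "homog n f"
  shows "homog n (subst \<rho> f)"
proof (rule cst.peval_induct)
  fix t assume "t \<in> keys f"
  then have "n = 0 + int (mon_deg t)" using assms(2) by (simp add: homog_def)
  then show "homog n (cst (lookup f t) * (\<Prod>i\<in>UNIV. \<rho> i ^ lookup t i))"
    using homog_mult[OF homog_cst homog_prod_power[of \<rho> t], of "lookup f t"] assms(1) by simp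
qed (auto intro: homog_add)

lemma comp_subst:
  fixes \<rho> :: "'v::finite \<Rightarrow> ('w::finite, 'a::comm_ring_1) pol"
  assumes "\<And>i. homog 1 (\<rho> i)"
  shows "comp n (subst \<rho> f) = subst \<rho> (comp n f)"
proof (induction f rule: pol_induct)
  case (mon t c)
  have "homog (int (mon_deg t)) (single t c)" by (simp add: homog_single)
  then show ?case
    using comp_homog[of "mon_deg t" "single t c" n] comp_homog[OF homog_subst[OF assms], of "mon_deg t" "single t c" n]
    by auto
qed (simp add: restr_add cst.peval_add)

lemma idl_ker_subst: "idl {f. subst \<rho> f = 0}"
  by (rule idlI) (simp_all add: cst.peval_add cst.peval_mult)

lemma graded_ker_subst:
  fixes \<rho> :: "'v::finite \<Rightarrow> ('w::finite, 'a::comm_ring_1) pol"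
  assumes "\<And>i. homog 1 (\<rho> i)"
  shows "graded {f. subst \<rho> f = 0}"
  by (simp add: graded_def idl_ker_subst comp_subst[OF assms, symmetric])

text \<open>Prime because the target is a domain, graded because linear forms preserve
  degrees.\<close>

lemma point_ker_subst:
  fixes \<rho> :: "4 \<Rightarrow> 'a::field cring"
  assumes "\<And>i. homog 1 (\<rho> i)" "\<rho> i \<noteq> 0"
  shows "{f. subst \<rho> f = 0} \<in> points"
  by (rule pointsI[of _ i]) (use graded_ker_subst[OF assms(1)] assms(2) in \<open>auto simp: cst.peval_mult\<close>)

lemma subst_cst:
  fixes e :: "'v::finite \<Rightarrow> 'a::comm_ring_1"
  shows "(subst (\<lambda>i. cst (e i)) f :: ('w, 'a) pol) = cst (peval (\<lambda>x. x) e f)"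
proof (induction f rule: pol_induct)
  interpret id: coeff_hom "\<lambda>x::'a. x" by unfold_locales auto
  have pw: "(cst (x ^ n) :: ('w, 'a) pol) = cst x ^ n" for x :: 'a and n by (induction n) (simp_all add: cst_mult)
  have pr: "(cst (\<Prod>i\<in>A. f i) :: ('w, 'a) pol) = (\<Prod>i\<in>A. cst (f i))" for A and f :: "'v \<Rightarrow> 'a"
    by (induction A rule: infinite_finite_induct) (simp_all add: cst_mult)
  { case (mon t c) show ?case by (simp add: cst.peval_single id.peval_single cst_mult pr pw) }
  { case (add p q) then show ?case by (simp add: cst.peval_add id.peval_add cst_add) }
qed

section \<open>Closed points of a coordinate line\<close>

locale line =
  fixes V :: "4 set" and u w :: 4
  assumes uw: "u \<noteq> w" "u \<notin> V" "w \<notin> V" and UN: "UNIV = V \<union> {u, w}"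
begin

lemma not_V: "i \<notin> V \<Longrightarrow> i = u \<or> i = w"
  using UN by blast

lemma mon_deg_line: "mon_deg t = vdeg V t + lookup t u + lookup t w"
proof -
  have "mon_deg t = (\<Sum>i\<in>V \<union> {u, w}. lookup t i)" by (simp only: mon_deg_def UN[symmetric])
  also have "\<dots> = vdeg V t + (\<Sum>i\<in>{u, w}. lookup t i)"
    unfolding vdeg_def by (rule sum.union_disjoint) (use uw in auto)
  finally show ?thesis using uw by simp
qed

text \<open>The point of the line with (u : w) = (\<alpha> : 1), with \<open>var w\<close> as
  homogeneous parameter. The point w = 0 is reached by exchanging the two coordinates
  (\<open>line_swap\<close>).\<close>

definition lin_sub :: "'a::field \<Rightarrow> 4 \<Rightarrow> 'a cring"
  where "lin_sub \<alpha> i = var w * cst (if i \<in> V then 0 else if i = u then \<alpha> else 1)"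

definition lin_pt :: "'a::field \<Rightarrow> 'a cring set"
  where "lin_pt \<alpha> = {f. subst (lin_sub \<alpha>) f = 0}"

lemma homog_lin_sub: "homog 1 (lin_sub \<alpha> i)"
  unfolding lin_sub_def by (rule homog_mult[OF homog_var homog_cst, simplified])

lemma lin_pt_point: "lin_pt \<alpha> \<in> points"
  unfolding lin_pt_def by (rule point_ker_subst[OF homog_lin_sub, of _ w]) (use uw in \<open>simp add: lin_sub_def\<close>)

lemma lin_pt_diff: "var i - lin_sub \<alpha> i \<in> lin_pt \<alpha>"
  using uw by (simp add: lin_pt_def cst.peval_diff lin_sub_def cst.peval_mult cst.peval_cst)

lemma line_lin_pt: "vpow V 1 \<subset> (lin_pt \<alpha> :: 'a::field cring set)"
proof -
  have "var ` V \<subseteq> (lin_pt \<alpha> :: 'a cring set)" by (auto simp: lin_pt_def lin_sub_def)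
  then have "vpow V 1 \<subseteq> (lin_pt \<alpha> :: 'a cring set)"
    unfolding ideal_gen_vars[symmetric] by (rule ideal_gen_least[OF points_idl[OF lin_pt_point]])
  moreover have "kill V (var u - lin_sub \<alpha> u) \<noteq> (0 :: 'a cring)"
  proof
    assume "kill V (var u - lin_sub \<alpha> u) = (0 :: 'a cring)"
    then have "var u = var w * (cst \<alpha> :: 'a cring)" using uw by (simp add: lin_sub_def kill_simps)
    then have "lookup (var u :: 'a cring) (single u 1) = lookup (cst \<alpha> * var w :: 'a cring) (single u 1)"
      by (simp only: mult.commute)
    moreover have "single w 1 \<noteq> single u (1::nat)" using uw by (metis lookup_single_eq lookup_single_not_eq zero_neq_one)
    ultimately show False by (simp add: lookup_cst_mult lookup_single_not_eq)
  qed
  then have "var u - lin_sub \<alpha> u \<notin> (vpow V 1 :: 'a cring set)" by (simp add: kill_eq_0)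
  ultimately show ?thesis using lin_pt_diff[of u \<alpha>] by blast
qed

lemma subst_lin_sub:
  assumes "homog (int n) f"
  shows "subst (lin_sub \<alpha>) f = var w ^ n * cst (peval (\<lambda>x. x) (\<lambda>i. if i \<in> V then 0 else if i = u then \<alpha> else 1) f)"
  unfolding lin_sub_def cst.peval_scale[OF assms] subst_cst ..

lemma lin_pt_sub_point:
  assumes "Q \<in> points" "\<And>i. i \<in> V \<Longrightarrow> var i \<in> Q" "var u - cst \<alpha> * var w \<in> Q"
  shows "lin_pt \<alpha> \<subseteq> Q"
proof
  have I: "idl Q" by (rule points_idl[OF assms(1)])
  fix f assume f: "f \<in> lin_pt \<alpha>"
  have "subst var f - subst (lin_sub \<alpha>) f \<in> Q"
  proof (rule idl_peval_cong[OF I])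
    fix i show "var i - lin_sub \<alpha> i \<in> Q"
      using assms not_V[of i] uw idl_0[OF I] by (auto simp: lin_sub_def mult.commute)
  qed
  then show "f \<in> Q" using f by (simp add: lin_pt_def)
qed

lemma lin_pt_closed: "closed_point (lin_pt \<alpha> :: 'a::field cring set)"
  unfolding closed_point_def
proof (intro conjI lin_pt_point ballI notI)
  fix Q :: "'a cring set" assume Q: "Q \<in> points" and sub: "lin_pt \<alpha> \<subset> Q"
  have I: "idl Q" by (rule points_idl[OF Q])
  obtain f n where f: "f \<in> Q" "homog (int n) f" "f \<notin> lin_pt \<alpha>"
    using graded_ext[OF points_graded[OF Q] points_idl[OF lin_pt_point]] sub by blast
  have d: "var i - lin_sub \<alpha> i \<in> Q" for i using lin_pt_diff sub by blast
  have "subst var f - subst (lin_sub \<alpha>) f \<in> Q" by (rule idl_peval_cong[OF I d])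
  then have "subst (lin_sub \<alpha>) f \<in> Q" using f idl_cong[OF I] by simp
  \<comment> \<open>The value at the point of a form that does not vanish there. Since it is a
    nonzero constant, a larger prime contains a power of \<open>var w\<close>, and then every
    variable.\<close>
  moreover define c where "c = peval (\<lambda>x. x) (\<lambda>i. if i \<in> V then 0 else if i = u then \<alpha> else 1) f"
  ultimately have m: "var w ^ n * cst c \<in> Q" using subst_lin_sub[OF f(2)] by simp
  have "c \<noteq> 0" using f(3) subst_lin_sub[OF f(2)] by (auto simp: c_def lin_pt_def)
  then have "cst (inverse c) * (var w ^ n * cst c) = (var w ^ n :: 'a cring)"
    by (simp add: mult.left_commute flip: cst_mult)
  then have "var w ^ n \<in> Q" using idl_mult[OF I m] by metis
  then have w: "var w \<in> Q" by (rule points_power[OF Q])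
  have "var i \<in> Q" for i
    using d[of i] idl_cong[OF I d[of i]] idl_mult_right[OF I w] by (simp add: lin_sub_def)
  then show False using points_var[OF Q] by blast
qed

lemma line_point: "(vpow V 1 :: 'a::field cring set) \<in> points"
  by (rule pointsI[of _ w])
     (use uw in \<open>auto simp: graded_vpow one_notin_vpow mon_in_vpow vdeg_single dest: vpow_prime\<close>)

text \<open>The binary form of degree \<open>n\<close> attached to a polynomial in one variable. The
  bound \<open>n\<close> may exceed the degree of \<open>p\<close>, which accounts for factors
  \<open>var w\<close>.\<close>

definition hm :: "nat \<Rightarrow> 'a::field poly \<Rightarrow> 'a cring"
  where "hm n p = (\<Sum>j\<le>n. cst (coeff p j) * (var u ^ j * var w ^ (n - j)))"

lemma hm_pCons_0: "hm (Suc n) (pCons 0 q) = var u * hm n q"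
  unfolding hm_def by (subst sum.atMost_Suc_shift) (simp add: sum_distrib_left mult_ac)

lemma hm_smult:
  assumes "degree q \<le> n" shows "hm (Suc n) (smult \<alpha> q) = cst \<alpha> * var w * hm n q"
proof -
  have "coeff q (Suc n) = 0" using assms by (simp add: coeff_eq_0)
  moreover have "(\<Sum>j\<le>n. cst (coeff (smult \<alpha> q) j) * (var u ^ j * var w ^ (Suc n - j)))
      = (\<Sum>j\<le>n. cst \<alpha> * var w * (cst (coeff q j) * (var u ^ j * var w ^ (n - j))))"
    by (rule sum.cong) (auto simp: cst_mult Suc_diff_le mult_ac)
  ultimately show ?thesis by (simp add: hm_def sum_distrib_left)
qed

lemma hm_diff: "hm n (p - q) = hm n p - hm n q"
proof -
  have "cst (a - b) = (cst a - cst b :: 'a cring)" for a b by (simp add: cst_def single_diff)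
  then show ?thesis by (simp add: hm_def left_diff_distrib sum_subtractf)
qed

text \<open>Over an algebraically closed field the form is a constant times a product of linear
  factors, and a prime without these factors does not contain it. Roots are split off one at a time;
  a constant \<open>p\<close> leaves a power of \<open>var w\<close>.\<close>

lemma hm_notin:
  fixes p :: "'a::alg_closed_field poly"
  assumes Q: "Q \<in> points" "var w \<notin> Q" "\<And>\<alpha>. var u - cst \<alpha> * var w \<notin> Q"
  shows "p \<noteq> 0 \<Longrightarrow> degree p \<le> n \<Longrightarrow> hm n p \<notin> Q"
proof (induction n arbitrary: p)
  have c: "cst c * var w ^ k \<notin> Q" if "c \<noteq> 0" for c k
  proof
    assume "cst c * var w ^ k \<in> Q"
    then have "cst (inverse c) * (cst c * var w ^ k) \<in> Q" by (rule idl_mult[OF points_idl[OF Q(1)]])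
    then show False using that points_power[OF Q(1)] Q(2) by (simp flip: mult.assoc cst_mult)
  qed
  {
    case 0
    then have "coeff p 0 \<noteq> 0" by (metis leading_coeff_neq_0 le_zero_eq)
    then show ?case using c[of "coeff p 0" 0] by (simp add: hm_def)
  next
    case (Suc n)
    show ?case
    proof (cases "degree p = 0")
      case True
      then obtain a where a: "p = [:a:]" using degree_eq_zeroE by blast
      then have "hm (Suc n) p = cst a * var w ^ Suc n"
        unfolding hm_def by (subst sum.atMost_Suc_shift) simp
      then show ?thesis using c[of a "Suc n"] a Suc.prems by simp
    next
      case False
      then obtain \<alpha> where "poly p \<alpha> = 0" using alg_closed_imp_poly_has_root[of p] by auto
      then obtain q where q: "p = [:-\<alpha>, 1:] * q" by (metis dvdE poly_eq_0_iff_dvd)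
      have "q \<noteq> 0" using q Suc.prems by auto
      then have "degree p = Suc (degree q)" unfolding q by (subst degree_mult_eq) auto
      then have dq: "degree q \<le> n" using Suc.prems by simp
      have "p = pCons 0 q - smult \<alpha> q" by (simp add: q)
      then have "hm (Suc n) p = (var u - cst \<alpha> * var w) * hm n q"
        by (simp add: hm_diff hm_pCons_0 hm_smult[OF dq] left_diff_distrib)
      then show ?thesis using points_prime[OF Q(1)] Q(3) Suc.IH[OF \<open>q \<noteq> 0\<close> dq] by auto
    qed
  }
qed

lemma kill_hm:
  assumes "homog (int n) f"
  shows "\<exists>p. degree p \<le> n \<and> kill V f = hm n p"
proof (intro exI conjI)
  let ?p = "\<Sum>j\<le>n. monom (lookup f (single u j + single w (n - j))) j"
  show "degree ?p \<le> n"
    by (rule degree_sum_le) (auto intro: order.trans[OF degree_monom_le])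
  have cf: "coeff ?p j = lookup f (single u j + single w (n - j))" if "j \<le> n" for j
    using that by (simp add: coeff_sum)
  have vv: "vdeg V (single u a + single w b) = 0" for a b using uw by (simp add: vdeg_add vdeg_single)
  show "kill V f = hm n ?p"
  proof (rule poly_mapping_eqI)
    fix t
    have "lookup (hm n ?p) t = (\<Sum>j\<le>n. if single u j + single w (n - j) = t then lookup f t else 0)"
      unfolding hm_def lookup_sum
      by (rule sum.cong) (auto simp: cf lookup_cst_mult var_power mult_single lookup_single when_def)
    also have "\<dots> = lookup (kill V f) t"
    proof (cases "t \<in> keys f \<and> vdeg V t = 0")
      case True
      then have md: "lookup t u + lookup t w = n" using assms mon_deg_line[of t] by (auto simp: homog_def)
      have t: "single u (lookup t u) + single w (n - lookup t u) = t"
      proof (rule poly_mapping_eqI)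
        fix i
        have "i \<in> V \<Longrightarrow> lookup t i = 0" using True by (simp add: vdeg_def)
        then show "lookup (single u (lookup t u) + single w (n - lookup t u)) i = lookup t i"
          using not_V[of i] uw md by (auto simp: lookup_add lookup_single when_def)
      qed
      have "single u j + single w (n - j) = t \<longleftrightarrow> j = lookup t u" for j
        using t uw by (auto simp: lookup_add lookup_single when_def)
      then show ?thesis using True md by (simp add: kill_eq_restr lookup_restr)
    next
      case False
      then have "lookup (kill V f) t = 0" by (auto simp: kill_eq_restr lookup_restr in_keys_iff)
      moreover have "(if single u j + single w (n - j) = t then lookup f t else 0) = 0" for j
        using False vv by (auto simp: in_keys_iff)
      ultimately show ?thesis by simp
    qed
    finally show "lookup (kill V f) t = lookup (hm n ?p) t" by simp
  qed
qed

end

lemma line_swap: "line V u w \<Longrightarrow> line V w u"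
  by (auto simp: line_def)

text \<open>A form in \<open>P\<close> that does not vanish on the line restricts to a nonzero
  binary form. One of its linear factors is in \<open>P\<close>, and with it the ideal of a rational
  point, which is already closed.\<close>

lemma (in line) line_point_closed:
  fixes P :: "'a::alg_closed_field cring set"
  assumes P: "P \<in> points" and sub: "vpow V 1 \<subset> P"
  shows "closed_point P"
proof -
  interpret sw: line V w u by (rule line_swap) unfold_locales
  have I: "idl P" by (rule points_idl[OF P])
  obtain f n where f: "f \<in> P" "homog (int n) f" "f \<notin> vpow V 1"
    using graded_ext[OF points_graded[OF P] idl_vpow[of V 1]] sub by blast
  obtain p where p: "degree p \<le> n" "kill V f = hm n p" using kill_hm[OF f(2)] by blast
  have "p \<noteq> 0" using f(3) p by (auto simp: hm_def kill_eq_0[symmetric])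
  have "f - kill V f \<in> P" using diff_kill sub by blast
  then have "hm n p \<in> P" using f(1) idl_cong[OF I] p by simp
  then have "var w \<in> P \<or> (\<exists>\<alpha>. var u - cst \<alpha> * var w \<in> P)"
    using hm_notin[OF P _ _ \<open>p \<noteq> 0\<close> p(1)] by blast
  moreover have "var i \<in> P" if "i \<in> V" for i using var_in_vpow[OF that] sub by blast
  ultimately have "(\<exists>\<alpha>. lin_pt \<alpha> \<subseteq> P) \<or> sw.lin_pt 0 \<subseteq> P"
    using lin_pt_sub_point[OF P] sw.lin_pt_sub_point[OF P, of 0] by (metis cst_simps(1) diff_zero mult_zero_left)
  then show ?thesis
    using lin_pt_closed sw.lin_pt_closed[of 0] P unfolding closed_point_def by (metis psubsetI)
qed

text \<open>Being primary to the ideal of the line, tested on homogeneous elements only. The ideals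
  used later contain \<open>var w - 1\<close>, which is neither on the line nor cancellable, so the
  unrestricted conditions would fail for them.\<close>

definition lprim :: "4 set \<Rightarrow> 'a::field cring set \<Rightarrow> bool"
  where "lprim V I \<longleftrightarrow> idl I \<and> (\<forall>f g n. homog n g \<longrightarrow> f * g \<in> I \<longrightarrow> f \<in> I \<or> g \<in> vpow V 1) \<and>
     (\<exists>N. vpow V N \<subseteq> I) \<and> (\<forall>f n. f \<in> I \<longrightarrow> homog n f \<longrightarrow> f \<in> vpow V 1)"

lemma lprimD:
  assumes "lprim V I"
  shows lprim_idl: "idl I" and lprim_cancel: "homog n g \<Longrightarrow> f * g \<in> I \<Longrightarrow> g \<notin> vpow V 1 \<Longrightarrow> f \<in> I"
    and lprim_power: "\<exists>N. vpow V N \<subseteq> I" and lprim_sub: "f \<in> I \<Longrightarrow> homog n f \<Longrightarrow> f \<in> vpow V 1"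
  using assms unfolding lprim_def by blast+

lemma vpow_sub_point: "P \<in> points \<Longrightarrow> vpow V 1 \<subseteq> P \<longleftrightarrow> (\<forall>i\<in>V. var i \<in> P)"
  using ideal_gen_least[OF points_idl, of P "var ` V"] var_in_vpow
  by (auto simp: ideal_gen_vars)

text \<open>Two ideals are treated together for the sake of disjoint unions; for a single structure
  both are taken equal.\<close>

lemma support_lprim2:
  fixes I :: "'a::field cring set"
  assumes "lprim V I" "lprim V' I'"
  shows "support (assoc_sheaf (I \<inter> I')) = {P \<in> points. vpow V 1 \<subseteq> P \<or> vpow V' 1 \<subseteq> P}"
proof (intro equalityI subsetI)
  fix P :: "'a cring set" assume "P \<in> support (assoc_sheaf (I \<inter> I'))"
  then have P: "P \<in> points" "\<And>f n. f \<in> I \<inter> I' \<Longrightarrow> homog n f \<Longrightarrow> f \<in> P" by (auto simp: support_assoc)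
  obtain N N' where N: "vpow V N \<subseteq> I" "vpow V' N' \<subseteq> I'" using assms lprim_power by metis
  show "P \<in> {P \<in> points. vpow V 1 \<subseteq> P \<or> vpow V' 1 \<subseteq> P}"
  proof (rule ccontr)
    assume "P \<notin> {P \<in> points. vpow V 1 \<subseteq> P \<or> vpow V' 1 \<subseteq> P}"
    then obtain i j where ij: "i \<in> V" "j \<in> V'" "var i \<notin> P" "var j \<notin> P"
      using P vpow_sub_point by blast
    have "var i ^ N * var j ^ N' \<in> I \<inter> I'"
      using N ij var_power_in_vpow idl_mult[OF lprim_idl[OF assms(2)]] idl_mult_right[OF lprim_idl[OF assms(1)]] by blast
    then have "var i ^ N * var j ^ N' \<in> P"
      using P(2) homog_mult[OF homog_var_power homog_var_power] by blast
    then show False using points_prime[OF P(1)] points_power[OF P(1)] ij by blast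
  qed
next
  fix P :: "'a cring set" assume "P \<in> {P \<in> points. vpow V 1 \<subseteq> P \<or> vpow V' 1 \<subseteq> P}"
  then show "P \<in> support (assoc_sheaf (I \<inter> I'))"
    using lprim_sub[OF assms(1)] lprim_sub[OF assms(2)] by (auto simp: support_assoc)
qed

text \<open>Points strictly above the generic point of a line are closed, which bounds the
  dimension. An associated point annihilates a section that is nonzero modulo one of the two ideals;
  primariness then places it inside the ideal of that line, so it is not closed.\<close>

lemma lcm_curve_lprim2:
  fixes I :: "'a::alg_closed_field cring set"
  assumes I: "lprim V I" and I': "lprim V' I'" and l: "line V u w" and l': "line V' u' w'"
  shows "lcm_curve (assoc_sheaf (I \<inter> I'))"
  unfolding lcm_curve_def
proof (intro conjI allI impI)
  interpret l: line V u w by (rule l)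
  interpret l': line V' u' w' by (rule l')
  let ?C = "assoc_sheaf (I \<inter> I')"
  have idl: "idl (I \<inter> I')" by (intro idl_Int lprim_idl[OF I] lprim_idl[OF I'])
  note sup = support_lprim2[OF I I']
  show "closed_subscheme ?C" by (rule closed_subscheme_assoc[OF idl])
  show "has_dimension ?C 1"
    unfolding has_dimension_def
  proof
    show "has_chain ?C 1"
      unfolding has_chain_def
    proof (intro exI[of _ "\<lambda>i. if i = 0 then vpow V 1 else l.lin_pt 0"] conjI allI impI)
      fix i :: nat
      have sub: "vpow V 1 \<subset> (l.lin_pt 0 :: 'a cring set)" by (rule l.line_lin_pt)
      then have "vpow V 1 \<in> support ?C" "l.lin_pt 0 \<in> support ?C"
        unfolding sup using l.line_point[where ?'a = 'a] l.lin_pt_point[of "0 :: 'a"] by blast+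
      then show "(if i = 0 then vpow V 1 else l.lin_pt 0) \<in> support ?C" by (cases "i = 0") (simp_all only: if_True if_False simp_thms)
      assume "i < 1"
      then have "i = 0" by simp
      then show "(if i = 0 then vpow V 1 else l.lin_pt 0) \<subset> (if Suc i = 0 then vpow V 1 else l.lin_pt 0 :: 'a cring set)"
        by (simp only: if_True if_False simp_thms nat.distinct sub)
    qed
    show "\<not> has_chain ?C (Suc 1)"
    proof
      assume "has_chain ?C (Suc 1)"
      then obtain P :: "nat \<Rightarrow> 'a cring set" where P: "\<And>i. i \<le> Suc 1 \<Longrightarrow> P i \<in> support ?C" "\<And>i. i < Suc 1 \<Longrightarrow> P i \<subset> P (Suc i)"
        unfolding has_chain_def by blast
      have "vpow V 1 \<subset> P 1 \<or> vpow V' 1 \<subset> P 1" "P 1 \<in> points" "P 1 \<subset> P 2" "P 2 \<in> points"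
      proof -
        have "P 0 \<subset> P 1" "P 1 \<subset> P 2" using P(2)[of 0] P(2)[of 1] by (simp_all add: numeral_2_eq_2 One_nat_def)
        moreover have "P 0 \<in> support ?C" "P 1 \<in> support ?C" "P 2 \<in> support ?C"
          by (rule P(1), simp)+
        ultimately show "vpow V 1 \<subset> P 1 \<or> vpow V' 1 \<subset> P 1" "P 1 \<in> points" "P 1 \<subset> P 2" "P 2 \<in> points"
          unfolding sup by blast+
      qed
      then show False
        using l.line_point_closed[of "P 1"] l'.line_point_closed[of "P 1"] unfolding closed_point_def by blast
    qed
  qed
  fix P assume P: "associated_point ?C P"
  then obtain h s where h: "P \<in> points" "h \<in> basics" "h \<notin> P" and s: "s \<in> sect UNIV 0 h"
    and ann: "{r \<in> regular h. r * s \<in> sect (I \<inter> I') 0 h} = sect P 0 h"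
  proof -
    obtain h s where *: "P \<in> points" "h \<in> basics" "h \<notin> P" "s \<in> regular h"
      "{r \<in> regular h. r * s \<in> assoc_sheaf (I \<inter> I') h} = assoc_sheaf P h"
      using P unfolding associated_point_def by blast
    show ?thesis by (rule that[OF *(1-3)]) (use * in \<open>simp_all only: assoc_sheaf_eq sections_O_eq\<close>)
  qed
  obtain f k where f: "s = quot f (h ^ k)" "homog (int k * int (tot_deg h)) f"
    using s by (auto elim!: sectE)
  have "1 \<notin> sect P 0 h"
    using quot_in_sect_point[OF h, of 0 0 1] points_one[OF h(1)] homog_one by (simp add: fract_collapse)
  moreover have "1 \<in> {r \<in> regular h. r * s \<in> sect (I \<inter> I') 0 h}" if "s \<in> sect (I \<inter> I') 0 h"
    using that one_in_regular[of h] by (simp add: sections_O_eq)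
  ultimately have "s \<notin> sect (I \<inter> I') 0 h" unfolding ann by blast
  then have nj: "f * h ^ j \<notin> I \<inter> I'" for j
    using quot_in_sect_iff[OF h(2) idl, of k 0 f] f by auto
  \<comment> \<open>A form \<open>p\<close> in \<open>P\<close> acts on sections through the
    fraction of \<open>p ^ tot_deg h\<close> by a power of \<open>h\<close>. This sends
    \<open>s\<close> into the ideal, and cancelling in the primary ideal forces \<open>p\<close> to
    vanish on the line.\<close>
  have *: "P \<subseteq> vpow W 1" if W: "lprim W J" "I \<inter> I' \<subseteq> J" "\<And>j. f * h ^ j \<notin> J" for W J
  proof (rule graded_ext[OF points_graded[OF h(1)] idl_vpow])
    fix p n assume p: "p \<in> P" "homog (int n) p"
    let ?d = "tot_deg h"
    have hp: "homog (int n * int ?d + 0) (p ^ ?d)" using homog_power[OF p(2), of ?d] by (simp add: mult.commute)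
    have "p ^ ?d \<in> P" by (rule idl_power[OF points_idl[OF h(1)] p(1) basics_pos[OF h(2)]])
    then have "quot (p ^ ?d) (h ^ n) \<in> sect P 0 h" using quot_in_sect_point[OF h hp] by simp
    then have "quot (p ^ ?d) (h ^ n) * s \<in> sect (I \<inter> I') 0 h" using ann by auto
    then have "quot (p ^ ?d * f) (h ^ (n + k)) \<in> sect (I \<inter> I') 0 h" by (simp add: f power_add)
    moreover have "homog (int (n + k) * int ?d + 0) (p ^ ?d * f)"
      using homog_mult[OF hp f(2)] by (simp add: algebra_simps)
    ultimately obtain j where "p ^ ?d * f * h ^ j \<in> I \<inter> I'"
      using quot_in_sect_iff[OF h(2) idl, of "n + k" 0 "p ^ ?d * f"] by blast
    then have "p ^ ?d * f * h ^ j \<in> J" using W(2) by blast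
    then have "(f * h ^ j) * p ^ ?d \<in> J" by (simp add: mult_ac)
    then have "p ^ ?d \<in> vpow W 1" using lprim_cancel[OF W(1) hp] W(3) by blast
    moreover have "x ^ i \<in> vpow W 1 \<Longrightarrow> x \<in> vpow W 1" for x :: "'a cring" and i
    proof (induction i)
      case (Suc i)
      then show ?case using vpow_prime[of x "x ^ i" W] by auto
    qed (use one_notin_vpow[of W, where ?'a = 'a] in simp)
    ultimately show "p \<in> vpow W 1" by blast
  qed
  have "(\<forall>j. f * h ^ j \<notin> I) \<or> (\<forall>j. f * h ^ j \<notin> I')"
  proof (rule ccontr)
    assume "\<not> ((\<forall>j. f * h ^ j \<notin> I) \<or> (\<forall>j. f * h ^ j \<notin> I'))"
    then obtain a b where ab: "f * h ^ a \<in> I" "f * h ^ b \<in> I'" by blast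
    have "f * h ^ (a + b) = h ^ b * (f * h ^ a)" "f * h ^ (a + b) = h ^ a * (f * h ^ b)"
      by (simp_all add: power_add mult_ac)
    then have "f * h ^ (a + b) \<in> I" "f * h ^ (a + b) \<in> I'"
      using idl_mult[OF lprim_idl[OF I] ab(1), of "h ^ b"] idl_mult[OF lprim_idl[OF I'] ab(2), of "h ^ a"]
      by (simp_all only:)
    then show False using nj[of "a + b"] by blast
  qed
  then have "P \<subseteq> vpow V 1 \<or> P \<subseteq> vpow V' 1" using *[OF I] *[OF I'] by blast
  then have "P \<subset> l.lin_pt 0 \<or> P \<subset> l'.lin_pt 0"
    using l.line_lin_pt[of "0 :: 'a"] l'.line_lin_pt[of "0 :: 'a"] by blast
  then show "\<not> closed_point P"
    using l.lin_pt_point[of "0 :: 'a"] l'.lin_pt_point[of "0 :: 'a"] unfolding closed_point_def by blast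
qed

text \<open>A coordinate of the line can be cancelled modulo a line-primary ideal, so such ideals
  are already saturated.\<close>

lemma H0_lprim2:
  fixes I :: "'a::field cring set"
  assumes I: "lprim V I" and I': "lprim V' I'" and l: "line V u w" and l': "line V' u' w'" and n: "n \<ge> 0"
  shows "H0 (assoc_sheaf (I \<inter> I')) n = {F \<in> I \<inter> I'. homog n F}"
proof (rule H0_assoc[OF _ n])
  show "idl (I \<inter> I')" by (intro idl_Int lprim_idl[OF I] lprim_idl[OF I'])
  have *: "F \<in> J" if J: "lprim W J" "line W a b" and F: "\<And>i. \<exists>k. F * var i ^ k \<in> J" for W J a b and F :: "'a cring"
  proof -
    interpret line W a b by (rule J)
    obtain k where "F * var b ^ k \<in> J" using F by blast
    moreover have "var b ^ k \<notin> (vpow W 1 :: 'a cring set)"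
      using uw by (simp add: var_power vpow_def vdeg_single)
    ultimately show ?thesis using lprim_cancel[OF J(1) homog_var_power] by blast
  qed
  show "F \<in> I \<inter> I'" if "\<And>i. \<exists>k. F * var i ^ k \<in> I \<inter> I'" for F
    using *[OF I l, of F] *[OF I' l', of F] that by blast
qed

section \<open>Dimensions\<close>

interpretation pvs: vector_space "scal :: 'a::field \<Rightarrow> ('v, 'a) pol \<Rightarrow> ('v, 'a) pol"
  by (rule vector_space_scal)

lemma finite_mon_deg: "finite {t :: 'v::finite \<Rightarrow>\<^sub>0 nat. mon_deg t = n}"
proof (rule finite_imageD)
  have "lookup ` {t :: 'v \<Rightarrow>\<^sub>0 nat. mon_deg t = n} \<subseteq> (UNIV \<rightarrow>\<^sub>E {..n})"
  proof
    fix f :: "'v \<Rightarrow> nat" assume "f \<in> lookup ` {t. mon_deg t = n}"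
    then obtain t where "f = lookup t" "mon_deg t = n" by blast
    moreover have "lookup t i \<le> mon_deg t" for i
      unfolding mon_deg_def by (rule member_le_sum) auto
    ultimately have "f i \<le> n" for i by metis
    then show "f \<in> (UNIV \<rightarrow>\<^sub>E {..n})" by (simp add: PiE_UNIV_domain Pi_def)
  qed
  then show "finite (lookup ` {t :: 'v \<Rightarrow>\<^sub>0 nat. mon_deg t = n})"
    by (rule finite_subset) (rule finite_PiE; simp)
  show "inj_on lookup {t :: 'v \<Rightarrow>\<^sub>0 nat. mon_deg t = n}"
    by (rule inj_onI) (simp add: lookup_inject)
qed

lemma keys_scal: "keys (scal c p) \<subseteq> keys p"
  by (auto simp: in_keys_iff scal_eq lookup_cst_mult)

lemma span_mon: "pvs.span (mon ` A) = {f :: ('v, 'a::field) pol. keys f \<subseteq> A}"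
proof
  have "pvs.subspace {f :: ('v, 'a) pol. keys f \<subseteq> A}"
  proof (rule pvs.subspaceI)
    show "x + y \<in> {f. keys f \<subseteq> A}" if "x \<in> {f. keys f \<subseteq> A}" "y \<in> {f. keys f \<subseteq> A}" for x y :: "('v, 'a) pol"
      using that Poly_Mapping.keys_add[of x y] by blast
    show "scal c x \<in> {f. keys f \<subseteq> A}" if "x \<in> {f. keys f \<subseteq> A}" for c and x :: "('v, 'a) pol"
      using that keys_scal[of c x] by blast
  qed simp
  then show "pvs.span (mon ` A) \<subseteq> {f :: ('v, 'a) pol. keys f \<subseteq> A}"
    by (rule pvs.span_minimal[rotated]) auto
  show "{f :: ('v, 'a) pol. keys f \<subseteq> A} \<subseteq> pvs.span (mon ` A)"
  proof safe
    fix f :: "('v, 'a) pol" assume "keys f \<subseteq> A"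
    then have "single t (lookup f t) \<in> pvs.span (mon ` A)" if "t \<in> keys f" for t
      using that pvs.span_scale[OF pvs.span_base, of "mon t" "mon ` A" "lookup f t"]
      by (auto simp: scal_def mult_single)
    then show "f \<in> pvs.span (mon ` A)"
      by (subst pol_sum_monomials[of f]) (rule pvs.span_sum)
  qed
qed

abbreviation forms :: "nat \<Rightarrow> ('v::finite, 'a::field) pol set"
  where "forms n \<equiv> {F. homog (int n) F}"

lemma forms_span: "forms n = pvs.span (mon ` {t. mon_deg t = n})"
  by (auto simp: span_mon homog_def)

context
  fixes n :: nat
begin

lemma indep_forms_finite:
  fixes B :: "('v::finite, 'a::field) pol set"
  assumes "B \<subseteq> forms n" "pvs.independent B" shows "finite B"
  using pvs.independent_span_bound[of "mon ` {t. mon_deg t = n}" B] assms finite_mon_deg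
  by (auto simp: forms_span)

lemma dim_mono_forms:
  fixes U :: "('v::finite, 'a::field) pol set"
  assumes "S \<subseteq> U" "U \<subseteq> forms n"
  shows "dim_k S \<le> dim_k U"
proof -
  obtain B where B: "B \<subseteq> S" "pvs.independent B" "S \<subseteq> pvs.span B" "card B = dim_k S"
    using pvs.basis_exists by blast
  then obtain B' where B': "B \<subseteq> B'" "B' \<subseteq> U" "pvs.independent B'" "U \<subseteq> pvs.span B'"
    using pvs.maximal_independent_subset_extend[of B U] assms by (metis order_trans)
  then have "card B' = dim_k U" by (intro pvs.basis_card_eq_dim)
  moreover have "finite B'" using indep_forms_finite B' assms by blast
  ultimately show ?thesis using B B' card_mono by metis
qed

text \<open>Monomials are adjoined one at a time: a dependence writes the new monomial as an element
  of \<open>U\<close> plus earlier monomials, and \<open>ind\<close> makes that element of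
  \<open>U\<close> zero.\<close>

lemma indep_compl:
  fixes U :: "('v::finite, 'a::field) pol set"
  assumes "finite A" "pvs.independent BU" "BU \<subseteq> U" "pvs.subspace U"
    and ind: "\<And>f. keys f \<subseteq> A \<Longrightarrow> f \<in> U \<Longrightarrow> f = 0"
  shows "pvs.independent (BU \<union> mon ` A) \<and> (finite BU \<longrightarrow> card (BU \<union> mon ` A) = card BU + card A)"
  using assms(1) ind
proof (induction A rule: finite_induct)
  case empty
  then show ?case using assms by simp
next
  case (insert t A)
  have "mon t \<notin> pvs.span (BU \<union> mon ` A)"
  proof
    assume "mon t \<in> pvs.span (BU \<union> mon ` A)"
    then obtain f b where fb: "mon t = f + b" "f \<in> pvs.span BU" "b \<in> pvs.span (mon ` A)"
      unfolding pvs.span_Un by blast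
    have "f \<in> U" using fb(2) pvs.span_minimal[OF assms(3,4)] by blast
    moreover have kb: "keys b \<subseteq> A" using fb by (simp add: span_mon)
    moreover have "keys f \<subseteq> insert t A"
    proof -
      have "f = mon t - b" using fb(1) by simp
      then show ?thesis using kb keys_diff[of "mon t" b] by auto
    qed
    ultimately have "f = 0" using insert.prems by blast
    then have "b = mon t" using fb(1) by (simp only: add_0)
    then have "lookup b t = 1" by (simp only: lookup_single_eq)
    then have "t \<in> keys b" by (simp add: in_keys_iff)
    then show False using kb insert.hyps by blast
  qed
  note nt = this
  have IH: "pvs.independent (BU \<union> mon ` A) \<and> (finite BU \<longrightarrow> card (BU \<union> mon ` A) = card BU + card A)"
    by (rule insert.IH) (use insert.prems in blast)
  have "mon t \<notin> BU \<union> mon ` A" using nt by (rule contrapos_nn) (rule pvs.span_base)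
  note nin = this
  have eq: "BU \<union> mon ` insert t A = insert (mon t) (BU \<union> mon ` A)" by blast
  show ?case unfolding eq
  proof (intro conjI impI)
    show "pvs.independent (insert (mon t) (BU \<union> mon ` A))"
      by (rule pvs.independent_insertI[OF nt]) (use IH in blast)
    assume "finite BU"
    then have "finite (BU \<union> mon ` A)" using insert.hyps(1) by blast
    then show "card (insert (mon t) (BU \<union> mon ` A)) = card BU + card (insert t A)"
      using IH \<open>finite BU\<close> by (simp only: card_insert_disjoint nin insert.hyps not_False_eq_True add_Suc_right)
  qed
qed

text \<open>Half of \<open>dim_compl\<close>, for the situation where normal forms are known to be
  independent but not to span; it bounds a Hilbert function from below.\<close>

lemma dim_compl_le:
  fixes U :: "('v::finite, 'a::field) pol set"
  assumes "finite A" "pvs.subspace U" "U \<subseteq> forms n" "\<And>t. t \<in> A \<Longrightarrow> mon_deg t = n"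
    and ind: "\<And>f. keys f \<subseteq> A \<Longrightarrow> f \<in> U \<Longrightarrow> f = 0"
  shows "dim_k U + card A \<le> dim_k (forms n :: ('v, 'a) pol set)"
proof -
  obtain B where B: "B \<subseteq> U" "pvs.independent B" "U \<subseteq> pvs.span B" "card B = dim_k U"
    using pvs.basis_exists by blast
  have fin: "finite B" using indep_forms_finite B assms by blast
  have i: "pvs.independent (B \<union> mon ` A)" "card (B \<union> mon ` A) = dim_k U + card A"
    using indep_compl[OF assms(1) B(2,1) assms(2) ind] fin B(4) by auto
  moreover have sub: "B \<union> mon ` A \<subseteq> (forms n :: ('v, 'a) pol set)" using B assms(3,4) by (auto simp: homog_single)
  ultimately have "card (B \<union> mon ` A) \<le> dim_k (forms n :: ('v, 'a) pol set)"
    using dim_mono_forms[OF sub order_refl] pvs.dim_eq_card_independent[OF i(1)] by simp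
  then show ?thesis using i by simp
qed

lemma dim_compl:
  fixes U :: "('v::finite, 'a::field) pol set"
  assumes "finite A" "pvs.subspace U" "U \<subseteq> forms n" "\<And>t. t \<in> A \<Longrightarrow> mon_deg t = n"
    and ind: "\<And>f. keys f \<subseteq> A \<Longrightarrow> f \<in> U \<Longrightarrow> f = 0"
    and spn: "\<And>f. f \<in> forms n \<Longrightarrow> \<exists>b. keys b \<subseteq> A \<and> f - b \<in> U"
  shows "dim_k (forms n :: ('v, 'a) pol set) = dim_k U + card A"
proof -
  obtain B where B: "B \<subseteq> U" "pvs.independent B" "U \<subseteq> pvs.span B" "card B = dim_k U"
    using pvs.basis_exists by blast
  have fin: "finite B" using indep_forms_finite B assms by blast
  have i: "pvs.independent (B \<union> mon ` A)" "card (B \<union> mon ` A) = dim_k U + card A"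
    using indep_compl[OF assms(1) B(2,1) assms(2) ind] fin B(4) by auto
  have "B \<union> mon ` A \<subseteq> (forms n :: ('v, 'a) pol set)" using B assms(3,4) by (auto simp: homog_single)
  moreover have "forms n \<subseteq> pvs.span (B \<union> mon ` A)"
  proof
    fix f :: "('v, 'a) pol" assume "f \<in> forms n"
    then obtain b where b: "keys b \<subseteq> A" "f - b \<in> U" using spn by blast
    then have "f - b \<in> pvs.span (B \<union> mon ` A)" "b \<in> pvs.span (B \<union> mon ` A)"
      using B(3) span_mon[of A] pvs.span_mono[of B "B \<union> mon ` A"] pvs.span_mono[of "mon ` A" "B \<union> mon ` A"] by auto
    then show "f \<in> pvs.span (B \<union> mon ` A)" using pvs.span_add by fastforce
  qed
  ultimately show ?thesis using pvs.basis_card_eq_dim i by metis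
qed

end

lemma subspace_idl_forms: "idl I \<Longrightarrow> pvs.subspace {F \<in> I. homog n F}"
  by (rule pvs.subspaceI) (auto intro: idl_0 idl_add idl_mult homog_add homog_scal simp: scal_eq homog_scal[unfolded scal_eq])

section \<open>Multiple structures on a line given by a parametrization\<close>

lemma vpow_single_factor:
  fixes f :: "('v::finite, 'a::comm_ring_1) pol"
  assumes "f \<in> vpow {i} n" shows "\<exists>f'. f = var i ^ n * f'"
proof -
  have "f \<in> {f. var i ^ n dvd f}"
  proof (rule vpow_in_idl[OF _ _ assms])
    show "idl {f. var i ^ n dvd f}" by (rule idlI) auto
    fix t :: "'v \<Rightarrow>\<^sub>0 nat" assume "vdeg {i} t = n"
    then have "t = single i n + (t - single i n)"
      by (intro poly_mapping_eqI) (auto simp: vdeg_def lookup_add lookup_minus lookup_single when_def)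
    then have "(mon t :: ('v, 'a) pol) = var i ^ n * mon (t - single i n)"
      by (metis mult_single mult_1 var_power)
    then show "(mon t :: ('v, 'a) pol) \<in> {f. var i ^ n dvd f}" by simp
  qed
  then show ?thesis by (auto elim: dvdE)
qed

lemma var_power_mult_vpow: "var i ^ k * f \<in> vpow {i} (k + n) \<longleftrightarrow> f \<in> vpow {i} n"
  for f :: "('v::{finite,linorder}, 'a::idom) pol"
proof
  assume "var i ^ k * f \<in> vpow {i} (k + n)"
  then obtain f' where "var i ^ k * f = var i ^ (k + n) * f'" using vpow_single_factor by blast
  then have "f = var i ^ n * f'" by (simp add: power_add)
  then show "f \<in> vpow {i} n" by (metis idl_mult_right[OF idl_vpow] var_power_in_vpow singletonI)
next
  assume "f \<in> vpow {i} n"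
  then show "var i ^ k * f \<in> vpow {i} (k + n)" by (intro vpow_mult var_power_in_vpow) simp
qed

text \<open>\<open>var i\<close> is prime, so its powers can be divided out one factor at a
  time.\<close>

lemma vpow_single_cancel:
  fixes p q :: "('v::{finite,linorder}, 'a::idom) pol"
  shows "p * q \<in> vpow {i} n \<Longrightarrow> q \<notin> vpow {i} 1 \<Longrightarrow> p \<in> vpow {i} n"
proof (induction n arbitrary: p)
  case (Suc n)
  then have "p * q \<in> vpow {i} 1" using vpow_mono[of 1 "Suc n" "{i}"] by auto
  then have "p \<in> vpow {i} 1" using Suc vpow_prime by blast
  then obtain p' where p: "p = var i ^ 1 * p'" using vpow_single_factor by blast
  then have "var i ^ 1 * (p' * q) \<in> vpow {i} (1 + n)" using Suc.prems by (simp add: mult.assoc plus_1_eq_Suc)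
  then have "p' \<in> vpow {i} n" using Suc unfolding var_power_mult_vpow by blast
  then show ?case unfolding p using var_power_mult_vpow[of i 1 p' n] by (simp add: plus_1_eq_Suc)
qed (simp add: vpow_def)

text \<open>A structure of multiplicity \<open>d\<close> on the line x = y = 0, given in the chart w
  = 1 by y = x \<Phi> modulo x^d; \<kappa> and t record \<Phi> on the line. The names of the
  variables are parameters because the same construction is used on X = Y = 0 and on Z = W = 0, and
  \<open>d\<close> will also stand for multiplicities other than 3m - 1.\<close>

locale pline =
  fixes x y z w :: 4 and \<Phi> :: "'a::field cring" and t :: 'a and \<kappa> d :: nat
  assumes dist: "x \<noteq> y" "x \<noteq> z" "x \<noteq> w" "y \<noteq> z" "y \<noteq> w" "z \<noteq> w" and UN4: "UNIV = {x, y, z, w}"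
    and \<Phi>: "kill {x} \<Phi> = cst (inverse t) * var z ^ \<kappa>" and t: "t \<noteq> 0" and d: "d > 0"
begin

abbreviation "V \<equiv> {x, y}"

sublocale line V z w
  by unfold_locales (use dist UN4 in auto)

definition rho :: "4 \<Rightarrow> 'a cring"
  where "rho i = (if i = x then var x else if i = y then var x * \<Phi> else if i = z then var z else 1)"

definition theta :: "'a cring \<Rightarrow> 'a cring" where "theta = subst rho"

text \<open>The ideal of the chart w = 1 pulled back to all four variables. It is not homogeneous
  (\<open>var w - 1\<close> belongs to it), but its forms are exactly the equations of the
  curve.\<close>

definition idealC :: "'a cring set" where "idealC = {f. theta f \<in> vpow {x} d}"

lemma rho_simps [simp]: "rho x = var x" "rho y = var x * \<Phi>" "rho z = var z" "rho w = 1"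
  using dist by (simp_all add: rho_def)

lemma theta_simps: "theta (p + q) = theta p + theta q" "theta (p * q) = theta p * theta q"
  "theta (p - q) = theta p - theta q" "theta (p ^ n) = theta p ^ n"
  "theta (- p) = - theta p" "theta (cst c) = cst c"
  "theta 0 = 0" "theta 1 = 1" "theta (var i) = rho i"
  "theta (scal c p) = cst c * theta p"
  "theta (sum F A) = (\<Sum>a\<in>A. theta (F a))"
  by (simp_all add: theta_def subst_simps)

lemma idl_idealC: "idl idealC"
  by (rule idlI) (auto simp: idealC_def theta_simps idl_0[OF idl_vpow] idl_add[OF idl_vpow] idl_mult[OF idl_vpow])

lemma vdegV: "vdeg V s = lookup s x + lookup s y"
  using dist by (simp add: vdeg_def)

lemma mon_deg4: "mon_deg s = lookup s x + lookup s y + lookup s z + lookup s w"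
  by (simp add: mon_deg_line vdegV)

lemma theta_mon: "theta (mon s) = var x ^ vdeg V s * (\<Phi> ^ lookup s y * var z ^ lookup s z)"
proof -
  have "theta (mon s) = (\<Prod>i\<in>{x, y, z, w}. rho i ^ lookup s i)"
    by (simp only: theta_def cst.peval_mon UN4)
  also have "\<dots> = var x ^ vdeg V s * (\<Phi> ^ lookup s y * var z ^ lookup s z)"
    using dist by (simp add: vdegV power_add power_mult_distrib mult_ac)
  finally show ?thesis .
qed

lemma vpow_idealC: "vpow V d \<subseteq> idealC"
proof
  fix f :: "'a cring" assume "f \<in> vpow V d"
  then show "f \<in> idealC"
  proof (rule vpow_in_idl[OF idl_idealC, rotated])
    fix s assume "vdeg V s = d"
    then show "mon s \<in> idealC"
      using var_power_in_vpow[of x "{x}" d] by (auto simp: idealC_def theta_mon intro: idl_mult_right[OF idl_vpow])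
  qed
qed

lemma kill_theta: "kill {x} (theta f) = subst (\<lambda>i. if i \<in> V then 0 else if i = z then var z else 1) f"
proof -
  have "kill {x} (theta f) = subst (\<lambda>i. kill {x} (theta (var i))) f"
    by (rule cst.peval_unique) (simp_all add: theta_simps kill_simps)
  also have "(\<lambda>i. kill {x} (theta (var i))) = (\<lambda>i. if i \<in> V then 0 else if i = z then var z else 1)"
  proof
    fix i have "i \<in> {x, y, z, w}" using UN4 by blast
    then show "kill {x} (theta (var i)) = (if i \<in> V then 0 else if i = z then var z else 1)"
      using dist by (auto simp: theta_simps kill_simps)
  qed
  finally show ?thesis .
qed

text \<open>On the line \<open>theta\<close> only sets w = 1, and a binary form of given degree in z
  and w is determined by its values there.\<close>

lemma theta_line:
  assumes "homog n f" shows "theta f \<in> vpow {x} 1 \<longleftrightarrow> f \<in> vpow V 1"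
proof (cases "f = 0")
  case False
  then have n: "homog (int (nat n)) f" using assms homog_negative[of n f] by force
  let ?\<rho> = "\<lambda>i. if i \<in> V then 0 else if i = z then var z else (1 :: 'a cring)"
  obtain p where p: "degree p \<le> nat n" "kill V f = hm (nat n) p" using kill_hm[OF n] by blast
  have "f - kill V f \<in> {f. subst ?\<rho> f = 0}"
  proof -
    have "ideal_gen (var ` V) \<subseteq> {f. subst ?\<rho> f = 0}"
      by (rule ideal_gen_least[OF idl_ker_subst]) auto
    then show ?thesis using diff_kill[of f V] unfolding ideal_gen_vars by blast
  qed
  then have "subst ?\<rho> f = subst ?\<rho> (hm (nat n) p)" by (simp add: cst.peval_diff p)
  also have "\<dots> = (\<Sum>j\<le>nat n. cst (coeff p j) * var z ^ j)"
    using dist by (simp add: hm_def subst_simps)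
  finally have eq: "subst ?\<rho> f = (\<Sum>j\<le>nat n. cst (coeff p j) * var z ^ j)" .
  have lk: "lookup (subst ?\<rho> f) (single z j) = coeff p j" if "j \<le> nat n" for j
  proof -
    have "lookup (subst ?\<rho> f) (single z j) = (\<Sum>k\<le>nat n. if k = j then coeff p j else 0)"
      unfolding eq lookup_sum
      by (rule sum.cong) (auto simp: lookup_cst_mult var_power lookup_single when_def inj_eq[OF inj_single])
    then show ?thesis using that by simp
  qed
  have "theta f \<in> vpow {x} 1 \<longleftrightarrow> subst ?\<rho> f = 0" by (simp only: kill_eq_0[symmetric] kill_theta)
  also have "\<dots> \<longleftrightarrow> hm (nat n) p = 0"
  proof
    assume "subst ?\<rho> f = 0"
    then have "coeff p j = 0" if "j \<le> nat n" for j using lk[OF that] by simp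
    then show "hm (nat n) p = 0" by (simp add: hm_def)
  next
    assume "hm (nat n) p = 0"
    then show "subst ?\<rho> f = 0" using \<open>subst ?\<rho> f = subst ?\<rho> (hm (nat n) p)\<close> by simp
  qed
  also have "\<dots> \<longleftrightarrow> f \<in> vpow V 1" by (simp only: kill_eq_0[symmetric] p)
  finally show ?thesis .
qed (simp add: theta_simps idl_0[OF idl_vpow])

text \<open>Powers of the prime x are primary, and by \<open>theta_line\<close> a form that does not
  vanish on the line is not divisible by x after the substitution.\<close>

lemma lprim_idealC: "lprim V idealC"
  unfolding lprim_def
proof (intro conjI allI impI)
  show "idl idealC" by (rule idl_idealC)
  show "\<exists>N. vpow V N \<subseteq> idealC" using vpow_idealC by blast
  show "f \<in> idealC \<or> g \<in> vpow V 1" if "homog n g" "f * g \<in> idealC" for f g n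
    using that vpow_single_cancel[of "theta f" "theta g" x d] theta_line[OF that(1)]
    by (auto simp: idealC_def theta_simps)
  show "f \<in> vpow V 1" if "f \<in> idealC" "homog n f" for f n
    using that theta_line[OF that(2)] vpow_mono[of 1 d "{x}"] d by (auto simp: idealC_def)
qed

text \<open>Normal forms of degree \<open>n\<close> modulo the curve. To first order the curve
  satisfies t w^\<kappa> y = z^\<kappa> x, so the product z^\<kappa> x can be eliminated, as can
  everything of order \<open>d\<close> along the line.\<close>

definition Can :: "nat \<Rightarrow> (4 \<Rightarrow>\<^sub>0 nat) set"
  where "Can n = {s. mon_deg s = n \<and> vdeg V s < d \<and> (lookup s x = 0 \<or> lookup s z < \<kappa>)}"

lemma finite_Can: "finite (Can n)"
  by (rule finite_subset[OF _ finite_mon_deg[of n]]) (auto simp: Can_def)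

lemma exponent_eqI: "lookup s x = lookup s' x \<Longrightarrow> lookup s y = lookup s' y \<Longrightarrow> lookup s z = lookup s' z \<Longrightarrow>
   lookup s w = lookup s' w \<Longrightarrow> s = s'"
proof (rule poly_mapping_eqI)
  fix i assume "lookup s x = lookup s' x" "lookup s y = lookup s' y" "lookup s z = lookup s' z" "lookup s w = lookup s' w"
  moreover have "i \<in> {x, y, z, w}" using UN4 by blast
  ultimately show "lookup s i = lookup s' i" by blast
qed

text \<open>Up to a nonzero constant \<open>theta (mon s)\<close> starts with x^i z^j for the two
  numbers i, j compared here, so normal forms have distinct initial terms. A missing factor y would
  have to be made up by \<kappa> factors z, and these may not occur together with x.\<close>

lemma Can_inj:
  assumes "s \<in> Can n" "s' \<in> Can n" "vdeg V s = vdeg V s'"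
    "\<kappa> * lookup s y + lookup s z = \<kappa> * lookup s' y + lookup s' z"
  shows "s = s'"
proof -
  have *: "\<not> lookup s y < lookup s' y" if "s \<in> Can n" "vdeg V s = vdeg V s'"
    "\<kappa> * lookup s y + lookup s z = \<kappa> * lookup s' y + lookup s' z" for s s'
  proof
    assume lt: "lookup s y < lookup s' y"
    then have "\<kappa> * (lookup s y + 1) \<le> \<kappa> * lookup s' y" by (intro mult_le_mono2) simp
    then have "\<kappa> * lookup s y + \<kappa> \<le> \<kappa> * lookup s' y" by (simp only: distrib_left mult_1_right)
    then have "\<kappa> \<le> lookup s z" using that(3) by linarith
    then have "lookup s x = 0" using that(1) by (auto simp: Can_def)
    then show False using lt that(2) by (simp add: vdegV)
  qed
  have "lookup s y = lookup s' y" using *[of s s'] *[of s' s] assms by force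
  then show ?thesis using assms by (intro exponent_eqI) (auto simp: vdegV Can_def mon_deg4)
qed

text \<open>Divide \<open>theta f\<close> by the lowest power x^i and set x = 0: what remains is a
  combination of distinct powers of z, by \<open>Can_inj\<close>, and it vanishes although i <
  d.\<close>

lemma Can_indep:
  assumes "keys f \<subseteq> Can n" "f \<in> idealC"
  shows "f = 0"
proof (rule ccontr)
  assume "f \<noteq> 0"
  then have ne: "vdeg V ` keys f \<noteq> {}" by simp
  define i where "i = Min (vdeg V ` keys f)"
  have "i \<in> vdeg V ` keys f" unfolding i_def by (rule Min_in) (use ne in auto)
  then obtain s0 where s0: "s0 \<in> keys f" "vdeg V s0 = i" by blast
  have ge: "i \<le> vdeg V s" if "s \<in> keys f" for s unfolding i_def using that by (intro Min_le) auto
  define R where "R = (\<Sum>s\<in>keys f. cst (lookup f s) * (var x ^ (vdeg V s - i) * (\<Phi> ^ lookup s y * var z ^ lookup s z)))"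
  have "theta f = (\<Sum>s\<in>keys f. cst (lookup f s) * theta (mon s))"
  proof -
    have th: "theta (single s c) = cst c * theta (mon s)" for s c by (subst single_conv_cst) (simp add: theta_simps)
    have "theta f = (\<Sum>s\<in>keys f. theta (single s (lookup f s)))"
      by (subst pol_sum_monomials[of f]) (simp only: theta_simps)
    then show ?thesis by (simp only: th[of _ "lookup f _"])
  qed
  also have "\<dots> = var x ^ i * R"
    unfolding R_def sum_distrib_left
  proof (rule sum.cong)
    fix s assume "s \<in> keys f"
    then have "var x ^ vdeg V s = (var x ^ i * var x ^ (vdeg V s - i) :: 'a cring)"
      using ge by (simp flip: power_add)
    then show "cst (lookup f s) * theta (mon s) = var x ^ i * (cst (lookup f s) * (var x ^ (vdeg V s - i) * (\<Phi> ^ lookup s y * var z ^ lookup s z)))"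
      by (simp add: theta_mon mult_ac)
  qed simp
  finally have "var x ^ i * R \<in> vpow {x} d" using assms by (simp add: idealC_def)
  moreover have "i < d" using s0 assms by (auto simp: Can_def)
  ultimately have "var x ^ i * R \<in> vpow {x} (i + 1)" using vpow_mono[of "i + 1" d "{x}"] by auto
  then have "kill {x} R = 0" unfolding var_power_mult_vpow kill_eq_0 .
  moreover have ks: "kill {x} (sum F A) = (\<Sum>a\<in>A. kill {x} (F a))" for F :: "_ \<Rightarrow> 'a cring" and A :: "(4 \<Rightarrow>\<^sub>0 nat) set"
    by (simp add: kill_def cst.peval_sum)
  moreover have "kill {x} (cst (lookup f s) * (var x ^ (vdeg V s - i) * (\<Phi> ^ lookup s y * var z ^ lookup s z)))
      = (if vdeg V s = i then cst (lookup f s * inverse t ^ lookup s y) * var z ^ (\<kappa> * lookup s y + lookup s z) else 0)"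
    if "s \<in> keys f" for s
  proof -
    have pw: "(cst (a ^ n) :: 'a cring) = cst a ^ n" for a n by (induction n) (simp_all add: cst_mult)
    show ?thesis using ge[OF that] dist
      by (cases "vdeg V s = i")
         (simp_all add: kill_simps \<Phi> power_mult_distrib cst_mult pw power_add power_mult mult_ac power_0_left)
  qed
  ultimately have "(\<Sum>s\<in>keys f. if vdeg V s = i then cst (lookup f s * inverse t ^ lookup s y) * var z ^ (\<kappa> * lookup s y + lookup s z) else 0) = (0 :: 'a cring)"
    by (simp add: R_def)
  from arg_cong[OF this, of "\<lambda>p. lookup p (single z (\<kappa> * lookup s0 y + lookup s0 z))"]
  have "0 = (\<Sum>s\<in>keys f. lookup (if vdeg V s = i then cst (lookup f s * inverse t ^ lookup s y) * var z ^ (\<kappa> * lookup s y + lookup s z) else 0) (single z (\<kappa> * lookup s0 y + lookup s0 z)))"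
    by (simp only: lookup_sum lookup_zero)
  also have "\<dots> = (\<Sum>s\<in>keys f. if s = s0 then lookup f s0 * inverse t ^ lookup s0 y else 0)"
  proof (rule sum.cong)
    fix s assume s: "s \<in> keys f"
    have "s = s0" if "vdeg V s = i" "\<kappa> * lookup s y + lookup s z = \<kappa> * lookup s0 y + lookup s0 z"
      using Can_inj[of s n s0] s s0 assms that by auto
    then show "lookup (if vdeg V s = i then cst (lookup f s * inverse t ^ lookup s y) * var z ^ (\<kappa> * lookup s y + lookup s z) else 0) (single z (\<kappa> * lookup s0 y + lookup s0 z))
      = (if s = s0 then lookup f s0 * inverse t ^ lookup s0 y else 0)"
      using s0 by (auto simp: lookup_cst_mult var_power lookup_single when_def inj_eq[OF inj_single])
  qed simp
  also have "\<dots> = lookup f s0 * inverse t ^ lookup s0 y" using s0 by simp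
  finally show False using s0 t by (simp add: in_keys_iff)
qed

text \<open>Normal forms are counted by their initial terms: for order i the exponent of z takes
  every value from 0 to n - i + i \<kappa>.\<close>

lemma card_Can:
  assumes n: "d + \<kappa> \<le> n"
  shows "card (Can n) = (\<Sum>i<d. n - i + 1 + i * \<kappa>)"
proof -
  let ?J = "SIGMA i:{..<d}. {..<n - i + 1 + i * \<kappa>}"
  have "bij_betw (\<lambda>s. (vdeg V s, \<kappa> * lookup s y + lookup s z)) (Can n) ?J"
    unfolding bij_betw_def
  proof
    show "inj_on (\<lambda>s. (vdeg V s, \<kappa> * lookup s y + lookup s z)) (Can n)"
      by (rule inj_onI) (auto intro: Can_inj)
    show "(\<lambda>s. (vdeg V s, \<kappa> * lookup s y + lookup s z)) ` Can n = ?J"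
    proof (intro equalityI subsetI)
      fix p assume "p \<in> (\<lambda>s. (vdeg V s, \<kappa> * lookup s y + lookup s z)) ` Can n"
      then obtain s where s: "s \<in> Can n" "p = (vdeg V s, \<kappa> * lookup s y + lookup s z)" by blast
      have "\<kappa> * lookup s y \<le> \<kappa> * vdeg V s" by (simp add: vdegV)
      moreover have "lookup s z \<le> n - vdeg V s" using s by (auto simp: Can_def mon_deg4 vdegV)
      ultimately have "\<kappa> * lookup s y + lookup s z < n - vdeg V s + 1 + vdeg V s * \<kappa>"
        by (simp only: mult.commute[of \<kappa> "vdeg V s"])
      then show "p \<in> ?J" using s by (auto simp: Can_def)
    next
      fix p assume "p \<in> ?J"
      then obtain i j where p: "p = (i, j)" "i < d" "j \<le> n - i + i * \<kappa>" by auto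
      \<comment> \<open>The exponent of y: as many blocks of \<kappa> as fit into \<open>j\<close>,
        but at most \<open>i\<close>. What is left over is the exponent of z.\<close>
      define q where "q = (if i * \<kappa> \<le> j then i else j div \<kappa>)"
      define b where "b = j - \<kappa> * q"
      have q: "q \<le> i" "\<kappa> * q \<le> j" "q = i \<or> b < \<kappa>" "b \<le> n - i"
      proof -
        consider "i * \<kappa> \<le> j" | "\<kappa> > 0" "j < i * \<kappa>" by (metis gr0I mult_0_right not_le zero_le)
        then have "q \<le> i \<and> \<kappa> * q \<le> j \<and> (q = i \<or> b < \<kappa>) \<and> b \<le> n - i"
        proof cases
          case 1
          then show ?thesis using p by (simp add: q_def b_def mult.commute)
        next
          case 2
          have "j div \<kappa> < i" using 2 by (simp add: less_mult_imp_div_less mult.commute)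
          moreover have "b = j mod \<kappa>" using 2 by (simp add: q_def b_def minus_mult_div_eq_mod)
          then have "b < \<kappa>" using 2 by simp
          \<comment> \<open>The bound on \<open>n\<close> enters here: a remainder below \<kappa>
            must fit into the total degree.\<close>
          moreover have "\<kappa> \<le> n - i" using n p by simp
          ultimately show ?thesis using 2 by (simp add: q_def)
        qed
        then show "q \<le> i" "\<kappa> * q \<le> j" "q = i \<or> b < \<kappa>" "b \<le> n - i" by auto
      qed
      have jb: "\<kappa> * q + b = j" using q(2) by (simp add: b_def)
      define s where "s = single x (i - q) + single y q + single z b + single w (n - i - b)"
      have "lookup s x = i - q" "lookup s y = q" "lookup s z = b" "lookup s w = n - i - b"
        using dist by (auto simp: s_def lookup_add lookup_single when_def)
      then have "s \<in> Can n" "(vdeg V s, \<kappa> * lookup s y + lookup s z) = p"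
        using q(1,3,4) jb p n by (auto simp: Can_def mon_deg4 vdegV)
      then show "p \<in> (\<lambda>s. (vdeg V s, \<kappa> * lookup s y + lookup s z)) ` Can n" by force
    qed
  qed
  then have "card (Can n) = card ?J" by (rule bij_betw_same_card)
  then show ?thesis by simp
qed

end

text \<open>Two global equations of the curve whose linear parts in x, y are \<open>f0\<close> times
  a power of z and of w. Together they say that, modulo second order, \<open>f0\<close> is an
  equation at every point of the line, including w = 0, about which the parametrisation says nothing
  directly.\<close>

locale pline_span = pline +
  fixes N :: nat and \<iota>z \<iota>w :: "'a cring"
  assumes iz: "\<iota>z \<in> idealC" "homog (int (N + \<kappa> + 1)) \<iota>z"
      "var z ^ N * (cst t * var w ^ \<kappa> * var y - var z ^ \<kappa> * var x) - \<iota>z \<in> vpow V 2"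
    and iw: "\<iota>w \<in> idealC" "homog (int (N + \<kappa> + 1)) \<iota>w"
      "var w ^ N * (cst t * var w ^ \<kappa> * var y - var z ^ \<kappa> * var x) - \<iota>w \<in> vpow V 2"
begin

definition f0 :: "'a cring" where "f0 = cst t * var w ^ \<kappa> * var y - var z ^ \<kappa> * var x"

lemma homog_f0: "homog (int (\<kappa> + 1)) f0"
proof -
  have "homog (0 + int \<kappa> + 1) (cst t * var w ^ \<kappa> * var y :: 'a cring)"
    by (intro homog_mult homog_cst homog_var_power homog_var)
  moreover have "homog (int \<kappa> + 1) (var z ^ \<kappa> * var x :: 'a cring)"
    by (intro homog_mult homog_cst homog_var_power homog_var)
  ultimately show ?thesis unfolding f0_def by (intro homog_diff) simp_all
qed

definition Sp :: "nat \<Rightarrow> 'a cring set"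
  where "Sp n = {f. \<exists>b. keys b \<subseteq> Can n \<and> f - b \<in> idealC}"

lemma Sp_add: "f \<in> Sp n \<Longrightarrow> g \<in> Sp n \<Longrightarrow> f + g \<in> Sp n"
proof -
  assume "f \<in> Sp n" "g \<in> Sp n"
  then obtain b b' where b: "keys b \<subseteq> Can n" "f - b \<in> idealC" "keys b' \<subseteq> Can n" "g - b' \<in> idealC"
    by (auto simp: Sp_def)
  then have "keys (b + b') \<subseteq> Can n" "f + g - (b + b') \<in> idealC"
    using Poly_Mapping.keys_add[of b b'] idl_add_cong[OF idl_idealC] by blast+
  then show ?thesis by (auto simp: Sp_def)
qed

lemma Sp_cst: "f \<in> Sp n \<Longrightarrow> cst c * f \<in> Sp n"
proof -
  assume "f \<in> Sp n"
  then obtain b where b: "keys b \<subseteq> Can n" "f - b \<in> idealC" by (auto simp: Sp_def)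
  then have "keys (cst c * b) \<subseteq> Can n" "cst c * f - cst c * b \<in> idealC"
    using keys_scal[of c b] idl_mult[OF idl_idealC, of "f - b" "cst c"] by (auto simp: scal_eq right_diff_distrib)
  then show ?thesis unfolding Sp_def by blast
qed

lemma Sp_ideal: "f \<in> idealC \<Longrightarrow> f \<in> Sp n"
  by (auto simp: Sp_def intro!: exI[of _ 0])

lemma Sp_sum: "(\<And>a. a \<in> A \<Longrightarrow> f a \<in> Sp n) \<Longrightarrow> sum f A \<in> Sp n"
  by (induction A rule: infinite_finite_induct) (auto intro: Sp_add Sp_ideal idl_0[OF idl_idealC])

lemma Sp_pol: "(\<And>s. s \<in> keys f \<Longrightarrow> mon s \<in> Sp n) \<Longrightarrow> f \<in> Sp n"
  by (subst pol_sum_monomials, rule Sp_sum, subst single_conv_cst) (rule Sp_cst)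

text \<open>Rewriting z^\<kappa> x as t w^\<kappa> y keeps the order along the line and lowers the
  exponent of x; the error terms have higher order. Hence the lexicographic induction, which ends at
  order \<open>d\<close>.\<close>

lemma Sp_mon:
  assumes n: "n \<ge> d + \<kappa> + 2 * N"
  shows "mon_deg s = n \<Longrightarrow> mon s \<in> Sp n"
proof (induction "(d - vdeg V s, lookup s x)" arbitrary: s rule: wf_induct_rule[OF wf_lex_prod[OF wf_less_than wf_less_than]])
  case 1
  note IH = 1(1) and s = 1(2)
  show ?case
  proof (cases "vdeg V s < d")
    case False
    then show ?thesis by (intro Sp_ideal subsetD[OF vpow_idealC] single_in_vpow) simp
  next
    case lt: True
    show ?thesis
    proof (cases "lookup s x = 0 \<or> lookup s z < \<kappa>")
      case True
      then have "s \<in> Can n" using lt s by (simp add: Can_def)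
      then have "keys (mon s :: 'a cring) \<subseteq> Can n \<and> mon s - mon s \<in> idealC"
        using idl_0[OF idl_idealC] by simp
      then show ?thesis unfolding Sp_def by blast
    next
      case False
      then have pos: "lookup s x > 0" "lookup s z \<ge> \<kappa>" by simp_all
      define r where "r = s - single x 1 - single z \<kappa>"
      have lr: "lookup r x = lookup s x - 1" "lookup r y = lookup s y" "lookup r z = lookup s z - \<kappa>" "lookup r w = lookup s w"
        using dist by (auto simp: r_def lookup_minus lookup_single when_def)
      have e1: "r + single x 1 + single z \<kappa> = s"
        by (rule exponent_eqI) (use lr pos dist in \<open>auto simp: lookup_add lookup_single when_def\<close>)
      define s' where "s' = r + single y 1 + single w \<kappa>"
      have ls: "lookup s' x = lookup s x - 1" "lookup s' y = lookup s y + 1" "lookup s' z = lookup s z - \<kappa>" "lookup s' w = lookup s w + \<kappa>"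
        using lr dist by (auto simp: s'_def lookup_add lookup_single when_def)
      have dr: "mon_deg r = n - \<kappa> - 1" "vdeg V r = vdeg V s - 1" using s lr pos by (auto simp: mon_deg4 vdegV)
      have e2: "mon r * f0 = cst t * mon s' - mon s"
      proof -
        have "mon r * (var w ^ \<kappa> * var y) = (mon s' :: 'a cring)" "mon r * (var z ^ \<kappa> * var x) = (mon s :: 'a cring)"
          unfolding s'_def by (simp_all add: var_power mult_single add_ac flip: e1)
        moreover have "mon r * f0 = cst t * (mon r * (var w ^ \<kappa> * var y)) - mon r * (var z ^ \<kappa> * var x)"
          unfolding f0_def right_diff_distrib by (simp only: mult_ac)
        ultimately show ?thesis by (simp only:)
      qed
      have "mon s' \<in> Sp n"
      proof (rule IH)
        show "((d - vdeg V s', lookup s' x), d - vdeg V s, lookup s x) \<in> less_than <*lex*> less_than"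
          using ls pos by (simp add: vdegV)
        show "mon_deg s' = n" using s ls pos by (simp add: mon_deg4)
      qed
      moreover have "mon r * f0 \<in> Sp n"
      proof -
        \<comment> \<open>The degree is so large that z or w occurs at least N times in the
          cofactor; the corresponding equation then realises the rewriting.\<close>
        have "N \<le> lookup r z \<or> N \<le> lookup r w" using lr s lt n pos by (auto simp: mon_deg4 vdegV)
        then obtain v \<iota> where v: "N \<le> lookup r v" "v = z \<or> v = w" "\<iota> \<in> idealC" "homog (int (N + \<kappa> + 1)) \<iota>" "var v ^ N * f0 - \<iota> \<in> vpow V 2"
          using iz iw unfolding f0_def[symmetric] by blast
        define r' where "r' = r - single v N"
        have rr: "r = r' + single v N"
          by (rule poly_mapping_eqI) (use v in \<open>auto simp: r'_def lookup_add lookup_minus lookup_single when_def\<close>)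
        have vr: "vdeg V r' = vdeg V r" unfolding rr vdeg_add using v dist by (auto simp: vdeg_single)
        have "mon r = mon r' * (var v ^ N :: 'a cring)" unfolding var_power mult_single by (simp flip: rr)
        then have e3: "mon r * f0 = mon r' * \<iota> + mon r' * (var v ^ N * f0 - \<iota>)"
          by (simp add: algebra_simps)
        let ?E = "mon r' * (var v ^ N * f0 - \<iota>)"
        \<comment> \<open>\<open>r'\<close> has one factor x less than \<open>s\<close>, and the
          error is of second order, so the order rises by one and the induction hypothesis covers
          these monomials.\<close>
        have "?E \<in> vpow V (vdeg V r' + 2)" by (intro vpow_mult v single_in_vpow) simp
        moreover have "vdeg V r' + 2 = vdeg V s + 1" using vr dr pos by (simp add: vdegV)
        ultimately have E1: "?E \<in> vpow V (vdeg V s + 1)" by (simp only:)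
        have "mon_deg r = mon_deg r' + N" by (simp add: rr mon_deg_add)
        then have n': "int n = int (mon_deg r') + int (N + \<kappa> + 1)" using dr n d by simp
        have "homog (int N + int (\<kappa> + 1)) (var v ^ N * f0)" by (intro homog_mult homog_var_power homog_f0)
        then have "homog (int (N + \<kappa> + 1)) (var v ^ N * f0)" by (simp only: of_nat_add add.assoc)
        then have h: "homog (int n) ?E" unfolding n'
          using v(4) by (intro homog_mult homog_single homog_diff refl)
        have "?E \<in> Sp n"
        proof (rule Sp_pol)
          fix q assume "q \<in> keys ?E"
          then have q: "vdeg V s + 1 \<le> vdeg V q" "mon_deg q = n" using E1 h by (auto simp: vpow_def homog_def)
          show "mon q \<in> Sp n" by (rule IH) (use q lt in auto)
        qed
        moreover have "mon r' * \<iota> \<in> Sp n" by (intro Sp_ideal idl_mult[OF idl_idealC] v)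
        ultimately show ?thesis unfolding e3 by (intro Sp_add)
      qed
      moreover have "mon s = cst t * mon s' + cst (-1) * (mon r * f0)"
        unfolding e2 by (simp add: cst_def single_uminus)
      ultimately show ?thesis by (metis Sp_add Sp_cst)
    qed
  qed
qed

lemma Sp_forms: "n \<ge> d + \<kappa> + 2 * N \<Longrightarrow> homog (int n) f \<Longrightarrow> \<exists>b. keys b \<subseteq> Can n \<and> f - b \<in> idealC"
proof -
  assume "n \<ge> d + \<kappa> + 2 * N" "homog (int n) f"
  then have "mon s \<in> Sp n" if "s \<in> keys f" for s
    using that by (intro Sp_mon) (auto simp: homog_def)
  then have "f \<in> Sp n" by (rule Sp_pol)
  then show ?thesis by (simp add: Sp_def)
qed

end

section \<open>Hilbert functions\<close>

lemma hilbert_function_compl: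
  fixes I :: "'a::field cring set"
  assumes H0: "H0 (assoc_sheaf I) (int n) = {F \<in> I. homog (int n) F}" and I: "idl I"
    and A: "finite A" "\<And>s. s \<in> A \<Longrightarrow> mon_deg s = n"
    and ind: "\<And>f. keys f \<subseteq> A \<Longrightarrow> f \<in> I \<Longrightarrow> f = 0"
    and spn: "\<And>f. homog (int n) f \<Longrightarrow> \<exists>b. keys b \<subseteq> A \<and> f - b \<in> I"
  shows "hilbert_function (assoc_sheaf I) n = int (card A)"
proof -
  have hA: "homog (int n) b" if "keys b \<subseteq> A" for b :: "'a cring"
    unfolding homog_def using that A(2) by blast
  have "dim_k (forms n :: 'a cring set) = dim_k {F \<in> I. homog (int n) F} + card A"
  proof (rule dim_compl[OF A(1) subspace_idl_forms[OF I] _ A(2)])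
    show "f = 0" if "keys f \<subseteq> A" "f \<in> {F \<in> I. homog (int n) F}" for f
      using ind[of f] that by blast
    show "\<exists>b. keys b \<subseteq> A \<and> f - b \<in> {F \<in> I. homog (int n) F}" if f: "f \<in> forms n" for f
    proof -
      obtain b where b: "keys b \<subseteq> A" "f - b \<in> I" using spn[of f] f by blast
      then have "homog (int n) (f - b)" using f hA[of b] by (intro homog_diff) auto
      then show ?thesis using b by blast
    qed
  qed blast
  then show ?thesis by (simp add: hilbert_function_def H0)
qed

text \<open>Constant term of the Hilbert polynomial, that is, one minus the arithmetic genus: the
  part independent of n in the sum of n - i + 1 + i \<kappa> over i < d.\<close>

definition ccoef :: "nat \<Rightarrow> nat \<Rightarrow> int"
  where "ccoef d \<kappa> = int d + (int \<kappa> - 1) * (\<Sum>i<d. int i)"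

lemma count_formula:
  assumes "d \<le> n" shows "int (\<Sum>i<d. n - i + 1 + i * \<kappa>) = int d * int n + ccoef d \<kappa>"
proof -
  have "int (\<Sum>i<d. n - i + 1 + i * \<kappa>) = (\<Sum>i<d. (int n + 1) + (int \<kappa> - 1) * int i)"
    unfolding of_nat_sum
  proof (rule sum.cong)
    fix i assume "i \<in> {..<d}"
    then have "i \<le> n" using assms by simp
    then show "int (n - i + 1 + i * \<kappa>) = int n + 1 + (int \<kappa> - 1) * int i"
      by (simp add: of_nat_diff algebra_simps)
  qed simp
  also have "\<dots> = int d * (int n + 1) + (int \<kappa> - 1) * (\<Sum>i<d. int i)"
    by (simp only: sum.distrib sum_constant sum_distrib_left[symmetric] card_lessThan distrib_left)
  finally show ?thesis by (simp only: ccoef_def distrib_left mult_1_right add.assoc)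
qed

lemma sum_lessThan_int: "2 * (\<Sum>i<d. int i) = int d * (int d - 1)"
  by (induction d) (simp_all add: algebra_simps)

lemma curve_degree_genusI:
  assumes "\<And>n. n \<ge> M \<Longrightarrow> hilbert_function C n = int \<delta> * int n + (1 - \<gamma>)"
  shows "curve_degree_genus C \<delta> \<gamma>"
  unfolding curve_degree_genus_def hilbert_polynomial_def eventually_sequentially
  by (rule exI[of _ M]) (simp add: assms algebra_simps)

context pline
begin

lemma H0_idealC: "n \<ge> 0 \<Longrightarrow> H0 (assoc_sheaf idealC) n = {F \<in> idealC. homog n F}"
  using H0_lprim2[OF lprim_idealC lprim_idealC line_axioms line_axioms] by simp

lemma Can_deg: "s \<in> Can n \<Longrightarrow> mon_deg s = n"
  by (simp add: Can_def)

end

context pline_span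
begin

lemma hilbert_idealC:
  assumes n: "n \<ge> d + \<kappa> + 2 * N"
  shows "hilbert_function (assoc_sheaf idealC) n = int d * int n + ccoef d \<kappa>"
proof -
  have "hilbert_function (assoc_sheaf idealC) n = int (card (Can n))"
    by (rule hilbert_function_compl[OF H0_idealC idl_idealC finite_Can Can_deg Can_indep Sp_forms]) (use n in simp_all)
  then show ?thesis using n by (simp only: card_Can count_formula) 
qed

lemma curve_degree_idealC: "curve_degree_genus (assoc_sheaf idealC) d (1 - ccoef d \<kappa>)"
  by (rule curve_degree_genusI[of "d + \<kappa> + 2 * N"]) (simp add: hilbert_idealC)

end

text \<open>For disjoint lines, large monomials in the basis of one quotient lie in the other ideal.\<close>

lemma hilbert_disjoint:
  assumes P: "pline_span x y z w \<Phi> t \<kappa> d N \<iota>z \<iota>w" and Q: "pline_span z w x y \<Phi>' t' \<kappa>' d' N' \<iota>z' \<iota>w'"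
    and n: "n \<ge> d + \<kappa> + 2 * N + (d' + \<kappa>' + 2 * N')"
  shows "hilbert_function (assoc_sheaf (pline.idealC x y z \<Phi> d \<inter> pline.idealC z w x \<Phi>' d')) n
    = int (d + d') * int n + (ccoef d \<kappa> + ccoef d' \<kappa>')"
proof -
  interpret P: pline_span x y z w \<Phi> t \<kappa> d N \<iota>z \<iota>w by (rule P)
  interpret Q: pline_span z w x y \<Phi>' t' \<kappa>' d' N' \<iota>z' \<iota>w' by (rule Q)
  let ?I = "P.idealC" and ?J = "Q.idealC"
  have pj: "mon s \<in> ?J" if "s \<in> P.Can n" for s
  proof (rule subsetD[OF Q.vpow_idealC], rule single_in_vpow)
    show "d' \<le> vdeg {z, w} s" using that n by (auto simp: P.Can_def P.mon_deg4 P.vdegV Q.vdegV)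
  qed
  have qi: "mon s \<in> ?I" if "s \<in> Q.Can n" for s
  proof (rule subsetD[OF P.vpow_idealC], rule single_in_vpow)
    show "d \<le> vdeg {x, y} s" using that n by (auto simp: Q.Can_def P.mon_deg4 P.vdegV Q.vdegV)
  qed
  have comb: "f \<in> K" if "idl K" "\<And>s. s \<in> A \<Longrightarrow> mon s \<in> K" "keys f \<subseteq> A" for f :: "'a cring" and K A
  proof -
    have "single s (lookup f s) \<in> K" if "s \<in> keys f" for s
      using that \<open>keys f \<subseteq> A\<close> idl_mult[OF \<open>idl K\<close>] \<open>\<And>s. s \<in> A \<Longrightarrow> mon s \<in> K\<close>
      by (subst single_conv_cst) blast
    then show ?thesis by (subst pol_sum_monomials) (rule idl_sum[OF \<open>idl K\<close>])
  qed
  have disj: "P.Can n \<inter> Q.Can n = {}"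
  proof (rule ccontr)
    assume "P.Can n \<inter> Q.Can n \<noteq> {}"
    then obtain s where s: "s \<in> P.Can n" "s \<in> Q.Can n" by blast
    then show False using n by (auto simp: P.Can_def Q.Can_def P.mon_deg4 P.vdegV Q.vdegV)
  qed
  have "hilbert_function (assoc_sheaf (?I \<inter> ?J)) n = int (card (P.Can n \<union> Q.Can n))"
  proof (rule hilbert_function_compl)
    show "H0 (assoc_sheaf (?I \<inter> ?J)) (int n) = {F \<in> ?I \<inter> ?J. homog (int n) F}"
      by (rule H0_lprim2[OF P.lprim_idealC Q.lprim_idealC P.line_axioms Q.line_axioms]) simp
    show "idl (?I \<inter> ?J)" by (intro idl_Int P.idl_idealC Q.idl_idealC)
    show "finite (P.Can n \<union> Q.Can n)" by (simp add: P.finite_Can Q.finite_Can)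
    show "mon_deg s = n" if "s \<in> P.Can n \<union> Q.Can n" for s using that P.Can_deg Q.Can_deg by blast
  next
    fix f assume f: "keys f \<subseteq> P.Can n \<union> Q.Can n" "f \<in> ?I \<inter> ?J"
    define p where "p = restr (P.Can n) f"
    define q where "q = restr (- P.Can n) f"
    have fpq: "f = p + q" unfolding p_def q_def by (rule restr_compl)
    have kp: "keys p \<subseteq> P.Can n" and kq: "keys q \<subseteq> Q.Can n"
      using f by (auto simp: p_def q_def keys_restr)
    have pJ: "p \<in> ?J" by (rule comb[OF Q.idl_idealC pj kp])
    have qI: "q \<in> ?I" by (rule comb[OF P.idl_idealC qi kq])
    have "p = f - q" "q = f - p" by (simp_all add: fpq)
    then have "p \<in> ?I" "q \<in> ?J"
      using f(2) idl_diff[OF P.idl_idealC _ qI, of f] idl_diff[OF Q.idl_idealC _ pJ, of f] by auto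
    then show "f = 0" using P.Can_indep[OF kp] Q.Can_indep[OF kq] fpq by simp
  next
    fix f :: "'a cring" assume f: "homog (int n) f"
    obtain b where b: "keys b \<subseteq> P.Can n" "f - b \<in> ?I" using P.Sp_forms[OF _ f] n by auto
    obtain c where c: "keys c \<subseteq> Q.Can n" "f - c \<in> ?J" using Q.Sp_forms[OF _ f] n by auto
    have "b \<in> ?J" by (rule comb[OF Q.idl_idealC pj b(1)])
    moreover have "c \<in> ?I" by (rule comb[OF P.idl_idealC qi c(1)])
    \<comment> \<open>Chinese remainders: \<open>b\<close> lies in the second ideal and
      \<open>c\<close> in the first, so \<open>b + c\<close> is congruent to \<open>f\<close> modulo
      both.\<close>
    ultimately have "f - b - c \<in> ?I" "f - c - b \<in> ?J"
      using idl_diff[OF P.idl_idealC b(2)] idl_diff[OF Q.idl_idealC c(2)] by blast+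
    moreover have "f - b - c = f - (b + c)" "f - c - b = f - (b + c)" by simp_all
    moreover have "keys (b + c) \<subseteq> P.Can n \<union> Q.Can n"
      using b c Poly_Mapping.keys_add[of b c] by blast
    ultimately show "\<exists>b. keys b \<subseteq> P.Can n \<union> Q.Can n \<and> f - b \<in> ?I \<inter> ?J" by (metis IntI)
  qed
  also have "card (P.Can n \<union> Q.Can n) = card (P.Can n) + card (Q.Can n)"
    by (rule card_Un_disjoint[OF P.finite_Can Q.finite_Can disj])
  also have "int \<dots> = int (\<Sum>i<d. n - i + 1 + i * \<kappa>) + int (\<Sum>i<d'. n - i + 1 + i * \<kappa>')"
    using n by (simp only: of_nat_add P.card_Can Q.card_Can)
  also have "\<dots> = (int d * int n + ccoef d \<kappa>) + (int d' * int n + ccoef d' \<kappa>')"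
    using n by (simp only: count_formula)
  finally show ?thesis by (simp add: algebra_simps)
qed

section \<open>The type\<close>

context pline
begin

text \<open>\<open>Dp f\<close> is the image of the class of \<open>f\<close> under the map
  $\mathcal{I}_L/\mathcal{I}_L^2 \to \mathcal{O}_L(\kappa - 1)$ with $x \mapsto t w^\kappa$, $y \mapsto z^\kappa$.\<close>

definition eps :: "4 \<Rightarrow> 'a cring poly"
  where "eps i = (if i = x then [:0, cst t * var w ^ \<kappa>:] else if i = y then [:0, var z ^ \<kappa>:] else [:var i:])"

definition Dp :: "'a cring \<Rightarrow> 'a cring"
  where "Dp f = coeff (peval (\<lambda>a. [:cst a:]) eps f) 1"

lemma coeff_hom_pC: "coeff_hom (\<lambda>a. [:cst a:] :: 'a cring poly)"
  by unfold_locales (simp_all add: cst_add cst_mult one_pCons)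

sublocale pC: coeff_hom "\<lambda>a. [:cst a:] :: 'a cring poly"
  by (rule coeff_hom_pC)

lemma coeff0_eps: "coeff (pC.ev eps f) 0 = kill V f"
proof -
  have "coeff (pC.ev eps f) 0 = subst (\<lambda>i. coeff (pC.ev eps (var i)) 0) f"
    by (rule cst.peval_unique) (simp_all add: pC.peval_add pC.peval_mult pC.peval_cst coeff_mult)
  also have "(\<lambda>i. coeff (pC.ev eps (var i)) 0) = (\<lambda>i. if i \<in> V then 0 else var i)"
    by (simp add: fun_eq_iff eps_def)
  finally show ?thesis by (simp add: kill_def)
qed

lemma coeff_pCons_1: "coeff (pCons a p) 1 = coeff p 0"
  by (simp add: One_nat_def)

lemma coeff_mult_00: "coeff (p * q) 0 = coeff p 0 * coeff q 0"
  by (simp add: coeff_mult)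

lemma coeff_mult_1: "coeff (p * q) 1 = coeff p 0 * coeff q 1 + coeff p 1 * coeff q 0"
  by (simp add: coeff_mult One_nat_def)

lemma Dp_simps: "Dp (f + g) = Dp f + Dp g" "Dp (f - g) = Dp f - Dp g" "Dp (cst c) = 0"
  "Dp (f * g) = kill V f * Dp g + Dp f * kill V g" "Dp 0 = 0"
  by (simp_all add: Dp_def pC.peval_simps coeff_mult_1 coeff0_eps coeff_pCons_1)

lemma Dp_var: "Dp (var x) = cst t * var w ^ \<kappa>" "Dp (var y) = var z ^ \<kappa>"
  using dist by (simp_all add: Dp_def eps_def coeff_pCons_1)

text \<open>Give the auxiliary variable degree 1 - \<kappa>. Then \<open>eps\<close> preserves
  degrees, and the coefficient of the first power has its degree raised by \<kappa> - 1.\<close>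

lemma homog_Dp:
  assumes "homog n f" shows "homog (n + int \<kappa> - 1) (Dp f)"
proof -
  let ?G = "\<lambda>n p. \<forall>j. homog (n + int j * (int \<kappa> - 1)) (coeff p j)"
  have G_mult: "?G (n + m) (p * q)" if "?G n p" "?G m q" for n m and p q :: "'a cring poly"
  proof
    fix j
    have "homog (n + m + int j * (int \<kappa> - 1)) (coeff p i * coeff q (j - i))" if "i \<le> j" for i
    proof -
      have "homog ((n + int i * (int \<kappa> - 1)) + (m + int (j - i) * (int \<kappa> - 1))) (coeff p i * coeff q (j - i))"
        using \<open>?G n p\<close> \<open>?G m q\<close> by (intro homog_mult) auto
      moreover have "(n + int i * (int \<kappa> - 1)) + (m + int (j - i) * (int \<kappa> - 1)) = n + m + int j * (int \<kappa> - 1)"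
        using that by (simp add: of_nat_diff algebra_simps)
      ultimately show ?thesis by simp
    qed
    then show "homog (n + m + int j * (int \<kappa> - 1)) (coeff (p * q) j)"
      unfolding coeff_mult by (intro homog_sum) auto
  qed
  have G_one: "?G 0 [:cst c:]" for c :: 'a
    by (auto simp: coeff_pCons homog_cst split: nat.split)
  have hx: "homog (int \<kappa>) (cst t * var w ^ \<kappa> :: 'a cring)"
    using homog_mult[OF homog_cst homog_var_power] by simp
  have G_eps: "?G 1 (eps i)" for i
    using hx homog_var_power[of \<kappa> z, where ?'a = 'a] homog_var[of i, where ?'a = 'a]
    by (auto simp: eps_def coeff_pCons split: nat.split)
  have G_pow: "?G (int k) (eps i ^ k)" for i k
  proof (induction k)
    case 0
    then show ?case using G_one[of 1] by (simp add: one_pCons)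
  next
    case (Suc k)
    from G_mult[OF G_eps[of i] Suc] show ?case by (simp add: algebra_simps)
  qed
  have G_prod: "?G (\<Sum>i\<in>A. int (lookup s i)) (\<Prod>i\<in>A. eps i ^ lookup s i)" for s A
  proof (induction A rule: infinite_finite_induct)
    case (insert i A)
    from G_mult[OF G_pow insert.IH] insert.hyps show ?case by simp
  qed (use G_one[of 1] in \<open>simp_all add: one_pCons\<close>)
  have "?G n (pC.ev eps f)"
  proof (rule pC.peval_induct)
    fix s assume "s \<in> keys f"
    then have "n = 0 + (\<Sum>i\<in>UNIV. int (lookup s i))" using assms by (simp add: homog_def mon_deg_def)
    then show "?G n ([:cst (lookup f s):] * (\<Prod>i\<in>UNIV. eps i ^ lookup s i))"
      using G_mult[OF G_one[of "lookup f s"] G_prod[of s UNIV]] by simp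
  qed (auto intro: homog_add)
  from this[rule_format, of 1] show ?thesis by (simp add: Dp_def algebra_simps)
qed

lemma kill_Dp: "kill V (Dp f) = Dp f"
proof -
  let ?K = "{p :: 'a cring poly. \<forall>j. kill V (coeff p j) = coeff p j}"
  have mult: "p * q \<in> ?K" if "p \<in> ?K" "q \<in> ?K" for p q
  proof -
    have "kill V (sum F A) = (\<Sum>a\<in>A. kill V (F a))" for F :: "nat \<Rightarrow> 'a cring" and A
      by (simp add: kill_def cst.peval_sum)
    then show ?thesis using that by (simp add: coeff_mult kill_simps)
  qed
  have c: "[:cst c:] \<in> ?K" for c :: 'a by (auto simp: coeff_pCons kill_simps split: nat.split)
  have e: "eps i \<in> ?K" for i using dist
    by (auto simp: eps_def coeff_pCons kill_simps split: nat.split)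
  have pw: "eps i ^ k \<in> ?K" for i k
  proof (induction k)
    case (Suc k) then show ?case using mult[OF e Suc] by simp
  qed (use c[of 1] in \<open>simp add: one_pCons\<close>)
  have pr: "(\<Prod>i\<in>A. eps i ^ lookup s i) \<in> ?K" for s A
  proof (induction A rule: infinite_finite_induct)
    case (insert i A) then show ?case using mult[OF pw insert.IH] by simp
  qed (use c[of 1] in \<open>simp_all add: one_pCons\<close>)
  have "pC.ev eps f \<in> ?K"
    by (rule pC.peval_induct) (use mult[OF c pr] in \<open>auto simp: kill_simps\<close>)
  then show ?thesis by (simp add: Dp_def)
qed

lemma Dp_vpow2: "f \<in> vpow V 2 \<Longrightarrow> Dp f = 0"
proof -
  assume "f \<in> vpow V 2"
  then have "f \<in> ideal_prod UNIV (vpow V 1) (vpow V 1)"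
    using ideal_prod_vpow[of V 1, where ?'a = 'a] by (simp add: numeral_2_eq_2 One_nat_def)
  moreover have "ideal_prod UNIV (vpow V 1) (vpow V 1) \<subseteq> {f. Dp f = 0 \<and> kill V f = (0 :: 'a cring)}"
  proof (rule ideal_prod_least)
    show "submod UNIV {f. Dp f = 0 \<and> kill V f = (0 :: 'a cring)}"
      by (simp add: submod_def Dp_simps kill_simps)
    show "f * g \<in> {f. Dp f = 0 \<and> kill V f = 0}" if "f \<in> vpow V 1" "g \<in> vpow V 1" for f g :: "'a cring"
      using that by (simp add: Dp_simps kill_simps kill_eq_0[symmetric])
  qed
  ultimately show ?thesis by blast
qed

text \<open>If x is replaced by t times the auxiliary variable, then y = x \<Phi> becomes z^\<kappa>
  times that variable to first order, so \<open>theta\<close> turns into \<open>eps\<close> at w =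
  1. A factor x^2 of \<open>theta f\<close> therefore kills the first order coefficient.\<close>

lemma Dp_idealC:
  assumes f: "f \<in> idealC" "homog n f" and d2: "d \<ge> 2"
  shows "Dp f = 0"
proof -
  define J where "J = {p :: 'a cring poly. coeff p 0 = 0 \<and> coeff p 1 = 0}"
  have J: "idl J"
    by (rule idlI) (auto simp: J_def coeff_mult_1 coeff_mult_00)
  define \<sigma> :: "4 \<Rightarrow> 'a cring poly" where "\<sigma> i = (if i = x then [:0, cst t:] else if i = w then 1 else [:var i:])" for i
  define \<tau> :: "4 \<Rightarrow> 'a cring poly" where "\<tau> i = (if i = x then [:0, cst t:] else if i = y then [:0, var z ^ \<kappa>:] else if i = z then [:var z:] else 1)" for i
  have c0: "coeff (pC.ev \<sigma> \<Phi>) 0 = cst (inverse t) * var z ^ \<kappa>"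
  proof -
    have fe: "(\<lambda>i. coeff (pC.ev \<sigma> (var i)) 0) = (\<lambda>i. if i = x then 0 else if i = w then 1 else var i)"
      by (simp add: fun_eq_iff \<sigma>_def)
    have "coeff (pC.ev \<sigma> f) 0 = subst (\<lambda>i. coeff (pC.ev \<sigma> (var i)) 0) f" for f
      by (rule cst.peval_unique) (simp_all add: pC.peval_add pC.peval_mult pC.peval_cst coeff_mult)
    then have e: "coeff (pC.ev \<sigma> f) 0 = subst (\<lambda>i. if i = x then 0 else if i = w then 1 else var i) f" for f
      unfolding fe .
    have "coeff (pC.ev \<sigma> \<Phi>) 0 = coeff (pC.ev \<sigma> (kill {x} \<Phi>)) 0"
    proof -
      have "\<Phi> - kill {x} \<Phi> \<in> {f. subst (\<lambda>i. if i = x then 0 else if i = w then 1 else var i) f = (0 :: 'a cring)}"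
      proof (rule subsetD[OF _ diff_kill])
        show "vpow {x} 1 \<subseteq> {f. subst (\<lambda>i. if i = x then 0 else if i = w then 1 else var i) f = (0 :: 'a cring)}"
          unfolding ideal_gen_vars[symmetric] by (rule ideal_gen_least[OF idl_ker_subst]) auto
      qed
      then show ?thesis unfolding e by (simp add: cst.peval_diff)
    qed
    also have "\<dots> = cst (inverse t) * var z ^ \<kappa>"
      unfolding e \<Phi> using dist by (simp add: subst_simps)
    finally show ?thesis .
  qed
  have "pC.ev \<sigma> (theta f) - pC.ev \<tau> f \<in> J"
  proof -
    have "pC.ev \<sigma> (theta f) = pC.ev (\<lambda>i. pC.ev \<sigma> (theta (var i))) f"
      by (rule pC.peval_unique) (simp_all add: theta_simps pC.peval_add pC.peval_mult pC.peval_cst)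
    moreover have d: "pC.ev \<sigma> (theta (var i)) - \<tau> i \<in> J" for i
    proof -
      have "i \<in> {x, y, z, w}" using UN4 by blast
      moreover have "cst t * (cst (inverse t) * var z ^ \<kappa>) = (var z ^ \<kappa> :: 'a cring)"
        using t by (simp flip: mult.assoc cst_mult)
      ultimately show ?thesis using dist c0
        by (auto simp: theta_simps pC.peval_mult \<sigma>_def[of x] \<sigma>_def[of z] \<sigma>_def[of w] \<tau>_def J_def coeff_mult_1 coeff_mult_00 coeff_pCons_1)
    qed
    moreover have "pC.ev (\<lambda>i. pC.ev \<sigma> (theta (var i))) f - pC.ev \<tau> f \<in> J" by (rule idl_peval_cong[OF J d])
    ultimately show ?thesis by (simp only:)
  qed
  moreover have "pC.ev \<sigma> (theta f) \<in> J"
  proof -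
    have "theta f \<in> vpow {x} 2" using f d2 vpow_mono[of 2 d "{x}"] by (auto simp: idealC_def)
    then obtain f' where f': "theta f = var x ^ 2 * f'" using vpow_single_factor by blast
    have "pC.ev \<sigma> (var x ^ 2) = [:0, cst t:] * [:0, cst t:]"
      by (simp only: power2_eq_square pC.peval_mult pC.peval_var) (simp add: \<sigma>_def)
    then have "pC.ev \<sigma> (var x ^ 2) \<in> J" by (simp add: J_def coeff_pCons_1)
    then show ?thesis unfolding f' pC.peval_mult by (rule idl_mult_right[OF J])
  qed
  ultimately have "pC.ev \<tau> f \<in> J" using idl_cong[OF J] by blast
  then have m: "coeff (pC.ev \<tau> f) 1 = 0" by (simp add: J_def)
  have mp: "map_poly theta (pC.ev eps f) = pC.ev \<tau> f"
  proof -
    have th0: "theta 0 = 0" by (simp add: theta_simps)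
    have "map_poly theta (pC.ev eps f) = pC.ev (\<lambda>i. map_poly theta (pC.ev eps (var i))) f"
    proof (rule pC.peval_unique)
      show "map_poly theta (pC.ev eps (p * q)) = map_poly theta (pC.ev eps p) * map_poly theta (pC.ev eps q)" for p q
        by (rule poly_eqI) (simp add: coeff_map_poly th0 pC.peval_mult coeff_mult theta_simps)
      show "map_poly theta (pC.ev eps (p + q)) = map_poly theta (pC.ev eps p) + map_poly theta (pC.ev eps q)" for p q
        by (rule poly_eqI) (simp add: coeff_map_poly th0 pC.peval_add theta_simps)
      show "map_poly theta (pC.ev eps (cst a)) = [:cst a:]" for a
        by (rule poly_eqI) (simp add: coeff_map_poly th0 pC.peval_cst theta_simps coeff_pCons split: nat.split)
    qed
    moreover have "map_poly theta (pC.ev eps (var i)) = \<tau> i" for i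
    proof -
      have "i \<in> {x, y, z, w}" using UN4 by blast
      then show ?thesis using dist
        by (intro poly_eqI) (auto simp: coeff_map_poly th0 eps_def \<tau>_def theta_simps coeff_pCons one_pCons split: nat.split)
    qed
    ultimately show ?thesis by simp
  qed
  have "coeff (map_poly theta (pC.ev eps f)) 1 = theta (Dp f)"
    by (simp only: Dp_def coeff_map_poly[where f = theta, OF theta_simps(7)])
  then have "theta (Dp f) = 0" using m mp by (simp only:)
  \<comment> \<open>\<open>Dp f\<close> is a form in z and w alone (\<open>kill_Dp\<close>), hence
    determined by its value at w = 1.\<close>
  then have "Dp f \<in> vpow V 1"
    using theta_line[OF homog_Dp[OF f(2)]] idl_0[OF idl_vpow[of "{x}" 1, where ?'a = 'a]] by simp
  then show ?thesis by (simp add: kill_Dp flip: kill_eq_0)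
qed

end

section \<open>The isomorphism of the conormal quotient with O_L(\<kappa> - 1)\<close>

lemma diff_telescope: "(a - b) + (b - c) = (a - c :: 'r::ab_group_add)"
  by simp

lemma quot_add: "D \<noteq> 0 \<Longrightarrow> quot A D + quot B D = quot (A + B) D" for A B D :: "'a::field cring"
proof -
  assume D: "D \<noteq> 0"
  have "quot A D + quot B D = quot ((A + B) * D) (D * D)" using D by (simp add: distrib_right)
  then show ?thesis using quot_cancel[OF D D] by simp
qed

lemma quot_diff: "D \<noteq> 0 \<Longrightarrow> quot A D - quot B D = quot (A - B) D" for A B D :: "'a::field cring"
  using quot_add[of D A "- B"] by simp

lemma sect_minus:
  fixes h :: "'a::field cring"
  assumes h: "h \<in> basics" and I: "idl I" and x: "x \<in> sect I n h" shows "- x \<in> sect I n h"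
proof -
  obtain f r where f: "x = quot f (h ^ r)" "f \<in> I" "homog (int r * int (tot_deg h) + n) f"
    using x by (auto elim!: sectE)
  have "quot (- f) (h ^ r) \<in> sect I n h" by (intro sectI idl_minus[OF I] homog_minus f)
  then show ?thesis using f by simp
qed

lemma sect_diff:
  fixes h :: "'a::field cring"
  assumes h: "h \<in> basics" and I: "idl I" and x: "x \<in> sect I n h" "y \<in> sect I n h" shows "x - y \<in> sect I n h"
  using sect_add[OF h I x(1) sect_minus[OF h I x(2)]] by simp

context pline_span
begin

text \<open>A monomial of large degree contains x, y, or many factors z or w, so the ideal contains
  every such monomial. Exactness over D_+(h) is thereby reduced to multiplication by powers of z and
  of w.\<close>

lemma power_in_idl:
  fixes h :: "'a cring"
  assumes E: "idl E" "var x \<in> E" "var y \<in> E" "var z ^ M \<in> E" "var w ^ M \<in> E" and h: "h \<in> basics"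
  shows "h ^ (2 * M + 1) \<in> E"
proof -
  have m: "mon s \<in> E" if s: "mon_deg s \<ge> 2 * M + 1" for s
  proof -
    have *: "mon s \<in> E" if "lookup s i \<ge> k" "var i ^ k \<in> E" for i k
    proof -
      have "s = single i k + (s - single i k)"
        by (rule poly_mapping_eqI) (use that(1) in \<open>auto simp: lookup_add lookup_minus lookup_single when_def\<close>)
      then have "(mon s :: 'a cring) = var i ^ k * mon (s - single i k)"
        by (metis mult_single mult_1 var_power)
      then show ?thesis using idl_mult_right[OF E(1) that(2)] by simp
    qed
    have "lookup s x \<ge> 1 \<or> lookup s y \<ge> 1 \<or> lookup s z \<ge> M \<or> lookup s w \<ge> M"
      using s by (simp only: mon_deg4) linarith
    then show ?thesis using *[of 1 x] *[of 1 y] *[of M z] *[of M w] E by auto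
  qed
  have "single s (lookup (h ^ (2 * M + 1)) s) \<in> E" if "s \<in> keys (h ^ (2 * M + 1))" for s
  proof -
    have "mon_deg s = (2 * M + 1) * tot_deg h" by (rule basics_power_keys[OF h that])
    moreover have "(2 * M + 1) * 1 \<le> (2 * M + 1) * tot_deg h" by (rule mult_le_mono2) (use basics_pos[OF h] in simp)
    ultimately have "mon s \<in> E" by (intro m) simp
    then show ?thesis by (subst single_conv_cst) (rule idl_mult[OF E(1)])
  qed
  then show ?thesis by (subst pol_sum_monomials) (rule idl_sum[OF E(1)])
qed

lemma vpow1_decomp:
  assumes "f \<in> (vpow V 1 :: 'a cring set)" obtains p q where "f = var x * p + var y * q"
proof -
  have "vpow V 1 \<subseteq> {f. \<exists>p q. f = var x * p + var y * (q :: 'a cring)}"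
    unfolding ideal_gen_vars[symmetric]
  proof (rule ideal_gen_least)
    show "idl {f. \<exists>p q. f = var x * p + var y * (q :: 'a cring)}"
    proof (rule idlI)
      show "0 \<in> {f. \<exists>p q. f = var x * p + var y * (q :: 'a cring)}" by (auto intro!: exI[of _ 0])
      fix f g :: "'a cring" assume "f \<in> {f. \<exists>p q. f = var x * p + var y * q}" "g \<in> {f. \<exists>p q. f = var x * p + var y * q}"
      then obtain p q p' q' where "f = var x * p + var y * q" "g = var x * p' + var y * q'" by blast
      then have "f + g = var x * (p + p') + var y * (q + q')" by (simp add: algebra_simps)
      then show "f + g \<in> {f. \<exists>p q. f = var x * p + var y * q}" by blast
    next
      fix r f :: "'a cring" assume "f \<in> {f. \<exists>p q. f = var x * p + var y * q}"
      then obtain p q where "f = var x * p + var y * q" by blast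
      then have "r * f = var x * (r * p) + var y * (r * q)" by (simp add: algebra_simps)
      then show "r * f \<in> {f. \<exists>p q. f = var x * p + var y * q}" by blast
    qed
    have "var x = var x * 1 + var y * (0 :: 'a cring)" "var y = var x * 0 + var y * (1 :: 'a cring)" by simp_all
    then show "var ` V \<subseteq> {f. \<exists>p q. f = var x * p + var y * (q :: 'a cring)}" by blast
  qed
  then obtain p q where "f = var x * p + var y * q" using assms by blast
  then show ?thesis by (rule that)
qed

lemma comp_Dp: "comp n (Dp f) = (if \<kappa> \<le> n + 1 then Dp (comp (n + 1 - \<kappa>) f) else 0)" if k: "\<kappa> \<ge> 1"
proof (induction f rule: pol_induct)
  case (mon s c)
  have "homog (int (mon_deg s)) (single s c)" by (simp add: homog_single)
  from homog_Dp[OF this] have "homog (int (mon_deg s + \<kappa> - 1)) (Dp (single s c))" using k by (simp add: of_nat_diff)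
  from comp_homog[OF this, of n] show ?case
    using comp_homog[of "mon_deg s" "single s c" "n + 1 - \<kappa>"] \<open>homog (int (mon_deg s)) (single s c)\<close> k
    by (auto simp: Dp_simps)
qed (simp add: restr_add Dp_simps)

text \<open>Exactness in the middle. If p, q are the coefficients of the linear part of
  \<open>f\<close>, then t w^\<kappa> p + z^\<kappa> q = 0 on the line, so w^\<kappa> f and
  z^\<kappa> f are multiples of \<open>f0\<close> up to second order; N further factors bring
  \<open>f0\<close> into the ideal of the curve.\<close>

lemma Dp_zero_multiple:
  assumes f: "f \<in> vpow V 1" and D: "Dp f = 0"
  shows "var z ^ (N + \<kappa>) * f \<in> ideal_sum (gr_part idealC) (vpow V 2)"
    "var w ^ (N + \<kappa>) * f \<in> ideal_sum (gr_part idealC) (vpow V 2)"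
proof -
  let ?G = "ideal_sum (gr_part idealC) (vpow V 2)"
  have Gi: "idl (gr_part idealC)" using graded_gr_part[OF idl_idealC] by (simp add: graded_def)
  have G: "idl ?G" by (intro idl_sum_ideal Gi idl_vpow)
  have f0G: "var v ^ N * f0 \<in> ?G" if vzw: "v = z \<or> v = w" for v
  proof -
    obtain \<iota> where i: "\<iota> \<in> idealC" "homog (int (N + \<kappa> + 1)) \<iota>" "var v ^ N * f0 - \<iota> \<in> vpow V 2"
      using vzw iz iw unfolding f0_def[symmetric] by blast
    then have "\<iota> \<in> gr_part idealC" using gr_part_homog[OF idl_idealC] by blast
    then have "\<iota> + (var v ^ N * f0 - \<iota>) \<in> ?G" using i unfolding ideal_sum_def by blast
    then show ?thesis by simp
  qed
  obtain p q where pq: "f = var x * p + var y * q" using vpow1_decomp[OF f] by blast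
  have kk: "kill V (var x) = 0" "kill V (var y) = (0 :: 'a cring)" by (simp_all add: kill_simps)
  have D0: "cst t * var w ^ \<kappa> * kill V p = - (var z ^ \<kappa> * kill V q)"
    using D unfolding pq Dp_simps Dp_var kk by (simp add: eq_neg_iff_add_eq_0)
  have f2: "f - (var x * kill V p + var y * kill V q) \<in> vpow V 2"
  proof -
    have "f - (var x * kill V p + var y * kill V q) = var x * (p - kill V p) + var y * (q - kill V q)"
      unfolding pq by (simp add: algebra_simps)
    also have "\<dots> \<in> vpow V (1 + 1)"
      by (intro idl_add[OF idl_vpow] vpow_mult var_in_vpow diff_kill) auto
    finally show ?thesis by (simp only: one_add_one)
  qed
  let ?l = "var x * kill V p + var y * kill V q"
  have "cst t * var w ^ \<kappa> * ?l = kill V q * f0"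
  proof -
    have "cst t * var w ^ \<kappa> * ?l = var x * (cst t * var w ^ \<kappa> * kill V p) + cst t * var w ^ \<kappa> * var y * kill V q"
      by (simp add: algebra_simps)
    then show ?thesis unfolding D0 f0_def by (simp add: algebra_simps)
  qed
  moreover have "var z ^ \<kappa> * ?l = - (kill V p * f0)"
  proof -
    have "var z ^ \<kappa> * ?l = var z ^ \<kappa> * var x * kill V p + var y * (var z ^ \<kappa> * kill V q)"
      by (simp add: algebra_simps)
    also have "var z ^ \<kappa> * kill V q = - (cst t * var w ^ \<kappa> * kill V p)" using D0 by simp
    finally show ?thesis unfolding f0_def by (simp add: algebra_simps)
  qed
  ultimately have l: "cst t * var w ^ \<kappa> * ?l = kill V q * f0" "var z ^ \<kappa> * ?l = - (kill V p * f0)" by blast+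
  have V2G: "g \<in> ?G" if "g \<in> vpow V 2" for g using that by (rule ideal_sum_right[OF Gi])
  have w: "cst t * (var w ^ (N + \<kappa>) * f) \<in> ?G"
  proof -
    have "cst t * (var w ^ (N + \<kappa>) * f) = kill V q * (var w ^ N * f0) + cst t * var w ^ (N + \<kappa>) * (f - ?l)"
    proof -
      have "cst t * (var w ^ (N + \<kappa>) * f) = var w ^ N * (cst t * var w ^ \<kappa> * ?l) + cst t * var w ^ (N + \<kappa>) * (f - ?l)"
        by (simp add: power_add algebra_simps)
      then show ?thesis unfolding l by (simp add: mult_ac)
    qed
    then show ?thesis using idl_add[OF G idl_mult[OF G f0G[of w]] idl_mult[OF G V2G[OF f2]]] by simp
  qed
  have e: "cst (inverse t) * (cst t * (var w ^ (N + \<kappa>) * f)) = var w ^ (N + \<kappa>) * f"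
    using t by (simp flip: mult.assoc cst_mult)
  show "var w ^ (N + \<kappa>) * f \<in> ?G" using idl_mult[OF G w, of "cst (inverse t)"] unfolding e .
  have e2: "var z ^ (N + \<kappa>) * f = (- kill V p) * (var z ^ N * f0) + var z ^ (N + \<kappa>) * (f - ?l)"
  proof -
    have "var z ^ (N + \<kappa>) * f = var z ^ N * (var z ^ \<kappa> * ?l) + var z ^ (N + \<kappa>) * (f - ?l)"
      by (simp add: power_add algebra_simps)
    then show ?thesis unfolding l by (simp add: mult_ac)
  qed
  show "var z ^ (N + \<kappa>) * f \<in> ?G"
    by (subst e2, rule idl_add[OF G idl_mult[OF G f0G[of z]] idl_mult[OF G V2G[OF f2]]]) simp
qed

abbreviation "sB n h \<equiv> sect (vpow V 1 :: 'a cring set) n h"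

text \<open>One computation serves twice: \<open>c = 1\<close> gives independence of the chosen
  fraction, \<open>c = h'\<close> compatibility with restriction. \<open>Dp\<close> is applied to
  the cross-multiplied numerators, where one term of the product rule vanishes on the line.\<close>

lemma phi_well_defined:
  fixes h c :: "'a cring"
  assumes h: "h \<in> basics" and h1: "h * c \<in> basics" and c: "homog (int \<gamma>) c"
    and f: "f \<in> vpow V 1" "homog (int r * int (tot_deg h)) f"
    and f1: "f1 \<in> vpow V 1" "homog (int r1 * int (tot_deg (h * c))) f1"
    and eq: "quot f (h ^ r) = quot f1 ((h * c) ^ r1)"
  shows "quot (Dp f) (h ^ r) - quot (Dp f1) ((h * c) ^ r1) \<in> sB (int \<kappa> - 1) (h * c)"
proof -
  let ?h = "h * c" and ?e = "int \<kappa> - 1"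
  have nz: "h \<noteq> 0" "c \<noteq> 0" using h h1 basics_nz by fastforce+
  have dg: "tot_deg ?h = tot_deg h + \<gamma>"
    by (rule tot_deg_homog) (use homog_mult[OF basics_homog[OF h] c] nz in simp_all)
  have e: "f * ?h ^ r1 = f1 * h ^ r" using eq nz by (simp add: eq_fract)
  have k0: "kill V f = 0" "kill V f1 = 0" using f f1 by (simp_all add: kill_eq_0)
  let ?n = "Dp f * ?h ^ r1 - Dp f1 * h ^ r"
  have "Dp (f * ?h ^ r1) = Dp (f1 * h ^ r)" by (simp only: e)
  then have "Dp f * kill V (?h ^ r1) = Dp f1 * kill V (h ^ r)"
    unfolding Dp_simps(4) k0 by simp
  then have "kill V ?n = 0" unfolding kill_simps(2,3) kill_Dp by simp
  then have n1: "?n \<in> vpow V 1" by (simp only: kill_eq_0)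
  have hn: "homog (int r * int (tot_deg h) + ?e + int r1 * int (tot_deg ?h)) ?n"
  proof (rule homog_diff)
    show "homog (int r * int (tot_deg h) + ?e + int r1 * int (tot_deg ?h)) (Dp f * ?h ^ r1)"
      using homog_mult[OF homog_Dp[OF f(2)] homog_basics_power[OF h1, of r1]] by (simp add: algebra_simps)
    show "homog (int r * int (tot_deg h) + ?e + int r1 * int (tot_deg ?h)) (Dp f1 * h ^ r)"
      using homog_mult[OF homog_Dp[OF f1(2)] homog_basics_power[OF h, of r]] by (simp add: algebra_simps)
  qed
  have "quot (?n * c ^ r) (?h ^ (r + r1)) \<in> sB ?e ?h"
  proof (rule sectI)
    show "?n * c ^ r \<in> vpow V 1" by (rule idl_mult_right[OF idl_vpow n1])
    have "int r * int (tot_deg h) + ?e + int r1 * int (tot_deg ?h) + int r * int \<gamma> = int (r + r1) * int (tot_deg ?h) + ?e"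
      unfolding dg of_nat_add by (simp add: algebra_simps)
    then show "homog (int (r + r1) * int (tot_deg ?h) + ?e) (?n * c ^ r)"
      using homog_mult[OF hn homog_power[OF c, of r]] by (simp only:)
  qed
  moreover have "quot (Dp f) (h ^ r) - quot (Dp f1) (?h ^ r1) = quot (?n * c ^ r) (?h ^ (r + r1))"
  proof -
    have "quot (Dp f) (h ^ r) - quot (Dp f1) (?h ^ r1) = quot ?n (h ^ r * ?h ^ r1)"
      using nz by (simp add: diff_fract)
    also have "\<dots> = quot (?n * c ^ r) ((h ^ r * ?h ^ r1) * c ^ r)"
      by (rule quot_cancel[symmetric]) (use nz in auto)
    also have "(h ^ r * ?h ^ r1) * c ^ r = ?h ^ (r + r1)"
      by (simp add: power_add power_mult_distrib mult_ac)
    finally show ?thesis .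
  qed
  ultimately show ?thesis by simp
qed

text \<open>The map sends f / h^r to Dp f / h^r. It is injective on classes by
  \<open>Dp_zero_multiple\<close>, and surjective because on the line its image contains z^\<kappa>
  and w^\<kappa>.\<close>

lemma has_type_idealC:
  assumes d2: "d \<ge> 2" and k1: "\<kappa> \<ge> 1"
  shows "has_type (assoc_sheaf (vpow V 1)) (assoc_sheaf idealC) (int \<kappa> - 1)"
proof -
  let ?e = "int \<kappa> - 1"
  define R where "R h X f r \<longleftrightarrow> X = quot f (h ^ r) \<and> f \<in> vpow V 1 \<and> homog (int r * int (tot_deg h)) f"
    for h :: "'a cring" and X f r
  \<comment> \<open>A representing fraction is chosen for every section; linearity and compatibility
    with restriction hold only modulo the ideal of the line, which is all that is asked.\<close>
  define pick where "pick h X = (SOME fr. R h X (fst fr) (snd fr))" for h X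
  define phi where "phi h X = quot (Dp (fst (pick h X))) (h ^ snd (pick h X))" for h X
  have pick: "R h X (fst (pick h X)) (snd (pick h X))" if "X \<in> sB 0 h" for h X
  proof -
    from that obtain f r where "X = quot f (h ^ r)" "f \<in> vpow V 1" "homog (int r * int (tot_deg h) + 0) f" by (rule sectE)
    then have "R h X f r" by (simp add: R_def)
    then have "\<exists>fr. R h X (fst fr) (snd fr)" by (intro exI[of _ "(f, r)"]) simp
    then show ?thesis unfolding pick_def by (rule someI_ex)
  qed
  have WD: "quot (Dp f) (h ^ r) - quot (Dp f1) (h ^ r1) \<in> sB ?e h" if "h \<in> basics" "R h X f r" "R h X f1 r1" for h X f r f1 r1
    using phi_well_defined[of h 1 0 f r f1 r1] that homog_one by (simp add: R_def)
  have phi_eq: "phi h X - quot (Dp f) (h ^ r) \<in> sB ?e h" if "h \<in> basics" "R h X f r" for h X f r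
  proof -
    have "X \<in> sB 0 h" using that(2) by (auto simp: R_def intro!: sectI)
    then show ?thesis unfolding phi_def by (intro WD[OF that(1) pick that(2)])
  qed
  have gv: "graded (vpow V k :: 'a cring set)" for k by (rule graded_vpow)
  have sBI: "quot p (h ^ r) \<in> sB ?e h" if "p \<in> vpow V 1" "homog (int r * int (tot_deg h) + ?e) p" for p h r
    using that by (rule sectI)
  have hD: "homog (int r * int (tot_deg h) + ?e) (Dp f)" if "R h X f r" for h X f r
    using homog_Dp[of "int r * int (tot_deg h)" f] that by (simp add: R_def algebra_simps)
  have main: "(\<forall>X\<in>sB 0 h. phi h X \<in> sect UNIV ?e h) \<and>
     (\<forall>X\<in>sB 0 h. \<forall>Y\<in>sB 0 h. phi h (X + Y) - (phi h X + phi h Y) \<in> sB ?e h) \<and>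
     (\<forall>s\<in>sect UNIV 0 h. \<forall>X\<in>sB 0 h. phi h (s * X) - s * phi h X \<in> sB ?e h) \<and>
     (\<forall>X\<in>sB 0 h. phi h X \<in> sB ?e h \<longleftrightarrow> X \<in> ideal_sum (sect (vpow V 2) 0 h) (sect idealC 0 h)) \<and>
     (\<forall>Y\<in>sect UNIV ?e h. \<exists>X\<in>sB 0 h. phi h X - Y \<in> sB ?e h) \<and>
     (\<forall>h'\<in>basics. \<forall>X\<in>sB 0 h. phi (h * h') X - phi h X \<in> sB ?e (h * h'))" if h: "h \<in> basics" for h
  proof (intro conjI ballI)
    note sm = sect_minus[OF h idl_vpow[of V 1]] and sa = sect_add[OF h idl_vpow[of V 1]] and sd = sect_diff[OF h idl_vpow[of V 1]]
    have hz: "h \<noteq> 0" using h by simp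
    let ?\<delta> = "tot_deg h"
    {
      fix X assume X: "X \<in> sB 0 h"
      show "phi h X \<in> sect UNIV ?e h"
        unfolding phi_def by (rule sectI) (use hD[OF pick[OF X]] in auto)
    next
      fix X Y assume X: "X \<in> sB 0 h" and Y: "Y \<in> sB 0 h"
      obtain f r g s where f: "R h X f r" "phi h X = quot (Dp f) (h ^ r)" and g: "R h Y g s" "phi h Y = quot (Dp g) (h ^ s)"
        using pick[OF X] pick[OF Y] unfolding phi_def by blast
      have kf: "kill V f = 0" "kill V g = 0" using f g by (auto simp: R_def kill_eq_0)
      have hfg: "homog (int r * int ?\<delta>) f" "homog (int s * int ?\<delta>) g" using f g by (auto simp: R_def)
      let ?F = "f * h ^ s + g * h ^ r"
      have RF: "R h (X + Y) ?F (r + s)"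
        unfolding R_def
      proof (intro conjI)
        show "X + Y = quot ?F (h ^ (r + s))" using f g hz by (simp add: R_def power_add)
        show "?F \<in> vpow V 1" using f g by (auto simp: R_def intro!: idl_add[OF idl_vpow] idl_mult_right[OF idl_vpow])
        show "homog (int (r + s) * int ?\<delta>) ?F"
          using homog_mult[OF hfg(1) homog_basics_power[OF h, of s]] homog_mult[OF hfg(2) homog_basics_power[OF h, of r]]
          by (intro homog_add) (simp_all add: algebra_simps)
      qed
      let ?P = "Dp ?F - (Dp f * h ^ s + Dp g * h ^ r)"
      have "?P \<in> vpow V 1"
        unfolding kill_eq_0[symmetric] kill_simps(1-3) kill_Dp by (simp add: Dp_simps kf)
      moreover have "homog (int (r + s) * int ?\<delta> + ?e) ?P"
        using homog_mult[OF hD[OF f(1)] homog_basics_power[OF h, of s]] homog_mult[OF hD[OF g(1)] homog_basics_power[OF h, of r]]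
        by (intro homog_diff homog_add hD[OF RF]) (simp_all add: algebra_simps)
      ultimately have "quot ?P (h ^ (r + s)) \<in> sB ?e h" by (rule sBI)
      moreover have "quot ?P (h ^ (r + s)) = quot (Dp ?F) (h ^ (r + s)) - (phi h X + phi h Y)"
      proof -
        have "phi h X + phi h Y = quot (Dp f * h ^ s + Dp g * h ^ r) (h ^ (r + s))"
          using f g hz by (simp add: power_add)
        then show ?thesis using hz by (simp add: quot_diff del: diff_fract)
      qed
      ultimately have "(phi h (X + Y) - quot (Dp ?F) (h ^ (r + s))) + (quot (Dp ?F) (h ^ (r + s)) - (phi h X + phi h Y)) \<in> sB ?e h"
        using phi_eq[OF h RF] by (intro sa) simp_all
      then show "phi h (X + Y) - (phi h X + phi h Y) \<in> sB ?e h" by (simp only: diff_telescope)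
    next
      fix s X assume s: "s \<in> sect UNIV 0 h" and X: "X \<in> sB 0 h"
      obtain g k where g: "s = quot g (h ^ k)" "homog (int k * int ?\<delta>) g" using s by (auto elim!: sectE)
      obtain f r where f: "R h X f r" "phi h X = quot (Dp f) (h ^ r)" using pick[OF X] unfolding phi_def by blast
      have kf: "kill V f = 0" using f by (auto simp: R_def kill_eq_0)
      have hf: "homog (int r * int ?\<delta>) f" using f by (auto simp: R_def)
      have RF: "R h (s * X) (g * f) (k + r)"
        unfolding R_def
      proof (intro conjI)
        show "s * X = quot (g * f) (h ^ (k + r))" using f g by (simp add: R_def power_add)
        show "g * f \<in> vpow V 1" using f by (auto simp: R_def intro!: idl_mult[OF idl_vpow])
        show "homog (int (k + r) * int ?\<delta>) (g * f)"
          using homog_mult[OF g(2) hf] by (simp add: algebra_simps)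
      qed
      let ?P = "Dp (g * f) - g * Dp f"
      have "?P \<in> vpow V 1"
        unfolding kill_eq_0[symmetric] kill_simps(1-3) kill_Dp by (simp add: Dp_simps kf)
      moreover have "homog (int (k + r) * int ?\<delta> + ?e) ?P"
        using homog_mult[OF g(2) hD[OF f(1)]]
        by (intro homog_diff hD[OF RF]) (simp_all add: algebra_simps)
      ultimately have "quot ?P (h ^ (k + r)) \<in> sB ?e h" by (rule sBI)
      moreover have "quot ?P (h ^ (k + r)) = quot (Dp (g * f)) (h ^ (k + r)) - s * phi h X"
      proof -
        have "s * phi h X = quot (g * Dp f) (h ^ (k + r))" using f g by (simp add: power_add)
        then show ?thesis using hz by (simp add: quot_diff del: diff_fract)
      qed
      ultimately have "(phi h (s * X) - quot (Dp (g * f)) (h ^ (k + r))) + (quot (Dp (g * f)) (h ^ (k + r)) - s * phi h X) \<in> sB ?e h"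
        using phi_eq[OF h RF] by (intro sa) simp_all
      then show "phi h (s * X) - s * phi h X \<in> sB ?e h" by (simp only: diff_telescope)
    next
      fix X assume X: "X \<in> sB 0 h"
      obtain f r where f: "R h X f r" "phi h X = quot (Dp f) (h ^ r)" using pick[OF X] unfolding phi_def by blast
      have hf: "homog (int r * int ?\<delta> + 0) f" "f \<in> vpow V 1" "X = quot f (h ^ r)" using f by (auto simp: R_def)
      show "phi h X \<in> sB ?e h \<longleftrightarrow> X \<in> ideal_sum (sect (vpow V 2) 0 h) (sect idealC 0 h)"
      proof
        assume ph: "phi h X \<in> sB ?e h"
        show "X \<in> ideal_sum (sect (vpow V 2) 0 h) (sect idealC 0 h)"
        \<comment> \<open>In the first case D_+(h) misses the line, and every section lies in the
          square of its ideal.\<close>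
        proof (cases "h \<in> vpow V 1")
          case True
          have "h * h \<in> vpow V (1 + 1)" by (intro vpow_mult True)
          then have "f * h ^ 2 \<in> vpow V 2"
            unfolding one_add_one power2_eq_square by (rule idl_mult[OF idl_vpow])
          then have "X \<in> sect (vpow V 2) 0 h"
            unfolding hf(3) quot_in_sect_iff[OF h idl_vpow hf(1)] by blast
          then have "X + 0 \<in> ideal_sum (sect (vpow V 2) 0 h) (sect idealC 0 h)"
            using sect_zero[OF h idl_idealC, of 0] unfolding ideal_sum_def by blast
          then show ?thesis by simp
        next
          case False
          have "Dp f = 0"
          proof -
            obtain j where "Dp f * h ^ j \<in> vpow V 1"
              using ph unfolding f(2) quot_in_sect_iff[OF h idl_vpow hD[OF f(1)]] by blast
            moreover have "h ^ j \<notin> vpow V 1" for j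
              using False one_notin_vpow[of V, where ?'a = 'a] by (induction j) (auto dest: vpow_prime)
            ultimately have "Dp f \<in> vpow V 1" using vpow_prime[of "Dp f" "h ^ j" V] by blast
            then show ?thesis by (simp add: kill_eq_0[symmetric] kill_Dp)
          qed
          \<comment> \<open>The multipliers that bring \<open>f\<close> into the square plus the
            curve: x, y and powers of z and w, hence a power of \<open>h\<close>.
            \<open>gr_part\<close> is needed because only forms in \<open>idealC\<close> define
            sections.\<close>
          define E where "E = {g. g * f \<in> ideal_sum (gr_part idealC) (vpow V 2)}"
          have Gi: "idl (gr_part idealC)" using graded_gr_part[OF idl_idealC] by (simp add: graded_def)
          have G: "idl (ideal_sum (gr_part idealC) (vpow V 2))" by (intro idl_sum_ideal Gi idl_vpow)
          have "idl E"
          proof (rule idlI)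
            show "0 \<in> E" using idl_0[OF G] by (simp add: E_def)
            show "a + b \<in> E" if "a \<in> E" "b \<in> E" for a b
              using that idl_add[OF G] by (simp add: E_def distrib_right)
            show "a * b \<in> E" if "b \<in> E" for a b
              using that idl_mult[OF G] by (simp add: E_def mult.assoc)
          qed
          moreover have "var i \<in> E" if "i \<in> V" for i
          proof -
            have "var i * f \<in> vpow V (1 + 1)" by (intro vpow_mult var_in_vpow that hf)
            then show ?thesis unfolding E_def one_add_one by (intro CollectI ideal_sum_right[OF Gi])
          qed
          moreover have "var z ^ (N + \<kappa>) \<in> E" "var w ^ (N + \<kappa>) \<in> E"
            using Dp_zero_multiple[OF hf(2) \<open>Dp f = 0\<close>] by (simp_all add: E_def)
          ultimately have "h ^ (2 * (N + \<kappa>) + 1) \<in> E" by (intro power_in_idl h) auto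
          then obtain j where "h ^ j * f \<in> ideal_sum (gr_part idealC) (vpow V 2)" by (auto simp: E_def)
          then obtain a b where ab: "h ^ j * f = a + b" "a \<in> gr_part idealC" "b \<in> vpow V 2"
            unfolding ideal_sum_def by blast
          \<comment> \<open>The summands \<open>a\<close> and \<open>b\<close> may be inhomogeneous;
            their components in the degree of the sum stay in the respective ideals.\<close>
          let ?n = "(j + r) * ?\<delta>"
          have hh: "homog (int ?n) (h ^ j * f)"
            using homog_mult[OF homog_basics_power[OF h, of j] hf(1)] by (simp add: algebra_simps)
          then have eq: "h ^ j * f = comp ?n a + comp ?n b"
            using comp_homog[OF hh, of ?n] unfolding ab(1) restr_add by simp
          have "comp ?n a \<in> idealC" using ab(2) by (simp add: gr_part_def)
          then have "quot (comp ?n a) (h ^ (j + r)) \<in> sect idealC 0 h"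
            using homog_comp[of ?n a] by (intro sectI) (simp_all add: algebra_simps)
          moreover have "comp ?n b \<in> vpow V 2" using ab(3) gv[of 2] by (simp add: graded_def)
          then have "quot (comp ?n b) (h ^ (j + r)) \<in> sect (vpow V 2) 0 h"
            using homog_comp[of ?n b] by (intro sectI) (simp_all add: algebra_simps)
          moreover have "X = quot (comp ?n b) (h ^ (j + r)) + quot (comp ?n a) (h ^ (j + r))"
          proof -
            have "quot (comp ?n b) (h ^ (j + r)) + quot (comp ?n a) (h ^ (j + r)) = quot (h ^ j * f) (h ^ (j + r))"
              using hz eq by (simp add: add.commute quot_add del: add_fract)
            also have "\<dots> = quot (f * h ^ j) (h ^ r * h ^ j)" by (simp add: power_add mult.commute)
            also have "\<dots> = X" unfolding hf(3) by (rule quot_cancel) (use hz in auto)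
            finally show ?thesis by simp
          qed
          ultimately show ?thesis unfolding ideal_sum_def by blast
        qed
      next
        assume "X \<in> ideal_sum (sect (vpow V 2) 0 h) (sect idealC 0 h)"
        then obtain f1 a f2 b where F: "X = quot f1 (h ^ a) + quot f2 (h ^ b)" "f1 \<in> vpow V 2" "f2 \<in> idealC"
          "homog (int a * int ?\<delta>) f1" "homog (int b * int ?\<delta>) f2"
          by (auto simp: ideal_sum_def elim!: sectE)
        have f21: "f2 \<in> vpow V 1" by (rule lprim_sub[OF lprim_idealC F(3,5)])
        have f11: "f1 \<in> vpow V 1" using F(2) vpow_mono[of 1 2 V] by auto
        let ?F = "f1 * h ^ b + f2 * h ^ a"
        have "R h X ?F (a + b)"
          unfolding R_def
        proof (intro conjI)
          show "X = quot ?F (h ^ (a + b))" unfolding F(1) using hz by (simp add: power_add)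
          show "?F \<in> vpow V 1" by (intro idl_add[OF idl_vpow] idl_mult_right[OF idl_vpow] f11 f21)
          show "homog (int (a + b) * int ?\<delta>) ?F"
            using homog_mult[OF F(4) homog_basics_power[OF h, of b]] homog_mult[OF F(5) homog_basics_power[OF h, of a]]
            by (intro homog_add) (simp_all add: algebra_simps)
        qed
        from phi_eq[OF h this] have "phi h X - quot (Dp ?F) (h ^ (a + b)) \<in> sB ?e h" .
        moreover have "Dp ?F = 0"
          using Dp_vpow2[OF F(2)] Dp_idealC[OF F(3,5) d2] f11 f21 by (simp add: Dp_simps kill_eq_0[symmetric])
        ultimately show "phi h X \<in> sB ?e h" by (simp add: fract_collapse)
      qed
    next
      fix Y assume "Y \<in> sect UNIV ?e h"
      then obtain G r where G: "Y = quot G (h ^ r)" "homog (int r * int ?\<delta> + ?e) G" by (auto elim!: sectE)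
      \<comment> \<open>The polynomials attained by \<open>Dp\<close> modulo the line. They form an
        ideal containing x, y, z^\<kappa> and w^\<kappa>, hence a power of \<open>h\<close>.\<close>
      define E where "E = {g. \<exists>f\<in>vpow V 1. Dp f - g \<in> vpow V 1}"
      have "idl E"
      proof (rule idlI)
        show "0 \<in> E" unfolding E_def using idl_0[OF idl_vpow[of V 1]] Dp_simps(5) by force
        show "a + b \<in> E" if "a \<in> E" "b \<in> E" for a b
        proof -
          obtain f f' where "f \<in> vpow V 1" "f' \<in> vpow V 1" "Dp f - a \<in> vpow V 1" "Dp f' - b \<in> vpow V 1" using \<open>a \<in> E\<close> \<open>b \<in> E\<close> unfolding E_def by blast
          then have "f + f' \<in> vpow V 1" "Dp (f + f') - (a + b) \<in> vpow V 1"
            using idl_add_cong[OF idl_vpow[of V 1], of "Dp f" a "Dp f'" b] idl_add[OF idl_vpow[of V 1], of f f']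
            by (simp_all add: Dp_simps)
          then show ?thesis unfolding E_def by blast
        qed
        show "a * b \<in> E" if "b \<in> E" for a b
        proof -
          obtain f where f: "f \<in> vpow V 1" "Dp f - b \<in> vpow V 1" using \<open>b \<in> E\<close> unfolding E_def by blast
          have "a * f \<in> vpow V 1" by (rule idl_mult[OF idl_vpow f(1)])
          moreover have "Dp (a * f) = kill V a * Dp f" using f(1) by (simp add: Dp_simps kill_eq_0[symmetric])
          moreover have "kill V a * Dp f - a * b = - ((a - kill V a) * Dp f) + a * (Dp f - b)" by (simp add: algebra_simps)
          moreover have "\<dots> \<in> vpow V 1"
            by (intro idl_add[OF idl_vpow] idl_minus[OF idl_vpow] idl_mult_right[OF idl_vpow diff_kill] idl_mult[OF idl_vpow] f)
          ultimately show ?thesis unfolding E_def by (metis (mono_tags, lifting) mem_Collect_eq)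
        qed
      qed
      moreover have "var i \<in> E" if "i \<in> V" for i
      proof -
        have "Dp 0 - var i \<in> vpow V 1" unfolding Dp_simps(5) diff_0
          by (intro idl_minus[OF idl_vpow] var_in_vpow that)
        then show ?thesis unfolding E_def using idl_0[OF idl_vpow[of V 1]] by blast
      qed
      moreover have "var z ^ \<kappa> \<in> E"
      proof -
        have "Dp (var y) - var z ^ \<kappa> \<in> vpow V 1" unfolding Dp_var diff_self by (rule idl_0[OF idl_vpow])
        moreover have "var y \<in> (vpow V 1 :: 'a cring set)" by (rule var_in_vpow) simp
        ultimately show ?thesis unfolding E_def by blast
      qed
      moreover have "var w ^ \<kappa> \<in> E"
      proof -
        have "Dp (cst (inverse t) * var x) = kill V (cst (inverse t)) * (cst t * var w ^ \<kappa>)"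
          by (simp only: Dp_simps Dp_var mult_zero_left add_0_right)
        also have "\<dots> = var w ^ \<kappa>" using t by (simp add: kill_simps flip: mult.assoc cst_mult)
        finally have "Dp (cst (inverse t) * var x) - var w ^ \<kappa> \<in> vpow V 1" using idl_0[OF idl_vpow[of V 1]] by simp
        moreover have "cst (inverse t) * var x \<in> (vpow V 1 :: 'a cring set)" by (intro idl_mult[OF idl_vpow] var_in_vpow) simp
        ultimately show ?thesis unfolding E_def by blast
      qed
      ultimately have "h ^ (2 * \<kappa> + 1) \<in> E" by (intro power_in_idl h) auto
      then have "G * h ^ (2 * \<kappa> + 1) \<in> E" by (rule idl_mult[OF \<open>idl E\<close>])
      then obtain j F where F: "F \<in> vpow V 1" "Dp F - G * h ^ j \<in> vpow V 1" unfolding E_def by blast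
      define n where "n = (r + j) * ?\<delta>"
      define F' where "F' = comp n F"
      have F'1: "F' \<in> vpow V 1" using F(1) gv[of 1] by (simp add: graded_def F'_def)
      have hG: "homog (int (n + \<kappa> - 1)) (G * h ^ j)"
        using homog_mult[OF G(2) homog_basics_power[OF h, of j]] k1 by (simp add: n_def of_nat_diff algebra_simps)
      have "comp (n + \<kappa> - 1) (Dp F - G * h ^ j) = Dp F' - G * h ^ j"
      proof -
        have "restr A (p - q) = restr A p - restr A q" for A and p q :: "'a cring"
          by (rule poly_mapping_eqI) (simp add: lookup_restr lookup_minus)
        then show ?thesis using comp_homog[OF hG, of "n + \<kappa> - 1"] comp_Dp[OF k1, of "n + \<kappa> - 1" F] k1 by (simp add: F'_def)
      qed
      then have D1: "Dp F' - G * h ^ j \<in> vpow V 1"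
        using F(2) gv[of 1] unfolding graded_def by metis
      have hF: "homog (int (r + j) * int ?\<delta>) F'" using homog_comp[of n F] by (simp add: F'_def n_def)
      let ?X = "quot F' (h ^ (r + j))"
      have RX: "R h ?X F' (r + j)" unfolding R_def using F'1 hF by blast
      have X: "?X \<in> sB 0 h" using F'1 hF by (intro sectI) simp_all
      have "quot (Dp F' - G * h ^ j) (h ^ (r + j)) \<in> sB ?e h"
      proof (rule sBI[OF D1])
        have "int (n + \<kappa> - 1) = int (r + j) * int ?\<delta> + ?e" using k1 by (simp add: n_def of_nat_diff)
        then show "homog (int (r + j) * int ?\<delta> + ?e) (Dp F' - G * h ^ j)"
          using homog_diff[OF _ hG, of "Dp F'"] hD[OF RX] by (simp only:)
      qed
      moreover have "quot (Dp F' - G * h ^ j) (h ^ (r + j)) = quot (Dp F') (h ^ (r + j)) - Y"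
      proof -
        have "Y = quot (G * h ^ j) (h ^ (r + j))" unfolding G(1) power_add by (rule quot_cancel[symmetric]) (use hz in auto)
        then show ?thesis using hz by (simp add: quot_diff del: diff_fract)
      qed
      ultimately have "(phi h ?X - quot (Dp F') (h ^ (r + j))) + (quot (Dp F') (h ^ (r + j)) - Y) \<in> sB ?e h"
        using phi_eq[OF h RX] by (intro sa) simp_all
      then show "\<exists>X\<in>sB 0 h. phi h X - Y \<in> sB ?e h" using X unfolding diff_telescope by blast
    next
      fix h' :: "'a cring" and X assume h': "h' \<in> basics" and X: "X \<in> sB 0 h"
      have hh: "h * h' \<in> basics" using h h' by simp
      have X': "X \<in> sB 0 (h * h')" by (rule sect_restrict_mult[OF h h' idl_vpow X])
      from pick[OF X] pick[OF X']
      have "quot (Dp (fst (pick h X))) (h ^ snd (pick h X)) - quot (Dp (fst (pick (h * h') X))) ((h * h') ^ snd (pick (h * h') X)) \<in> sB ?e (h * h')"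
        unfolding R_def by (intro phi_well_defined[OF h hh basics_homog[OF h']]) auto
      then have "- (phi h X - phi (h * h') X) \<in> sB ?e (h * h')" unfolding phi_def by (rule sect_minus[OF hh idl_vpow])
      then show "phi (h * h') X - phi h X \<in> sB ?e (h * h')" by simp
    }
  qed
  have e0: "?e \<ge> 0" using k1 by simp
  show ?thesis
    unfolding has_type_def quotient_sheaf_iso_def
  proof (rule exI[of _ phi], rule ballI)
    fix h :: "'a cring" assume h: "h \<in> basics"
    have tw: "twist ?e (assoc_sheaf (vpow V 1)) h = sB ?e h" if "h \<in> basics" for h
      by (rule twist_assoc[OF that idl_vpow e0])
    show "(\<forall>x\<in>assoc_sheaf (vpow V 1) h. phi h x \<in> sections_O ?e h) \<and>
         (\<forall>x\<in>assoc_sheaf (vpow V 1) h. \<forall>y\<in>assoc_sheaf (vpow V 1) h.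
             phi h (x + y) - (phi h x + phi h y) \<in> twist ?e (assoc_sheaf (vpow V 1)) h) \<and>
         (\<forall>r\<in>regular h. \<forall>x\<in>assoc_sheaf (vpow V 1) h. phi h (r * x) - r * phi h x \<in> twist ?e (assoc_sheaf (vpow V 1)) h) \<and>
         (\<forall>x\<in>assoc_sheaf (vpow V 1) h. (phi h x \<in> twist ?e (assoc_sheaf (vpow V 1)) h) =
             (x \<in> ideal_sum (sheaf_pow (assoc_sheaf (vpow V 1)) 2 h) (assoc_sheaf idealC h))) \<and>
         (\<forall>y\<in>sections_O ?e h. \<exists>x\<in>assoc_sheaf (vpow V 1) h. phi h x - y \<in> twist ?e (assoc_sheaf (vpow V 1)) h) \<and>
         (\<forall>h'\<in>basics. \<forall>x\<in>assoc_sheaf (vpow V 1) h. phi (h * h') x - phi h x \<in> twist ?e (assoc_sheaf (vpow V 1)) (h * h'))"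
      using main[OF h] h by (simp only: assoc_sheaf_eq[OF h] sections_O_eq tw mult_basics sheaf_pow_vpow) (simp add: tw)
  qed
qed

end

declare single_one [simp del] single_numeral [simp del] single_of_nat [simp del]

section \<open>The curves $C_t$\<close>

lemma exhaust_4: "i = 0 \<or> i = 1 \<or> i = 2 \<or> i = 3" for i :: 4
proof (induct i)
  case (of_int z)
  then have "0 \<le> z" and "z < 4" by simp_all
  then have "z = 0 \<or> z = 1 \<or> z = 2 \<or> z = 3" by arith
  then show ?case by auto
qed

lemma exhaust_3: "i = 0 \<or> i = 1 \<or> i = 2" for i :: 3
proof (induct i)
  case (of_int z)
  then have "0 \<le> z" and "z < 3" by simp_all
  then have "z = 0 \<or> z = 1 \<or> z = 2" by arith
  then show ?case by auto
qed

lemma UNIV_4: "(UNIV :: 4 set) = {0, 1, 2, 3}"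
  using exhaust_4 by blast

lemma UNIV_3: "(UNIV :: 3 set) = {0, 1, 2}"
  using exhaust_3 by blast

lemma sum_UNIV_3: "(\<Sum>i\<in>(UNIV :: 3 set). f i) = f 0 + f 1 + f 2"
  unfolding UNIV_3 by (simp add: add.assoc)

lemma prod_UNIV_3: "(\<Prod>i\<in>(UNIV :: 3 set). f i) = f 0 * f 1 * f 2"
  unfolding UNIV_3 by (simp add: mult.assoc)

lemma sum_UNIV_4: "(\<Sum>i\<in>(UNIV :: 4 set). f i) = f 0 + f 1 + f 2 + f 3"
  unfolding UNIV_4 by (simp add: add.assoc)

lemma lookup_partial: "lookup (partial i p) v = of_nat (lookup v i + 1) * lookup p (v + single i 1)"
proof -
  have eq: "s - single i 1 = v \<longleftrightarrow> s = v + single i 1" if "lookup s i > 0" for s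
  proof
    assume "s - single i 1 = v"
    then show "s = v + single i 1"
      using that by (intro poly_mapping_eqI) (auto simp: lookup_add lookup_minus lookup_single when_def)
  qed simp
  have "lookup (partial i p) v = (\<Sum>s\<in>keys p. if s = v + single i 1 then of_nat (lookup v i + 1) * lookup p s else 0)"
    unfolding partial_def lookup_sum
  proof (rule sum.cong)
    fix s assume "s \<in> keys p"
    show "lookup (single (s - single i 1) (of_nat (lookup s i) * lookup p s)) v = (if s = v + single i 1 then of_nat (lookup v i + 1) * lookup p s else 0)"
    proof (cases "lookup s i = 0")
      case True
      then have "s \<noteq> v + single i 1" by (auto simp: lookup_add)
      then show ?thesis using True by simp
    next
      case False
      then show ?thesis using eq[of s] by (auto simp: lookup_single when_def lookup_add)
    qed
  qed simp
  then show ?thesis by (simp add: in_keys_iff)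
qed

text \<open>The derivative along \<open>var i\<close> is \<open>var j ^ M\<close>, which has no zero
  on D_+(var j).\<close>

lemma smooth_graph:
  fixes H :: "'a::field cring"
  assumes H: "\<And>s. s \<in> keys H \<Longrightarrow> lookup s i = 0" and ij: "i \<noteq> j" and hom: "homog n (var i * var j ^ M - H)"
  shows "smooth_surface_on (var j) (var i * var j ^ M - H)"
  unfolding smooth_surface_on_def
proof (intro conjI ballI impI)
  show "\<exists>n. homog n (var i * var j ^ M - H)" using hom by blast
  fix Q :: "'a cring set" assume Q: "Q \<in> points" and "var j \<notin> Q \<and> var i * var j ^ M - H \<in> Q"
  then have j: "var j \<notin> Q" by blast
  have "partial i (var i * var j ^ M - H) = var j ^ M"
  proof (rule poly_mapping_eqI)
    fix v
    have "lookup H (v + single i 1) = 0" using H[of "v + single i 1"] by (auto simp: in_keys_iff lookup_add)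
    moreover have "single i 1 + single j M = v + single i 1 \<longleftrightarrow> single j M = v"
      by (metis add.commute add_left_cancel)
    moreover have "lookup v i = 0" if "single j M = v" using that ij by (auto simp: lookup_single when_def)
    ultimately show "lookup (partial i (var i * var j ^ M - H)) v = lookup (var j ^ M) v"
      by (auto simp: lookup_partial lookup_minus var_power mult_single lookup_single when_def)
  qed
  then show "\<exists>k. partial k (var i * var j ^ M - H) \<notin> Q"
    using points_power[OF Q] j by (intro exI[of _ i]) auto
qed

section \<open>The power series phi and the equation of the surface\<close>

definition rho3 :: "'r \<Rightarrow> 'r \<Rightarrow> 'r \<Rightarrow> 3 \<Rightarrow> 'r"
  where "rho3 p q r i = (if i = 0 then p else if i = 1 then q else r)"

lemma rho3_simps [simp]: "rho3 p q r 0 = p" "rho3 p q r 1 = q" "rho3 p q r 2 = r"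
  by (simp_all add: rho3_def)

lemma xy_power_eq: "xy_power n = vpow {0, 1} n"
  using ideal_pow_vars[of "{0, 1 :: 3}" n] by (simp add: xy_power_def)

text \<open>Homogenisation by powers of W up to degree \<open>n\<close>. Because the difference is
  truncated, the result is homogeneous only if no monomial of \<open>f\<close> has degree above
  \<open>n\<close>.\<close>

definition hmg :: "nat \<Rightarrow> 'a::field cring \<Rightarrow> 'a cring"
  where "hmg n f = (\<Sum>s\<in>keys f. single (s + single 3 (n - mon_deg s)) (lookup f s))"

lemma keys_hmg: "s' \<in> keys (hmg n f) \<Longrightarrow> \<exists>s\<in>keys f. s' = s + single 3 (n - mon_deg s)"
  unfolding hmg_def using keys_sum[of "\<lambda>s. single (s + single 3 (n - mon_deg s)) (lookup f s)" "keys f"] by (auto split: if_splits)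

lemma homog_hmg: "(\<And>s. s \<in> keys f \<Longrightarrow> mon_deg s \<le> n) \<Longrightarrow> homog (int n) (hmg n f)"
  unfolding homog_def by (auto dest!: keys_hmg simp: mon_deg_add)

locale ct =
  fixes m d a :: nat and g :: "(3, 'a::field) pol" and t :: 'a
  assumes m2: "m \<ge> 2" and dm: "d = 3 * m - 1" and gg: "good_g m d g" and t0: "t \<noteq> 0"
begin

text \<open>The exponent of z in the leading coefficient of phi: z^a comes from the equation of the
  surface, z^m from g restricted to the line.\<close>

definition \<kappa> :: nat where "\<kappa> = a + m"

definition gx :: "'a cring \<Rightarrow> 'a cring \<Rightarrow> 'a cring \<Rightarrow> 'a cring"
  where "gx p q r = subst (rho3 p q r) g"

lemma gx_sum: "gx p q r = (\<Sum>s\<in>keys g. cst (lookup g s) * (p ^ lookup s 0 * q ^ lookup s 1 * r ^ lookup s 2))"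
  by (simp add: gx_def peval_def prod_UNIV_3)

lemma gx_cong: "idl I \<Longrightarrow> q - q' \<in> I \<Longrightarrow> gx p q r - gx p q' r \<in> I"
  unfolding gx_def by (rule idl_peval_cong) (auto simp: rho3_def idl_0)

lemma kill_gx: "kill W (gx p q r) = gx (kill W p) (kill W q) (kill W r)"
proof -
  have "kill W (gx p q r) = subst (\<lambda>i. kill W (subst (rho3 p q r) (var i))) g"
    unfolding gx_def by (rule cst.peval_unique) (simp_all add: kill_simps subst_simps)
  also have "(\<lambda>i. kill W (subst (rho3 p q r) (var i))) = rho3 (kill W p) (kill W q) (kill W r)"
    by (auto simp: rho3_def fun_eq_iff)
  finally show ?thesis by (simp add: gx_def)
qed

lemma keys_g:
  assumes "s \<in> keys g"
  shows "lookup s 0 + 2 * lookup s 1 + 3 * lookup s 2 = 3 * m" "lookup s 0 + lookup s 1 + 2 \<le> d"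
proof -
  show "lookup s 0 + 2 * lookup s 1 + 3 * lookup s 2 = 3 * m"
    using gg assms by (auto simp: good_g_def WT_homog_def WT_def)
  have "mon s \<notin> (vpow {0, 1} (d - 1) :: (3, 'a) pol set)"
    using gg assms unfolding good_g_def xy_power_eq by blast
  then show "lookup s 0 + lookup s 1 + 2 \<le> d" using m2 dm by (simp add: mon_in_vpow vdeg_def)
qed

lemma lookup_g_zm: "lookup g (single 2 m) = 1"
proof -
  obtain a where a: "\<And>i s. i \<in> {1..m} \<Longrightarrow> s \<in> keys (a i) \<Longrightarrow> lookup s 2 = 0"
    "g = var 2 ^ m + (\<Sum>i=1..m. a i * var 2 ^ (m - i))"
    using gg unfolding good_g_def by blast
  have "lookup (a i * var 2 ^ (m - i)) (single 2 m) = 0" if i: "i \<in> {1..m}" for i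
  proof (rule ccontr)
    assume "lookup (a i * var 2 ^ (m - i)) (single 2 m) \<noteq> 0"
    then have "single 2 m \<in> keys (a i * var 2 ^ (m - i))" by (simp add: in_keys_iff)
    then obtain s s' where s: "single 2 m = s + s'" "s \<in> keys (a i)" "s' \<in> keys (var 2 ^ (m - i) :: (3, 'a) pol)"
      using keys_mult[of "a i" "var 2 ^ (m - i)"] by blast
    then have "s' = single 2 (m - i)" by (simp add: var_power split: if_splits)
    then have "m = lookup s 2 + (m - i)" using s(1) by (metis lookup_add lookup_single_eq)
    moreover have "lookup s 2 = 0" "i \<ge> 1" "i \<le> m" using a(1)[OF i s(2)] i by auto
    ultimately show False by linarith
  qed
  then show ?thesis unfolding a(2) by (simp add: lookup_add lookup_sum var_power)
qed

lemma keys_g_pos: "s \<in> keys g \<Longrightarrow> s \<noteq> single 2 m \<Longrightarrow> lookup s 0 + lookup s 1 > 0"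
proof (rule ccontr)
  assume s: "s \<in> keys g" "s \<noteq> single 2 m" "\<not> lookup s 0 + lookup s 1 > 0"
  then have "lookup s 0 = 0" "lookup s 1 = 0" "lookup s 2 = m" using keys_g(1)[OF s(1)] by auto
  then have "lookup s i = lookup (single 2 m) i" for i
    using exhaust_3[of i] by (auto simp: lookup_single when_def)
  then show False using s(2) poly_mapping_eqI by blast
qed

lemma gx_line: "gx 0 0 r = r ^ m"
proof -
  have "gx 0 0 r = (\<Sum>s\<in>keys g. if s = single 2 m then r ^ m else 0)"
    unfolding gx_sum
  proof (rule sum.cong)
    fix s assume "s \<in> keys g"
    then show "cst (lookup g s) * (0 ^ lookup s 0 * 0 ^ lookup s 1 * r ^ lookup s 2) = (if s = single 2 m then r ^ m else 0)"
      using keys_g_pos[of s] by (auto simp: lookup_g_zm lookup_single when_def power_0_left)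
  qed simp
  also have "\<dots> = r ^ m" using lookup_g_zm by (simp add: in_keys_iff)
  finally show ?thesis .
qed

primrec phi :: "nat \<Rightarrow> 'a cring" where
  "phi 0 = 0"
| "phi (Suc k) = var 0 * (cst (inverse t) * (var 2 ^ a * gx (var 0) (phi k) (var 2)))"

text \<open>The quotient of \<open>phi K\<close> by x, as the parametrisation y = x \<Phi>
  requires.\<close>

definition PhiQ :: "nat \<Rightarrow> 'a cring"
  where "PhiQ K = cst (inverse t) * (var 2 ^ a * gx (var 0) (phi (K - 1)) (var 2))"

lemma phi_PhiQ: "K \<ge> 1 \<Longrightarrow> phi K = var 0 * PhiQ K"
  by (cases K) (simp_all add: PhiQ_def)

text \<open>The factor x in front of the recursion gains one order at each iteration.\<close>

lemma phi_Suc_diff: "phi (Suc k) - phi k \<in> vpow {0} (Suc k)"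
proof (induction k)
  case 0
  have "var 0 * p \<in> vpow {0} 1" for p :: "'a cring" by (intro idl_mult_right[OF idl_vpow] var_in_vpow) simp
  then show ?case by (simp add: One_nat_def)
next
  case (Suc k)
  have "gx (var 0) (phi (Suc k)) (var 2) - gx (var 0) (phi k) (var 2) \<in> vpow {0} (Suc k)"
    by (rule gx_cong[OF idl_vpow Suc])
  then have "cst (inverse t) * (var 2 ^ a * (gx (var 0) (phi (Suc k)) (var 2) - gx (var 0) (phi k) (var 2))) \<in> vpow {0} (Suc k)"
    by (intro idl_mult[OF idl_vpow])
  then have "var 0 ^ 1 * (cst (inverse t) * (var 2 ^ a * (gx (var 0) (phi (Suc k)) (var 2) - gx (var 0) (phi k) (var 2)))) \<in> vpow {0} (1 + Suc k)"
    unfolding var_power_mult_vpow .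
  moreover have "phi (Suc (Suc k)) - phi (Suc k) = var 0 ^ 1 * (cst (inverse t) * (var 2 ^ a * (gx (var 0) (phi (Suc k)) (var 2) - gx (var 0) (phi k) (var 2))))"
    by (simp only: phi.simps(2)[of "Suc k"] phi.simps(2)[of k] power_one_right right_diff_distrib)
  ultimately show ?case by (simp only: plus_1_eq_Suc)
qed

lemma phi_diff: "j \<le> k \<Longrightarrow> phi k - phi j \<in> vpow {0} (Suc j)"
proof (induction k)
  case (Suc k)
  show ?case
  proof (cases "j = Suc k")
    case False
    then have "phi k - phi j \<in> vpow {0} (Suc j)" using Suc by simp
    moreover have "phi (Suc k) - phi k \<in> vpow {0} (Suc j)"
      using phi_Suc_diff[of k] vpow_mono[of "Suc j" "Suc k" "{0}"] Suc.prems False by auto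
    ultimately show ?thesis using idl_trans[OF idl_vpow[of "{0}" "Suc j"]] by blast
  qed (simp only: diff_self idl_0[OF idl_vpow])
qed (simp add: idl_0[OF idl_vpow])

lemma phi_vpow: "phi k \<in> vpow {0} 1"
  using phi_diff[of 0 k] by (simp add: One_nat_def)

lemma kill_PhiQ: "kill {0} (PhiQ K) = cst (inverse t) * var 2 ^ \<kappa>"
proof -
  have "kill {0} (phi (K - 1)) = 0" using phi_vpow by (simp only: kill_eq_0)
  then show ?thesis by (simp add: PhiQ_def kill_simps kill_gx gx_line \<kappa>_def power_add)
qed

lemma kill_phi: "kill {1, 3} (phi k) = phi k"
  by (induction k) (simp_all add: kill_simps kill_gx)

definition surf :: "'a cring"
  where "surf = var 0 * homogenize (d - 1) g * var 2 ^ a - scal t (var 1 * var 3 ^ (a + d - 1))"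

lemma homog_surf: "homog (int (a + d)) surf"
proof -
  have "homog (int (d - 1)) (homogenize (d - 1) g)"
    unfolding homogenize_def
  proof (intro homog_sum homog_scal)
    fix s assume s: "s \<in> keys g"
    \<comment> \<open>For x^i y^j z^l the weight d + 1 gives 3 (i + j + l) = d + 1 + 2 i + j, and i
      + j \<le> d - 2 bounds this by 3 (d - 1).\<close>
    have "mon_deg s \<le> d - 1"
      using keys_g[OF s] dm m2 by (simp add: mon_deg_def sum_UNIV_3)
    then have "int (d - 1) = int (lookup s 0) + int (lookup s 1) + int (lookup s 2) + int (d - 1 - mon_deg s)"
      by (simp add: mon_deg_def sum_UNIV_3)
    then show "homog (int (d - 1)) (var 0 ^ lookup s 0 * var 1 ^ lookup s 1 * var 2 ^ lookup s 2 * var 3 ^ (d - 1 - mon_deg s) :: 'a cring)"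
      by (simp only:) (intro homog_mult homog_var_power)
  qed
  then have "homog (1 + int (d - 1) + int a) (var 0 * homogenize (d - 1) g * var 2 ^ a)"
    by (intro homog_mult homog_var homog_var_power)
  moreover have "homog (1 + int (a + d - 1)) (scal t (var 1 * var 3 ^ (a + d - 1)) :: 'a cring)"
    by (intro homog_scal homog_mult homog_var homog_var_power)
  moreover have "1 + int (d - 1) + int a = int (a + d)" "1 + int (a + d - 1) = int (a + d)" using dm m2 by auto
  ultimately show ?thesis unfolding surf_def by (intro homog_diff) (simp_all only:)
qed

end

text \<open>Truncation order \<open>K\<close> and multiplicity \<open>r\<close> are kept apart from
  \<open>d\<close>: in the uniqueness proof a structure of unknown multiplicity appears, and it is
  identified with \<open>d\<close> only after comparing degrees.\<close>

locale ctK = ct +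
  fixes K r :: nat
  assumes K: "K \<ge> d" "r \<le> K" and r: "r > 0"
begin

sublocale pline 0 1 2 3 "PhiQ K" t \<kappa> r
  by unfold_locales (use kill_PhiQ t0 r UNIV_4 in simp_all)

lemma K1: "K \<ge> 1" using K dm m2 by simp

lemma rho_1: "rho 1 = phi K"
  using phi_PhiQ[OF K1] by simp

lemma theta_var: "theta (var 0) = var 0" "theta (var 1) = phi K" "theta (var 2) = var 2" "theta (var 3) = 1"
  using rho_1 rho_simps(1,3,4) by (simp_all only: theta_simps(9))

lemma theta_homogenize: "theta (homogenize n g) = gx (var 0) (phi K) (var 2)"
  by (simp only: homogenize_def gx_sum theta_simps(2,4,10,11) theta_var power_one mult_1_right)

text \<open>On the parametrised curve the equation of the surface measures the defect of the
  iteration, which is of order K + 1.\<close>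

lemma theta_surf: "theta surf = cst t * (phi (Suc K) - phi K)"
proof -
  have "cst t * phi (Suc K) = (cst t * cst (inverse t)) * (var 0 * (var 2 ^ a * gx (var 0) (phi K) (var 2)))"
    by (simp add: mult_ac)
  also have "cst t * cst (inverse t) = (1 :: 'a cring)" using t0 by (simp flip: cst_mult)
  finally have "cst t * phi (Suc K) = var 0 * gx (var 0) (phi K) (var 2) * var 2 ^ a" by (simp add: mult_ac)
  then show ?thesis unfolding surf_def theta_simps(2-4,10) theta_homogenize theta_var
    by (simp add: right_diff_distrib del: phi.simps)
qed

lemma surf_idealC: "surf \<in> idealC"
proof -
  have "phi (Suc K) - phi K \<in> vpow {0} r"
    using phi_Suc_diff[of K] vpow_mono[of r "Suc K" "{0}"] K by auto
  then show ?thesis unfolding idealC_def mem_Collect_eq theta_surf by (rule idl_mult[OF idl_vpow])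
qed

lemma theta_fixed: "kill {1, 3} f = f \<Longrightarrow> theta f = f"
proof -
  assume f: "kill {1, 3} f = f"
  have "theta (kill {1, 3} f) = subst (\<lambda>i. theta (kill {1, 3} (var i))) f"
    by (rule cst.peval_unique) (simp_all add: theta_simps kill_simps)
  also have "(\<lambda>i. theta (kill {1, 3} (var i))) = (\<lambda>i. if i \<in> {1, 3} then 0 else var i)"
  proof
    fix i :: 4
    show "theta (kill {1, 3} (var i)) = (if i \<in> {1, 3} then 0 else var i)"
      using exhaust_4[of i] by (auto simp: kill_simps theta_simps theta_var[unfolded theta_simps(9)])
  qed
  also have "subst (\<lambda>i. if i \<in> {1, 3} then 0 else var i) f = kill {1, 3} f" by (simp add: kill_def)
  finally show ?thesis using f by simp
qed

lemma theta_hmg: "theta (hmg n f) = theta f"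
proof -
  have "theta (single (s + single 3 k) c) = theta (single s c)" for s k c
  proof -
    have "single (s + single 3 k) c = single s c * (var 3 ^ k :: 'a cring)"
      by (simp add: var_power mult_single)
    then show ?thesis by (simp only: theta_simps(2,4) theta_var power_one mult_1_right)
  qed
  then have "theta (hmg n f) = (\<Sum>s\<in>keys f. theta (single s (lookup f s)))"
    unfolding hmg_def theta_simps(11) by simp
  also have "\<dots> = theta f"
    by (simp only: theta_simps(11)[symmetric] pol_sum_monomials[symmetric])
  finally show ?thesis .
qed

lemma hmg_vpow: "f \<in> vpow V k \<Longrightarrow> hmg n f \<in> vpow V k"
  unfolding vpow_def by (auto dest!: keys_hmg simp: vdeg_add vdeg_single)

text \<open>The homogenisation of y - phi, linear in y and hence smooth where w is nonzero. The
  leading term of phi is separated as \<open>q\<close>; everything else is of second order, which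
  yields the comparison with the linear form t w^\<kappa> y - z^\<kappa> x.\<close>

lemma exists_Fw:
  obtains M F H where "F = var 1 * var 3 ^ M - H" "\<And>s. s \<in> keys H \<Longrightarrow> lookup s 1 = 0" "homog (int (M + 1)) F"
    "theta F = 0" "var 3 ^ M * (cst t * var 3 ^ \<kappa> * var 1 - var 2 ^ \<kappa> * var 0) - cst t * var 3 ^ \<kappa> * F \<in> vpow V 2"
proof -
  define q where "q = cst (inverse t) * (var 0 * var 2 ^ \<kappa> :: 'a cring)"
  define rest where "rest = phi K - q"
  define M where "M = max \<kappa> (tot_deg rest)"
  define H where "H = q * var 3 ^ (M - \<kappa>) + hmg (M + 1) rest"
  define F where "F = var 1 * var 3 ^ M - H"
  have "rest = var 0 ^ 1 * (PhiQ K - kill {0} (PhiQ K))"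
    by (simp only: rest_def phi_PhiQ[OF K1] kill_PhiQ q_def right_diff_distrib power_one_right mult.left_commute)
  also have "\<dots> \<in> vpow {0} (1 + 1)" unfolding var_power_mult_vpow by (rule diff_kill)
  finally have "rest \<in> vpow {0} 2" by (simp only: one_add_one)
  then have rest2: "rest \<in> vpow V 2" by (auto simp: vpow_def vdeg_def)
  have kq: "kill {1, 3} q = q" by (simp add: q_def kill_simps)
  then have kr: "kill {1, 3} rest = rest" by (simp add: rest_def kill_simps kill_phi)
  have keyz: "lookup s 1 = 0" if "kill {1, 3} f = f" "s \<in> keys f" for f :: "'a cring" and s
  proof -
    have "s \<in> keys (restr {s. vdeg {1, 3} s = 0} f)" using that by (simp flip: kill_eq_restr)
    then show ?thesis by (simp add: keys_restr vdeg_def)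
  qed
  have th: "theta F = 0"
    unfolding F_def H_def theta_simps(1-4) theta_hmg theta_fixed[OF kq] theta_fixed[OF kr] theta_var
    by (simp add: rest_def)
  have kM: "\<kappa> \<le> M" "tot_deg rest \<le> M" by (simp_all add: M_def)
  have hq: "homog (int (\<kappa> + 1)) q"
    unfolding q_def using homog_mult[OF homog_cst homog_mult[OF homog_var homog_var_power]] by (simp add: add.commute)
  have hF: "homog (int (M + 1)) F"
  proof -
    have "homog (1 + int M) (var 1 * var 3 ^ M :: 'a cring)" by (intro homog_mult homog_var homog_var_power)
    moreover have "homog (int (\<kappa> + 1) + int (M - \<kappa>)) (q * var 3 ^ (M - \<kappa>))"
      by (intro homog_mult hq homog_var_power)
    moreover have "homog (int (M + 1)) (hmg (M + 1) rest)"
      using mon_deg_le_tot_deg[of _ rest] kM by (intro homog_hmg) (meson le_add1 order_trans)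
    moreover have "1 + int M = int (M + 1)" "int (\<kappa> + 1) + int (M - \<kappa>) = int (M + 1)" using kM by auto
    ultimately show ?thesis unfolding F_def H_def by (intro homog_diff homog_add) simp_all
  qed
  have kH: "lookup s 1 = 0" if "s \<in> keys H" for s
  proof -
    have "s \<in> keys (q * var 3 ^ (M - \<kappa>)) \<or> s \<in> keys (hmg (M + 1) rest)"
      using that Poly_Mapping.keys_add[of "q * var 3 ^ (M - \<kappa>)" "hmg (M + 1) rest"] unfolding H_def by blast
    then show ?thesis
    proof
      assume "s \<in> keys (q * var 3 ^ (M - \<kappa>))"
      then obtain s1 s2 where "s = s1 + s2" "s1 \<in> keys q" "s2 \<in> keys (var 3 ^ (M - \<kappa>) :: 'a cring)"
        using keys_mult[of q "var 3 ^ (M - \<kappa>)"] by blast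
      then show ?thesis using keyz[OF kq] by (auto simp: var_power lookup_add lookup_single when_def split: if_splits)
    next
      assume "s \<in> keys (hmg (M + 1) rest)"
      then show ?thesis using keyz[OF kr] by (auto dest!: keys_hmg simp: lookup_add lookup_single when_def)
    qed
  qed
  have tq: "cst t * var 3 ^ \<kappa> * (q * var 3 ^ (M - \<kappa>)) = var 3 ^ M * (var 2 ^ \<kappa> * var 0)"
  proof -
    have "cst t * var 3 ^ \<kappa> * (q * var 3 ^ (M - \<kappa>)) = (cst t * cst (inverse t)) * (var 3 ^ \<kappa> * var 3 ^ (M - \<kappa>)) * (var 2 ^ \<kappa> * var 0)"
      by (simp only: q_def mult_ac)
    also have "cst t * cst (inverse t) = (1 :: 'a cring)" using t0 by (simp flip: cst_mult)
    also have "var 3 ^ \<kappa> * var 3 ^ (M - \<kappa>) = (var 3 ^ M :: 'a cring)" using kM by (simp flip: power_add)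
    finally show ?thesis by simp
  qed
  have "var 3 ^ M * (cst t * var 3 ^ \<kappa> * var 1 - var 2 ^ \<kappa> * var 0) - cst t * var 3 ^ \<kappa> * F
      = cst t * var 3 ^ \<kappa> * (q * var 3 ^ (M - \<kappa>)) - var 3 ^ M * (var 2 ^ \<kappa> * var 0) + cst t * var 3 ^ \<kappa> * hmg (M + 1) rest"
    unfolding F_def H_def by (simp add: algebra_simps)
  also have "\<dots> = cst t * var 3 ^ \<kappa> * hmg (M + 1) rest" by (simp only: tq diff_self add_0)
  also have "\<dots> \<in> vpow V 2" by (intro idl_mult[OF idl_vpow] hmg_vpow rest2)
  finally show ?thesis using that[OF F_def kH hF th] by blast
qed

text \<open>Weights $2$ and $3$ for $y$ and $z$; modulo $x^d$ and after multiplication by a power of $z$, the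
  element \<open>f\<close> is a polynomial in $\varphi$ and $z$ of bounded weight.\<close>

definition Good :: "int \<Rightarrow> 'a cring \<Rightarrow> bool"
  where "Good c f \<longleftrightarrow> (\<exists>N \<Psi>. (\<forall>s\<in>keys \<Psi>. lookup s 0 = 0 \<and> lookup s 3 = 0 \<and> int (2 * lookup s 1 + 3 * lookup s 2) \<le> c + 3 * int N) \<and>
     var 2 ^ N * f - theta \<Psi> \<in> vpow {0} d)"

lemma GoodI: "(\<And>s. s \<in> keys \<Psi> \<Longrightarrow> lookup s 0 = 0 \<and> lookup s 3 = 0 \<and> int (2 * lookup s 1 + 3 * lookup s 2) \<le> c + 3 * int N) \<Longrightarrow>
     var 2 ^ N * f - theta \<Psi> \<in> vpow {0} d \<Longrightarrow> Good c f"
  unfolding Good_def by blast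

text \<open>A factor z raises the weight and its bound alike by 3, so N may be taken arbitrarily
  large; sums need a common power of z.\<close>

lemma Good_raise:
  assumes "Good c f"
  shows "\<exists>N0. \<forall>N\<ge>N0. \<exists>\<Psi>. (\<forall>s\<in>keys \<Psi>. lookup s 0 = 0 \<and> lookup s 3 = 0 \<and> int (2 * lookup s 1 + 3 * lookup s 2) \<le> c + 3 * int N) \<and>
     var 2 ^ N * f - theta \<Psi> \<in> vpow {0} d"
proof -
  obtain N \<Psi> where N: "\<And>s. s \<in> keys \<Psi> \<Longrightarrow> lookup s 0 = 0 \<and> lookup s 3 = 0 \<and> int (2 * lookup s 1 + 3 * lookup s 2) \<le> c + 3 * int N"
    "var 2 ^ N * f - theta \<Psi> \<in> vpow {0} d" using assms unfolding Good_def by blast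
  show ?thesis
  proof (intro exI[of _ N] allI impI exI conjI ballI)
    fix M s assume M: "M \<ge> N" and s: "s \<in> keys (var 2 ^ (M - N) * \<Psi>)"
    then obtain s' where "s = single 2 (M - N) + s'" "s' \<in> keys \<Psi>"
      using keys_mult[of "var 2 ^ (M - N)" \<Psi>] by (auto simp: var_power split: if_splits)
    then show "lookup s 0 = 0" "lookup s 3 = 0" "int (2 * lookup s 1 + 3 * lookup s 2) \<le> c + 3 * int M"
      using N(1)[of s'] M by (auto simp: lookup_add lookup_single when_def of_nat_diff)
  next
    fix M assume M: "M \<ge> N"
    have "var 2 ^ (M - N) * (var 2 ^ N * f - theta \<Psi>) \<in> vpow {0} d" by (intro idl_mult[OF idl_vpow] N)
    moreover have "var 2 ^ (M - N) * (var 2 ^ N * f - theta \<Psi>) = var 2 ^ M * f - theta (var 2 ^ (M - N) * \<Psi>)"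
    proof -
      have "var 2 ^ M = var 2 ^ (M - N) * (var 2 ^ N :: 'a cring)" using M by (simp flip: power_add)
      then show ?thesis by (simp only: theta_simps(2,4) theta_var right_diff_distrib mult.assoc)
    qed
    ultimately show "var 2 ^ M * f - theta (var 2 ^ (M - N) * \<Psi>) \<in> vpow {0} d" by simp
  qed
qed

lemma Good_add:
  assumes "Good c f" "Good c f'" shows "Good c (f + f')"
proof -
  obtain N0 N0' where N0: "\<And>N. N \<ge> N0 \<Longrightarrow> \<exists>\<Psi>. (\<forall>s\<in>keys \<Psi>. lookup s 0 = 0 \<and> lookup s 3 = 0 \<and> int (2 * lookup s 1 + 3 * lookup s 2) \<le> c + 3 * int N) \<and>
     var 2 ^ N * f - theta \<Psi> \<in> vpow {0} d" "\<And>N. N \<ge> N0' \<Longrightarrow> \<exists>\<Psi>. (\<forall>s\<in>keys \<Psi>. lookup s 0 = 0 \<and> lookup s 3 = 0 \<and> int (2 * lookup s 1 + 3 * lookup s 2) \<le> c + 3 * int N) \<and>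
     var 2 ^ N * f' - theta \<Psi> \<in> vpow {0} d" using Good_raise[OF assms(1)] Good_raise[OF assms(2)] by blast
  define N where "N = max N0 N0'"
  obtain \<Psi> \<Psi>' where P: "\<And>s. s \<in> keys \<Psi> \<Longrightarrow> lookup s 0 = 0 \<and> lookup s 3 = 0 \<and> int (2 * lookup s 1 + 3 * lookup s 2) \<le> c + 3 * int N"
    "var 2 ^ N * f - theta \<Psi> \<in> vpow {0} d" "\<And>s. s \<in> keys \<Psi>' \<Longrightarrow> lookup s 0 = 0 \<and> lookup s 3 = 0 \<and> int (2 * lookup s 1 + 3 * lookup s 2) \<le> c + 3 * int N"
    "var 2 ^ N * f' - theta \<Psi>' \<in> vpow {0} d"
    using N0(1)[of N] N0(2)[of N] unfolding N_def by (meson max.cobounded1 max.cobounded2)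
  show ?thesis
  proof (rule GoodI[of "\<Psi> + \<Psi>'"])
    fix s assume "s \<in> keys (\<Psi> + \<Psi>')"
    then have "s \<in> keys \<Psi> \<or> s \<in> keys \<Psi>'" using Poly_Mapping.keys_add[of \<Psi> \<Psi>'] by blast
    then show "lookup s 0 = 0 \<and> lookup s 3 = 0 \<and> int (2 * lookup s 1 + 3 * lookup s 2) \<le> c + 3 * int N"
      using P(1,3) by blast
  next
    show "var 2 ^ N * (f + f') - theta (\<Psi> + \<Psi>') \<in> vpow {0} d"
      unfolding distrib_left theta_simps(1) by (rule idl_add_cong[OF idl_vpow P(2,4)])
  qed
qed

lemma Good_cst:
  assumes "Good c f" shows "Good c (cst b * f)"
proof -
  obtain N \<Psi> where N: "\<And>s. s \<in> keys \<Psi> \<Longrightarrow> lookup s 0 = 0 \<and> lookup s 3 = 0 \<and> int (2 * lookup s 1 + 3 * lookup s 2) \<le> c + 3 * int N"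
    "var 2 ^ N * f - theta \<Psi> \<in> vpow {0} d" using assms unfolding Good_def by blast
  show ?thesis
  proof (rule GoodI[of "cst b * \<Psi>"])
    fix s assume "s \<in> keys (cst b * \<Psi>)"
    then have "s \<in> keys \<Psi>" using keys_scal[of b \<Psi>] by (auto simp: scal_eq)
    then show "lookup s 0 = 0 \<and> lookup s 3 = 0 \<and> int (2 * lookup s 1 + 3 * lookup s 2) \<le> c + 3 * int N" by (rule N)
  next
    have "cst b * (var 2 ^ N * f - theta \<Psi>) \<in> vpow {0} d" by (rule idl_mult[OF idl_vpow N(2)])
    then show "var 2 ^ N * (cst b * f) - theta (cst b * \<Psi>) \<in> vpow {0} d"
      by (simp only: theta_simps(2,6) right_diff_distrib mult.left_commute)
  qed
qed

lemma Good_vpow: "f \<in> vpow {0} d \<Longrightarrow> Good c f"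
  by (rule GoodI[of 0 c 0]) (simp_all add: theta_simps)

lemma Good_sum: "(\<And>a. a \<in> A \<Longrightarrow> Good c (F a)) \<Longrightarrow> Good c (sum F A)"
  by (induction A rule: infinite_finite_induct) (auto intro: Good_add Good_vpow idl_0[OF idl_vpow])

lemma Good_mono: "Good c f \<Longrightarrow> c \<le> c' \<Longrightarrow> Good c' f"
  unfolding Good_def by (meson add_right_mono order_trans)

lemma Good_shift: "Good (c + 3 * int k) (var 2 ^ k * f) \<Longrightarrow> Good c f"
proof -
  assume "Good (c + 3 * int k) (var 2 ^ k * f)"
  then obtain N \<Psi> where N: "\<And>s. s \<in> keys \<Psi> \<Longrightarrow> lookup s 0 = 0 \<and> lookup s 3 = 0 \<and> int (2 * lookup s 1 + 3 * lookup s 2) \<le> c + 3 * int k + 3 * int N"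
    "var 2 ^ N * (var 2 ^ k * f) - theta \<Psi> \<in> vpow {0} d" unfolding Good_def by blast
  show ?thesis
  proof (rule GoodI[of \<Psi> c "N + k"])
    fix s assume "s \<in> keys \<Psi>"
    from N(1)[OF this] show "lookup s 0 = 0 \<and> lookup s 3 = 0 \<and> int (2 * lookup s 1 + 3 * lookup s 2) \<le> c + 3 * int (N + k)"
      by simp
  qed (use N(2) in \<open>simp add: power_add mult.assoc\<close>)
qed

text \<open>The rewriting rule: t phi = x z^a g(x, phi, z) modulo x^d, solved for the contribution x
  z^a z^m of the leading monomial of g.\<close>

lemma z_kappa_x:
  "var 2 ^ \<kappa> * var 0 - (cst t * phi K + (\<Sum>s\<in>keys g - {single 2 m}. cst (- lookup g s) * (var 0 ^ (lookup s 0 + 1) * phi K ^ lookup s 1 * var 2 ^ (lookup s 2 + a)))) \<in> vpow {0} d"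
proof -
  let ?T = "\<lambda>s. cst (lookup g s) * (var 0 ^ lookup s 0 * phi K ^ lookup s 1 * var 2 ^ lookup s 2)"
  have zm: "single 2 m \<in> keys g" using lookup_g_zm by (simp add: in_keys_iff)
  have "gx (var 0) (phi K) (var 2) = ?T (single 2 m) + (\<Sum>s\<in>keys g - {single 2 m}. ?T s)"
    unfolding gx_sum by (rule sum.remove[OF finite_keys zm])
  also have "?T (single 2 m) = var 2 ^ m" by (simp add: lookup_g_zm lookup_single when_def)
  finally have gxe: "gx (var 0) (phi K) (var 2) = var 2 ^ m + (\<Sum>s\<in>keys g - {single 2 m}. ?T s)" .
  have tt: "cst t * cst (inverse t) = (1 :: 'a cring)" using t0 by (simp flip: cst_mult)
  have "cst t * phi (Suc K) = (cst t * cst (inverse t)) * (var 0 * var 2 ^ a * gx (var 0) (phi K) (var 2))"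
    by (simp add: mult_ac)
  also have "\<dots> = var 2 ^ \<kappa> * var 0 + (\<Sum>s\<in>keys g - {single 2 m}. var 0 * var 2 ^ a * ?T s)"
    unfolding tt gxe by (simp add: \<kappa>_def power_add algebra_simps sum_distrib_left)
  also have "(\<Sum>s\<in>keys g - {single 2 m}. var 0 * var 2 ^ a * ?T s) =
     - (\<Sum>s\<in>keys g - {single 2 m}. cst (- lookup g s) * (var 0 ^ (lookup s 0 + 1) * phi K ^ lookup s 1 * var 2 ^ (lookup s 2 + a)))"
    unfolding sum_negf[symmetric]
  proof (rule sum.cong)
    fix s
    have "cst (- lookup g s) = (- cst (lookup g s) :: 'a cring)" by (simp add: cst_def single_uminus)
    then show "var 0 * var 2 ^ a * ?T s = - (cst (- lookup g s) * (var 0 ^ (lookup s 0 + 1) * phi K ^ lookup s 1 * var 2 ^ (lookup s 2 + a)))"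
      by (simp add: power_add mult_ac)
  qed simp
  finally have e: "var 2 ^ \<kappa> * var 0 - (cst t * phi K + (\<Sum>s\<in>keys g - {single 2 m}. cst (- lookup g s) * (var 0 ^ (lookup s 0 + 1) * phi K ^ lookup s 1 * var 2 ^ (lookup s 2 + a)))) = cst t * (phi (Suc K) - phi K)"
    by (simp only: right_diff_distrib) (simp del: phi.simps)
  have "phi (Suc K) - phi K \<in> vpow {0} d"
    using phi_Suc_diff[of K] vpow_mono[of d "Suc K" "{0}"] K by auto
  then show ?thesis unfolding e by (rule idl_mult[OF idl_vpow])
qed

text \<open>Apply \<open>z_kappa_x\<close> to one factor x. The term with phi has one x less and
  saves the weight 3\<kappa> - 1; the others keep their weight, since g is homogeneous of weight 3m,
  but have larger order p + q. The saving is claimed once, however many factors x are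
  present.\<close>

lemma Good_mon:
  "Good (int (p + 2 * q + 3 * k) - (if p > 0 then 3 * int \<kappa> - 1 else 0)) (var 0 ^ p * phi K ^ q * var 2 ^ k)"
proof (induction "(d - (p + q), p)" arbitrary: p q k rule: wf_induct_rule[OF wf_lex_prod[OF wf_less_than wf_less_than]])
  case 1
  note IH = 1
  let ?f = "var 0 ^ p * phi K ^ q * var 2 ^ k" and ?\<tau> = "3 * int \<kappa> - 1"
  have pw: "phi K ^ q \<in> vpow {0} q" for q
  proof (induction q)
    case (Suc q)
    then show ?case using vpow_mult[OF phi_vpow Suc] by (simp add: plus_1_eq_Suc)
  qed (simp add: vpow_def)
  show ?case
  proof (cases "p + q < d")
    case False
    have "var 0 ^ p * phi K ^ q \<in> vpow {0} (p + q)" by (intro vpow_mult var_power_in_vpow pw) simp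
    then have "var 0 ^ p * phi K ^ q \<in> vpow {0} d" using vpow_mono[of d "p + q" "{0}"] False by auto
    then have "?f \<in> vpow {0} d" by (rule idl_mult_right[OF idl_vpow])
    then show ?thesis by (rule Good_vpow)
  next
    case lt: True
    show ?thesis
    proof (cases "p = 0")
      case True
      show ?thesis
      proof (rule GoodI[of "var 1 ^ q * var 2 ^ k" _ 0])
        fix s assume "s \<in> keys (var 1 ^ q * var 2 ^ k :: 'a cring)"
        then have "s = single 1 q + single 2 k" by (simp add: var_power mult_single split: if_splits)
        then show "lookup s 0 = 0 \<and> lookup s 3 = 0 \<and> int (2 * lookup s 1 + 3 * lookup s 2) \<le> int (p + 2 * q + 3 * k) - (if p > 0 then ?\<tau> else 0) + 3 * int 0"
          using True by (simp add: lookup_add lookup_single when_def)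
      next
        have "var 2 ^ 0 * ?f - theta (var 1 ^ q * var 2 ^ k) = 0"
          using True by (simp only: theta_simps(2,4) theta_var) simp
        then show "var 2 ^ 0 * ?f - theta (var 1 ^ q * var 2 ^ k) \<in> vpow {0} d" by (simp only: idl_0[OF idl_vpow])
      qed
    next
      case False
      then obtain p' where p: "p = Suc p'" by (cases p) auto
      let ?c = "int (p + 2 * q + 3 * k) - ?\<tau> + 3 * int \<kappa>"
      let ?M = "var 0 ^ p' * phi K ^ q * var 2 ^ k"
      let ?R = "\<Sum>s\<in>keys g - {single 2 m}. cst (- lookup g s) * (var 0 ^ (lookup s 0 + 1) * phi K ^ lookup s 1 * var 2 ^ (lookup s 2 + a))"
      have G1: "Good ?c (cst t * (var 0 ^ p' * phi K ^ (q + 1) * var 2 ^ k))"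
      proof (rule Good_cst, rule Good_mono)
        show "Good (int (p' + 2 * (q + 1) + 3 * k) - (if p' > 0 then ?\<tau> else 0)) (var 0 ^ p' * phi K ^ (q + 1) * var 2 ^ k)"
          by (rule IH) (simp add: p One_nat_def)
        \<comment> \<open>For p = 1 both sides agree: z^\<kappa> x has weight 3\<kappa> + 1, and phi
          counts 2.\<close>
        show "int (p' + 2 * (q + 1) + 3 * k) - (if p' > 0 then ?\<tau> else 0) \<le> ?c" using m2 by (simp add: p \<kappa>_def)
      qed
      have G2: "Good ?c (cst (- lookup g s) * (var 0 ^ (p + lookup s 0) * phi K ^ (q + lookup s 1) * var 2 ^ (k + (lookup s 2 + a))))"
        if s: "s \<in> keys g - {single 2 m}" for s
      proof (rule Good_cst, rule Good_mono)
        show "Good (int (p + lookup s 0 + 2 * (q + lookup s 1) + 3 * (k + (lookup s 2 + a))) - (if p + lookup s 0 > 0 then ?\<tau> else 0))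
          (var 0 ^ (p + lookup s 0) * phi K ^ (q + lookup s 1) * var 2 ^ (k + (lookup s 2 + a)))"
        proof (rule IH)
          \<comment> \<open>Every monomial of g other than z^m contains x or y, so the order p + q
            grows and the first component of the measure drops.\<close>
          have "lookup s 0 + lookup s 1 > 0" by (rule keys_g_pos) (use s in simp_all)
          then show "((d - (p + lookup s 0 + (q + lookup s 1)), p + lookup s 0), d - (p + q), p) \<in> less_than <*lex*> less_than"
            using lt by auto
        qed
        have "lookup s 0 + 2 * lookup s 1 + 3 * lookup s 2 = 3 * m" by (rule keys_g(1)) (use s in simp)
        then have "p + lookup s 0 + 2 * (q + lookup s 1) + 3 * (k + (lookup s 2 + a)) = p + 2 * q + 3 * k + 3 * \<kappa>"
          unfolding \<kappa>_def by (simp add: algebra_simps)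
        then have "int (p + lookup s 0 + 2 * (q + lookup s 1) + 3 * (k + (lookup s 2 + a))) = int (p + 2 * q + 3 * k + 3 * \<kappa>)"
          by (simp only:)
        then have "int (p + lookup s 0 + 2 * (q + lookup s 1) + 3 * (k + (lookup s 2 + a))) = int (p + 2 * q + 3 * k) + 3 * int \<kappa>"
          by simp
        then show "int (p + lookup s 0 + 2 * (q + lookup s 1) + 3 * (k + (lookup s 2 + a))) - (if p + lookup s 0 > 0 then ?\<tau> else 0) \<le> ?c"
          using p by simp
      qed
      have e: "var 2 ^ \<kappa> * ?f = cst t * (var 0 ^ p' * phi K ^ (q + 1) * var 2 ^ k)
         + (\<Sum>s\<in>keys g - {single 2 m}. cst (- lookup g s) * (var 0 ^ (p + lookup s 0) * phi K ^ (q + lookup s 1) * var 2 ^ (k + (lookup s 2 + a))))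
         + ?M * (var 2 ^ \<kappa> * var 0 - (cst t * phi K + ?R))"
      proof -
        have "?M * ?R = (\<Sum>s\<in>keys g - {single 2 m}. cst (- lookup g s) * (var 0 ^ (p + lookup s 0) * phi K ^ (q + lookup s 1) * var 2 ^ (k + (lookup s 2 + a))))"
          unfolding sum_distrib_left by (rule sum.cong) (simp_all add: p power_add mult_ac)
        moreover have "?M * (cst t * phi K) = cst t * (var 0 ^ p' * phi K ^ (q + 1) * var 2 ^ k)"
          by (simp add: power_add mult_ac)
        moreover have "?M * (var 2 ^ \<kappa> * var 0) = var 2 ^ \<kappa> * ?f" by (simp add: p mult_ac)
        ultimately show ?thesis by (simp only: right_diff_distrib distrib_left) simp
      qed
      have "Good ?c (var 2 ^ \<kappa> * ?f)"
        unfolding e by (intro Good_add Good_sum G1 G2 Good_vpow idl_mult[OF idl_vpow] z_kappa_x)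
      then have "Good (int (p + 2 * q + 3 * k) - ?\<tau>) ?f" by (rule Good_shift)
      then show ?thesis using p by simp
    qed
  qed
qed

text \<open>The equation near w = 0. By \<open>Good_mon\<close>, x z^N is congruent to a polynomial
  in phi and z of weight at most 3 N + 2 - 3\<kappa>; the bound on weights is turned into a bound on
  degrees so that homogenising in degree N + 1 is possible.\<close>

lemma exists_Fz:
  obtains N F H where "F = var 0 * var 2 ^ N - H" "\<And>s. s \<in> keys H \<Longrightarrow> lookup s 0 = 0" "homog (int (N + 1)) F"
    "theta F \<in> vpow {0} d"
proof -
  have "Good (2 - 3 * int \<kappa>) (var 0)"
    using Good_mon[of 1 0 0] by (simp add: One_nat_def)
  then obtain N \<Psi> where P: "\<And>s. s \<in> keys \<Psi> \<Longrightarrow> lookup s 0 = 0 \<and> lookup s 3 = 0 \<and> int (2 * lookup s 1 + 3 * lookup s 2) \<le> 2 - 3 * int \<kappa> + 3 * int N"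
    "var 2 ^ N * var 0 - theta \<Psi> \<in> vpow {0} d" unfolding Good_def by blast
  \<comment> \<open>Monomials with \<open>d\<close> or more factors phi vanish modulo x^d and are
    dropped; the passage from weight to degree needs fewer than \<open>d\<close> such
    factors.\<close>
  define A where "A = {s :: 4 \<Rightarrow>\<^sub>0 nat. lookup s 1 < d}"
  define \<Psi>' where "\<Psi>' = restr A \<Psi>"
  have "restr (- A) \<Psi> \<in> vpow {1} d" by (auto simp: vpow_def keys_restr A_def vdeg_def)
  then obtain f' where f': "restr (- A) \<Psi> = var 1 ^ d * f'" using vpow_single_factor by blast
  have "phi K ^ d \<in> vpow {0} d"
  proof -
    have "phi K ^ q \<in> vpow {0} q" for q
    proof (induction q)
      case (Suc q)
      then show ?case using vpow_mult[OF phi_vpow Suc] by (simp add: plus_1_eq_Suc)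
    qed (simp add: vpow_def)
    then show ?thesis .
  qed
  then have "theta (restr (- A) \<Psi>) \<in> vpow {0} d"
    unfolding f' theta_simps(2,4) theta_var by (rule idl_mult_right[OF idl_vpow])
  moreover have "theta \<Psi> = theta \<Psi>' + theta (restr (- A) \<Psi>)"
    unfolding \<Psi>'_def theta_simps(1)[symmetric] by (simp flip: restr_compl)
  ultimately have P': "var 2 ^ N * var 0 - theta \<Psi>' \<in> vpow {0} d"
    using idl_add[OF idl_vpow P(2)] by fastforce
  define F where "F = var 0 * var 2 ^ N - hmg (N + 1) \<Psi>'"
  have kd: "mon_deg s \<le> N" "lookup s 0 = 0" if "s \<in> keys \<Psi>'" for s
  proof -
    have s: "s \<in> keys \<Psi>" "lookup s 1 < d" using that by (auto simp: \<Psi>'_def keys_restr A_def)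
    then show "lookup s 0 = 0" using P by blast
    \<comment> \<open>Here d = 3m - 1 is used. For y^i z^j one has 3 (i + j) = (2 i + 3 j) + i \<le>
      3 N + 2 - 3\<kappa> + d - 1 \<le> 3 N.\<close>
    have "int d \<le> 3 * int \<kappa> - 1" using dm m2 by (simp add: \<kappa>_def of_nat_diff)
    then show "mon_deg s \<le> N" using P(1)[OF s(1)] s(2) by (simp add: mon_deg_def sum_UNIV_4)
  qed
  show ?thesis
  proof (rule that[OF F_def])
    show "lookup s 0 = 0" if "s \<in> keys (hmg (N + 1) \<Psi>')" for s
      using that kd(2) by (auto dest!: keys_hmg simp: lookup_add lookup_single when_def)
    have "homog (1 + int N) (var 0 * var 2 ^ N :: 'a cring)" by (intro homog_mult homog_var homog_var_power)
    moreover have "homog (int (N + 1)) (hmg (N + 1) \<Psi>')" using kd(1) by (intro homog_hmg) (meson le_add1 order_trans)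
    ultimately show "homog (int (N + 1)) F" unfolding F_def by (intro homog_diff) (simp_all add: add.commute)
    show "theta F \<in> vpow {0} d"
      using P' unfolding F_def theta_simps(2-4) theta_hmg theta_var by (simp only: mult.commute)
  qed
qed

end

section \<open>Smoothness, degree and type of the constructed curves\<close>

lemma line_L_eq: "line_L = assoc_sheaf (vpow {0, 1} 1)"
  by (simp add: line_L_def flip: ideal_gen_vars)

lemma lprim_vpow: "lprim V (vpow V 1 :: 'a::field cring set)"
  unfolding lprim_def using idl_vpow vpow_prime by blast

lemma support_line:
  "support (assoc_sheaf (vpow V 1 :: 'a::field cring set)) = {P \<in> points. vpow V 1 \<subseteq> P}"
proof -
  have "support (assoc_sheaf (vpow V 1 \<inter> vpow V 1 :: 'a cring set)) = {P \<in> points. vpow V 1 \<subseteq> P \<or> vpow V 1 \<subseteq> P}"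
    by (rule support_lprim2[OF lprim_vpow lprim_vpow])
  then show ?thesis by simp
qed

lemma is_line_L: "is_line (line_L :: 'a::field sheaf)"
  unfolding is_line_def
proof (rule exI[of _ "var 0"], rule exI[of _ "var 1"], intro conjI allI impI)
  fix \<alpha> \<beta> :: 'a
  assume e: "scal \<alpha> (var 0) + scal \<beta> (var 1) = (0 :: 'a cring)"
  have "single (1 :: 4) (1 :: nat) \<noteq> single 0 1"
  proof
    assume "single (1 :: 4) (1 :: nat) = single 0 1"
    from arg_cong[OF this, of "\<lambda>s. lookup s 1"] show False by (simp add: lookup_single when_def)
  qed
  then have "lookup (scal \<alpha> (var 0) + scal \<beta> (var 1) :: 'a cring) (single 0 1) = \<alpha>"
    "lookup (scal \<alpha> (var 0) + scal \<beta> (var 1) :: 'a cring) (single 1 1) = \<beta>"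
    by (auto simp: lookup_add scal_eq lookup_cst_mult lookup_single when_def)
  then show "\<alpha> = 0" "\<beta> = 0" using e by simp_all
qed (simp_all add: homog_var line_L_def)

context pline
begin

lemma support_idealC: "support (assoc_sheaf idealC) = {P \<in> points. vpow V 1 \<subseteq> P}"
  using support_lprim2[OF lprim_idealC lprim_idealC] by simp

end

context ctK
begin

text \<open>The equation \<open>G\<close> has the right linear part by construction. For
  \<open>F\<close> the linear part is pinned down by the vanishing of \<open>Dp\<close>: every
  element of the ideal, vanishing to order two on the parametrised curve, is tangent to it.\<close>

lemma exists_span:
  assumes rd: "r \<le> d"
  shows "\<exists>N \<iota>z \<iota>w. pline_span 0 1 2 3 (PhiQ K) t \<kappa> r N \<iota>z \<iota>w"
proof -
  \<comment> \<open>The multiplicity r may be 1, whereas \<open>Dp_idealC\<close> needs at least 2;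
    as \<open>F\<close> vanishes to order \<open>d\<close>, it is treated with multiplicity
    \<open>d\<close>.\<close>
  interpret D: ctK m d a g t K d
    by unfold_locales (use K dm m2 in simp_all)
  let ?f0 = "cst t * var 3 ^ \<kappa> * var 1 - var 2 ^ \<kappa> * var 0 :: 'a cring"
  obtain Nz F H where F: "F = var 0 * var 2 ^ Nz - H" "\<And>s. s \<in> keys H \<Longrightarrow> lookup s 0 = 0" "homog (int (Nz + 1)) F"
    "theta F \<in> vpow {0} d" by (rule exists_Fz, (rule that; assumption))
  obtain M G H' where G: "G = var 1 * var 3 ^ M - H'" "\<And>s. s \<in> keys H' \<Longrightarrow> lookup s 1 = 0" "homog (int (M + 1)) G"
    "theta G = 0" "var 3 ^ M * ?f0 - cst t * var 3 ^ \<kappa> * G \<in> vpow V 2" by (rule exists_Fw, (rule that; assumption))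
  have FD: "F \<in> D.idealC" using F(4) by (simp add: D.idealC_def)
  have F1: "F \<in> vpow V 1" by (rule lprim_sub[OF D.lprim_idealC FD F(3)])
  have Fr: "F \<in> idealC" using F(4) vpow_mono[OF rd, of "{0}"] by (auto simp: idealC_def)
  have Gr: "G \<in> idealC" by (simp add: idealC_def G(4) idl_0[OF idl_vpow])
  have d2: "d \<ge> 2" using dm m2 by simp
  \<comment> \<open>The terms with x cancel in this combination, so it is y times some q. Since
    \<open>Dp\<close> of it is z^\<kappa> q on the line and vanishes, q vanishes on the line and the
    combination is of second order.\<close>
  let ?L = "var 2 ^ Nz * ?f0 + var 2 ^ \<kappa> * F"
  have kf0: "kill V ?f0 = 0" by (simp add: kill_simps)
  have kF: "kill V F = 0" using F1 by (simp add: kill_eq_0)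
  have kv: "kill V (var 1) = 0" "kill V (var 0) = (0 :: 'a cring)" "kill V (var 2) = (var 2 :: 'a cring)" "kill V (var 3) = (var 3 :: 'a cring)"
    by (simp_all add: kill_simps)
  have "Dp ?f0 = cst t * var 3 ^ \<kappa> * var 2 ^ \<kappa> - var 2 ^ \<kappa> * (cst t * var 3 ^ \<kappa>)"
    by (simp only: Dp_simps kill_simps(2,4,6) kv Dp_var) simp
  then have "Dp ?f0 = 0" by (simp add: mult_ac)
  moreover have "Dp F = 0" by (rule D.Dp_idealC[OF FD F(3) d2])
  ultimately have DL: "Dp ?L = 0" by (simp only: Dp_simps kf0 kF) simp
  have L1: "?L \<in> vpow V 1"
    using kf0 F1 by (intro idl_add[OF idl_vpow] idl_mult[OF idl_vpow]) (simp_all only: kill_eq_0)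
  have "?L = cst t * var 2 ^ Nz * var 3 ^ \<kappa> * var 1 - var 2 ^ \<kappa> * H"
    unfolding F(1) by (simp add: algebra_simps)
  moreover have "kill {0} H = H" unfolding kill_eq_restr by (rule restr_id) (use F(2) in \<open>auto simp: vdeg_def\<close>)
  ultimately have "kill {0} ?L = ?L" by (simp add: kill_simps)
  then have "lookup s 0 = 0" if "s \<in> keys ?L" for s
  proof -
    have "s \<in> keys (restr {s. vdeg {0} s = 0} ?L)" using that \<open>kill {0} ?L = ?L\<close> by (simp only: kill_eq_restr)
    then show ?thesis by (simp add: keys_restr vdeg_def)
  qed
  then have "?L \<in> vpow {1} 1" using L1 unfolding vpow_def by (force simp: vdegV vdeg_def)
  then obtain q where q: "?L = var 1 ^ 1 * q" using vpow_single_factor by blast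
  have "Dp ?L = var 2 ^ \<kappa> * kill V q"
    unfolding q power_one_right Dp_simps(4) Dp_var kv by simp
  then have "kill V q = 0" using DL by simp
  then have "q \<in> vpow V 1" by (simp only: kill_eq_0)
  then have "var 1 ^ 1 * q \<in> vpow V (1 + 1)" by (intro vpow_mult var_power_in_vpow) auto
  then have L2: "?L \<in> vpow V 2" unfolding q one_add_one .
  define N where "N = Nz + M"
  define \<iota>z where "\<iota>z = var 2 ^ M * (- (var 2 ^ \<kappa> * F))"
  define \<iota>w where "\<iota>w = var 3 ^ Nz * (cst t * var 3 ^ \<kappa> * G)"
  have hz: "homog (int (N + \<kappa> + 1)) \<iota>z"
  proof -
    have "homog (int M + (int \<kappa> + int (Nz + 1))) \<iota>z"
      unfolding \<iota>z_def by (intro homog_mult homog_minus homog_var_power F)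
    then show ?thesis by (simp add: N_def algebra_simps)
  qed
  have hw: "homog (int (N + \<kappa> + 1)) \<iota>w"
  proof -
    have "homog (int Nz + (0 + int \<kappa> + int (M + 1))) \<iota>w"
      unfolding \<iota>w_def by (intro homog_mult homog_cst homog_var_power G)
    then show ?thesis by (simp add: N_def algebra_simps)
  qed
  have ez: "var 2 ^ N * ?f0 - \<iota>z = var 2 ^ M * ?L"
    unfolding N_def \<iota>z_def by (simp add: power_add algebra_simps)
  have ew: "var 3 ^ N * ?f0 - \<iota>w = var 3 ^ Nz * (var 3 ^ M * ?f0 - cst t * var 3 ^ \<kappa> * G)"
    unfolding N_def \<iota>w_def by (simp add: power_add algebra_simps)
  have "pline_span 0 1 2 3 (PhiQ K) t \<kappa> r N \<iota>z \<iota>w"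
  proof (unfold_locales)
    show "\<iota>z \<in> idealC" unfolding \<iota>z_def by (intro idl_mult[OF idl_idealC] idl_minus[OF idl_idealC] Fr)
    show "\<iota>w \<in> idealC" unfolding \<iota>w_def by (intro idl_mult[OF idl_idealC] Gr)
    show "var 2 ^ N * ?f0 - \<iota>z \<in> vpow V 2" unfolding ez by (rule idl_mult[OF idl_vpow L2])
    show "var 3 ^ N * ?f0 - \<iota>w \<in> vpow V 2" unfolding ew by (rule idl_mult[OF idl_vpow G(5)])
  qed (rule hz hw)+
  then show ?thesis by blast
qed

text \<open>At a point of the line z or w is nonzero, and there the equation linear in x,
  respectively in y, defines a smooth surface through the curve.\<close>

lemma locally_smooth:
  assumes rd: "r \<le> d"
  shows "locally_in_smooth_surface line_L (assoc_sheaf idealC)"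
  unfolding locally_in_smooth_surface_def
proof
  fix P :: "'a cring set" assume "P \<in> support line_L"
  then have P: "P \<in> points" "vpow V 1 \<subseteq> P" by (simp_all add: line_L_eq support_line)
  have v: "var 0 \<in> P" "var 1 \<in> P" using P(2) var_in_vpow[of 0 V] var_in_vpow[of 1 V] by auto
  have sub: "surface F (var j) \<subseteq> assoc_sheaf idealC (var j)" if "F \<in> idealC" for F j
    using sect_mono[OF ideal_gen_least[OF idl_idealC], of "{F}" 0 "var j"] that
    by (simp add: surface_def assoc_sheaf_eq)
  obtain i where "var i \<notin> P" using points_var[OF P(1)] by blast
  then have "var 2 \<notin> P \<or> var 3 \<notin> P" using v exhaust_4[of i] by auto
  then show "\<exists>h\<in>basics. h \<notin> P \<and> (\<exists>F. smooth_surface_on h F \<and> surface F h \<subseteq> assoc_sheaf idealC h)"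
  proof
    assume h: "var 2 \<notin> P"
    obtain Nz F H where F: "F = var 0 * var 2 ^ Nz - H" "\<And>s. s \<in> keys H \<Longrightarrow> lookup s 0 = 0" "homog (int (Nz + 1)) F"
      "theta F \<in> vpow {0} d" by (rule exists_Fz, (rule that; assumption))
    have "F \<in> idealC" using F(4) vpow_mono[OF rd, of "{0}"] by (auto simp: idealC_def)
    moreover have "smooth_surface_on (var 2) F"
      using F(3) unfolding F(1) by (intro smooth_graph[OF F(2)]) auto
    ultimately show ?thesis using h sub[of F 2] var_basics by blast
  next
    assume h: "var 3 \<notin> P"
    obtain M G H' where G: "G = var 1 * var 3 ^ M - H'" "\<And>s. s \<in> keys H' \<Longrightarrow> lookup s 1 = 0" "homog (int (M + 1)) G"
      "theta G = 0" "var 3 ^ M * (cst t * var 3 ^ \<kappa> * var 1 - var 2 ^ \<kappa> * var 0) - cst t * var 3 ^ \<kappa> * G \<in> vpow V 2"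
      by (rule exists_Fw, (rule that; assumption))
    have "G \<in> idealC" by (simp add: idealC_def G(4) idl_0[OF idl_vpow])
    moreover have "smooth_surface_on (var 3) G"
      using G(3) unfolding G(1) by (intro smooth_graph[OF G(2)]) auto
    ultimately show ?thesis using h sub[of G 3] var_basics by blast
  qed
qed

lemma surface_contains: "contained_in (assoc_sheaf idealC) (surface surf)"
  unfolding contained_in_def
proof
  fix h :: "'a cring" assume h: "h \<in> basics"
  show "surface surf h \<subseteq> assoc_sheaf idealC h"
    using sect_mono[OF ideal_gen_least[OF idl_idealC], of "{surf}" 0 h] surf_idealC h
    by (simp add: surface_def assoc_sheaf_eq)
qed

lemma has_type_C:
  assumes "r \<le> d" "r \<ge> 2"
  shows "has_type line_L (assoc_sheaf idealC) (int \<kappa> - 1)"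
proof -
  obtain N \<iota>z \<iota>w where "pline_span 0 1 2 3 (PhiQ K) t \<kappa> r N \<iota>z \<iota>w" using exists_span[OF assms(1)] by blast
  then interpret S: pline_span 0 1 2 3 "PhiQ K" t \<kappa> r N \<iota>z \<iota>w .
  show ?thesis unfolding line_L_eq using assms m2 by (intro S.has_type_idealC) (simp_all add: \<kappa>_def)
qed

lemma curve_degree_C:
  assumes "r \<le> d"
  shows "curve_degree_genus (assoc_sheaf idealC) r (1 - ccoef r \<kappa>)"
proof -
  obtain N \<iota>z \<iota>w where "pline_span 0 1 2 3 (PhiQ K) t \<kappa> r N \<iota>z \<iota>w" using exists_span[OF assms] by blast
  then interpret S: pline_span 0 1 2 3 "PhiQ K" t \<kappa> r N \<iota>z \<iota>w .
  show ?thesis by (rule S.curve_degree_idealC)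
qed

end

section \<open>Uniqueness\<close>

text \<open>By Zorn's lemma there is an ideal maximal among those that contain \<open>I\<close> and
  avoid the powers of \<open>f\<close>; such an ideal is prime.\<close>

lemma prime_avoiding:
  fixes I :: "'r::comm_ring_1 set"
  assumes I: "idl I" and f: "\<And>n. f ^ n \<notin> I"
  obtains P where "idl P" "I \<subseteq> P" "\<And>a b. a * b \<in> P \<Longrightarrow> a \<in> P \<or> b \<in> P" "f \<notin> P" "1 \<notin> P"
proof -
  let ?A = "{J. idl J \<and> I \<subseteq> J \<and> (\<forall>n. f ^ n \<notin> J)}"
  have "\<exists>M\<in>?A. \<forall>X\<in>?A. M \<subseteq> X \<longrightarrow> X = M"
  proof (rule subset_Zorn_nonempty)
    show "?A \<noteq> {}" using I f by blast
    fix Ch assume Ch: "Ch \<noteq> {}" "subset.chain ?A Ch"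
    have "idl (\<Union>Ch)"
    proof (rule idlI)
      show "0 \<in> \<Union>Ch" using Ch idl_0 by (fastforce simp: subset.chain_def)
      show "x + y \<in> \<Union>Ch" if xy: "x \<in> \<Union>Ch" "y \<in> \<Union>Ch" for x y
      proof -
        obtain X Y where XY: "X \<in> Ch" "Y \<in> Ch" "x \<in> X" "y \<in> Y" using xy by blast
        then have "X \<subseteq> Y \<or> Y \<subseteq> X" using Ch(2) by (auto simp: subset_chain_def)
        then obtain Z where Z: "Z \<in> Ch" "x \<in> Z" "y \<in> Z" using XY by blast
        then have "idl Z" using Ch(2) by (auto simp: subset_chain_def)
        then show ?thesis using Z idl_add by blast
      qed
      show "r * x \<in> \<Union>Ch" if x: "x \<in> \<Union>Ch" for r x
      proof -
        obtain X where X: "X \<in> Ch" "x \<in> X" using x by blast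
        then have "idl X" using Ch(2) by (auto simp: subset_chain_def)
        then show ?thesis using X idl_mult by blast
      qed
    qed
    then show "\<Union>Ch \<in> ?A" using Ch by (fastforce simp: subset_chain_def)
  qed
  then obtain P where PA: "P \<in> ?A" and mx: "\<forall>X\<in>?A. P \<subseteq> X \<longrightarrow> X = P" by (rule bexE)
  have P: "idl P" "I \<subseteq> P" "\<And>n. f ^ n \<notin> P" using PA by simp_all
  have max: "X = P" if "idl X" "I \<subseteq> X" "\<And>n. f ^ n \<notin> X" "P \<subseteq> X" for X
  proof -
    have "X \<in> ?A" using that by simp
    then show ?thesis using mx that(4) by (simp only:)
  qed
  have ext: "\<exists>n p r. f ^ n = p + r * a \<and> p \<in> P" if a: "a \<notin> P" for a
  proof (rule ccontr)
    assume neg: "\<not> (\<exists>n p r. f ^ n = p + r * a \<and> p \<in> P)"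
    let ?X = "{p + r * a | p r. p \<in> P}"
    have "idl ?X"
    proof (rule idlI)
      show "0 \<in> ?X" using idl_0[OF P(1)] by (auto intro!: exI[of _ 0])
      fix u v assume "u \<in> ?X" "v \<in> ?X"
      then obtain p r p' r' where "u = p + r * a" "v = p' + r' * a" "p \<in> P" "p' \<in> P" by blast
      then have "u + v = (p + p') + (r + r') * a" "p + p' \<in> P" using idl_add[OF P(1)] by (auto simp: algebra_simps)
      then show "u + v \<in> ?X" by blast
    next
      fix s v assume "v \<in> ?X"
      then obtain p r where "v = p + r * a" "p \<in> P" by blast
      then have "s * v = s * p + (s * r) * a" "s * p \<in> P" using idl_mult[OF P(1)] by (auto simp: algebra_simps)
      then show "s * v \<in> ?X" by blast
    qed
    moreover have "P \<subseteq> ?X"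
    proof
      fix p assume "p \<in> P"
      moreover have "p = p + 0 * a" by simp
      ultimately show "p \<in> ?X" by blast
    qed
    ultimately have "?X = P"
    proof (intro max)
      show "I \<subseteq> ?X" using P(2) \<open>P \<subseteq> ?X\<close> by (rule order_trans)
      show "f ^ n \<notin> ?X" for n using neg by blast
    qed
    moreover have "a = 0 + 1 * a" by simp
    then have "a \<in> ?X" using idl_0[OF P(1)] by blast
    ultimately show False using a by blast
  qed
  show ?thesis
  proof (rule that[OF P(1,2)])
    show "f \<notin> P" using P(3)[of 1] by simp
    show "1 \<notin> P" using P(3)[of 0] by simp
    fix a b assume ab: "a * b \<in> P"
    show "a \<in> P \<or> b \<in> P"
    proof (rule ccontr)
      assume "\<not> (a \<in> P \<or> b \<in> P)"
      then obtain n p r n' p' r' where e: "f ^ n = p + r * a" "p \<in> P" "f ^ n' = p' + r' * b" "p' \<in> P"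
        using ext[of a] ext[of b] by blast
      have "f ^ (n + n') = p * (p' + r' * b) + (r * a) * p' + (r * r') * (a * b)"
        unfolding power_add e(1,3) by (simp add: algebra_simps)
      moreover have "p * (p' + r' * b) + (r * a) * p' + (r * r') * (a * b) \<in> P"
        by (intro idl_add[OF P(1)] idl_mult_right[OF P(1) e(2)] idl_mult[OF P(1) e(4)] idl_mult[OF P(1) ab])
      ultimately show False using P(3)[of "n + n'"] by simp
    qed
  qed
qed

section \<open>Ideals of a subscheme on the four standard charts\<close>

definition chart :: "4 \<Rightarrow> 'a::field cring \<Rightarrow> 'a cfield"
  where "chart c = peval (\<lambda>a. quot (cst a) 1) (\<lambda>i. quot (var i) (var c))"

lemma coeff_hom_quot: "coeff_hom (\<lambda>a. quot (cst a) 1 :: 'a::field cfield)"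
  by unfold_locales (simp_all add: cst_add cst_mult fract_collapse)

interpretation quot: coeff_hom "\<lambda>a. quot (cst a) 1 :: 'a::field cfield"
  by (rule coeff_hom_quot)

lemma chart_simps: "chart c (p + q) = chart c p + chart c q" "chart c (p * q) = chart c p * chart c q"
  "chart c 0 = 0" "chart c (p - q) = chart c p - chart c q" "chart c 1 = 1"
  by (simp_all add: chart_def quot.peval_simps)

lemma chart_homog:
  assumes "homog (int n) f" shows "chart c f = quot f (var c ^ n)"
proof -
  have e: "(\<lambda>i. quot (var i) (var c)) = (\<lambda>i. quot 1 (var c) * quot (var i) 1)" by simp
  have "chart c f = quot 1 (var c) ^ n * quot.ev (\<lambda>i. quot (var i) 1) f"
    unfolding chart_def e by (rule quot.peval_scale[OF assms])
  also have "quot.ev (\<lambda>i. quot (var i) 1) f = quot f 1"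
    by (rule quot.peval_unique[symmetric]) simp_all
  also have "quot 1 (var c) ^ n = quot 1 (var c ^ n)"
    by (induction n) (simp_all add: fract_collapse)
  finally show ?thesis by simp
qed

lemma chart_var: "chart c (var c) = (1 :: 'a::field cfield)"
proof -
  have "quot (1 * var c) (1 * var c) = quot 1 (1 :: 'a cring)" by (rule quot_cancel) simp_all
  then show ?thesis unfolding chart_def quot.peval_var by (simp add: fract_collapse)
qed

lemma chart_regular: "chart c f \<in> regular (var c)"
proof -
  have R: "subring (regular (var c :: 'a cring))" by simp
  have sm: "chart c (comp n f) \<in> regular (var c)" for n
    unfolding chart_homog[OF homog_comp] sections_O_eq using homog_comp[of n f] by (intro sectI) simp_all
  have "chart c f = (\<Sum>n\<in>mon_deg ` keys f. chart c (comp n f))"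
    by (subst sum_restr_level[of f mon_deg]) (simp only: chart_def quot.peval_sum)
  also have "\<dots> \<in> regular (var c)"
    using R sm by (intro submod_sum[of "regular (var c)"]) (auto simp: subring_def submod_def)
  finally show ?thesis .
qed

text \<open>The ideal on the chart, pulled back along dehomogenisation to all four variables, so
  that it can be compared directly with \<open>idealC\<close>; it contains
  \<open>var c - 1\<close>.\<close>

definition chart_ideal :: "'a::field sheaf \<Rightarrow> 4 \<Rightarrow> 'a cring set"
  where "chart_ideal C c = {f. chart c f \<in> C (var c)}"

context
  fixes C :: "'a::field sheaf" assumes C: "closed_subscheme C"
begin

lemma idl_chart_ideal: "idl (chart_ideal C c)"
proof (rule idlI)
  have sm: "submod (regular (var c)) (C (var c))" by (rule closed_subscheme_submod[OF C var_basics])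
  show "0 \<in> chart_ideal C c" using sm by (simp add: chart_ideal_def chart_simps submod_def)
  show "f + g \<in> chart_ideal C c" if "f \<in> chart_ideal C c" "g \<in> chart_ideal C c" for f g
    using sm that by (simp add: chart_ideal_def chart_simps submod_def)
  show "r * f \<in> chart_ideal C c" if "f \<in> chart_ideal C c" for r f
  proof -
    have "chart c r \<in> regular (var c)" by (rule chart_regular)
    then show ?thesis using sm that by (simp add: chart_ideal_def chart_simps submod_def)
  qed
qed

lemma chart_ideal_var: "var c - 1 \<in> chart_ideal C c"
  using idl_0[OF idl_chart_ideal[of c]] by (simp add: chart_ideal_def chart_simps chart_var)

lemma chart_ideal_homog: "homog (int n) f \<Longrightarrow> f \<in> chart_ideal C c \<longleftrightarrow> quot f (var c ^ n) \<in> C (var c)"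
  by (simp add: chart_ideal_def chart_homog)

text \<open>The passage from D_+(h) to a chart goes through their intersection and costs a power of
  \<open>h\<close>.\<close>

lemma chart_ideal_loc:
  assumes h: "h \<in> basics" and X: "X \<in> C h" "X = quot f (h ^ r)" "homog (int r * int (tot_deg h)) f"
  shows "\<exists>j. h ^ j * f \<in> chart_ideal C c"
proof -
  have "X \<in> C (h * var c)"
    using X(1) unfolding closed_subscheme_loc[OF C h var_basics] by (intro CollectI exI[of _ 0]) simp
  then have "X \<in> C (var c * h)" by (simp only: mult.commute)
  then obtain k where k: "loc_unit (var c) h ^ k * X \<in> C (var c)"
    unfolding closed_subscheme_loc[OF C var_basics h] by blast
  have sm: "submod (regular (var c)) (C (var c))" by (rule closed_subscheme_submod[OF C var_basics])
  have "loc_unit (var c) h ^ r \<in> regular (var c)"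
    by (rule subring_power[OF subring_regular[OF var_basics] loc_unit_regular[OF var_basics h]])
  then have "loc_unit (var c) h ^ r * (loc_unit (var c) h ^ k * X) \<in> C (var c)" using k sm unfolding submod_def by blast
  moreover have "loc_unit (var c) h ^ r * (loc_unit (var c) h ^ k * X) = quot (h ^ k * f) (var c ^ (tot_deg h * (r + k)))"
  proof -
    have "loc_unit (var c) h ^ r * (loc_unit (var c) h ^ k * X) = loc_unit (var c) h ^ (r + k) * X"
      by (simp only: power_add mult.assoc)
    also have "\<dots> = quot (h ^ (r + k) * f) (var c ^ (tot_deg h * (r + k)) * h ^ r)"
      unfolding loc_unit_power X(2) tot_deg_var by simp
    also have "h ^ (r + k) * f = (h ^ k * f) * h ^ r" by (simp add: power_add mult_ac)
    also have "quot ((h ^ k * f) * h ^ r) (var c ^ (tot_deg h * (r + k)) * h ^ r) = quot (h ^ k * f) (var c ^ (tot_deg h * (r + k)))"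
      by (rule quot_cancel) (use h in auto)
    finally show ?thesis .
  qed
  moreover have "homog (int (tot_deg h * (r + k))) (h ^ k * f)"
    using homog_mult[OF homog_basics_power[OF h, of k] X(3)] by (simp add: algebra_simps)
  ultimately show ?thesis using chart_ideal_homog by metis
qed

lemma chart_ideal_transfer:
  assumes f: "homog (int n) f" "f \<in> chart_ideal C c"
  shows "\<exists>j. var c ^ j * f \<in> chart_ideal C c'"
proof (rule chart_ideal_loc[OF var_basics _ refl])
  show "quot f (var c ^ n) \<in> C (var c)" using f chart_ideal_homog by blast
  show "homog (int n * int (tot_deg (var c :: 'a cring))) f" using f by simp
qed

text \<open>Otherwise a prime contains the chart ideal but no power of \<open>var v\<close>. The
  forms in it define a point, which lies in the support of \<open>C\<close> and yet does not contain
  \<open>var v\<close>.\<close>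

lemma nilpotent_on_support:
  assumes sup: "support C = {P \<in> points. vpow V 1 \<subseteq> P}" and v: "v \<in> V"
  shows "\<exists>n. var v ^ n \<in> chart_ideal C c"
proof (rule ccontr)
  assume "\<nexists>n. var v ^ n \<in> chart_ideal C c"
  then obtain P where P: "idl P" "chart_ideal C c \<subseteq> P" "\<And>a b. a * b \<in> P \<Longrightarrow> a \<in> P \<or> b \<in> P" "var v \<notin> P" "1 \<notin> P"
    using prime_avoiding[OF idl_chart_ideal[of c], of "var v"] by blast
  have hg: "f \<in> gr_part P \<longleftrightarrow> f \<in> P" if "homog n f" for f n by (rule gr_part_homog[OF P(1) that])
  have cP: "var c \<notin> P"
  proof
    assume "var c \<in> P"
    then have "var c - (var c - 1) \<in> P" using chart_ideal_var[of c] P(2) idl_diff[OF P(1)] by blast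
    then show False using P(5) by simp
  qed
  have pt: "gr_part P \<in> points"
  proof (rule pointsI[of _ c])
    show gr: "graded (gr_part P)" by (rule graded_gr_part[OF P(1)])
    show "1 \<notin> gr_part P" using hg[OF homog_one] P(5) by blast
    show "var c \<notin> gr_part P" using hg[OF homog_var] cP by blast
    show "f \<in> gr_part P \<or> g \<in> gr_part P" if "f * g \<in> gr_part P" for f g
    proof (rule graded_primeI[OF gr _ that])
      fix f g :: "'a cring" and n k
      assume f: "homog (int n) f" and g: "homog (int k) g" and fg: "f * g \<in> gr_part P"
      have "f * g \<in> P" using fg hg[OF homog_mult[OF f g]] by blast
      then have "f \<in> P \<or> g \<in> P" by (rule P(3))
      then show "f \<in> gr_part P \<or> g \<in> gr_part P" using hg[OF f] hg[OF g] by blast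
    qed
  qed
  have "gr_part P \<in> support C"
    unfolding support_def
  proof (intro CollectI conjI ballI impI pt subsetI)
    fix h X assume h: "h \<in> basics" "h \<notin> gr_part P" and X: "X \<in> C h"
    have "X \<in> sect UNIV 0 h" using closed_subscheme_regular[OF C h(1)] X by (auto simp: sections_O_eq)
    then obtain f r where f: "X = quot f (h ^ r)" "homog (int r * int (tot_deg h)) f" by (auto elim!: sectE)
    then obtain j where "h ^ j * f \<in> P" using chart_ideal_loc[OF h(1) X, of f r c] P(2) by blast
    moreover have "h \<notin> P" using h hg[OF basics_homog[OF h(1)]] by blast
    then have "h ^ j \<notin> P" using P(3,5) by (induction j) auto
    ultimately have "f \<in> P" using P(3) by blast
    then have "f \<in> gr_part P" using hg[OF f(2)] by blast
    then show "X \<in> assoc_sheaf (gr_part P) h"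
      unfolding assoc_sheaf_eq[OF h(1)] f(1) using f(2) by (intro sectI) simp_all
  qed
  then have "var v \<in> gr_part P" using sup var_in_vpow[OF v] by blast
  then show False using hg[OF homog_var] P(4) by blast
qed

end

lemma last_not_in:
  assumes "idl I" "f \<notin> I" "e ^ N * f \<in> (I :: 'r::comm_ring_1 set)"
  shows "\<exists>i. e ^ i * f \<notin> I \<and> e * (e ^ i * f) \<in> I"
proof -
  define n where "n = (LEAST n. e ^ n * f \<in> I)"
  have n: "e ^ n * f \<in> I" unfolding n_def by (rule LeastI[of _ N]) (rule assms(3))
  have "n \<noteq> 0" using n assms(2) by (cases n) auto
  then obtain i where i: "n = Suc i" by (cases n) auto
  have "e ^ i * f \<notin> I" using not_less_Least[of i "\<lambda>n. e ^ n * f \<in> I"] i unfolding n_def by simp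
  then show ?thesis using n i by (auto simp: mult.assoc)
qed

context line
begin

text \<open>Without embedded points the ideal on a chart is primary: otherwise some multiple of \<open>f\<close> is annihilated
  exactly by the maximal ideal of a closed point of the line.\<close>

lemma chart_ideal_primary:
  fixes C :: "'a::alg_closed_field sheaf"
  assumes C: "lcm_curve C" and sup: "support C = {P \<in> points. vpow V 1 \<subseteq> P}" and V: "V = {v1, v2}"
    and q: "homog (int n) q" "q \<notin> vpow V 1" "q * f \<in> chart_ideal C w"
  shows "f \<in> chart_ideal C w"
proof (rule ccontr)
  assume f: "f \<notin> chart_ideal C w"
  let ?I = "chart_ideal C w"
  have cl: "closed_subscheme C" using C by (simp add: lcm_curve_def)
  have I: "idl ?I" by (rule idl_chart_ideal[OF cl])
  obtain N1 N2 where N: "var v1 ^ N1 \<in> ?I" "var v2 ^ N2 \<in> ?I"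
    using nilpotent_on_support[OF cl sup, of v1 w] nilpotent_on_support[OF cl sup, of v2 w] V by blast
  \<comment> \<open>Multiply \<open>f\<close> by v1 and then by v2 as long as it stays outside the
    ideal; the resulting \<open>f2\<close> is annihilated by both variables, so only the restriction
    of \<open>q\<close> to the line acts on it.\<close>
  obtain i where i: "var v1 ^ i * f \<notin> ?I" "var v1 * (var v1 ^ i * f) \<in> ?I"
    using last_not_in[OF I f idl_mult_right[OF I N(1)]] by blast
  obtain j where j: "var v2 ^ j * (var v1 ^ i * f) \<notin> ?I" "var v2 * (var v2 ^ j * (var v1 ^ i * f)) \<in> ?I"
    using last_not_in[OF I i(1) idl_mult_right[OF I N(2)]] by blast
  define f2 where "f2 = var v2 ^ j * (var v1 ^ i * f)"
  have f2: "f2 \<notin> ?I" "var v2 * f2 \<in> ?I" using j by (simp_all add: f2_def)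
  have "var v2 ^ j * (var v1 * (var v1 ^ i * f)) \<in> ?I" by (rule idl_mult[OF I i(2)])
  then have f2v1: "var v1 * f2 \<in> ?I" by (simp add: f2_def mult_ac)
  define E where "E g = {e. e * g \<in> ?I}" for g
  have E: "idl (E g)" for g
    by (rule idlI) (auto simp: E_def distrib_right mult.assoc idl_0[OF I] intro: idl_add[OF I] idl_mult[OF I])
  have VE: "vpow V 1 \<subseteq> E f2"
    unfolding ideal_gen_vars[symmetric] using f2 f2v1 V by (intro ideal_gen_least[OF E]) (auto simp: E_def)
  obtain p where p: "degree p \<le> n" "kill V q = hm n p" using kill_hm[OF q(1)] by blast
  have "p \<noteq> 0" using q(2) p by (auto simp: hm_def kill_eq_0[symmetric])
  have "(var v2 ^ j * var v1 ^ i) * (q * f) \<in> ?I" by (rule idl_mult[OF I q(3)])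
  then have "q \<in> E f2" by (simp add: E_def f2_def mult_ac)
  moreover have "q - kill V q \<in> E f2" using diff_kill[of q V] VE by blast
  ultimately have hmE: "hm n p \<in> E f2" using idl_cong[OF E[of f2], of q "kill V q"] unfolding p(2) by blast
  \<comment> \<open>The restriction of \<open>q\<close> is a product of linear forms that
    annihilates \<open>f2\<close>. Some linear form u - \<alpha> w is the first to annihilate a
    partial product times \<open>f2\<close>; powers of w cannot be responsible, since w acts as
    1.\<close>
  have "\<exists>s \<alpha>. s * f2 \<notin> ?I \<and> (var u - cst \<alpha> * var w) * (s * f2) \<in> ?I"
    using \<open>p \<noteq> 0\<close> p(1) hmE
  proof (induction n arbitrary: p)
    case 0
    then have nz: "coeff p 0 \<noteq> 0" by (metis leading_coeff_neq_0 le_zero_eq)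
    have "cst (coeff p 0) * f2 \<in> ?I" using 0 by (simp add: E_def hm_def)
    then have "cst (inverse (coeff p 0)) * (cst (coeff p 0) * f2) \<in> ?I" by (rule idl_mult[OF I])
    then have "f2 \<in> ?I" using nz by (simp flip: mult.assoc cst_mult)
    then show ?case using f2 by blast
  next
    case (Suc n)
    show ?case
    proof (cases "degree p = 0")
      case True
      then obtain b where b: "p = [:b:]" using degree_eq_zeroE by blast
      have e: "hm (Suc n) p = cst b * var w ^ Suc n"
        unfolding hm_def by (subst sum.atMost_Suc_shift) (simp add: b)
      have "var w ^ Suc n - 1 ^ Suc n \<in> ?I" by (rule idl_power_cong[OF I chart_ideal_var[OF cl]])
      then have "cst b * f2 * (var w ^ Suc n - 1) \<in> ?I" using idl_mult[OF I, of "var w ^ Suc n - 1" "cst b * f2"] by simp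
      moreover have "cst b * var w ^ Suc n * f2 \<in> ?I" using Suc.prems(3) unfolding e by (simp add: E_def)
      ultimately have "cst b * var w ^ Suc n * f2 - cst b * f2 * (var w ^ Suc n - 1) \<in> ?I" by (intro idl_diff[OF I])
      moreover have "cst b * var w ^ Suc n * f2 - cst b * f2 * (var w ^ Suc n - 1) = cst b * f2"
        by (simp only: right_diff_distrib mult_1_right mult_ac) simp
      ultimately have "cst b * f2 \<in> ?I" by (simp only:)
      then have "cst (inverse b) * (cst b * f2) \<in> ?I" by (rule idl_mult[OF I])
      then have "f2 \<in> ?I" using b Suc.prems(1) by (simp flip: mult.assoc cst_mult)
      then show ?thesis using f2 by blast
    next
      case False
      then obtain \<alpha> where "poly p \<alpha> = 0" using alg_closed_imp_poly_has_root[of p] by auto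
      then obtain p' where p': "p = [:-\<alpha>, 1:] * p'" by (metis dvdE poly_eq_0_iff_dvd)
      have "p' \<noteq> 0" using p' Suc.prems by auto
      then have "degree p = Suc (degree p')" unfolding p' by (subst degree_mult_eq) auto
      then have dq: "degree p' \<le> n" using Suc.prems by simp
      have "p = pCons 0 p' - smult \<alpha> p'" by (simp add: p')
      then have e: "hm (Suc n) p = (var u - cst \<alpha> * var w) * hm n p'"
        by (simp add: hm_diff hm_pCons_0 hm_smult[OF dq] left_diff_distrib)
      show ?thesis
      proof (cases "hm n p' * f2 \<in> ?I")
        case True
        then show ?thesis using Suc.IH[OF \<open>p' \<noteq> 0\<close> dq] by (simp add: E_def)
      next
        case False
        moreover have "(var u - cst \<alpha> * var w) * (hm n p' * f2) \<in> ?I"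
          using Suc.prems(3) unfolding e by (simp add: E_def mult.assoc)
        ultimately show ?thesis by blast
      qed
    qed
  qed
  then obtain s \<alpha> where s: "s * f2 \<notin> ?I" "(var u - cst \<alpha> * var w) * (s * f2) \<in> ?I" by blast
  define f3 where "f3 = s * f2"
  have f3: "f3 \<notin> ?I" using s by (simp add: f3_def)
  have V3: "var v \<in> E f3" if "v \<in> V" for v
  proof -
    have "var v * f2 \<in> ?I" using that V f2 f2v1 by auto
    then have "s * (var v * f2) \<in> ?I" by (rule idl_mult[OF I])
    then show ?thesis by (simp add: E_def f3_def mult_ac)
  qed
  have d3: "var i - lin_sub \<alpha> i \<in> E f3" for i
  proof -
    have "var u - var w * cst \<alpha> \<in> E f3" using s by (simp add: E_def f3_def mult.commute)
    then show ?thesis using V3[of i] not_V[of i] uw idl_0[OF E[of f3]] by (auto simp: lin_sub_def)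
  qed
  have sub3: "g - subst (lin_sub \<alpha>) g \<in> E f3" for g
  proof -
    have "subst var g - subst (lin_sub \<alpha>) g \<in> E f3" by (rule idl_peval_cong[OF E d3])
    then show ?thesis by simp
  qed
  \<comment> \<open>Modulo the annihilator of \<open>f3\<close> every form equals its value at the
    point times a power of w, hence a constant; the annihilator is therefore exactly the maximal
    ideal of that point.\<close>
  have "{r \<in> regular (var w). r * chart w f3 \<in> C (var w)} = assoc_sheaf (lin_pt \<alpha>) (var w)"
    unfolding assoc_sheaf_eq[OF var_basics]
  proof (intro equalityI subsetI)
    fix r assume "r \<in> {r \<in> regular (var w). r * chart w f3 \<in> C (var w)}"
    then have r: "r \<in> sect UNIV 0 (var w)" "r * chart w f3 \<in> C (var w)" by (auto simp: sections_O_eq)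
    then obtain g k where g: "r = quot g (var w ^ k)" "homog (int k) g" by (auto elim!: sectE)
    then have "chart w (g * f3) \<in> C (var w)" using r by (simp add: chart_simps chart_homog)
    then have gE: "g \<in> E f3" by (simp add: E_def chart_ideal_def)
    have "g \<in> lin_pt \<alpha>"
    proof (rule ccontr)
      assume gn: "g \<notin> lin_pt \<alpha>"
      define b where "b = peval (\<lambda>x. x) (\<lambda>i. if i \<in> V then 0 else if i = u then \<alpha> else 1) g"
      have sg: "subst (lin_sub \<alpha>) g = var w ^ k * cst b" unfolding b_def by (rule subst_lin_sub[OF g(2)])
      then have "b \<noteq> 0" using gn by (auto simp: lin_pt_def)
      have "var w ^ k * cst b \<in> E f3" using gE idl_cong[OF E sub3[of g]] unfolding sg by blast
      moreover have "var w ^ k - 1 ^ k \<in> ?I" by (rule idl_power_cong[OF I chart_ideal_var[OF cl]])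
      then have "var w ^ k - 1 \<in> E f3" by (simp add: E_def idl_mult_right[OF I])
      then have "cst b * (var w ^ k - 1) \<in> E f3" by (rule idl_mult[OF E])
      ultimately have "var w ^ k * cst b - cst b * (var w ^ k - 1) \<in> E f3" by (intro idl_diff[OF E])
      moreover have "var w ^ k * cst b - cst b * (var w ^ k - 1) = cst b" by (simp add: algebra_simps)
      ultimately have "cst (inverse b) * cst b \<in> E f3" by (intro idl_mult[OF E]) (simp only:)
      then have "f3 \<in> ?I" using \<open>b \<noteq> 0\<close> by (simp add: E_def flip: cst_mult)
      then show False using f3 by blast
    qed
    then show "r \<in> sect (lin_pt \<alpha>) 0 (var w)" unfolding g(1) using g(2) by (intro sectI) simp_all
  next
    fix r assume "r \<in> sect (lin_pt \<alpha>) 0 (var w)"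
    then obtain g k where g: "r = quot g (var w ^ k)" "homog (int k) g" "g \<in> lin_pt \<alpha>" by (auto elim!: sectE)
    then have "g \<in> E f3" using sub3[of g] by (simp add: lin_pt_def)
    then have "chart w (g * f3) \<in> C (var w)" by (simp add: E_def chart_ideal_def)
    moreover have "r \<in> regular (var w)" unfolding g(1) sections_O_eq using g(2) by (intro sectI) simp_all
    ultimately show "r \<in> {r \<in> regular (var w). r * chart w f3 \<in> C (var w)}"
      using g by (simp add: chart_simps chart_homog)
  qed
  moreover have "var w \<notin> lin_pt \<alpha>" using uw by (simp add: lin_pt_def lin_sub_def)
  ultimately have "associated_point C (lin_pt \<alpha>)"
    unfolding associated_point_def
    by (intro conjI lin_pt_point bexI[of _ "var w"] bexI[of _ "chart w f3"] chart_regular var_basics)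
  then show False using C lin_pt_closed[of \<alpha>] unfolding lcm_curve_def by blast
qed

end

section \<open>Classification of the structures contained in the surface\<close>

lemma vpow_single_split:
  fixes b :: "('v::{finite,linorder}, 'a::idom) pol"
  assumes "b \<notin> vpow {v} r"
  shows "\<exists>i b'. i < r \<and> b = var v ^ i * b' \<and> b' \<notin> vpow {v} 1"
  using assms
proof (induction r)
  case 0
  then show ?case by (simp add: vpow_def)
next
  case (Suc r)
  show ?case
  proof (cases "b \<in> vpow {v} r")
    case True
    then obtain b' where b: "b = var v ^ r * b'" using vpow_single_factor by blast
    then have "b' \<notin> vpow {v} 1" using Suc.prems var_power_mult_vpow[of v r b' 1] by (simp add: One_nat_def)
    then show ?thesis using b by blast
  next
    case False
    then show ?thesis using Suc.IH less_Suc_eq by blast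
  qed
qed

context ctK
begin

lemma kill_theta_13: "kill {1, 3} (theta f) = theta f"
proof -
  have "kill {1, 3} (subst rho f) = subst (\<lambda>i. kill {1, 3} (subst rho (var i))) f"
    by (rule cst.peval_unique) (simp_all add: kill_simps subst_simps)
  also have "(\<lambda>i. kill {1, 3} (subst rho (var i))) = rho"
  proof
    fix i :: 4
    have "kill {1, 3} (rho i) = rho i"
      using exhaust_4[of i] rho_1 kill_phi[of K] rho_simps(1,3,4) by (elim disjE) (simp_all add: kill_simps)
    then show "kill {1, 3} (subst rho (var i)) = rho i" by simp
  qed
  finally show ?thesis by (simp add: theta_def)
qed

text \<open>For r > d no equation near w = 0 is available, so normal forms are not known to span;
  their independence suffices to exclude this case by degree.\<close>

lemma hilbert_lower:
  assumes n: "r + \<kappa> \<le> n"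
  shows "hilbert_function (assoc_sheaf idealC) n \<ge> int r * int n + ccoef r \<kappa>"
proof -
  have "dim_k {F \<in> idealC. homog (int n) F} + card (Can n) \<le> dim_k (forms n :: 'a cring set)"
  proof (rule dim_compl_le[of _ _ n])
    show "pvs.subspace {F \<in> idealC. homog (int n) F}" by (rule subspace_idl_forms[OF idl_idealC])
    show "f = 0" if "keys f \<subseteq> Can n" "f \<in> {F \<in> idealC. homog (int n) F}" for f
      using Can_indep[OF that(1)] that(2) by simp
  qed (auto intro: finite_Can Can_deg)
  moreover have "int (card (Can n)) = int r * int n + ccoef r \<kappa>"
    unfolding card_Can[OF n] by (rule count_formula) (use n in simp)
  ultimately show ?thesis unfolding hilbert_function_def by (simp add: H0_idealC)
qed

end

lemma curve_degree_lower:
  assumes "curve_degree C \<delta>" "\<And>n. n \<ge> M \<Longrightarrow> hilbert_function C n \<ge> int r * int n + c"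
  shows "r \<le> \<delta>"
proof (rule ccontr)
  assume "\<not> r \<le> \<delta>"
  then have r: "int r \<ge> int \<delta> + 1" by simp
  obtain \<gamma> where "\<forall>\<^sub>F n in sequentially. of_int (hilbert_function C n) = poly [:of_int (1 - \<gamma>), of_nat \<delta> :: rat:] (of_nat n)"
    using assms(1) unfolding curve_degree_def curve_degree_genus_def hilbert_polynomial_def by blast
  then obtain M' where M': "\<And>n. n \<ge> M' \<Longrightarrow> of_int (hilbert_function C n) = poly [:of_int (1 - \<gamma>), of_nat \<delta> :: rat:] (of_nat n)"
    unfolding eventually_sequentially by blast
  define n where "n = M + M' + nat (2 - \<gamma> - c)"
  have "of_int (hilbert_function C n) = (of_int (1 - \<gamma> + int \<delta> * int n) :: rat)"
    using M'[of n] by (simp add: n_def mult.commute)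
  then have e: "hilbert_function C n = 1 - \<gamma> + int \<delta> * int n" by (simp only: of_int_eq_iff)
  have "(int \<delta> + 1) * int n \<le> int r * int n" using r by (intro mult_right_mono) simp_all
  moreover have "hilbert_function C n \<ge> int r * int n + c" by (rule assms(2)) (simp add: n_def)
  moreover have "int n \<ge> 2 - \<gamma> - c" by (simp add: n_def)
  ultimately show False unfolding e by (simp add: distrib_right)
qed

lemma curve_degree_unique:
  assumes "curve_degree_genus C \<delta> \<gamma>" "curve_degree C \<delta>'"
  shows "\<delta>' = \<delta>"
proof -
  obtain \<gamma>' where "curve_degree_genus C \<delta>' \<gamma>'" using assms(2) unfolding curve_degree_def by blast
  with assms(1) have ev: "\<forall>\<^sub>F n in sequentially. poly [:of_int (1 - \<gamma>), of_nat \<delta> :: rat:] (of_nat n) = poly [:of_int (1 - \<gamma>'), of_nat \<delta>':] (of_nat n)"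
    unfolding curve_degree_genus_def hilbert_polynomial_def by eventually_elim simp
  then obtain M where M: "\<And>n. n \<ge> M \<Longrightarrow> poly [:of_int (1 - \<gamma>), of_nat \<delta> :: rat:] (of_nat n) = poly [:of_int (1 - \<gamma>'), of_nat \<delta>':] (of_nat n)"
    unfolding eventually_sequentially by blast
  have "(of_nat \<delta> :: rat) = of_nat \<delta>'" using M[of M] M[of "Suc M"] by (simp add: distrib_right)
  then show ?thesis by simp
qed

lemma surface_S_eq: "ct m d g t \<Longrightarrow> surface_S d g a t = surface (ct.surf d a g t)"
  by (simp add: surface_S_def ct.surf_def)

text \<open>An unknown structure on the line inside the surface; its degree is deliberately left
  open.\<close>

locale ctC = ct m d a g t for m d a and g :: "(3, 'a::alg_closed_field) pol" and t +
  fixes C :: "'a sheaf"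
  assumes C: "lcm_curve C" and supp: "support C = {P \<in> points. vpow {0, 1} 1 \<subseteq> P}"
    and contC: "contained_in C (surface surf)"
begin

abbreviation "J \<equiv> chart_ideal C 3"

lemma cl: "closed_subscheme C" using C by (simp add: lcm_curve_def)

lemma J: "idl J" by (rule idl_chart_ideal[OF cl])

lemma surf_J: "surf \<in> J"
proof -
  have "surf \<in> ideal_gen {surf}" using ideal_gen_superset[of "{surf}"] by simp
  then have "quot surf (var 3 ^ (a + d)) \<in> sect (ideal_gen {surf}) 0 (var 3)"
    using homog_surf by (intro sectI) simp_all
  then have "quot surf (var 3 ^ (a + d)) \<in> C (var 3)"
    using contC var_basics[of 3] unfolding contained_in_def surface_def by (auto simp: assoc_sheaf_eq)
  then show ?thesis using chart_ideal_homog[OF cl homog_surf] by simp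
qed

definition de :: "'a cring \<Rightarrow> 'a cring"
  where "de = subst (\<lambda>i. if i = 3 then 1 else var i)"

lemma de_J: "f - de f \<in> J"
proof -
  have "subst var f - de f \<in> J"
    unfolding de_def by (rule idl_peval_cong[OF J]) (auto simp: idl_0[OF J] chart_ideal_var[OF cl])
  then show ?thesis by simp
qed

lemma de_homogenize: "de (homogenize n g) = gx (var 0) (var 1) (var 2)"
  unfolding de_def by (simp only: homogenize_def gx_sum subst_simps) simp

lemma y_J: "var 1 - cst (inverse t) * (var 0 * (var 2 ^ a * gx (var 0) (var 1) (var 2))) \<in> J"
proof -
  have "de surf \<in> J" using idl_cong[OF J de_J] surf_J by blast
  then have "cst (- inverse t) * de surf \<in> J" by (rule idl_mult[OF J])
  moreover have "de surf = var 0 * gx (var 0) (var 1) (var 2) * var 2 ^ a - cst t * var 1"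
    unfolding surf_def using de_homogenize[of "d - 1"] by (simp add: de_def subst_simps)
  moreover have "cst (- inverse t) * (p - cst t * q) = q - cst (inverse t) * (p :: 'a cring)" for p q
  proof -
    have "cst (- inverse t) * (p - cst t * q) = cst (- inverse t) * p - (cst (- inverse t) * cst t) * q"
      by (simp only: right_diff_distrib mult.assoc)
    also have "cst (- inverse t) * cst t = (cst (- 1) :: 'a cring)" using t0 by (simp flip: cst_mult)
    also have "cst (- 1) = (- 1 :: 'a cring)" by (simp only: cst.c_minus cst_simps(2))
    finally show ?thesis by (simp add: cst.c_minus)
  qed
  ultimately show ?thesis by (simp add: mult_ac)
qed

text \<open>Inserting the congruence into the surface equation \<open>y_J\<close> gains a factor x,
  exactly as in the iteration that defines phi.\<close>

lemma phi_J_step: "var 1 - phi k \<in> ideal_sum J (vpow {0} k)"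
proof (induction k)
  case 0
  have "var 1 - phi 0 \<in> vpow {0} 0" by (simp add: vpow_def)
  then show ?case by (rule ideal_sum_right[OF J])
next
  case (Suc k)
  let ?E = "ideal_sum J (vpow {0} k)"
  have E: "idl ?E" by (rule idl_sum_ideal[OF J idl_vpow])
  have E': "idl (ideal_sum J (vpow {0} (Suc k)))" by (rule idl_sum_ideal[OF J idl_vpow])
  have "gx (var 0) (var 1) (var 2) - gx (var 0) (phi k) (var 2) \<in> ?E" by (rule gx_cong[OF E Suc])
  then obtain j v where jv: "gx (var 0) (var 1) (var 2) - gx (var 0) (phi k) (var 2) = j + v" "j \<in> J" "v \<in> vpow {0} k"
    unfolding ideal_sum_def by blast
  have "var 0 ^ 1 * v \<in> vpow {0} (1 + k)" using jv(3) by (simp only: var_power_mult_vpow)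
  then have v': "var 0 * v \<in> vpow {0} (Suc k)" by (simp only: power_one_right plus_1_eq_Suc)
  have "var 0 * (j + v) \<in> ideal_sum J (vpow {0} (Suc k))"
    unfolding distrib_left
    by (rule idl_add[OF E' ideal_sum_left[OF idl_vpow idl_mult[OF J jv(2)]] ideal_sum_right[OF J v']])
  then have "cst (inverse t) * (var 2 ^ a * (var 0 * (j + v))) \<in> ideal_sum J (vpow {0} (Suc k))"
    by (rule idl_mult[OF E' idl_mult[OF E']])
  moreover have "cst (inverse t) * (var 2 ^ a * (var 0 * (j + v))) =
      cst (inverse t) * (var 0 * (var 2 ^ a * gx (var 0) (var 1) (var 2))) - phi (Suc k)"
    unfolding jv(1)[symmetric] by (simp add: algebra_simps)
  ultimately have "cst (inverse t) * (var 0 * (var 2 ^ a * gx (var 0) (var 1) (var 2))) - phi (Suc k) \<in> ideal_sum J (vpow {0} (Suc k))"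
    by (simp only:)
  then show ?case by (rule idl_trans[OF E' ideal_sum_left[OF idl_vpow y_J]])
qed

lemma one_notin_J: "1 \<notin> J"
proof
  assume "1 \<in> J"
  then have "1 \<in> C (var 3)" by (simp add: chart_ideal_def chart_simps)
  moreover interpret L: line "{0, 1}" 2 3 by unfold_locales (use UNIV_4 in auto)
  have P: "(vpow {0, 1} 1 :: 'a cring set) \<in> points" by (rule L.line_point)
  then have "(vpow {0, 1} 1 :: 'a cring set) \<in> support C" using supp by simp
  moreover have v3: "var 3 \<notin> (vpow {0, 1} 1 :: 'a cring set)" by (simp add: mon_in_vpow vdeg_single)
  ultimately have "1 \<in> assoc_sheaf (vpow {0, 1} 1 :: 'a cring set) (var 3)"
    unfolding support_def using var_basics by blast
  then have "quot 1 (var 3 ^ 0) \<in> sect (vpow {0, 1} 1 :: 'a cring set) 0 (var 3)"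
    by (simp add: assoc_sheaf_eq fract_collapse)
  then have "1 \<in> (vpow {0, 1} 1 :: 'a cring set)"
    by (subst (asm) quot_in_sect_point[OF P var_basics v3]) (simp_all add: homog_one)
  then show False using one_notin_vpow by blast
qed

text \<open>Modulo the ideal \<open>J\<close> of the chart W = 1 every polynomial equals its image
  under \<open>theta\<close>, so \<open>J\<close> is determined by the least power of x in it. The
  remaining charts follow because there are no embedded points.\<close>

lemma C_eq_idealC: "\<exists>K r. ctK m d g t K r \<and> C = assoc_sheaf (pline.idealC 0 1 2 (PhiQ K) r)"
proof -
  obtain N where N: "var 0 ^ N \<in> J" using nilpotent_on_support[OF cl supp, of 0 3] by blast
  define r where "r = (LEAST r. var 0 ^ r \<in> J)"
  have rJ: "var 0 ^ r \<in> J" unfolding r_def by (rule LeastI[of _ N]) (rule N)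
  have rN: "r \<le> N" unfolding r_def by (rule Least_le) (rule N)
  have rmin: "var 0 ^ i \<notin> J" if "i < r" for i using not_less_Least[of i "\<lambda>r. var 0 ^ r \<in> J"] that unfolding r_def by blast
  have r0: "r > 0"
  proof (rule ccontr)
    assume "\<not> r > 0"
    then show False using rJ one_notin_J by simp
  qed
  \<comment> \<open>K at least N makes the truncation error of phi, a multiple of x^K, lie in
    \<open>J\<close>; K at least \<open>d\<close> is demanded by \<open>ctK\<close>.\<close>
  define K where "K = max N d"
  interpret ctK m d a g t K r by unfold_locales (use rN r0 in \<open>auto simp: K_def\<close>)
  have vJ: "vpow {0} k \<subseteq> J" if "k \<ge> r" for k
  proof
    fix f :: "'a cring" assume "f \<in> vpow {0} k"
    then have "f \<in> vpow {0} r" using vpow_mono[OF that] by blast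
    then obtain f' where "f = var 0 ^ r * f'" using vpow_single_factor by blast
    then show "f \<in> J" using idl_mult_right[OF J rJ] by simp
  qed
  have phiJ: "var 1 - phi K \<in> J"
  proof -
    obtain j v where jv: "var 1 - phi K = j + v" "j \<in> J" "v \<in> vpow {0} K"
      using phi_J_step[of K] unfolding ideal_sum_def by blast
    have "r \<le> K" using rN by (simp add: K_def)
    then have "v \<in> J" using vJ jv(3) by blast
    then show ?thesis unfolding jv(1) by (rule idl_add[OF J jv(2)])
  qed
  have th: "f - theta f \<in> J" for f
  proof -
    have "var i - rho i \<in> J" for i
      using exhaust_4[of i] rho_1 phiJ rho_simps(1,3,4) idl_0[OF J] chart_ideal_var[OF cl, of 3] by (elim disjE) simp_all
    then have "subst var f - subst rho f \<in> J" by (rule idl_peval_cong[OF J])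
    then show ?thesis by (simp add: theta_def)
  qed
  have JI: "J = idealC"
  proof (intro equalityI subsetI)
    fix f assume f: "f \<in> idealC"
    then have "theta f \<in> J" using vJ[of r] by (auto simp: idealC_def)
    then show "f \<in> J" using idl_cong[OF J th] by blast
  next
    fix f assume "f \<in> J"
    then have tJ: "theta f \<in> J" using idl_cong[OF J th] by blast
    show "f \<in> idealC"
    proof (rule ccontr)
      assume "f \<notin> idealC"
      then have "theta f \<notin> vpow {0} r" by (simp add: idealC_def)
      then obtain i b where b: "i < r" "theta f = var 0 ^ i * b" "b \<notin> vpow {0} 1" using vpow_single_split by blast
      have "var 0 ^ i * kill {1, 3} b = var 0 ^ i * b"
        using kill_theta_13[of f] unfolding b(2) by (simp add: kill_simps)
      then have kb: "kill {1, 3} b = b" by simp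
      \<comment> \<open>\<open>b\<close> is not divisible by x, so its homogenisation is a form that
        does not vanish on the line. As \<open>J\<close> is primary it can be cancelled, which
        leaves x^i in \<open>J\<close> with i < r.\<close>
      define q where "q = hmg (tot_deg b) b"
      have hq: "homog (int (tot_deg b)) q" unfolding q_def by (rule homog_hmg) (rule mon_deg_le_tot_deg)
      have tq: "theta q = b" unfolding q_def theta_hmg by (rule theta_fixed[OF kb])
      have qV: "q \<notin> vpow {0, 1} 1" using theta_line[OF hq] b(3) unfolding tq by blast
      have "q - b \<in> J" using th[of q] unfolding tq .
      then have "var 0 ^ i * q - var 0 ^ i * b \<in> J" unfolding right_diff_distrib[symmetric] by (rule idl_mult[OF J])
      then have "var 0 ^ i * q \<in> J" using idl_cong[OF J] tJ unfolding b(2) by blast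
      then have "q * var 0 ^ i \<in> J" by (simp only: mult.commute)
      then have "var 0 ^ i \<in> J" by (rule chart_ideal_primary[OF C supp refl hq qV])
      then show False using rmin[OF b(1)] by blast
    qed
  qed
  interpret S: line "{0, 1}" 3 2 by (rule line_swap, unfold_locales)
  have notV: "var 2 \<notin> (vpow {0, 1} 1 :: 'a cring set)" "var 3 \<notin> (vpow {0, 1} 1 :: 'a cring set)"
    by (simp_all add: mon_in_vpow vdeg_single)
  have pw: "var i ^ k \<notin> (vpow {0, 1} 1 :: 'a cring set)" if "var i \<notin> (vpow {0, 1} 1 :: 'a cring set)" for i k
    using points_power[OF line_point] that by blast
  have claim: "f \<in> chart_ideal C c \<longleftrightarrow> (\<exists>j. f * var c ^ j \<in> idealC)" if f: "homog (int n) f" for f n c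
  proof -
    consider "c = 0 \<or> c = 1" | "c = 2" | "c = 3" using exhaust_4[of c] by blast
    then show ?thesis
    proof cases
      \<comment> \<open>These charts do not meet the line: both ideals are the whole ring.\<close>
      case 1
      let ?I = "chart_ideal C c"
      have I: "idl ?I" by (rule idl_chart_ideal[OF cl])
      obtain N where N: "var c ^ N \<in> ?I" using nilpotent_on_support[OF cl supp, of c c] 1 by blast
      have "var c ^ N - 1 ^ N \<in> ?I" by (rule idl_power_cong[OF I chart_ideal_var[OF cl]])
      then have "1 ^ N \<in> ?I" using idl_cong[OF I] N by blast
      then have "f * 1 ^ N \<in> ?I" by (rule idl_mult[OF I])
      then have "f \<in> ?I" by simp
      moreover have "var c ^ r \<in> idealC" using vpow_idealC var_power_in_vpow[of c "{0, 1}" r] 1 by auto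
      then have "f * var c ^ r \<in> idealC" by (rule idl_mult[OF idl_idealC])
      ultimately show ?thesis by blast
    next
      case 2
      show ?thesis
      proof
        assume "f \<in> chart_ideal C c"
        then obtain j where "var c ^ j * f \<in> J" using chart_ideal_transfer[OF cl f, of c 3] by blast
        then show "\<exists>j. f * var c ^ j \<in> idealC" unfolding JI by (auto simp: mult.commute)
      next
        assume "\<exists>j. f * var c ^ j \<in> idealC"
        then obtain j where j: "f * var c ^ j \<in> J" unfolding JI by blast
        have hj: "homog (int (n + j)) (f * var c ^ j)" unfolding of_nat_add by (intro homog_mult f homog_var_power)
        \<comment> \<open>Going from W = 1 to Z = 1 costs powers of W and Z; neither vanishes on the
          line, so primariness on the chart Z = 1 removes them.\<close>
        obtain l where l: "var 3 ^ l * (f * var c ^ j) \<in> chart_ideal C 2" using chart_ideal_transfer[OF cl hj j] by blast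
        then have ql: "(var 3 ^ l * var 2 ^ j) * f \<in> chart_ideal C 2" by (simp add: mult_ac 2)
        have hq: "homog (int (l + j)) (var 3 ^ l * var 2 ^ j :: 'a cring)" unfolding of_nat_add by (intro homog_mult homog_var_power)
        have "var 3 ^ l * var 2 ^ j \<notin> (vpow {0, 1} 1 :: 'a cring set)" using vpow_prime pw[OF notV(1)] pw[OF notV(2)] by blast
        then have "f \<in> chart_ideal C 2" by (rule S.chart_ideal_primary[OF C supp refl hq _ ql])
        then show "f \<in> chart_ideal C c" by (simp add: 2)
      qed
    next
      case 3
      show ?thesis
      proof
        assume "f \<in> chart_ideal C c"
        then have "f * var c ^ 0 \<in> idealC" by (simp add: 3 JI)
        then show "\<exists>j. f * var c ^ j \<in> idealC" by blast
      next
        assume "\<exists>j. f * var c ^ j \<in> idealC"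
        then obtain j where "f * var 3 ^ j \<in> idealC" unfolding 3 by blast
        then have "f \<in> idealC" by (rule lprim_cancel[OF lprim_idealC homog_var_power _ pw[OF notV(2)]])
        then show "f \<in> chart_ideal C c" by (simp add: 3 JI)
      qed
    qed
  qed
  have "C = assoc_sheaf idealC"
  proof (rule closed_subscheme_eqI[OF cl closed_subscheme_assoc[OF idl_idealC]])
    fix c
    have e: "quot f (var c ^ n) \<in> C (var c) \<longleftrightarrow> quot f (var c ^ n) \<in> sect idealC 0 (var c)" if "homog (int n) f" for f n
      using chart_ideal_homog[OF cl that, of c] claim[OF that, of c] quot_in_sect_iff[OF var_basics[of c] idl_idealC, of n 0 f] that by simp
    show "C (var c) = assoc_sheaf idealC (var c)"
      unfolding assoc_sheaf_eq[OF var_basics]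
    proof (intro equalityI subsetI)
      fix x assume x: "x \<in> C (var c)"
      then have "x \<in> sect UNIV 0 (var c)" using closed_subscheme_regular[OF cl var_basics[of c]] by (auto simp: sections_O_eq)
      then obtain f n where f: "x = quot f (var c ^ n)" "homog (int n) f" by (auto elim!: sectE)
      then show "x \<in> sect idealC 0 (var c)" using e[OF f(2)] x by simp
    next
      fix x assume x: "x \<in> sect idealC 0 (var c)"
      then obtain f n where f: "x = quot f (var c ^ n)" "homog (int n) f" by (auto elim!: sectE)
      then show "x \<in> C (var c)" using e[OF f(2)] x by simp
    qed
  qed
  then show ?thesis using ctK_axioms by blast
qed

end

context ct
begin

lemma ctK_d: "ctK m d g t d d"
  by unfold_locales (use dm m2 in simp_all)

definition IC :: "'a cring set" where "IC = pline.idealC 0 1 2 (PhiQ d) d"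

text \<open>Iterates of phi beyond the d-th agree modulo x^d, so the ideal does not depend on the
  truncation.\<close>

lemma idealC_K:
  assumes "ctK m d g t K d" shows "pline.idealC 0 1 2 (PhiQ K) d = IC"
proof -
  interpret A: ctK m d a g t K d by (rule assms)
  interpret B: ctK m d a g t d d by (rule ctK_d)
  have "A.rho i - B.rho i \<in> vpow {0} d" for i
  proof -
    have "phi K - phi d \<in> vpow {0} d" using phi_diff[of d K] vpow_mono[of d "Suc d" "{0}"] A.K by auto
    then show ?thesis
      using exhaust_4[of i] A.rho_1 B.rho_1 A.rho_simps(1,3,4) B.rho_simps(1,3,4) idl_0[OF idl_vpow[of "{0}" d]]
      by (elim disjE) simp_all
  qed
  then have e: "A.theta f - B.theta f \<in> vpow {0} d" for f
    unfolding A.theta_def B.theta_def by (intro idl_peval_cong[OF idl_vpow])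
  show ?thesis
    unfolding IC_def A.idealC_def B.idealC_def using idl_cong[OF idl_vpow e] by blast
qed

end

lemma curve_C_eq:
  fixes g :: "(3, 'a::alg_closed_field) pol"
  assumes "ct m d g t"
  shows "lcm_structure d line_L (assoc_sheaf (ct.IC d a g t)) \<and> contained_in (assoc_sheaf (ct.IC d a g t)) (surface_S d g a t)"
    and "curve_C d g a t = assoc_sheaf (ct.IC d a g t)"
proof -
  interpret ct m d a g t by unfold_locales (use assms in \<open>auto simp: ct_def\<close>)
  interpret ctK m d a g t d d by (rule ctK_d)
  have IC: "IC = idealC" by (simp add: IC_def)
  have l: "line {0, 1} 2 3" by unfold_locales
  have "lcm_curve (assoc_sheaf (idealC \<inter> idealC))" by (rule lcm_curve_lprim2[OF lprim_idealC lprim_idealC l l])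
  moreover have "curve_degree (assoc_sheaf idealC) d" using curve_degree_C[OF order_refl] unfolding curve_degree_def by blast
  moreover have sl: "support line_L = {P \<in> points. vpow {0, 1} (1::nat) \<subseteq> (P :: 'a cring set)}" by (simp add: line_L_eq support_line)
  ultimately show ex: "lcm_structure d line_L (assoc_sheaf IC) \<and> contained_in (assoc_sheaf IC) (surface_S d g a t)"
    using support_idealC surface_contains surface_S_eq[OF ct_axioms] unfolding lcm_structure_def IC by simp
  show "curve_C d g a t = assoc_sheaf IC"
    unfolding curve_C_def the_lcm_structure_def
  proof (rule the_equality, rule ex)
    fix C :: "'a sheaf" assume C: "lcm_structure d line_L C \<and> contained_in C (surface_S d g a t)"
    then have deg: "curve_degree C d" by (simp add: lcm_structure_def)
    interpret ctC m d a g t C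
      by unfold_locales (use C sl surface_S_eq[OF ct_axioms] in \<open>simp_all add: lcm_structure_def\<close>)
    obtain K r where K: "ctK m d g t K r" "C = assoc_sheaf (pline.idealC 0 1 2 (PhiQ K) r)" using C_eq_idealC by blast
    interpret M: ctK m d a g t K r by (rule K(1))
    \<comment> \<open>First the lower bound on the Hilbert function excludes r > d; then the exact
      Hilbert polynomial is available and gives r = d.\<close>
    have "r \<le> d"
    proof (rule curve_degree_lower[OF deg])
      show "hilbert_function C n \<ge> int r * int n + ccoef r \<kappa>" if "n \<ge> r + \<kappa>" for n
        unfolding K(2) by (rule M.hilbert_lower[OF that])
    qed
    then have "curve_degree_genus C r (1 - ccoef r \<kappa>)" unfolding K(2) by (rule M.curve_degree_C)
    then have "d = r" by (rule curve_degree_unique[OF _ deg])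
    then show "C = assoc_sheaf IC" using K idealC_K by simp
  qed
qed

section \<open>Forms of low degree in the ideal of C_t\<close>

lemma lookup_mon_mult: "lookup (mon s * p) (s + t) = lookup p t"
proof (induction p rule: pol_induct)
  case (mon t' c)
  have "mon s * single t' c = single (s + t') c" by (simp add: mult_single)
  then show ?case by (simp only: lookup_single when_def add_left_cancel)
next
  case (add p q)
  then show ?case by (simp only: distrib_left lookup_add)
qed

lemma keys_mon_mult: "keys (mon s * p) = (+) s ` keys p"
proof (intro equalityI subsetI)
  fix k assume k: "k \<in> keys (mon s * p)"
  obtain a b where ab: "k = a + b" "a \<in> keys (mon s :: ('a, 'b) pol)" "b \<in> keys p" using keys_mult[of "mon s" p] k by blast
  have "a = s" using ab(2) by (simp split: if_splits)
  then show "k \<in> (+) s ` keys p" using ab by simp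
next
  fix k assume "k \<in> (+) s ` keys p"
  then show "k \<in> keys (mon s * p)" by (auto simp: in_keys_iff lookup_mon_mult)
qed

lemma var_power_mult_vpow_outside: "i \<notin> V \<Longrightarrow> var i ^ k * p \<in> vpow V n \<Longrightarrow> p \<in> vpow V n"
  unfolding vpow_def mem_Collect_eq var_power keys_mon_mult by (simp add: vdeg_add vdeg_single)

lemma tot_deg_mon_mult:
  fixes p :: "('v::finite, 'a::comm_ring_1) pol"
  assumes "p \<noteq> 0"
  shows "tot_deg (mon s * p) = mon_deg s + tot_deg p"
proof -
  have fin: "finite (mon_deg ` keys p)" and ne: "mon_deg ` keys p \<noteq> {}" using assms by auto
  have "mon_deg ` keys (mon s * p) = (+) (mon_deg s) ` (mon_deg ` keys p)"
    unfolding keys_mon_mult by (simp add: image_image mon_deg_add)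
  moreover have "Max ((+) (mon_deg s) ` (mon_deg ` keys p)) = mon_deg s + Max (mon_deg ` keys p)"
    using mono_Max_commute[of "(+) (mon_deg s)", OF _ fin ne] by (simp add: mono_def)
  ultimately show ?thesis using fin ne unfolding tot_deg_def by simp
qed

lemma restr_in_vpow: "p - restr {s. vdeg V s < n} p \<in> vpow V n"
proof -
  have "p - restr {s. vdeg V s < n} p = restr (- {s. vdeg V s < n}) p"
    using restr_compl[of p "{s. vdeg V s < n}"] by (simp add: algebra_simps)
  then show ?thesis by (auto simp: vpow_def keys_restr)
qed

definition ae :: "(4 \<Rightarrow>\<^sub>0 nat) \<Rightarrow> (3 \<Rightarrow>\<^sub>0 nat)"
  where "ae s = single 0 (lookup s 0) + single 1 (lookup s 1) + single 2 (lookup s 2)"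

lemma distinct_3: "(1::3) \<noteq> 0" "(2::3) \<noteq> 0" "(2::3) \<noteq> 1" "(0::3) \<noteq> 1" "(0::3) \<noteq> 2" "(1::3) \<noteq> 2"
  by simp_all

lemma lookup_ae: "lookup (ae s) 0 = lookup s 0" "lookup (ae s) 1 = lookup s 1" "lookup (ae s) 2 = lookup s 2"
  unfolding ae_def lookup_add lookup_single when_def
  by (simp_all only: distinct_3 if_False if_True add_0 add_0_right simp_thms)

lemma prod_UNIV_4: "(\<Prod>i\<in>(UNIV :: 4 set). f i) = f 0 * f 1 * f 2 * f 3"
  unfolding UNIV_4 by (simp add: mult.assoc)

context ct
begin

lemma primitive_IC:
  "locally_in_smooth_surface line_L (assoc_sheaf IC)" "has_type line_L (assoc_sheaf IC) (int a + int m - 1)"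
proof -
  interpret ctK m d a g t d d by (rule ctK_d)
  have d2: "d \<ge> 2" using dm m2 by simp
  show "locally_in_smooth_surface line_L (assoc_sheaf IC)" unfolding IC_def by (rule locally_smooth) simp
  show "has_type line_L (assoc_sheaf IC) (int a + int m - 1)"
    using has_type_C[OF order_refl d2] unfolding IC_def \<kappa>_def by simp
qed

text \<open>g is congruent to z^m modulo (x, y), and z^m can be cancelled modulo powers of (x, y);
  the order of \<open>u\<close> is raised one step at a time.\<close>

lemma g_mult_vpow:
  assumes "g * u \<in> vpow {0, 1} k"
  shows "u \<in> vpow {0, 1} k"
proof -
  have gn: "g - var 2 ^ m \<in> vpow {0, 1} 1"
    unfolding vpow_def
  proof (intro CollectI ballI)
    fix s assume s: "s \<in> keys (g - var 2 ^ m)"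
    have s1: "s \<noteq> single 2 m"
    proof
      assume "s = single 2 m"
      then have "lookup (g - var 2 ^ m) s = 0" by (simp add: lookup_minus lookup_g_zm var_power)
      then show False using s by (simp add: in_keys_iff)
    qed
    have "s \<in> keys g" using s s1 by (simp add: in_keys_iff lookup_minus var_power lookup_single when_def)
    then have "0 < lookup s 0 + lookup s 1" using s1 by (rule keys_g_pos)
    moreover have "vdeg {0, 1} s = lookup s 0 + lookup s 1" by (simp add: vdeg_def)
    ultimately show "1 \<le> vdeg {0, 1} s" by linarith
  qed
  have "u \<in> vpow {0, 1} j" if "j \<le> k" for j
    using that
  proof (induction j)
    case 0
    then show ?case by (simp add: vpow_def)
  next
    case (Suc j)
    then have "u \<in> vpow {0, 1} j" by simp
    then have "(g - var 2 ^ m) * u \<in> vpow {0, 1} (1 + j)" by (rule vpow_mult[OF gn])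
    moreover have "g * u \<in> vpow {0, 1} (1 + j)" using assms vpow_mono[of "1 + j" k "{0, 1}"] Suc.prems by auto
    ultimately have "g * u - (g - var 2 ^ m) * u \<in> vpow {0, 1} (1 + j)" by (intro idl_diff[OF idl_vpow])
    moreover have "g * u - (g - var 2 ^ m) * u = var 2 ^ m * u" by (simp add: algebra_simps)
    ultimately have "var 2 ^ m * u \<in> vpow {0, 1} (Suc j)" by (simp only: plus_1_eq_Suc)
    then show ?case by (rule var_power_mult_vpow_outside[rotated]) simp
  qed
  then show ?thesis by blast
qed

definition s3 :: "(3, 'a) pol" where "s3 = var 0 * var 2 ^ a * g - cst t * var 1"

definition aff :: "'a cring \<Rightarrow> (3, 'a) pol"
  where "aff = subst (\<lambda>i. if i = 3 then 1 else if i = 0 then var 0 else if i = 1 then var 1 else var 2)"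

lemma aff_simps: "aff (p * q) = aff p * aff q" "aff (p ^ k) = aff p ^ k" "aff (cst c) = cst c"
  "aff (p - q) = aff p - aff q" "aff (var 0) = var 0" "aff (var 1) = var 1" "aff (var 2) = var 2" "aff (var 3) = 1" "aff 0 = 0"
  by (simp_all add: aff_def subst_simps)

lemma aff_gx: "aff (gx p q r) = subst (rho3 (aff p) (aff q) (aff r)) g"
proof -
  have 1: "aff (subst (rho3 p q r) g) = subst (\<lambda>i. aff (subst (rho3 p q r) (var i))) g"
    by (rule cst.peval_unique[of "\<lambda>f. aff (subst (rho3 p q r) f)"]) (simp_all add: aff_def cst.peval_add cst.peval_mult cst.peval_cst)
  have 2: "(\<lambda>i. aff (subst (rho3 p q r) (var i))) = rho3 (aff p) (aff q) (aff r)"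
  proof
    fix i :: 3
    show "aff (subst (rho3 p q r) (var i)) = rho3 (aff p) (aff q) (aff r) i"
      using exhaust_3[of i] by (elim disjE) simp_all
  qed
  show ?thesis unfolding gx_def 1 2 ..
qed

lemma aff_single: "aff (single s c) = single (ae s) c"
proof -
  have "aff (single s c) = cst c * (var 0 ^ lookup s 0 * var 1 ^ lookup s 1 * var 2 ^ lookup s 2)"
    unfolding aff_def cst.peval_single prod_UNIV_4 by simp
  also have "\<dots> = single (0 + ae s) (c * (1 * 1 * 1))"
    unfolding var_power mult_single cst_def ae_def ..
  finally show ?thesis by simp
qed

lemma aff_sum: "aff F = (\<Sum>s\<in>keys F. single (ae s) (lookup F s))"
proof -
  have "aff F = aff (\<Sum>s\<in>keys F. single s (lookup F s))" by (simp only: pol_sum_monomials[symmetric])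
  also have "\<dots> = (\<Sum>s\<in>keys F. aff (single s (lookup F s)))" unfolding aff_def by (rule cst.peval_sum)
  finally show ?thesis by (simp only: aff_single)
qed

lemma keys_aff:
  assumes "homog (int n) F" "s' \<in> keys (aff F)" shows "mon_deg s' \<le> n"
proof -
  have "s' \<in> (\<Union>s\<in>keys F. keys (single (ae s) (lookup F s)))"
    using assms(2) keys_sum[of "\<lambda>s. single (ae s) (lookup F s)" "keys F"] unfolding aff_sum by blast
  then obtain s where s: "s \<in> keys F" "s' = ae s" by (auto split: if_splits)
  then have "mon_deg s = n" using assms(1) by (auto simp: homog_def)
  then show ?thesis unfolding s(2) mon_deg_def sum_UNIV_3 sum_UNIV_4 lookup_ae by linarith
qed

text \<open>Distinct monomials of the same degree stay distinct when W is set to 1, so nothing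
  cancels.\<close>

lemma aff_vpow:
  assumes F: "homog n F" and v: "aff F \<in> vpow {0, 1} k" shows "F \<in> vpow {0, 1} k"
  unfolding vpow_def
proof (intro CollectI ballI)
  fix s assume s: "s \<in> keys F"
  have "s' = s" if s': "s' \<in> keys F" "ae s' = ae s" for s'
  proof -
    have e: "lookup s' 0 = lookup s 0" "lookup s' 1 = lookup s 1" "lookup s' 2 = lookup s 2"
      using arg_cong[OF s'(2), of "\<lambda>e. lookup e 0"] arg_cong[OF s'(2), of "\<lambda>e. lookup e 1"] arg_cong[OF s'(2), of "\<lambda>e. lookup e 2"]
      unfolding lookup_ae .
    have "int (mon_deg s') = int (mon_deg s)" using F s s'(1) by (simp add: homog_def)
    then have "lookup s' 3 = lookup s 3" using e by (simp add: mon_deg_def sum_UNIV_4)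
    then have "lookup s' i = lookup s i" for i using e exhaust_4[of i] by auto
    then show ?thesis by (rule poly_mapping_eqI)
  qed
  then have "lookup (aff F) (ae s) = (\<Sum>s'\<in>keys F. if s' = s then lookup F s else 0)"
    unfolding aff_sum lookup_sum by (intro sum.cong) (auto simp: lookup_single when_def)
  also have "\<dots> = lookup F s" using s by simp
  finally have "ae s \<in> keys (aff F)" using s by (simp add: in_keys_iff)
  then have "k \<le> vdeg {0, 1} (ae s)" using v by (simp add: vpow_def)
  then show "k \<le> vdeg {0, 1} s" by (simp add: vdeg_def lookup_ae)
qed

abbreviation "A k \<equiv> ideal_sum (ideal_gen {s3}) (vpow {0, 1} k)"

lemma aff_phi: "var 1 - aff (phi k) \<in> A k"
proof (induction k)
  case 0
  have "var 1 - aff (phi 0) \<in> vpow {0, 1} 0" by (simp add: vpow_def)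
  then show ?case by (rule ideal_sum_right[OF idl_ideal_gen])
next
  case (Suc k)
  have A: "idl (A k)" for k by (rule idl_sum_ideal[OF idl_ideal_gen idl_vpow])
  let ?g' = "subst (rho3 (var 0) (aff (phi k)) (var 2)) g"
  have "subst var g - ?g' \<in> A k"
  proof (rule idl_peval_cong[OF A])
    show "var i - rho3 (var 0) (aff (phi k)) (var 2) i \<in> A k" for i
      using exhaust_3[of i] Suc idl_0[OF A[of k]] by (elim disjE) simp_all
  qed
  then have "g - ?g' \<in> A k" by simp
  then obtain j v where jv: "g - ?g' = j + v" "j \<in> ideal_gen {s3}" "v \<in> vpow {0, 1} k"
    unfolding ideal_sum_def by blast
  have "var 0 * v \<in> vpow {0, 1} (1 + k)" by (rule vpow_mult[OF var_in_vpow jv(3)]) simp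
  then have v': "var 0 * v \<in> vpow {0, 1} (Suc k)" by (simp only: plus_1_eq_Suc)
  have "var 0 * (j + v) \<in> A (Suc k)"
    unfolding distrib_left
    by (rule idl_add[OF A ideal_sum_left[OF idl_vpow idl_mult[OF idl_ideal_gen jv(2)]] ideal_sum_right[OF idl_ideal_gen v']])
  then have B: "cst (inverse t) * (var 2 ^ a * (var 0 * (j + v))) \<in> A (Suc k)"
    by (rule idl_mult[OF A idl_mult[OF A]])
  have "s3 \<in> ideal_gen {s3}" using ideal_gen_superset[of "{s3}"] by simp
  then have "cst (inverse t) * s3 \<in> A (Suc k)" by (rule ideal_sum_left[OF idl_vpow idl_mult[OF idl_ideal_gen]])
  with B have "cst (inverse t) * (var 2 ^ a * (var 0 * (j + v))) - cst (inverse t) * s3 \<in> A (Suc k)" by (rule idl_diff[OF A])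
  moreover have "cst (inverse t) * (var 2 ^ a * (var 0 * (j + v))) - cst (inverse t) * s3
      = (cst (inverse t) * cst t) * var 1 - cst (inverse t) * (var 2 ^ a * (var 0 * ?g'))"
    unfolding jv(1)[symmetric] s3_def by (simp add: algebra_simps)
  moreover have "cst (inverse t) * cst t = (1 :: (3, 'a) pol)" using t0 by (simp flip: cst_mult)
  moreover have "aff (phi (Suc k)) = cst (inverse t) * (var 2 ^ a * (var 0 * ?g'))"
    by (simp add: aff_simps aff_gx mult_ac)
  ultimately show ?case by simp
qed

text \<open>On the chart W = 1 the curve is the surface intersected with (x, y)^d: modulo these the
  substitution \<open>theta\<close> is the identity by \<open>aff_phi\<close>, and it sends
  \<open>F\<close> to a multiple of x^d.\<close>

lemma aff_IC:
  assumes "F \<in> IC" shows "\<exists>c. aff F - c * s3 \<in> vpow {0, 1} d"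
proof -
  interpret ctK m d a g t d d by (rule ctK_d)
  have A: "idl (A d)" by (rule idl_sum_ideal[OF idl_ideal_gen idl_vpow])
  have "theta F \<in> vpow {0} d" using assms by (simp add: IC_def idealC_def)
  then obtain f where "theta F = var 0 ^ d * f" using vpow_single_factor by blast
  then have "aff (theta F) = var 0 ^ d * aff f" by (simp add: aff_simps)
  moreover have "var 0 ^ d * aff f \<in> vpow {0, 1} d" by (intro idl_mult_right[OF idl_vpow] var_power_in_vpow) simp
  ultimately have t: "aff (theta F) \<in> A d" using ideal_sum_right[OF idl_ideal_gen] by simp
  have "aff (theta F) = subst (\<lambda>i. aff (theta (var i))) F"
    by (rule cst.peval_unique) (simp_all add: aff_def theta_def subst_simps)
  moreover have "aff F = subst (\<lambda>i. aff (var i)) F"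
    by (rule cst.peval_unique) (simp_all add: aff_def subst_simps)
  moreover have "subst (\<lambda>i. aff (var i)) F - subst (\<lambda>i. aff (theta (var i))) F \<in> A d"
  proof (rule idl_peval_cong[OF A])
    show "aff (var i) - aff (theta (var i)) \<in> A d" for i
      using exhaust_4[of i]
    proof (elim disjE)
      assume "i = 1"
      then show ?thesis using aff_phi[of d] by (simp only: theta_var aff_simps)
    qed (simp_all only: theta_var aff_simps diff_self idl_0[OF A], simp add: aff_def subst_simps idl_0[OF A])
  qed
  ultimately have "aff F - aff (theta F) \<in> A d" by simp
  then have "aff F \<in> A d" using idl_cong[OF A] t by blast
  then obtain j v where jv: "aff F = j + v" "j \<in> ideal_gen {s3}" "v \<in> vpow {0, 1} d" unfolding ideal_sum_def by blast
  have "ideal_gen {s3} \<subseteq> {c * s3 | c. True}"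
  proof (rule ideal_gen_least)
    show "idl {c * s3 | c. True}"
    proof (rule idlI)
      show "0 \<in> {c * s3 | c. True}" by (auto intro: exI[of _ 0])
      show "p + q \<in> {c * s3 | c. True}" if "p \<in> {c * s3 | c. True}" "q \<in> {c * s3 | c. True}" for p q
        using that by (auto simp flip: distrib_right)
      show "r * p \<in> {c * s3 | c. True}" if "p \<in> {c * s3 | c. True}" for r p
        using that by (auto simp flip: mult.assoc)
    qed
    show "{s3} \<subseteq> {c * s3 | c. True}" by (auto intro: exI[of _ 1])
  qed
  then obtain c where "j = c * s3" using jv(2) by blast
  then have "aff F - c * s3 \<in> vpow {0, 1} d" using jv by simp
  then show ?thesis by blast
qed

text \<open>The contributions x z^a g u and t y u to the equation are separated by weight: the first
  raises it by 3a + 3m + 1, the second by 2. Hence the top-weight part of the first survives in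
  \<open>F\<close>, and the degree of \<open>F\<close> bounds its monomials of order below
  \<open>d\<close>.\<close>

lemma low_degree:
  assumes np: "no_poly_of_degree d g" and F: "F \<in> IC" "homog (int n) F" and n: "n \<le> a + d - 1"
  shows "F \<in> vpow {0, 1} d"
proof (rule aff_vpow[OF F(2)], rule ccontr)
  assume nv: "aff F \<notin> vpow {0, 1} d"
  have d5: "d \<ge> 5" using dm m2 by simp
  obtain c where c: "aff F - c * s3 \<in> vpow {0, 1} d" using aff_IC[OF F(1)] by blast
  \<comment> \<open>Terms of \<open>c\<close> of order d - 1 may be dropped because
    \<open>s3\<close> itself has order 1.\<close>
  define u where "u = restr {s. vdeg {0, 1} s < d - 1} c"
  have s3v: "s3 \<in> vpow {0, 1} 1"
    unfolding s3_def
    by (intro idl_diff[OF idl_vpow] idl_mult_right[OF idl_vpow] idl_mult[OF idl_vpow] var_in_vpow) simp_all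
  have "(c - u) * s3 \<in> vpow {0, 1} (d - 1 + 1)" unfolding u_def by (rule vpow_mult[OF restr_in_vpow s3v])
  then have "(c - u) * s3 \<in> vpow {0, 1} d" using d5 by simp
  then have "(aff F - c * s3) + (c - u) * s3 \<in> vpow {0, 1} d" by (rule idl_add[OF idl_vpow c])
  moreover have "(aff F - c * s3) + (c - u) * s3 = aff F - u * s3" by (simp add: algebra_simps)
  ultimately have v: "aff F - u * s3 \<in> vpow {0, 1} d" by (simp only:)
  have ku: "vdeg {0, 1} s < d - 1" if "s \<in> keys u" for s using that by (simp add: u_def keys_restr)
  have "u \<noteq> 0" using v nv by auto
  define w where "w = Max (WT ` keys u)"
  have w: "w \<in> WT ` keys u" "\<And>s. s \<in> keys u \<Longrightarrow> WT s \<le> w" unfolding w_def using \<open>u \<noteq> 0\<close> by auto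
  define uw where "uw = restr {s. WT s = w} u"
  define u' where "u' = restr (- {s. WT s = w}) u"
  have usum: "u = uw + u'" unfolding uw_def u'_def by (rule restr_compl)
  obtain s0 where s0: "s0 \<in> keys uw" using w(1) by (auto simp: uw_def keys_restr)
  have WT_add: "WT (s + s') = WT s + WT s'" for s s' by (simp add: WT_def lookup_add)
  have WTg: "WT s = 3 * m" if "s \<in> keys g" for s using keys_g(1)[OF that] by (simp add: WT_def)
  have "uw \<notin> vpow {0, 1} (d - 1)"
  proof
    assume "uw \<in> vpow {0, 1} (d - 1)"
    then have "d - 1 \<le> vdeg {0, 1} s0" using s0 by (simp add: vpow_def)
    moreover have "s0 \<in> keys u" using s0 by (simp add: uw_def keys_restr)
    ultimately show False using ku by fastforce
  qed
  then have gu: "g * uw \<notin> vpow {0, 1} (d - 1)" using g_mult_vpow by blast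
  define \<tau> where "\<tau> = restr {s. vdeg {0, 1} s < d - 1} (g * uw)"
  have gt: "g * uw - \<tau> \<in> vpow {0, 1} (d - 1)" unfolding \<tau>_def by (rule restr_in_vpow)
  then have "\<tau> \<noteq> 0" using gu by auto
  \<comment> \<open>The monomial e = x z^a s has the weight of x z^a g times the top part of u. The
    rest of u contributes other weights, and y u contributes weights at most w + 2, so e is not
    cancelled. Its order is below \<open>d\<close>, so it occurs in \<open>aff F\<close>; removing x
    z^a from the degree bound a + d - 1 leaves d - 2.\<close>
  have degt: "mon_deg s \<le> d - 2" if s: "s \<in> keys \<tau>" for s
  proof -
    have s1: "s \<in> keys (g * uw)" "vdeg {0, 1} s < d - 1" using s by (simp_all add: \<tau>_def keys_restr)
    define e where "e = single 0 1 + single 2 a + s"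
    obtain p q where pq: "s = p + q" "p \<in> keys g" "q \<in> keys uw" using keys_mult[of g uw] s1(1) by blast
    have "WT q = w" using pq(3) by (simp add: uw_def keys_restr)
    then have WTe: "WT e = 1 + 3 * a + 3 * m + w"
      unfolding e_def pq(1) WT_add WTg[OF pq(2)] by (simp add: WT_def lookup_single when_def)
    have m: "(mon (single 0 1 + single 2 a) :: (3, 'a) pol) = var 0 * var 2 ^ a"
      by (simp add: var_power mult_single)
    have l1: "lookup (var 0 * var 2 ^ a * (g * uw)) e = lookup (g * uw) s"
      unfolding m[symmetric] e_def by (rule lookup_mon_mult)
    have l2: "lookup (var 0 * var 2 ^ a * (g * u')) e = 0"
    proof (rule ccontr)
      assume "lookup (var 0 * var 2 ^ a * (g * u')) e \<noteq> 0"
      then have "lookup (g * u') s \<noteq> 0" unfolding m[symmetric] e_def lookup_mon_mult .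
      then obtain p' q' where pq': "s = p' + q'" "p' \<in> keys g" "q' \<in> keys u'"
        using keys_mult[of g u'] by (auto simp: in_keys_iff[symmetric])
      then have "WT s = 3 * m + WT q'" using WTg by (simp add: WT_add)
      moreover have "WT s = 3 * m + w" using pq \<open>WT q = w\<close> WTg by (simp add: WT_add)
      moreover have "WT q' \<noteq> w" using pq'(3) by (simp add: u'_def keys_restr)
      ultimately show False by simp
    qed
    have l3: "lookup (cst t * (var 1 * u)) e = 0"
    proof (rule ccontr)
      assume "lookup (cst t * (var 1 * u)) e \<noteq> 0"
      then have "lookup (var 1 * u) e \<noteq> 0" by (auto simp: lookup_cst_mult)
      then have "e \<in> keys (var 1 * u)" by (simp add: in_keys_iff)
      then obtain q' where "e = single 1 1 + q'" "q' \<in> keys u" unfolding keys_mon_mult by blast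
      then have "WT e \<le> 2 + w" using w(2)[of q'] by (simp add: WT_add) (simp add: WT_def lookup_single when_def)
      then show False using WTe m2 by simp
    qed
    have "u * s3 = var 0 * var 2 ^ a * (g * uw) + var 0 * var 2 ^ a * (g * u') - cst t * (var 1 * u)"
      unfolding s3_def by (subst (1) usum) (simp add: algebra_simps usum)
    then have "lookup (u * s3) e = lookup (g * uw) s" using l1 l2 l3 by (simp only: lookup_add lookup_minus) simp
    moreover have "lookup (aff F - u * s3) e = 0"
    proof (rule ccontr)
      assume "lookup (aff F - u * s3) e \<noteq> 0"
      then have "d \<le> vdeg {0, 1} e" using v by (simp add: vpow_def in_keys_iff)
      then show False using s1(2) by (simp add: e_def vdeg_add vdeg_single)
    qed
    ultimately have "lookup (aff F) e = lookup (g * uw) s" by (simp add: lookup_minus)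
    then have "e \<in> keys (aff F)" using s1(1) by (simp add: in_keys_iff)
    then have "mon_deg e \<le> n" by (rule keys_aff[OF F(2)])
    then show ?thesis using n by (simp add: e_def mon_deg_add)
  qed
  let ?I = "ideal_sum (xy_power (d - 1)) (ideal_gen {g})"
  have I: "idl ?I" unfolding xy_power_eq by (rule idl_sum_ideal[OF idl_vpow idl_ideal_gen])
  have "g \<in> ideal_gen {g}" using ideal_gen_superset[of "{g}"] by simp
  then have "g * uw \<in> ideal_gen {g}" by (rule idl_mult_right[OF idl_ideal_gen])
  then have "g * uw \<in> ?I" unfolding xy_power_eq by (rule ideal_sum_right[OF idl_vpow])
  moreover have "g * uw - \<tau> \<in> ?I" unfolding xy_power_eq by (rule ideal_sum_left[OF idl_ideal_gen gt])
  ultimately have "\<tau> \<in> ?I" using idl_cong[OF I] by blast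
  \<comment> \<open>The hypothesis excludes degree exactly d - 2 only; a power of z fills up the
    degree.\<close>
  then have "var 2 ^ (d - 2 - tot_deg \<tau>) * \<tau> \<in> ?I" by (rule idl_mult[OF I])
  moreover have "tot_deg \<tau> \<le> d - 2" by (rule tot_deg_le) (rule degt)
  then have "tot_deg (var 2 ^ (d - 2 - tot_deg \<tau>) * \<tau>) = d - 2"
    unfolding var_power tot_deg_mon_mult[OF \<open>\<tau> \<noteq> 0\<close>] by simp
  moreover have "var 2 ^ (d - 2 - tot_deg \<tau>) * \<tau> \<noteq> 0"
    using \<open>\<tau> \<noteq> 0\<close> unfolding var_power keys_eq_empty[symmetric] keys_mon_mult by simp
  ultimately show False using np unfolding no_poly_of_degree_def by blast
qed

lemma H0_IC:
  assumes "n \<ge> 0" shows "H0 (assoc_sheaf IC) n = {F \<in> IC. homog n F}"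
proof -
  interpret ctK m d a g t d d by (rule ctK_d)
  show ?thesis unfolding IC_def by (rule H0_idealC[OF assms])
qed

lemma H0_IC_low:
  assumes np: "no_poly_of_degree d g" and n: "n \<le> int a + int d - 1"
  shows "H0 (assoc_sheaf IC) n = H0 (sheaf_pow line_L d) n"
proof (cases "n < 0")
  case True
  then show ?thesis by (simp add: H0_negative)
next
  case False
  then obtain k where k: "n = int k" by (metis not_less nonneg_int_cases)
  interpret ctK m d a g t d d by (rule ctK_d)
  have sat: "F \<in> vpow {0, 1} d" if F: "\<And>i. \<exists>k. F * var i ^ k \<in> vpow {0, 1} d" for F :: "'a cring"
  proof -
    obtain j where "F * var 3 ^ j \<in> vpow {0, 1} d" using F by blast
    then have "var 3 ^ j * F \<in> vpow {0, 1} d" by (simp only: mult.commute)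
    then show ?thesis by (rule var_power_mult_vpow_outside[rotated]) simp
  qed
  have "H0 (sheaf_pow line_L d) n = {F :: 'a cring. F \<in> vpow {0, 1} d \<and> homog n F}"
    unfolding line_L_eq sheaf_pow_vpow by (rule H0_assoc[OF idl_vpow _ sat]) (use False in simp_all)
  moreover have "k \<le> a + d - 1" using n k dm m2 by linarith
  then have "F \<in> IC \<longleftrightarrow> F \<in> vpow {0, 1} d" if "homog n F" for F
    using low_degree[OF np] that vpow_idealC unfolding k IC_def by blast
  ultimately show ?thesis using H0_IC[of n] False by auto
qed

end

section \<open>Primitive lines, and unions with a structure on Z = W = 0\<close>

lemma primitive_curve_C:
  fixes g :: "(3, 'a::alg_closed_field) pol"
  assumes "ct m d g t"
  shows "primitive_line_of_type d (int a + int m - 1) line_L (curve_C d g a t)"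
proof -
  interpret ct m d a g t by unfold_locales (use assms in \<open>auto simp: ct_def\<close>)
  have "d \<ge> 2" using dm m2 by simp
  then show ?thesis
    unfolding primitive_line_of_type_def primitive_line_def curve_C_eq(2)[OF assms]
    using is_line_L primitive_IC curve_C_eq(1)[OF assms] by blast
qed

text \<open>The structure of multiplicity \<open>e\<close> on the surface Y^k W = X^k Z. This
  equation is itself the linear form \<open>f0\<close>, so no extra powers are needed and N =
  0.\<close>

lemma pline_span_second:
  assumes "e > 0"
  shows "pline_span 2 3 0 1 (var 0 ^ k :: 'a::field cring) 1 k e 0
    (cst 1 * var 1 ^ k * var 3 - var 0 ^ k * var 2) (cst 1 * var 1 ^ k * var 3 - var 0 ^ k * var 2)"
proof -
  interpret Q: pline 2 3 0 1 "var 0 ^ k :: 'a cring" 1 k e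
  proof
    show "kill {2} (var 0 ^ k) = cst (inverse 1) * (var 0 ^ k :: 'a cring)" by (simp add: kill_simps)
    show "(UNIV :: 4 set) = {2, 3, 0, 1}" unfolding UNIV_4 by auto
  qed (use assms in simp_all)
  let ?f = "cst 1 * var 1 ^ k * var 3 - var 0 ^ k * var 2 :: 'a cring"
  have "Q.theta ?f = 0"
    unfolding Q.theta_def by (simp add: subst_simps)
  then have f: "?f \<in> Q.idealC" by (simp add: Q.idealC_def idl_0[OF idl_vpow])
  have "homog (0 + int k + 1) ?f"
  proof (rule homog_diff)
    show "homog (0 + int k + 1) (cst 1 * var 1 ^ k * var 3 :: 'a cring)" by (intro homog_mult homog_cst homog_var_power homog_var)
    have "homog (int k + 1) (var 0 ^ k * var 2 :: 'a cring)" by (intro homog_mult homog_var_power homog_var)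
    then show "homog (0 + int k + 1) (var 0 ^ k * var 2 :: 'a cring)" by (simp only: add_0)
  qed
  then have h: "homog (int (0 + k + 1)) ?f" by (simp only: of_nat_add of_nat_0 of_nat_1)
  show ?thesis
    by unfold_locales (use f h in \<open>simp_all only: power_0 mult_1_left diff_self idl_0[OF idl_vpow]\<close>)
qed

lemma vpow_degree:
  fixes F :: "('v::finite, 'a::comm_ring_1) pol"
  assumes "F \<in> vpow V d" "homog (int n) F" "n < d"
  shows "F = 0"
proof (rule ccontr)
  assume "F \<noteq> 0"
  then obtain s where s: "s \<in> keys F" unfolding keys_eq_empty[symmetric] by blast
  then have "mon_deg s = n" "d \<le> vdeg V s" using assms by (auto simp: homog_def vpow_def)
  moreover have "vdeg V s \<le> mon_deg s" unfolding vdeg_def mon_deg_def by (intro sum_mono2) simp_all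
  ultimately show False using assms(3) by simp
qed

context ct
begin

lemma IC_lprim: "lprim {0, 1} IC"
proof -
  interpret ctK m d a g t d d by (rule ctK_d)
  show ?thesis unfolding IC_def by (rule lprim_idealC)
qed

lemma IC_cancel: "F * var 3 ^ k \<in> IC \<Longrightarrow> F \<in> IC"
proof (rule lprim_cancel[OF IC_lprim homog_var_power])
  show "var 3 ^ k \<notin> (vpow {0, 1} 1 :: 'a cring set)"
    unfolding var_power mon_in_vpow by (simp add: vdeg_single)
qed

lemma not_on_surface_IC:
  assumes np: "no_poly_of_degree d g" and s: "s < d"
  shows "\<not> on_surface_of_degree (assoc_sheaf IC) s"
proof
  assume "on_surface_of_degree (assoc_sheaf IC) s"
  then obtain F where F: "F \<noteq> 0" "homog (int s) F" "contained_in (assoc_sheaf IC) (surface F)"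
    unfolding on_surface_of_degree_def by blast
  obtain k where "F * var 3 ^ k \<in> IC" using on_surface_mem[OF lprim_idl[OF IC_lprim] F(2,3)] by blast
  then have "F \<in> IC" by (rule IC_cancel)
  then have "F \<in> vpow {0, 1} d" by (rule low_degree[OF np _ F(2)]) (use s in simp)
  then show False using vpow_degree F(1,2) s by blast
qed

lemma exists_span_IC: "\<exists>N \<iota>z \<iota>w. pline_span 0 1 2 3 (PhiQ d) t \<kappa> d N \<iota>z \<iota>w"
proof -
  interpret ctK m d a g t d d by (rule ctK_d)
  show ?thesis by (rule exists_span) simp
qed

lemma genus_IC: "curve_degree_genus (assoc_sheaf IC) d (1 - ccoef d \<kappa>)"
proof -
  interpret ctK m d a g t d d by (rule ctK_d)
  show ?thesis unfolding IC_def by (rule curve_degree_C) simp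
qed

text \<open>Disjoint union with a multiple structure on the line $Z = W = 0$ whose quotient has a basis containing all
  monomials of degree \<open>< d + e\<close> in \<open>vpow {0, 1} d\<close>.\<close>

lemma union_curve:
  assumes e: "e > 0" "a = e" "e = 1 \<or> d + e \<le> k + 1" and np: "no_poly_of_degree d g"
  defines "U \<equiv> assoc_sheaf (IC \<inter> pline.idealC 2 3 0 (var 0 ^ k) e)"
  shows "curve_degree_genus U (d + e) (1 - (ccoef d \<kappa> + ccoef e k))"
    and "s < d + e \<Longrightarrow> \<not> on_surface_of_degree U s"
proof -
  let ?f = "cst 1 * var 1 ^ k * var 3 - var 0 ^ k * var 2 :: 'a cring"
  have Qs: "pline_span 2 3 0 1 (var 0 ^ k :: 'a cring) 1 k e 0 ?f ?f" by (rule pline_span_second[OF e(1)])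
  interpret Q: pline_span 2 3 0 1 "var 0 ^ k :: 'a cring" 1 k e 0 ?f ?f by (rule Qs)
  obtain N \<iota>z \<iota>w where Ps: "pline_span 0 1 2 3 (PhiQ d) t \<kappa> d N \<iota>z \<iota>w" using exists_span_IC by blast
  show "curve_degree_genus U (d + e) (1 - (ccoef d \<kappa> + ccoef e k))"
  proof (rule curve_degree_genusI)
    fix n assume "n \<ge> d + \<kappa> + 2 * N + (e + k + 2 * 0)"
    then have "hilbert_function U n = int (d + e) * int n + ccoef d \<kappa> + ccoef e k"
      using hilbert_disjoint[OF Ps Qs, of n] unfolding U_def IC_def by simp
    then show "hilbert_function U n = int (d + e) * int n + (1 - (1 - (ccoef d \<kappa> + ccoef e k)))" by simp
  qed
  assume s: "s < d + e"
  show "\<not> on_surface_of_degree U s"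
  proof
    assume "on_surface_of_degree U s"
    then obtain F where F: "F \<noteq> 0" "homog (int s) F" "contained_in U (surface F)"
      unfolding on_surface_of_degree_def by blast
    have I: "idl (IC \<inter> Q.idealC)" by (rule idl_Int[OF lprim_idl[OF IC_lprim] Q.idl_idealC])
    have ex: "\<exists>k. F * var i ^ k \<in> IC \<inter> Q.idealC" for i by (rule on_surface_mem[OF I F(2) F(3)[unfolded U_def]])
    obtain j where "F * var 3 ^ j \<in> IC" using ex[of 3] by blast
    then have FI: "F \<in> IC" by (rule IC_cancel)
    obtain j where j: "F * var 0 ^ j \<in> Q.idealC" using ex[of 0] by blast
    have "var 0 ^ j \<notin> (vpow {2, 3} 1 :: 'a cring set)" unfolding var_power mon_in_vpow by (simp add: vdeg_single)
    then have FQ: "F \<in> Q.idealC" by (rule lprim_cancel[OF Q.lprim_idealC homog_var_power j])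
    \<comment> \<open>\<open>low_degree\<close> reaches up to degree a + d - 1; this is why a =
      e.\<close>
    have Fv: "F \<in> vpow {0, 1} d" by (rule low_degree[OF np FI F(2)]) (use s e in simp)
    have "keys F \<subseteq> Q.Can s"
    proof
      fix p assume p: "p \<in> keys F"
      have m: "mon_deg p = s" using p F(2) by (auto simp: homog_def)
      have "d \<le> vdeg {0, 1} p" using p Fv by (simp add: vpow_def)
      then have v: "d \<le> lookup p 0 + lookup p 1" by (simp add: vdeg_def)
      have "lookup p 2 + lookup p 3 + (lookup p 0 + lookup p 1) < d + e"
        using m s unfolding mon_deg_def sum_UNIV_4 by linarith
      \<comment> \<open>At least \<open>d\<close> factors X, Y leave fewer than \<open>e\<close>
        factors Z, W. If e = 1 there is no Z at all; otherwise the degree is at most k, so Z and X^k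
        cannot both divide the monomial.\<close>
      then have "lookup p 2 + lookup p 3 < e" "lookup p 2 = 0 \<or> lookup p 0 < k" using v e(3) by linarith+
      then show "p \<in> Q.Can s" using m by (simp add: Q.Can_def vdeg_def)
    qed
    then show False using Q.Can_indep[OF _ FQ] F(1) by blast
  qed
qed

end

lemma lcm_union:
  fixes g :: "(3, 'a::alg_closed_field) pol"
  assumes "ct m d g t" "e > 0"
  shows "lcm_curve (assoc_sheaf (ct.IC d a g t \<inter> pline.idealC 2 3 0 (var 0 ^ k) e))"
proof -
  interpret ct m d a g t by unfold_locales (use assms(1) in \<open>auto simp: ct_def\<close>)
  interpret Q: pline_span 2 3 0 1 "var 0 ^ k :: 'a cring" 1 k e 0
    "cst 1 * var 1 ^ k * var 3 - var 0 ^ k * var 2" "cst 1 * var 1 ^ k * var 3 - var 0 ^ k * var 2"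
    by (rule pline_span_second[OF assms(2)])
  interpret P: ctK m d a g t d d by (rule ctK_d)
  show ?thesis by (rule lcm_curve_lprim2[OF IC_lprim Q.lprim_idealC P.line_axioms Q.line_axioms])
qed

section \<open>Arithmetic of the genus and conclusion\<close>

lemma six_choose: "6 * int ((n + 2) choose 3) = int n * (int n + 1) * (int n + 2)"
proof (induction n)
  case (Suc n)
  have "(Suc n + 2) choose 3 = ((n + 2) choose 2) + ((n + 2) choose 3)"
    by (simp add: numeral_3_eq_3 numeral_2_eq_2)
  moreover have "2 * int ((n + 2) choose 2) = (int n + 2) * (int n + 1)"
  proof -
    have "2 * ((n + 2) choose 2) = (n + 2) * (n + 1)" unfolding choose_two by (simp add: algebra_simps)
    then have "int (2 * ((n + 2) choose 2)) = int ((n + 2) * (n + 1))" by (simp only:)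
    then show ?thesis by (simp add: algebra_simps)
  qed
  ultimately show ?case using Suc by (simp add: algebra_simps)
qed simp

text \<open>With the constant term of the Hilbert polynomial written as n + c, the prescribed genus
  means that c is the binomial coefficient n over 3; the factor 6 avoids divisions.\<close>

lemma genus_formula:
  assumes "6 * c = int n * (int n - 1) * (int n - 2)"
  shows "(int n - 1) * int n + 1 - int ((n + 2) choose 3) = 1 - (int n + c)"
  using assms six_choose[of n] by (simp add: algebra_simps)

lemma six_ccoef: "6 * ccoef d k = 6 * int d + 3 * (int k - 1) * (int d * (int d - 1))"
proof -
  have "6 * ccoef d k = 6 * int d + 3 * (int k - 1) * (2 * (\<Sum>i<d. int i))"
    unfolding ccoef_def by (simp add: distrib_left)
  then show ?thesis by (simp only: sum_lessThan_int)
qed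

theorem theorem1p2:
  fixes m d :: nat
  assumes "m \<ge> 2" and "d = 3 * m - 1"
  shows
    "(\<forall>g :: (3, 'k::alg_closed_field) pol. good_g m d g \<longrightarrow>
        (\<forall>a t. t \<noteq> 0 \<longrightarrow>
           primitive_line_of_type d (int a + int m - 1) line_L (curve_C d g a t)) \<and>
        (no_poly_of_degree d g \<longrightarrow>
           (\<forall>a t. t \<noteq> 0 \<longrightarrow> (\<forall>n \<le> int a + int d - 1.
              H0 (curve_C d g a t) n = H0 (sheaf_pow line_L d) n)))) \<and>
     ((\<exists>g :: (3, 'k) pol. good_g m d g \<and> no_poly_of_degree d g) \<longrightarrow>
        (\<exists>L C :: 'k sheaf. primitive_line_of_type d ((int d - 2) div 3) L C \<and>
           \<not> on_surface_of_degree C (d - 1)) \<and>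
        (\<exists>L C :: 'k sheaf. primitive_line_of_type d ((int d + 1) div 3) L C \<and>
           (\<forall>n \<le> int d. H0 C n = H0 (sheaf_pow L d) n)) \<and>
        (\<exists>L C :: 'k sheaf. primitive_line_of_type d ((int d + 4) div 3) L C \<and>
           (\<forall>n \<le> int d + 1. H0 C n = H0 (sheaf_pow L d) n)) \<and>
        (\<forall>d' \<in> {d, d + 1, d + 2}. \<exists>C :: 'k sheaf. lcm_curve C \<and>
           curve_degree_genus C d'
             ((int d' - 1) * int d' + 1 - int ((d' + 2) choose 3)) \<and>
           (\<forall>s < d'. \<not> on_surface_of_degree C s)))"
proof -
  have ct: "ct m d g t" if "good_g m d g" "t \<noteq> 0" for g :: "(3, 'k) pol" and t
    using that assms by (simp add: ct_def)
  have H0: "H0 (curve_C d g a t) n = H0 (sheaf_pow line_L d) n"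
    if "good_g m d g" "no_poly_of_degree d g" "t \<noteq> 0" "n \<le> int a + int d - 1" for g :: "(3, 'k) pol" and a t n
    unfolding curve_C_eq(2)[OF ct[OF that(1,3)]] by (rule ct.H0_IC_low[OF ct[OF that(1,3)] that(2,4)])
  have dm: "int d = 3 * int m - 1" using assms by simp
  have d1: "d - 1 < d" using assms by simp
  have four: "\<exists>C :: 'k sheaf. lcm_curve C \<and>
      curve_degree_genus C d' ((int d' - 1) * int d' + 1 - int ((d' + 2) choose 3)) \<and> (\<forall>s < d'. \<not> on_surface_of_degree C s)"
    if g: "good_g m d g" "no_poly_of_degree d g" and d': "d' \<in> {d, d + 1, d + 2}" for g :: "(3, 'k) pol" and d'
  proof -
    note c = ct[OF g(1) one_neq_zero]
    have kap: "int (ct.\<kappa> m a) = int a + int m" for a by (simp add: ct.\<kappa>_def[OF c])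
    \<comment> \<open>With a = d' - d the curve C_t falls short of the required constant term by 0,
      1 or d + 2. A reduced line supplies 1, and the double line with k = d + 1 supplies d + 2; this
      k also satisfies the bound in \<open>union_curve\<close>.\<close>
    consider "d' = d" | "d' = d + 1" | "d' = d + 2" using d' by blast
    then show ?thesis
    proof cases
      case 1
      have "6 * (ccoef d (ct.\<kappa> m 0) - int d) = int d * (int d - 1) * (int d - 2)"
        unfolding right_diff_distrib six_ccoef kap dm by (simp add: algebra_simps)
      from genus_formula[OF this] have e: "(int d - 1) * int d + 1 - int ((d + 2) choose 3) = 1 - ccoef d (ct.\<kappa> m 0)" by simp
      have "lcm_curve (assoc_sheaf (ct.IC d 0 g 1))" using curve_C_eq(1)[OF c, of 0] by (simp add: lcm_structure_def)
      then show ?thesis unfolding 1 e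
        using ct.genus_IC[OF c, of 0] ct.not_on_surface_IC[OF c g(2), of _ 0] by blast
    next
      case 2
      let ?U = "assoc_sheaf (ct.IC d 1 g 1 \<inter> pline.idealC 2 3 0 (var 0 ^ 0) 1)"
      have "6 * (ccoef d (ct.\<kappa> m 1) + ccoef 1 0 - int (d + 1)) = int (d + 1) * (int (d + 1) - 1) * (int (d + 1) - 2)"
        unfolding right_diff_distrib distrib_left[of 6] six_ccoef kap by (simp add: dm algebra_simps)
      from genus_formula[OF this] have e: "(int (d + 1) - 1) * int (d + 1) + 1 - int ((d + 1 + 2) choose 3) = 1 - (ccoef d (ct.\<kappa> m 1) + ccoef 1 0)" by simp
      have U: "curve_degree_genus ?U (d + 1) (1 - (ccoef d (ct.\<kappa> m 1) + ccoef 1 0))" "\<And>s. s < d + 1 \<Longrightarrow> \<not> on_surface_of_degree ?U s"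
        by (rule ct.union_curve[OF c _ _ _ g(2)]; simp)+
      moreover have "lcm_curve ?U" by (rule lcm_union[OF c]) simp
      ultimately show ?thesis unfolding 2 e by blast
    next
      case 3
      let ?U = "assoc_sheaf (ct.IC d 2 g 1 \<inter> pline.idealC 2 3 0 (var 0 ^ (d + 1)) 2)"
      have "6 * (ccoef d (ct.\<kappa> m 2) + ccoef 2 (d + 1) - int (d + 2)) = int (d + 2) * (int (d + 2) - 1) * (int (d + 2) - 2)"
        unfolding right_diff_distrib distrib_left[of 6] six_ccoef kap by (simp add: dm algebra_simps)
      from genus_formula[OF this] have e: "(int (d + 2) - 1) * int (d + 2) + 1 - int ((d + 2 + 2) choose 3) = 1 - (ccoef d (ct.\<kappa> m 2) + ccoef 2 (d + 1))" by simp
      have U: "curve_degree_genus ?U (d + 2) (1 - (ccoef d (ct.\<kappa> m 2) + ccoef 2 (d + 1)))" "\<And>s. s < d + 2 \<Longrightarrow> \<not> on_surface_of_degree ?U s"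
        by (rule ct.union_curve[OF c _ _ _ g(2)]; simp)+
      moreover have "lcm_curve ?U" by (rule lcm_union[OF c]) simp
      ultimately show ?thesis unfolding 3 e by blast
    qed
  qed
  show ?thesis
  proof (intro conjI impI allI)
    fix g :: "(3, 'k) pol" and a and t :: 'k assume "good_g m d g" "t \<noteq> 0"
    then show "primitive_line_of_type d (int a + int m - 1) line_L (curve_C d g a t)" using primitive_curve_C ct by blast
  next
    fix g :: "(3, 'k) pol" and a n and t :: 'k assume "good_g m d g" "no_poly_of_degree d g" "t \<noteq> 0" "n \<le> int a + int d - 1"
    then show "H0 (curve_C d g a t) n = H0 (sheaf_pow line_L d) n" by (rule H0)
  next
    assume "\<exists>g :: (3, 'k) pol. good_g m d g \<and> no_poly_of_degree d g"
    then obtain g :: "(3, 'k) pol" where g: "good_g m d g" "no_poly_of_degree d g" by blast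
    note c = ct[OF g(1) one_neq_zero]
    \<comment> \<open>Since d + 1 = 3m the divisions are exact, and the three types are a + m - 1
      for a = 0, 1, 2.\<close>
    have ty: "(int d - 2) div 3 = int 0 + int m - 1" "(int d + 1) div 3 = int 1 + int m - 1" "(int d + 4) div 3 = int 2 + int m - 1"
      unfolding dm by simp_all
    show "\<exists>L C :: 'k sheaf. primitive_line_of_type d ((int d - 2) div 3) L C \<and> \<not> on_surface_of_degree C (d - 1)"
      unfolding ty using primitive_curve_C[OF c, of 0] ct.not_on_surface_IC[OF c g(2) d1, of 0]
      unfolding curve_C_eq(2)[OF c] by blast
    show "\<exists>L C :: 'k sheaf. primitive_line_of_type d ((int d + 1) div 3) L C \<and> (\<forall>n \<le> int d. H0 C n = H0 (sheaf_pow L d) n)"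
      unfolding ty
    proof (intro exI conjI allI impI)
      show "primitive_line_of_type d (int 1 + int m - 1) line_L (curve_C d g 1 1)" by (rule primitive_curve_C[OF c])
      show "H0 (curve_C d g 1 1) n = H0 (sheaf_pow line_L d) n" if "n \<le> int d" for n
        using that by (intro H0[OF g one_neq_zero]) simp
    qed
    show "\<exists>L C :: 'k sheaf. primitive_line_of_type d ((int d + 4) div 3) L C \<and> (\<forall>n \<le> int d + 1. H0 C n = H0 (sheaf_pow L d) n)"
      unfolding ty
    proof (intro exI conjI allI impI)
      show "primitive_line_of_type d (int 2 + int m - 1) line_L (curve_C d g 2 1)" by (rule primitive_curve_C[OF c])
      show "H0 (curve_C d g 2 1) n = H0 (sheaf_pow line_L d) n" if "n \<le> int d + 1" for n
        using that by (intro H0[OF g one_neq_zero]) simp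
    qed
    show "\<forall>d' \<in> {d, d + 1, d + 2}. \<exists>C :: 'k sheaf. lcm_curve C \<and>
        curve_degree_genus C d' ((int d' - 1) * int d' + 1 - int ((d' + 2) choose 3)) \<and> (\<forall>s < d'. \<not> on_surface_of_degree C s)"
      using four[OF g] by (rule ballI)
  qed
qed

end
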